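(* Let $\mu,\alpha>0$, $f\in H$, and assume either $\beta>3$, or $\beta=3$ and $4\alpha\mu>1$. Then the semigroup $S$ generated by the weak solutions possesses a global compact connected attractor $\mathcal{A}\subset H$, i.e. $\mathcal{A}$ is compact and connected in $H$, $S(t,\mathcal{A})=\mathcal{A}$ for all $t\ge0$, and $\operatorname{dist}_H(S(t,B),\mathcal{A})\to0$ as $t\to+\infty$ for every bounded $B\subset H$.
   Context: $\Omega\subset\mathbb{R}^3$ is a bounded open set with smooth boundary. $\mathcal{V}=\{u\in (C_0^\infty(\Omega))^3:\operatorname{div}u=0\}$, $H$ is the closure of $\mathcal{V}$ in $(L^2(\Omega))^3$ with inner product $(\cdot,\cdot)$ and norm $|\cdot|$, $V$ is the closure of $\mathcal{V}$ in $(H^1_0(\Omega))^3$ with inner product $((u,v))=\int_\Omega\nabla u:\nabla v\,dx$. $b(u,v,w)=\sum_{i,j=1}^3\int_\Omega u_i\,\partial_i v_j\, w_j\,dx$. The problem is the damped Navier–Stokes system $u_t-\mu\Delta u+(u\cdot\nabla)u+\alpha|u|^{\beta-1}u+\nabla p=f$, $\operatorname{div}u=0$, $u=0$ on $\partial\Omega$, $u(0)=u_0$, with $f\in H$ independent of time. A weak solution on $(0,T)$ with initial datum $u_0\in H$ is a function $u\in L^\infty(0,T;H)\cap L^2(0,T;V)\cap L^{\beta+1}(0,T;(L^{\beta+1}(\Omega))^3)$ with $u(0)=u_0$ such that for every $v\in V\cap (L^{\beta+1}(\Omega))^3$, $\frac{d}{dt}(u,v)+\mu((u,v))+b(u,u,v)+\alpha(|u|^{\beta-1}u,v)=(f,v)$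 in the sense of scalar distributions on $(0,T)$. It is known (and may be assumed) that when $\beta>3$, or $\beta=3$ and $4\alpha\mu\ge1$, for every $u_0\in H$ there is a unique globally defined weak solution, depending continuously in $H$ on $u_0$; $S(t,u_0)=u(t)$ denotes the resulting semigroup on $H$, $S(t,B)=\{S(t,u_0):u_0\in B\}$. $\operatorname{dist}_H(C,A)=\sup_{x\in C}\inf_{y\in A}|x-y|$. *)

theory Defs
  imports "HOL-Analysis.Analysis"
begin

type_synonym pt = "real^3"
type_synonym field = "real^3 \<Rightarrow> real^3"

definition pd :: "3 \<Rightarrow> (pt \<Rightarrow> real) \<Rightarrow> pt \<Rightarrow> real" where
  "pd i g x = frechet_derivative g (at x) (axis i 1)"

definition smooth_R3 :: "(pt \<Rightarrow> real) \<Rightarrow> bool" where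
  "smooth_R3 g \<longleftrightarrow> (\<forall>is x. (fold pd is g) differentiable (at x))"

definition smooth_R :: "(real \<Rightarrow> real) \<Rightarrow> bool" where
  "smooth_R \<psi> \<longleftrightarrow> (\<forall>k x. ((deriv ^^ k) \<psi>) differentiable (at x))"

definition smooth_boundary :: "pt set \<Rightarrow> bool" where
  "smooth_boundary \<Omega> \<longleftrightarrow> (\<exists>\<rho>. smooth_R3 \<rho> \<and> \<Omega> = {x. \<rho> x < 0} \<and>
      (\<forall>x. \<rho> x = 0 \<longrightarrow> (\<exists>i. pd i \<rho> x \<noteq> 0)))"

definition grad :: "field \<Rightarrow> pt \<Rightarrow> real^3^3" where
  "grad \<phi> x = (\<chi> i j. pd i (\<lambda>y. \<phi> y $ j) x)"

definition div_field :: "field \<Rightarrow> pt \<Rightarrow> real" where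
  "div_field \<phi> x = (\<Sum>j\<in>UNIV. pd j (\<lambda>y. \<phi> y $ j) x)"

definition test_field :: "pt set \<Rightarrow> field \<Rightarrow> bool" where
  "test_field \<Omega> \<phi> \<longleftrightarrow> (\<forall>j. smooth_R3 (\<lambda>x. \<phi> x $ j)) \<and>
      (\<exists>K. compact K \<and> K \<subseteq> \<Omega> \<and> (\<forall>x. x \<notin> K \<longrightarrow> \<phi> x = 0)) \<and>
      (\<forall>x. div_field \<phi> x = 0)"

definition test_fun :: "real \<Rightarrow> real \<Rightarrow> (real \<Rightarrow> real) \<Rightarrow> bool" where
  "test_fun a b \<psi> \<longleftrightarrow> smooth_R \<psi> \<and> (\<exists>c d. a < c \<and> d < b \<and> (\<forall>t. t \<notin> {c..d} \<longrightarrow> \<psi> t = 0))"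

section \<open>Lebesgue spaces on Omega (functions, modulo a.e. equality implicitly)\<close>

definition Lp :: "pt set \<Rightarrow> real \<Rightarrow> (pt \<Rightarrow> 'b::euclidean_space) \<Rightarrow> bool" where
  "Lp \<Omega> p v \<longleftrightarrow> v \<in> borel_measurable (lebesgue_on \<Omega>) \<and>
      integrable (lebesgue_on \<Omega>) (\<lambda>x. norm (v x) powr p)"

definition L2 :: "pt set \<Rightarrow> (pt \<Rightarrow> 'b::euclidean_space) \<Rightarrow> bool" where
  "L2 \<Omega> v \<longleftrightarrow> v \<in> borel_measurable (lebesgue_on \<Omega>) \<and>
      integrable (lebesgue_on \<Omega>) (\<lambda>x. (norm (v x))\<^sup>2)"

definition L2inner :: "pt set \<Rightarrow> (pt \<Rightarrow> 'b::euclidean_space) \<Rightarrow> (pt \<Rightarrow> 'b) \<Rightarrow> real" where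
  "L2inner \<Omega> u v = integral\<^sup>L (lebesgue_on \<Omega>) (\<lambda>x. inner (u x) (v x))"

definition L2norm :: "pt set \<Rightarrow> (pt \<Rightarrow> 'b::euclidean_space) \<Rightarrow> real" where
  "L2norm \<Omega> v = sqrt (integral\<^sup>L (lebesgue_on \<Omega>) (\<lambda>x. (norm (v x))\<^sup>2))"

definition L2dist :: "pt set \<Rightarrow> (pt \<Rightarrow> 'b::euclidean_space) \<Rightarrow> (pt \<Rightarrow> 'b) \<Rightarrow> real" where
  "L2dist \<Omega> u v = L2norm \<Omega> (\<lambda>x. u x - v x)"

definition H_space :: "pt set \<Rightarrow> field set" where
  "H_space \<Omega> = {u. L2 \<Omega> u \<and> (\<exists>\<phi>. (\<forall>n. test_field \<Omega> (\<phi> n)) \<and>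
       (\<lambda>n. L2dist \<Omega> u (\<phi> n)) \<longlonglongrightarrow> 0)}"

text \<open>u belongs to V (closure of \<V> in H^1_0) with gradient G (the L^2 limit of the
  gradients of an approximating sequence).\<close>
definition V_grad :: "pt set \<Rightarrow> field \<Rightarrow> (pt \<Rightarrow> real^3^3) \<Rightarrow> bool" where
  "V_grad \<Omega> u G \<longleftrightarrow> L2 \<Omega> u \<and> L2 \<Omega> G \<and> (\<exists>\<phi>. (\<forall>n. test_field \<Omega> (\<phi> n)) \<and>
       (\<lambda>n. L2dist \<Omega> u (\<phi> n)) \<longlonglongrightarrow> 0 \<and>
       (\<lambda>n. L2dist \<Omega> G (grad (\<phi> n))) \<longlonglongrightarrow> 0)"

definition V_space :: "pt set \<Rightarrow> field set" where
  "V_space \<Omega> = {u. \<exists>G. V_grad \<Omega> u G}"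

definition bform :: "pt set \<Rightarrow> field \<Rightarrow> (pt \<Rightarrow> real^3^3) \<Rightarrow> field \<Rightarrow> real" where
  "bform \<Omega> u Gv w = integral\<^sup>L (lebesgue_on \<Omega>)
      (\<lambda>x. \<Sum>i\<in>UNIV. \<Sum>j\<in>UNIV. u x $ i * Gv x $ i $ j * w x $ j)"

definition weak_solution ::
  "pt set \<Rightarrow> real \<Rightarrow> real \<Rightarrow> real \<Rightarrow> field \<Rightarrow> field \<Rightarrow> real \<Rightarrow> (real \<Rightarrow> field) \<Rightarrow> bool" where
  "weak_solution \<Omega> \<mu> \<alpha> \<beta> f u0 T u \<longleftrightarrow> 0 < T \<and>
     \<comment> \<open>L^infinity(0,T;H), with the (weakly continuous) representative fixing u(0)\<close>
     (\<forall>t\<in>{0..T}. u t \<in> H_space \<Omega>) \<and>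
     (\<exists>M. \<forall>t\<in>{0..T}. L2norm \<Omega> (u t) \<le> M) \<and>
     (\<forall>v\<in>H_space \<Omega>. continuous_on {0..T} (\<lambda>t. L2inner \<Omega> (u t) v)) \<and>
     L2dist \<Omega> (u 0) u0 = 0 \<and>
     \<comment> \<open>L^{beta+1}(0,T;L^{beta+1}(Omega))\<close>
     (\<lambda>(t,x). u t x) \<in> borel_measurable (lebesgue_on ({0<..<T} \<times> \<Omega>)) \<and>
     integrable (lebesgue_on ({0<..<T} \<times> \<Omega>)) (\<lambda>(t,x). norm (u t x) powr (\<beta> + 1)) \<and>
     \<comment> \<open>L^2(0,T;V), with gradient G, and the weak formulation\<close>
     (\<exists>G :: real \<Rightarrow> pt \<Rightarrow> real^3^3.
        (\<lambda>(t,x). G t x) \<in> borel_measurable (lebesgue_on ({0<..<T} \<times> \<Omega>)) \<and>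
        integrable (lebesgue_on ({0<..<T} \<times> \<Omega>)) (\<lambda>(t,x). (norm (G t x))\<^sup>2) \<and>
        (AE t in lebesgue_on {0<..<T}. V_grad \<Omega> (u t) (G t)) \<and>
        (\<forall>v Gv. V_grad \<Omega> v Gv \<and> Lp \<Omega> (\<beta> + 1) v \<longrightarrow>
           (let F = (\<lambda>t. \<mu> * L2inner \<Omega> (G t) Gv + bform \<Omega> (u t) (G t) v
                        + \<alpha> * L2inner \<Omega> (\<lambda>x. norm (u t x) powr (\<beta> - 1) *\<^sub>R u t x) v
                        - L2inner \<Omega> f v)
            in integrable (lebesgue_on {0<..<T}) F \<and>
               (\<forall>\<psi>. test_fun 0 T \<psi> \<longrightarrow>
                  integral\<^sup>L (lebesgue_on {0<..<T}) (\<lambda>t. L2inner \<Omega> (u t) v * deriv \<psi> t)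
                  = integral\<^sup>L (lebesgue_on {0<..<T}) (\<lambda>t. F t * \<psi> t)))))"

definition global_weak_solution ::
  "pt set \<Rightarrow> real \<Rightarrow> real \<Rightarrow> real \<Rightarrow> field \<Rightarrow> field \<Rightarrow> (real \<Rightarrow> field) \<Rightarrow> bool" where
  "global_weak_solution \<Omega> \<mu> \<alpha> \<beta> f u0 u \<longleftrightarrow> (\<forall>T>0. weak_solution \<Omega> \<mu> \<alpha> \<beta> f u0 T u)"

definition H_bounded :: "pt set \<Rightarrow> field set \<Rightarrow> bool" where
  "H_bounded \<Omega> B \<longleftrightarrow> (\<exists>R. \<forall>b\<in>B. L2norm \<Omega> b \<le> R)"

definition H_compact :: "pt set \<Rightarrow> field set \<Rightarrow> bool" where
  "H_compact \<Omega> A \<longleftrightarrow> (\<forall>s :: nat \<Rightarrow> field. (\<forall>n. s n \<in> A) \<longrightarrow>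
     (\<exists>a\<in>A. \<exists>r. strict_mono r \<and> (\<lambda>n. L2dist \<Omega> (s (r n)) a) \<longlonglongrightarrow> 0))"

definition H_open :: "pt set \<Rightarrow> field set \<Rightarrow> bool" where
  "H_open \<Omega> U \<longleftrightarrow> (\<forall>x\<in>U. \<exists>e>0. \<forall>y\<in>H_space \<Omega>. L2dist \<Omega> x y < e \<longrightarrow> y \<in> U)"

definition H_connected :: "pt set \<Rightarrow> field set \<Rightarrow> bool" where
  "H_connected \<Omega> A \<longleftrightarrow> \<not> (\<exists>U V. H_open \<Omega> U \<and> H_open \<Omega> V \<and> A \<subseteq> U \<union> V \<and>
       A \<inter> U \<noteq> {} \<and> A \<inter> V \<noteq> {} \<and> A \<inter> U \<inter> V = {})"

text \<open>Equality of subsets of H as subsets of the quotient of H by a.e.-equality.\<close>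
definition H_seteq :: "pt set \<Rightarrow> field set \<Rightarrow> field set \<Rightarrow> bool" where
  "H_seteq \<Omega> A B \<longleftrightarrow> (\<forall>a\<in>A. \<exists>b\<in>B. L2dist \<Omega> a b = 0) \<and> (\<forall>b\<in>B. \<exists>a\<in>A. L2dist \<Omega> a b = 0)"

definition dist_H :: "pt set \<Rightarrow> field set \<Rightarrow> field set \<Rightarrow> ereal" where
  "dist_H \<Omega> C A = (SUP x\<in>C. INF y\<in>A. ereal (L2dist \<Omega> x y))"

end

theory Submission
  imports Defs "HOL-Complex_Analysis.Great_Picard" "HOL-Library.Diagonal_Subsequence"
begin

text \<open>
  Testing the weak formulation at time \<open>r\<close> with the solution \<open>u(r)\<close> itself, over the time window
  \<open>(r - h, r)\<close>, averaging over \<open>r\<close> and letting \<open>h \<rightarrow> 0\<close> yields an energy inequality starting at the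
  initial datum. The convective term need not vanish in it: since \<open>u \<in> L\<^sup>4\<close> it is absorbed by viscosity
  and damping. The damping alone makes a ball absorbing. For compactness no bound on time derivatives is needed:
  the energy inequality bounds the gradients of a bounded family of trajectories in \<open>L\<^sup>2\<close> of space-time,
  so by Fatou's lemma infinitely many of them have bounded gradients at one common time \<open>t \<in> (0, 1)\<close>;
  there Rellich's theorem gives strong convergence, and the continuous map \<open>S(1 - t)\<close> carries it to time 1.
  The attractor is the \<open>\<omega>\<close>-limit set of the absorbing ball.
\<close>

section \<open>Global attractors of dissipative semigroups\<close>

text \<open>The weak formulation admits only time-independent test fields, and no time derivative of
  \<open>u\<close> is at hand that could be paired with \<open>u\<close>; hence the detour through a
  time lag. Cauchy-Schwarz turns (u(r-h), u(r)) into half squares, whose integral over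
  \<open>r\<close> telescopes. At the lower end exactly \<open>h\<close> times the initial energy is
  left, because the window is cut off at time 0; at the upper end weak continuity in
  \<open>H\<close> gives lower semicontinuity. In the other terms \<open>h\<close> tends to 0 by
  continuity of translations between dual Lebesgue spaces: the nonlinear terms lie in the dual of
  \<open>L^(\<beta>+1)\<close> since 1/2 + 1/(\<beta>+1) \<le> \<beta>/(\<beta>+1), that is \<beta>
  \<ge> 3. Strictness of 4\<alpha>\<mu> > 1 in the limit case leaves a positive share of both the
  gradient and the square norm. Fields are functions, not classes, so \<open>L2dist\<close> is only
  a pseudometric: the abstract part assumes the semigroup law up to distance zero and never deduces
  equality from distance zero. There \<open>compact_image\<close> is the only source of compactness,
  and \<open>segment\<close> supplies the paths used for connectedness.\<close>

locale dissipative_semigroup =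
  fixes X :: "'a set" and d :: "'a \<Rightarrow> 'a \<Rightarrow> real" and N :: "'a \<Rightarrow> real"
    and S :: "real \<Rightarrow> 'a \<Rightarrow> 'a" and \<rho> :: real
  assumes d_nonneg: "x \<in> X \<Longrightarrow> y \<in> X \<Longrightarrow> 0 \<le> d x y"
    and d_refl: "x \<in> X \<Longrightarrow> d x x = 0"
    and d_sym: "x \<in> X \<Longrightarrow> y \<in> X \<Longrightarrow> d x y = d y x"
    and d_triangle: "x \<in> X \<Longrightarrow> y \<in> X \<Longrightarrow> z \<in> X \<Longrightarrow> d x z \<le> d x y + d y z"
    and N_lipschitz: "x \<in> X \<Longrightarrow> y \<in> X \<Longrightarrow> N x \<le> N y + d x y"
    and S_in: "0 \<le> t \<Longrightarrow> x \<in> X \<Longrightarrow> S t x \<in> X"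
    and S_add: "0 \<le> s \<Longrightarrow> 0 \<le> t \<Longrightarrow> x \<in> X \<Longrightarrow> d (S (t + s) x) (S t (S s x)) = 0"
    and S_cont: "0 \<le> t \<Longrightarrow> x \<in> X \<Longrightarrow> 0 < e \<Longrightarrow> \<exists>\<delta>>0. \<forall>y\<in>X. d x y < \<delta> \<longrightarrow> d (S t x) (S t y) < e"
    and absorbing: "\<exists>t0\<ge>0. \<forall>t\<ge>t0. \<forall>x\<in>X. N x \<le> R \<longrightarrow> N (S t x) \<le> \<rho>"
    and compact_image: "(\<And>n. (xs :: nat \<Rightarrow> 'a) n \<in> X \<and> N (xs n) \<le> \<rho>) \<Longrightarrow>
      \<exists>a\<in>X. \<exists>r. strict_mono r \<and> (\<lambda>n::nat. d (S 1 (xs (r n))) a) \<longlonglongrightarrow> 0"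
    and segment: "x \<in> X \<Longrightarrow> y \<in> X \<Longrightarrow> \<exists>c L. c 0 = x \<and> c 1 = y \<and> (\<forall>\<theta>\<in>{0..1}. c \<theta> \<in> X \<and> N (c \<theta>) \<le> max (N x) (N y)) \<and>
      (\<forall>\<theta>\<in>{0..1}. \<forall>\<theta>'\<in>{0..1}. d (c \<theta>) (c \<theta>') \<le> L * \<bar>\<theta> - \<theta>'\<bar>)"
begin

text \<open>The \<omega>-limit set of the ball of radius \<rho> in sequential form: the intersection
  over s of the closures of the unions of the images of the ball under \<open>S t\<close>, t \<ge>
  s. The starting points may vary with \<open>n\<close>, which is what yields attraction uniform on
  bounded sets.\<close>

definition attractor :: "'a set" where
  "attractor = {z\<in>X. \<exists>x t. (\<forall>n. x n \<in> X \<and> N (x n) \<le> \<rho> \<and> 0 \<le> t n) \<and>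
      filterlim t at_top sequentially \<and> (\<lambda>n::nat. d (S (t n) (x n)) z) \<longlonglongrightarrow> 0}"

lemma tendsto_zero_le:
  assumes "\<And>n. w n \<in> X" "z \<in> X" "\<And>n. d (w n) z \<le> g n" "g \<longlonglongrightarrow> 0"
  shows "(\<lambda>n. d (w n) z) \<longlonglongrightarrow> 0"
  by (rule tendsto_sandwich[OF _ _ tendsto_const assms(4)]) (auto simp: d_nonneg assms)

lemma S_tendsto:
  assumes "0 \<le> t" "\<And>n. w n \<in> X" "z \<in> X" "(\<lambda>n::nat. d (w n) z) \<longlonglongrightarrow> 0"
  shows "(\<lambda>n. d (S t (w n)) (S t z)) \<longlonglongrightarrow> 0"
proof (rule LIMSEQ_I)
  fix e :: real assume "0 < e"
  then obtain \<delta> where \<delta>: "\<delta> > 0" "\<forall>y\<in>X. d z y < \<delta> \<longrightarrow> d (S t z) (S t y) < e"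
    using S_cont assms by blast
  obtain K where K: "\<And>n. n \<ge> K \<Longrightarrow> norm (d (w n) z - 0) < \<delta>"
    using LIMSEQ_D[OF assms(4) \<delta>(1)] by blast
  show "\<exists>no. \<forall>n\<ge>no. norm (d (S t (w n)) (S t z) - 0) < e"
  proof (intro exI allI impI)
    fix n assume "n \<ge> K"
    then have "d z (w n) < \<delta>" using K[of n] d_sym[of z "w n"] assms by auto
    then have "d (S t z) (S t (w n)) < e" using \<delta> assms by blast
    then show "norm (d (S t (w n)) (S t z) - 0) < e"
      using d_sym[of "S t z" "S t (w n)"] d_nonneg[of "S t z" "S t (w n)"] S_in assms by auto
  qed
qed

text \<open>All but the last unit of time is spent entering the absorbing ball;
  \<open>compact_image\<close> is then applied to the last unit. The index shift by \<open>K\<close>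
  discards the finitely many times that are too short for this.\<close>

lemma asymptotically_compact:
  assumes x: "\<And>n. x n \<in> X" "\<And>n. N (x n) \<le> R" and t: "\<And>n. 0 \<le> t n" "filterlim t at_top sequentially"
  shows "\<exists>a\<in>X. \<exists>r. strict_mono r \<and> (\<lambda>n::nat. d (S (t (r n)) (x (r n))) a) \<longlonglongrightarrow> 0"
proof -
  obtain t0 where t0: "t0 \<ge> 0" "\<And>t x. t \<ge> t0 \<Longrightarrow> x \<in> X \<Longrightarrow> N x \<le> R \<Longrightarrow> N (S t x) \<le> \<rho>"
    using absorbing by blast
  obtain K where K: "\<And>n. n \<ge> K \<Longrightarrow> t n \<ge> t0 + 1"
    using t(2) unfolding filterlim_at_top eventually_sequentially by blast
  define w where "w n = S (t (n + K) - 1) (x (n + K))" for n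
  have w: "w n \<in> X \<and> N (w n) \<le> \<rho>" for n
    using K[of "n + K"] t0 x by (auto simp: w_def intro!: S_in)
  have "\<exists>a\<in>X. \<exists>r. strict_mono r \<and> (\<lambda>n. d (S 1 (w (r n))) a) \<longlonglongrightarrow> 0"
    by (rule compact_image) (rule w)
  then obtain a r where a: "a \<in> X" "strict_mono r" "(\<lambda>n. d (S 1 (w (r n))) a) \<longlonglongrightarrow> 0"
    by blast
  have "d (S (t (r n + K)) (x (r n + K))) a \<le> d (S 1 (w (r n))) a" for n
  proof -
    have ge: "t (r n + K) - 1 \<ge> 0" using K[of "r n + K"] t0 by auto
    have "d (S (t (r n + K)) (x (r n + K))) (S 1 (w (r n))) = 0"
      using S_add[OF ge, of 1] x by (auto simp: w_def)
    moreover have "d (S (t (r n + K)) (x (r n + K))) a \<le> d (S (t (r n + K)) (x (r n + K))) (S 1 (w (r n))) + d (S 1 (w (r n))) a"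
      by (rule d_triangle) (use x t a w S_in in auto)
    ultimately show ?thesis by simp
  qed
  then have "(\<lambda>n. d (S (t (r n + K)) (x (r n + K))) a) \<longlonglongrightarrow> 0"
    by (intro tendsto_zero_le[OF _ _ _ a(3)]) (auto simp: x t a S_in)
  moreover have "strict_mono (\<lambda>n. r n + K)" using a(2) by (auto simp: strict_mono_def)
  ultimately show ?thesis using a(1) by blast
qed

text \<open>The definition only allows starting points in the absorbing ball. For an arbitrary
  bounded family the first \<open>t0\<close> units of time are run beforehand, and the sequence
  restarts from \<open>S t0 (x n)\<close>.\<close>

lemma attractorI:
  assumes x: "\<And>n. x n \<in> X" "\<And>n. N (x n) \<le> R" and t: "\<And>n. 0 \<le> t n" "filterlim t at_top sequentially"
    and z: "z \<in> X" "(\<lambda>n::nat. d (S (t n) (x n)) z) \<longlonglongrightarrow> 0"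
  shows "z \<in> attractor"
proof -
  obtain t0 where t0: "t0 \<ge> 0" "\<And>t x. t \<ge> t0 \<Longrightarrow> x \<in> X \<Longrightarrow> N x \<le> R \<Longrightarrow> N (S t x) \<le> \<rho>"
    using absorbing by blast
  obtain K where K: "\<And>n. n \<ge> K \<Longrightarrow> t n \<ge> t0"
    using t(2) unfolding filterlim_at_top eventually_sequentially by blast
  define w where "w n = S t0 (x (n + K))" for n
  define s where "s n = t (n + K) - t0" for n
  have ws: "w n \<in> X \<and> N (w n) \<le> \<rho> \<and> 0 \<le> s n" for n
    using K[of "n + K"] t0 x by (auto simp: w_def s_def intro!: S_in)
  have "filterlim (\<lambda>n. - t0 + t (n + K)) at_top sequentially"
    by (intro filterlim_tendsto_add_at_top[OF tendsto_const] filterlim_compose[OF t(2)]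
        filterlim_add_const_nat_at_top)
  then have fs: "filterlim s at_top sequentially" by (simp add: s_def[abs_def])
  have "d (S (s n) (w n)) z \<le> d (S (t (n + K)) (x (n + K))) z" for n
  proof -
    have "d (S (t (n + K)) (x (n + K))) (S (s n) (w n)) = 0"
      using S_add[OF t0(1), of "s n" "x (n + K)"] ws x by (auto simp: w_def s_def)
    moreover have "d (S (s n) (w n)) z \<le> d (S (s n) (w n)) (S (t (n + K)) (x (n + K))) + d (S (t (n + K)) (x (n + K))) z"
      by (rule d_triangle) (use x t z ws S_in in auto)
    moreover have "d (S (s n) (w n)) (S (t (n + K)) (x (n + K))) = d (S (t (n + K)) (x (n + K))) (S (s n) (w n))"
      by (rule d_sym) (simp_all add: x t ws S_in)
    ultimately show ?thesis by linarith
  qed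
  moreover have "(\<lambda>n. d (S (t (n + K)) (x (n + K))) z) \<longlonglongrightarrow> 0"
    using z(2) by (rule LIMSEQ_ignore_initial_segment)
  ultimately have "(\<lambda>n. d (S (s n) (w n)) z) \<longlonglongrightarrow> 0"
    using tendsto_zero_le[of "\<lambda>n. S (s n) (w n)" z "\<lambda>n. d (S (t (n + K)) (x (n + K))) z"] ws z S_in by blast
  then show ?thesis using ws fs z(1) unfolding attractor_def by blast
qed

lemma limit_in_attractor:
  assumes x: "\<And>n. x n \<in> X" "\<And>n. N (x n) \<le> R" and t: "\<And>n. 0 \<le> t n" "filterlim t at_top sequentially"
  shows "\<exists>a\<in>attractor. \<exists>r. strict_mono r \<and> (\<lambda>n::nat. d (S (t (r n)) (x (r n))) a) \<longlonglongrightarrow> 0"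
proof -
  obtain a r where a: "a \<in> X" "strict_mono r" "(\<lambda>n. d (S (t (r n)) (x (r n))) a) \<longlonglongrightarrow> 0"
    using asymptotically_compact[of x R t] assms by blast
  have "a \<in> attractor"
    by (rule attractorI[of "\<lambda>n. x (r n)" R "\<lambda>n. t (r n)"])
      (use x t a filterlim_compose[OF t(2) filterlim_subseq[OF a(2)]] in auto)
  then show ?thesis using a by blast
qed

lemma attractor_subset: "attractor \<subseteq> X" by (auto simp: attractor_def)

text \<open>Orbit points lie in the ball from some time on and \<open>N\<close> is Lipschitz, so one
  unit of slack covers the passage to the limit. In the proof of connectedness this bounds the
  segments between preimages uniformly.\<close>

lemma attractor_bounded:
  assumes "z \<in> attractor" shows "N z \<le> \<rho> + 1"
proof -
  obtain x t where xt: "\<And>n. x n \<in> X \<and> N (x n) \<le> \<rho> \<and> 0 \<le> t n" and z: "z \<in> X"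
      and t: "filterlim t at_top sequentially" and l: "(\<lambda>n::nat. d (S (t n) (x n)) z) \<longlonglongrightarrow> 0"
    using assms unfolding attractor_def by blast
  obtain t0 where t0: "t0 \<ge> 0" "\<And>t x. t \<ge> t0 \<Longrightarrow> x \<in> X \<Longrightarrow> N x \<le> \<rho> \<Longrightarrow> N (S t x) \<le> \<rho>"
    using absorbing by blast
  have "eventually (\<lambda>n. t n \<ge> t0) sequentially" using t unfolding filterlim_at_top by blast
  moreover have "eventually (\<lambda>n. d (S (t n) (x n)) z < 1) sequentially"
    using l by (rule order_tendstoD) simp
  ultimately have "eventually (\<lambda>n. N z \<le> \<rho> + 1) sequentially"
  proof eventually_elim
    case (elim n)
    have "N (S (t n) (x n)) \<le> \<rho>" using t0 elim xt by blast
    moreover have "N z \<le> N (S (t n) (x n)) + d z (S (t n) (x n))"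
      using N_lipschitz z xt S_in by auto
    ultimately show ?case using elim d_sym[of z "S (t n) (x n)"] z xt S_in by auto
  qed
  then show ?thesis by simp
qed

text \<open>Diagonal choice: each \<open>s n\<close> is replaced by an orbit point at time at least
  \<open>n\<close> within 1/(n+1) of it, and these orbit points fall under
  \<open>limit_in_attractor\<close>.\<close>

lemma attractor_compact:
  assumes s: "\<And>n::nat. s n \<in> attractor"
  shows "\<exists>a\<in>attractor. \<exists>r. strict_mono r \<and> (\<lambda>n. d (s (r n)) a) \<longlonglongrightarrow> 0"
proof -
  have sX: "s n \<in> X" for n using s attractor_subset by blast
  have "\<exists>x t. x \<in> X \<and> N x \<le> \<rho> \<and> real n \<le> t \<and> d (S t x) (s n) < inverse (real (Suc n))" for n
  proof -
    obtain x t where xt: "\<And>k. x k \<in> X \<and> N (x k) \<le> \<rho> \<and> 0 \<le> t k"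
      and t: "filterlim t at_top sequentially" and l: "(\<lambda>k::nat. d (S (t k) (x k)) (s n)) \<longlonglongrightarrow> 0"
      using s[of n] unfolding attractor_def by blast
    have "eventually (\<lambda>k. t k \<ge> real n) sequentially" using t unfolding filterlim_at_top by blast
    moreover have "eventually (\<lambda>k. d (S (t k) (x k)) (s n) < inverse (real (Suc n))) sequentially"
      using l by (rule order_tendstoD) simp
    ultimately have "eventually (\<lambda>k. t k \<ge> real n \<and> d (S (t k) (x k)) (s n) < inverse (real (Suc n))) sequentially"
      by (rule eventually_conj)
    then obtain k where "t k \<ge> real n \<and> d (S (t k) (x k)) (s n) < inverse (real (Suc n))"
      by (metis (mono_tags, lifting) eventually_sequentially order_refl)
    then show ?thesis using xt[of k] by blast
  qed
  then obtain x t where xt: "\<And>n. x n \<in> X" "\<And>n. N (x n) \<le> \<rho>" "\<And>n. real n \<le> t n"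
      "\<And>n. d (S (t n) (x n)) (s n) < inverse (real (Suc n))" by metis
  have t: "filterlim t at_top sequentially"
    by (rule filterlim_at_top_mono[OF filterlim_real_sequentially]) (simp add: xt)
  have t0: "0 \<le> t n" for n using xt(3)[of n] by linarith
  obtain a r where a: "a \<in> attractor" "strict_mono r" "(\<lambda>n. d (S (t (r n)) (x (r n))) a) \<longlonglongrightarrow> 0"
    using limit_in_attractor[of x \<rho> t] xt t t0 by blast
  have aX: "a \<in> X" using a attractor_subset by blast
  have "d (s (r n)) a \<le> inverse (real (Suc (r n))) + d (S (t (r n)) (x (r n))) a" for n
  proof -
    have yX: "S (t (r n)) (x (r n)) \<in> X" using S_in xt t0 by blast
    show ?thesis using d_triangle[OF sX[of "r n"] yX aX] xt(4)[of "r n"] d_sym[OF sX[of "r n"] yX] by linarith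
  qed
  moreover have "(\<lambda>n. inverse (real (Suc (r n))) + d (S (t (r n)) (x (r n))) a) \<longlonglongrightarrow> 0 + 0"
    by (intro tendsto_add a LIMSEQ_subseq_LIMSEQ[OF LIMSEQ_inverse_real_of_nat a(2), unfolded o_def])
  ultimately have "(\<lambda>n. d (s (r n)) a) \<longlonglongrightarrow> 0"
    using tendsto_zero_le[of "\<lambda>n. s (r n)" a "\<lambda>n. inverse (real (Suc (r n))) + d (S (t (r n)) (x (r n))) a"] sX aX
    by (simp del: of_nat_Suc)
  then show ?thesis using a by blast
qed

lemma attractor_forward:
  assumes "0 \<le> \<tau>" "z \<in> attractor" shows "S \<tau> z \<in> attractor"
proof -
  obtain x t where xt: "\<And>n. x n \<in> X \<and> N (x n) \<le> \<rho> \<and> 0 \<le> t n" and z: "z \<in> X"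
      and t: "filterlim t at_top sequentially" and l: "(\<lambda>n::nat. d (S (t n) (x n)) z) \<longlonglongrightarrow> 0"
    using assms unfolding attractor_def by blast
  have l': "(\<lambda>n. d (S \<tau> (S (t n) (x n))) (S \<tau> z)) \<longlonglongrightarrow> 0"
    by (rule S_tendsto) (use assms xt z l S_in in auto)
  have "d (S (\<tau> + t n) (x n)) (S \<tau> z) \<le> d (S \<tau> (S (t n) (x n))) (S \<tau> z)" for n
    using d_triangle[of "S (\<tau> + t n) (x n)" "S \<tau> (S (t n) (x n))" "S \<tau> z"] S_add[of "t n" \<tau> "x n"]
      xt z S_in assms by auto
  then have "(\<lambda>n. d (S (\<tau> + t n) (x n)) (S \<tau> z)) \<longlonglongrightarrow> 0"
    by (intro tendsto_zero_le[OF _ _ _ l']) (use assms xt z S_in in auto)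
  then show ?thesis
    using xt assms z S_in filterlim_tendsto_add_at_top[OF tendsto_const t, of \<tau>]
    by (intro attractorI[of x \<rho> "\<lambda>n. \<tau> + t n"]) auto
qed

text \<open>A preimage is a limit of the same orbits observed \<tau> earlier; continuity of
  \<open>S \<tau>\<close> carries it to \<open>z\<close>. Only distance zero comes out, since times
  of \<open>S\<close> add up only to that extent.\<close>

lemma attractor_backward:
  assumes "0 \<le> \<tau>" "z \<in> attractor" shows "\<exists>w\<in>attractor. d (S \<tau> w) z = 0"
proof -
  obtain x t where xt: "\<And>n. x n \<in> X \<and> N (x n) \<le> \<rho> \<and> 0 \<le> t n" and z: "z \<in> X"
      and t: "filterlim t at_top sequentially" and l: "(\<lambda>n::nat. d (S (t n) (x n)) z) \<longlonglongrightarrow> 0"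
    using assms unfolding attractor_def by blast
  obtain K where K: "\<And>n. n \<ge> K \<Longrightarrow> t n \<ge> \<tau>"
    using t unfolding filterlim_at_top eventually_sequentially by blast
  have tK: "0 \<le> t (n + K) - \<tau>" for n using K[of "n + K"] by simp
  have "filterlim (\<lambda>n. - \<tau> + t (n + K)) at_top sequentially"
    by (intro filterlim_tendsto_add_at_top[OF tendsto_const] filterlim_compose[OF t]
        filterlim_add_const_nat_at_top)
  then have "filterlim (\<lambda>n. t (n + K) - \<tau>) at_top sequentially" by simp
  then obtain w r where w: "w \<in> attractor" "strict_mono r"
      "(\<lambda>n. d (S (t (r n + K) - \<tau>) (x (r n + K))) w) \<longlonglongrightarrow> 0"
    using limit_in_attractor[of "\<lambda>n. x (n + K)" \<rho> "\<lambda>n. t (n + K) - \<tau>"] xt tK by blast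
  have wX: "w \<in> X" using w attractor_subset by blast
  let ?y = "\<lambda>n. S (t (r n + K) - \<tau>) (x (r n + K))"
  have yX: "?y n \<in> X" for n using xt tK S_in by auto
  have l1: "(\<lambda>n. d (S \<tau> (?y n)) (S \<tau> w)) \<longlonglongrightarrow> 0"
    by (rule S_tendsto) (use assms yX wX w in auto)
  have sm: "strict_mono (\<lambda>n. r n + K)" using w(2) by (auto simp: strict_mono_def)
  have l2: "(\<lambda>n. d (S (t (r n + K)) (x (r n + K))) z) \<longlonglongrightarrow> 0"
    using LIMSEQ_subseq_LIMSEQ[OF l sm] by (simp add: o_def)
  have le: "d (S \<tau> w) z \<le> d (S \<tau> (?y n)) (S \<tau> w) + d (S (t (r n + K)) (x (r n + K))) z" for n
  proof -
    have "d (S (t (r n + K)) (x (r n + K))) (S \<tau> (?y n)) = 0"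
      using S_add[OF tK[of "r n"] assms(1), of "x (r n + K)"] xt by auto
    then have "d (S \<tau> (?y n)) z \<le> d (S (t (r n + K)) (x (r n + K))) z"
      using d_triangle[of "S \<tau> (?y n)" "S (t (r n + K)) (x (r n + K))" z]
        d_sym[of "S \<tau> (?y n)" "S (t (r n + K)) (x (r n + K))"] xt yX z S_in assms by auto
    then show ?thesis
      using d_triangle[of "S \<tau> w" "S \<tau> (?y n)" z] d_sym[of "S \<tau> w" "S \<tau> (?y n)"] wX yX z S_in assms by auto
  qed
  have "d (S \<tau> w) z \<le> 0"
    using tendsto_add[OF l1 l2] le by (intro LIMSEQ_le_const[where X="\<lambda>n. d (S \<tau> (?y n)) (S \<tau> w) + d (S (t (r n + K)) (x (r n + K))) z"]) auto
  then show ?thesis using w d_nonneg[of "S \<tau> w" z] S_in wX z assms by force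
qed

text \<open>Failure would give orbit points at times tending to infinity, with bounded starting
  points, that stay at distance \<open>e\<close> from every point of the attractor, against
  \<open>limit_in_attractor\<close>.\<close>

lemma attractor_attracts:
  assumes "e > 0"
  shows "\<exists>t0\<ge>0. \<forall>t\<ge>t0. \<forall>x\<in>X. N x \<le> R \<longrightarrow> (\<exists>a\<in>attractor. d (S t x) a < e)"
proof (rule ccontr)
  assume "\<not> ?thesis"
  then have "\<exists>t x. t \<ge> real n \<and> x \<in> X \<and> N x \<le> R \<and> (\<forall>a\<in>attractor. \<not> d (S t x) a < e)" for n :: nat
    by (meson of_nat_0_le_iff)
  then obtain t x where xt: "\<And>n::nat. t n \<ge> real n" "\<And>n. x n \<in> X" "\<And>n. N (x n) \<le> R"
      "\<And>n a. a \<in> attractor \<Longrightarrow> \<not> d (S (t n) (x n)) a < e" by metis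
  have t: "filterlim t at_top sequentially"
    by (rule filterlim_at_top_mono[OF filterlim_real_sequentially]) (simp add: xt)
  have t0: "0 \<le> t n" for n using xt(1)[of n] by linarith
  obtain a r where a: "a \<in> attractor" "(\<lambda>n. d (S (t (r n)) (x (r n))) a) \<longlonglongrightarrow> 0"
    using limit_in_attractor[of x R t] xt t t0 by blast
  have "eventually (\<lambda>n. d (S (t (r n)) (x (r n))) a < e) sequentially"
    using a(2) assms by (rule order_tendstoD)
  then show False using xt(4)[OF a(1)] by (auto simp: eventually_sequentially)
qed

section \<open>Connectedness of the attractor\<close>

definition dist_to :: "'a set \<Rightarrow> 'a \<Rightarrow> real" where
  "dist_to C x = (INF a\<in>C. d x a)"

lemma dist_to_le:
  assumes "C \<subseteq> X" "x \<in> X" "a \<in> C" shows "dist_to C x \<le> d x a"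
  unfolding dist_to_def by (rule cINF_lower[OF bdd_belowI2[where m=0]]) (use assms d_nonneg in auto)

lemma dist_to_lipschitz:
  assumes "C \<subseteq> X" "C \<noteq> {}" "x \<in> X" "y \<in> X" shows "\<bar>dist_to C x - dist_to C y\<bar> \<le> d x y"
proof -
  have *: "dist_to C x - d x y \<le> dist_to C y" if "x \<in> X" "y \<in> X" for x y
    unfolding dist_to_def[of C y]
  proof (rule cINF_greatest[OF assms(2)])
    fix a assume "a \<in> C"
    then show "dist_to C x - d x y \<le> d y a"
      using dist_to_le[of C x a] d_triangle[of x y a] assms that by auto
  qed
  show ?thesis using *[of x y] *[of y x] d_sym[of x y] assms by auto
qed

text \<open>If the attractor split into two pieces, the image under \<open>S n\<close> of a segment joining
  preimages of a point of each piece would contain a point equidistant from both pieces; these points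
  accumulate at a point of the attractor equidistant from both pieces.\<close>

lemma attractor_connected:
  assumes U: "\<And>x. x \<in> U \<Longrightarrow> \<exists>e>0. \<forall>y\<in>X. d x y < e \<longrightarrow> y \<in> U"
    and V: "\<And>x. x \<in> V \<Longrightarrow> \<exists>e>0. \<forall>y\<in>X. d x y < e \<longrightarrow> y \<in> V"
    and cover: "attractor \<subseteq> U \<union> V" and ne: "attractor \<inter> U \<noteq> {}" "attractor \<inter> V \<noteq> {}"
    and disj: "attractor \<inter> U \<inter> V = {}"
  shows False
proof -
  let ?C = "attractor \<inter> U" and ?D = "attractor \<inter> V"
  define \<phi> where "\<phi> x = dist_to ?C x - dist_to ?D x" for x
  have CD: "?C \<subseteq> X" "?D \<subseteq> X" using attractor_subset by auto
  obtain a b where ab: "a \<in> ?C" "b \<in> ?D" using ne by blast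
  \<comment> \<open>The ball around \<open>z\<close> inside \<open>U\<close> contains no point of
    \<open>?D\<close>, as the two pieces are disjoint; its radius bounds the distance from
    below.\<close>
  have sep: "dist_to ?D z > 0" if zC: "z \<in> ?C" for z
  proof -
    obtain e where e: "e > 0" "\<forall>y\<in>X. d z y < e \<longrightarrow> y \<in> U" using U[of z] zC by blast
    have "e \<le> dist_to ?D z" unfolding dist_to_def
    proof (rule cINF_greatest[OF ne(2)])
      fix y assume "y \<in> attractor \<inter> V"
      then have "y \<in> X" "y \<notin> U" using disj CD by blast+
      then show "e \<le> d z y" using e(2) not_less by blast
    qed
    then show ?thesis using e by simp
  qed
  have sep': "dist_to ?C z > 0" if zC: "z \<in> ?D" for z
  proof -
    obtain e where e: "e > 0" "\<forall>y\<in>X. d z y < e \<longrightarrow> y \<in> V" using V[of z] zC by blast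
    have "e \<le> dist_to ?C z" unfolding dist_to_def
    proof (rule cINF_greatest[OF ne(1)])
      fix y assume "y \<in> attractor \<inter> U"
      then have "y \<in> X" "y \<notin> V" using disj CD by blast+
      then show "e \<le> d z y" using e(2) not_less by blast
    qed
    then show ?thesis using e by simp
  qed
  have z0: "dist_to C z \<le> 0" if "C \<subseteq> X" "z \<in> C" for C z
    using dist_to_le[of C z z] d_refl that by auto
  have \<phi>_lip: "\<bar>\<phi> x - \<phi> y\<bar> \<le> 2 * d x y" if "x \<in> X" "y \<in> X" for x y
    using dist_to_lipschitz[OF CD(1) ne(1) that] dist_to_lipschitz[OF CD(2) ne(2) that] unfolding \<phi>_def by linarith
  have \<phi>a: "\<phi> a < 0" using z0[OF CD(1) ab(1)] sep[OF ab(1)] unfolding \<phi>_def by simp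
  have \<phi>b: "\<phi> b > 0" using z0[OF CD(2) ab(2)] sep'[OF ab(2)] unfolding \<phi>_def by simp
  have "\<exists>y. y \<in> X \<and> N y \<le> \<rho> + 1 \<and> \<phi> (S (real n) y) = 0" for n
  proof -
    obtain a' where a': "a' \<in> attractor" "d (S (real n) a') a = 0"
      using attractor_backward[of "real n" a] ab by auto
    obtain b' where b': "b' \<in> attractor" "d (S (real n) b') b = 0"
      using attractor_backward[of "real n" b] ab by auto
    have X: "a' \<in> X" "b' \<in> X" "a \<in> X" "b \<in> X" using a' b' ab attractor_subset by auto
    obtain c L where c: "c 0 = a'" "c 1 = b'" "\<And>\<theta>. \<theta> \<in> {0..1} \<Longrightarrow> c \<theta> \<in> X"
        "\<And>\<theta>. \<theta> \<in> {0..1} \<Longrightarrow> N (c \<theta>) \<le> max (N a') (N b')"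
        "\<And>\<theta> \<theta>'. \<theta> \<in> {0..1} \<Longrightarrow> \<theta>' \<in> {0..1} \<Longrightarrow> d (c \<theta>) (c \<theta>') \<le> L * \<bar>\<theta> - \<theta>'\<bar>"
      using segment[OF X(1,2)] by blast
    define g where "g \<theta> = \<phi> (S (real n) (c \<theta>))" for \<theta> :: real
    have "continuous_on {0..1} g"
    proof (rule continuous_onI)
      fix \<theta> e :: real assume \<theta>: "\<theta> \<in> {0..1}" and "0 < e"
      then obtain \<delta> where \<delta>: "\<delta> > 0" "\<forall>y\<in>X. d (c \<theta>) y < \<delta> \<longrightarrow> d (S (real n) (c \<theta>)) (S (real n) y) < e / 2"
        using S_cont[of "real n" "c \<theta>" "e/2"] c(3)[OF \<theta>] by (metis half_gt_zero of_nat_0_le_iff)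
      show "\<exists>\<eta>>0. \<forall>\<theta>'\<in>{0..1}. dist \<theta>' \<theta> < \<eta> \<longrightarrow> dist (g \<theta>') (g \<theta>) \<le> e"
      proof (intro exI conjI ballI impI)
        \<comment> \<open>\<open>L\<close> comes without a sign, hence the absolute value; the added
          1 keeps the denominator positive.\<close>
        show "\<delta> / (\<bar>L\<bar> + 1) > 0" using \<delta> by simp
        fix \<theta>' assume \<theta>': "\<theta>' \<in> {0..1::real}" "dist \<theta>' \<theta> < \<delta> / (\<bar>L\<bar> + 1)"
        have "d (c \<theta>) (c \<theta>') \<le> L * \<bar>\<theta> - \<theta>'\<bar>" using c(5) \<theta> \<theta>' by blast
        also have "\<dots> \<le> (\<bar>L\<bar> + 1) * \<bar>\<theta> - \<theta>'\<bar>" by (rule mult_right_mono) auto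
        also have "\<dots> < \<delta>" using \<theta>'(2) by (simp add: dist_real_def abs_minus_commute field_simps)
        finally have "d (S (real n) (c \<theta>)) (S (real n) (c \<theta>')) < e / 2" using \<delta> c(3) \<theta>' by blast
        then show "dist (g \<theta>') (g \<theta>) \<le> e"
          using \<phi>_lip[of "S (real n) (c \<theta>)" "S (real n) (c \<theta>')"] c(3) \<theta> \<theta>' S_in
          by (auto simp: g_def dist_real_def)
      qed
    qed
    moreover have "g 0 \<le> 0"
      using \<phi>_lip[of "S (real n) a'" a] a' X S_in \<phi>a by (auto simp: g_def c)
    moreover have "0 \<le> g 1"
      using \<phi>_lip[of "S (real n) b'" b] b' X S_in \<phi>b by (auto simp: g_def c)
    ultimately obtain \<theta> where \<theta>: "0 \<le> \<theta>" "\<theta> \<le> 1" "g \<theta> = 0"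
      using IVT'[of g 0 0 1] by auto
    then have "c \<theta> \<in> X \<and> N (c \<theta>) \<le> \<rho> + 1 \<and> \<phi> (S (real n) (c \<theta>)) = 0"
      using c(3)[of \<theta>] c(4)[of \<theta>] attractor_bounded[OF a'(1)] attractor_bounded[OF b'(1)] by (auto simp: g_def)
    then show ?thesis by blast
  qed
  then obtain y where y: "\<And>n::nat. y n \<in> X" "\<And>n. N (y n) \<le> \<rho> + 1" "\<And>n. \<phi> (S (real n) (y n)) = 0" by metis
  obtain z r where z: "z \<in> attractor" "(\<lambda>n. d (S (real (r n)) (y (r n))) z) \<longlonglongrightarrow> 0"
    using limit_in_attractor[of y "\<rho> + 1" real] y filterlim_real_sequentially by auto
  have zX: "z \<in> X" using z attractor_subset by blast
  have "\<bar>\<phi> z\<bar> \<le> 2 * d (S (real (r n)) (y (r n))) z" for n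
    using \<phi>_lip[of "S (real (r n)) (y (r n))" z] y S_in zX by auto
  then have "\<bar>\<phi> z\<bar> \<le> 0"
    using tendsto_mult[OF tendsto_const z(2), of 2]
    by (intro LIMSEQ_le_const[where X="\<lambda>n. 2 * d (S (real (r n)) (y (r n))) z"]) auto
  then have eq: "dist_to ?C z = dist_to ?D z" by (simp add: \<phi>_def)
  show False
    using cover z(1) z0[OF CD(1), of z] z0[OF CD(2), of z] sep[of z] sep'[of z] eq by auto
qed

end

section \<open>Square integrable fields\<close>

lemma tendsto_zero_sandwich:
  fixes f g :: "nat \<Rightarrow> real"
  assumes "\<And>n. 0 \<le> f n" "\<And>n. f n \<le> g n" "g \<longlonglongrightarrow> 0"
  shows "f \<longlonglongrightarrow> 0"
  by (rule tendsto_sandwich[OF _ _ tendsto_const assms(3)]) (simp_all add: assms)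

lemma L2I: "v \<in> borel_measurable (lebesgue_on \<Omega>) \<Longrightarrow> integrable (lebesgue_on \<Omega>) (\<lambda>x. (norm (v x))\<^sup>2) \<Longrightarrow> L2 \<Omega> v"
  by (simp add: L2_def)

lemma L2_zero: "L2 \<Omega> (\<lambda>x. 0)"
  by (simp add: L2_def)

lemma norm_add_sq_le: "(norm (a + b))\<^sup>2 \<le> 2 * (norm a)\<^sup>2 + 2 * (norm b)\<^sup>2" for a b :: "'a::real_inner"
proof -
  have "(norm (a + b))\<^sup>2 + (norm (a - b))\<^sup>2 = 2 * (norm a)\<^sup>2 + 2 * (norm b)\<^sup>2"
    by (simp add: power2_norm_eq_inner inner_add inner_diff algebra_simps inner_commute)
  then show ?thesis using zero_le_power2[of "norm (a - b)"] by linarith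
qed

lemma L2_add: assumes "L2 \<Omega> u" "L2 \<Omega> v" shows "L2 \<Omega> (\<lambda>x. u x + v x)"
proof (rule L2I)
  have m: "u \<in> borel_measurable (lebesgue_on \<Omega>)" "v \<in> borel_measurable (lebesgue_on \<Omega>)"
    using assms by (auto simp: L2_def)
  then show "(\<lambda>x. u x + v x) \<in> borel_measurable (lebesgue_on \<Omega>)" by simp
  show "integrable (lebesgue_on \<Omega>) (\<lambda>x. (norm (u x + v x))\<^sup>2)"
    by (rule Bochner_Integration.integrable_bound[where f="\<lambda>x. 2 * (norm (u x))\<^sup>2 + 2 * (norm (v x))\<^sup>2"])
      (use assms m norm_add_sq_le in \<open>auto simp: L2_def\<close>)
qed

lemma L2_scaleR: assumes "L2 \<Omega> u" shows "L2 \<Omega> (\<lambda>x. c *\<^sub>R u x)"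
  using assms by (auto simp: L2_def power_mult_distrib)

lemma L2_diff: assumes "L2 \<Omega> u" "L2 \<Omega> v" shows "L2 \<Omega> (\<lambda>x. u x - v x)"
  using L2_add[OF assms(1) L2_scaleR[OF assms(2), of "-1"]] by simp

lemma L2_integrable_inner: assumes "L2 \<Omega> u" "L2 \<Omega> v"
  shows "integrable (lebesgue_on \<Omega>) (\<lambda>x. inner (u x) (v x))"
proof (rule Bochner_Integration.integrable_bound[where f="\<lambda>x. (norm (u x))\<^sup>2 + (norm (v x))\<^sup>2"])
  show "integrable (lebesgue_on \<Omega>) (\<lambda>x. (norm (u x))\<^sup>2 + (norm (v x))\<^sup>2)"
    using assms by (simp add: L2_def)
  show "(\<lambda>x. u x \<bullet> v x) \<in> borel_measurable (lebesgue_on \<Omega>)"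
    using assms by (intro borel_measurable_inner) (simp_all add: L2_def)
  have "\<bar>a \<bullet> b\<bar> \<le> (norm a)\<^sup>2 + (norm b)\<^sup>2" for a b :: 'a
  proof -
    have "\<bar>a \<bullet> b\<bar> \<le> norm a * norm b" by (rule Cauchy_Schwarz_ineq2)
    also have "\<dots> \<le> 2 * (norm a * norm b)" by simp
    also have "\<dots> \<le> (norm a)\<^sup>2 + (norm b)\<^sup>2" using sum_squares_bound[of "norm a" "norm b"] by (simp add: mult.assoc)
    finally show ?thesis .
  qed
  then show "AE x in lebesgue_on \<Omega>. norm (u x \<bullet> v x) \<le> norm ((norm (u x))\<^sup>2 + (norm (v x))\<^sup>2)" by simp
qed

lemma L2norm_nonneg: "0 \<le> L2norm \<Omega> u" by (simp add: L2norm_def)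

lemma L2norm_sq: "(L2norm \<Omega> u)\<^sup>2 = integral\<^sup>L (lebesgue_on \<Omega>) (\<lambda>x. (norm (u x))\<^sup>2)"
  by (simp add: L2norm_def)

lemma L2norm_sq_inner: "(L2norm \<Omega> u)\<^sup>2 = L2inner \<Omega> u u"
  by (simp add: L2norm_sq L2inner_def power2_norm_eq_inner)

lemma L2inner_commute: "L2inner \<Omega> u v = L2inner \<Omega> v u"
  by (simp add: L2inner_def inner_commute)

lemma L2inner_scaleR_left: "L2inner \<Omega> (\<lambda>x. c *\<^sub>R u x) w = c * L2inner \<Omega> u w"
  by (simp add: L2inner_def)

lemma L2norm_sq_add: assumes "L2 \<Omega> u" "L2 \<Omega> v"
  shows "(L2norm \<Omega> (\<lambda>x. u x + v x))\<^sup>2 = (L2norm \<Omega> u)\<^sup>2 + 2 * L2inner \<Omega> u v + (L2norm \<Omega> v)\<^sup>2"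
proof -
  have "(L2norm \<Omega> (\<lambda>x. u x + v x))\<^sup>2 = integral\<^sup>L (lebesgue_on \<Omega>) (\<lambda>x. inner (u x) (u x) + 2 * inner (u x) (v x) + inner (v x) (v x))"
    by (simp add: L2norm_sq power2_norm_eq_inner inner_add inner_commute algebra_simps)
  also have "\<dots> = L2inner \<Omega> u u + 2 * L2inner \<Omega> u v + L2inner \<Omega> v v"
    using assms by (simp add: L2inner_def L2_integrable_inner)
  finally show ?thesis by (simp add: L2norm_sq_inner)
qed

lemma L2norm_scaleR: "L2norm \<Omega> (\<lambda>x. c *\<^sub>R u x) = \<bar>c\<bar> * L2norm \<Omega> u"
  by (simp add: L2norm_def power_mult_distrib real_sqrt_mult)

text \<open>The square norm of \<open>u + s v\<close> is a nonnegative quadratic polynomial in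
  \<open>s\<close>; the sign of its discriminant is the claim.\<close>

lemma L2_Cauchy_Schwarz: assumes "L2 \<Omega> u" "L2 \<Omega> v"
  shows "L2inner \<Omega> u v \<le> L2norm \<Omega> u * L2norm \<Omega> v"
proof -
  define a b c where "a = (L2norm \<Omega> u)\<^sup>2" and "b = L2inner \<Omega> u v" and "c = (L2norm \<Omega> v)\<^sup>2"
  have q: "0 \<le> a + 2 * s * b + s\<^sup>2 * c" for s
    using L2norm_sq_add[OF assms(1) L2_scaleR[OF assms(2), of s]] zero_le_power2[of "L2norm \<Omega> (\<lambda>x. u x + s *\<^sub>R v x)"]
    by (simp add: a_def b_def c_def L2norm_scaleR power_mult_distrib L2inner_commute[of \<Omega> u] L2inner_scaleR_left algebra_simps)
  have "b\<^sup>2 \<le> a * c"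
  proof (cases "c = 0")
    case True
    \<comment> \<open>For \<open>c = 0\<close> the polynomial is affine in \<open>s\<close>, and the
      chosen value of \<open>s\<close> would make it equal to -1 if \<open>b\<close> were not
      0.\<close>
    then have "b = 0" using q[of "- (a + 1) / (2 * b)"] by (cases "b = 0") (auto simp: field_simps)
    then show ?thesis using True by simp
  next
    case False
    then have "c > 0" by (simp add: c_def)
    then show ?thesis using q[of "- b / c"] by (simp add: field_simps power2_eq_square)
  qed
  then have "b\<^sup>2 \<le> (L2norm \<Omega> u * L2norm \<Omega> v)\<^sup>2" by (simp add: a_def c_def power_mult_distrib)
  then show ?thesis unfolding b_def by (rule power2_le_imp_le) (simp add: L2norm_nonneg)
qed

lemma L2norm_triangle: assumes "L2 \<Omega> u" "L2 \<Omega> v"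
  shows "L2norm \<Omega> (\<lambda>x. u x + v x) \<le> L2norm \<Omega> u + L2norm \<Omega> v"
proof (rule power2_le_imp_le)
  show "(L2norm \<Omega> (\<lambda>x. u x + v x))\<^sup>2 \<le> (L2norm \<Omega> u + L2norm \<Omega> v)\<^sup>2"
    using L2norm_sq_add[OF assms] L2_Cauchy_Schwarz[OF assms] by (simp add: power2_sum)
qed (simp add: L2norm_nonneg)

lemma L2norm_minus: "L2norm \<Omega> (\<lambda>x. v x - u x) = L2norm \<Omega> (\<lambda>x. u x - v x)"
  by (simp add: L2norm_def norm_minus_commute)

lemma L2dist_nonneg: "0 \<le> L2dist \<Omega> u v" by (simp add: L2dist_def L2norm_nonneg)

lemma L2dist_commute: "L2dist \<Omega> u v = L2dist \<Omega> v u" unfolding L2dist_def by (rule L2norm_minus)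

lemma L2dist_refl: "L2dist \<Omega> u u = 0" by (simp add: L2dist_def L2norm_def)

lemma L2dist_triangle: assumes "L2 \<Omega> u" "L2 \<Omega> v" "L2 \<Omega> w"
  shows "L2dist \<Omega> u w \<le> L2dist \<Omega> u v + L2dist \<Omega> v w"
  using L2norm_triangle[OF L2_diff[OF assms(1,2)] L2_diff[OF assms(2,3)]] by (simp add: L2dist_def)

lemma L2norm_le_dist: assumes "L2 \<Omega> u" "L2 \<Omega> v"
  shows "L2norm \<Omega> u \<le> L2norm \<Omega> v + L2dist \<Omega> u v"
  using L2norm_triangle[OF assms(2) L2_diff[OF assms]] by (simp add: L2dist_def)

lemma L2norm_eq_of_dist_zero: assumes "L2 \<Omega> u" "L2 \<Omega> v" "L2dist \<Omega> u v = 0"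
  shows "L2norm \<Omega> u = L2norm \<Omega> v"
  using L2norm_le_dist[OF assms(1,2)] L2norm_le_dist[OF assms(2,1)] assms(3) L2dist_commute[of \<Omega> u v] by simp

section \<open>Completeness of the space of square integrable fields\<close>

lemma L1_le_L2:
  assumes \<Omega>: "\<Omega> \<in> lmeasurable" and v: "L2 \<Omega> v"
  shows "integrable (lebesgue_on \<Omega>) (\<lambda>x. norm (v x))"
    "integral\<^sup>L (lebesgue_on \<Omega>) (\<lambda>x. norm (v x)) \<le> sqrt (measure lebesgue \<Omega>) * L2norm \<Omega> v"
proof -
  have 1: "L2 \<Omega> (\<lambda>x. 1::real)"
    using \<Omega> by (auto simp: L2_def fmeasurable_def emeasure_restrict_space space_restrict_space intro!: finite_measure.integrable_const finite_measureI)
  have n: "L2 \<Omega> (\<lambda>x. norm (v x))" using v by (auto simp: L2_def)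
  show "integrable (lebesgue_on \<Omega>) (\<lambda>x. norm (v x))" using L2_integrable_inner[OF 1 n] by simp
  have "L2norm \<Omega> (\<lambda>x. 1::real) = sqrt (measure lebesgue \<Omega>)"
    using \<Omega> by (simp add: L2norm_def measure_restrict_space space_restrict_space fmeasurable_def)
  then show "integral\<^sup>L (lebesgue_on \<Omega>) (\<lambda>x. norm (v x)) \<le> sqrt (measure lebesgue \<Omega>) * L2norm \<Omega> v"
    using L2_Cauchy_Schwarz[OF 1 n] by (simp add: L2inner_def) (simp add: L2norm_def)
qed

text \<open>Riesz-Fischer: along a subsequence with geometrically small increments the sum of the
  increments has finite \<open>L^1\<close> norm, hence converges absolutely almost everywhere.
  Fatou's lemma then turns the pointwise limit into a limit in norm of the whole sequence.\<close>

theorem L2_complete: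
  fixes x :: "nat \<Rightarrow> pt \<Rightarrow> 'b::euclidean_space"
  assumes \<Omega>: "\<Omega> \<in> lmeasurable" and x: "\<And>n. L2 \<Omega> (x n)"
    and cauchy: "\<And>e. e > 0 \<Longrightarrow> \<exists>K. \<forall>m\<ge>K. \<forall>n\<ge>K. L2dist \<Omega> (x m) (x n) < e"
  shows "\<exists>z. L2 \<Omega> z \<and> (\<lambda>n. L2dist \<Omega> (x n) z) \<longlonglongrightarrow> 0"
proof -
  let ?M = "lebesgue_on \<Omega>"
  have [measurable]: "x n \<in> borel_measurable ?M" for n using x[of n] by (simp add: L2_def)
  have "\<exists>K. \<forall>m\<ge>K. \<forall>n\<ge>K. L2dist \<Omega> (x m) (x n) < (1/2)^k" for k
    using cauchy[of "(1/2)^k"] by simp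
  then obtain K where K: "\<And>k m n. m \<ge> K k \<Longrightarrow> n \<ge> K k \<Longrightarrow> L2dist \<Omega> (x m) (x n) < (1/2)^k"
    by metis
  \<comment> \<open>The sum makes both \<open>r k\<close> and \<open>r (Suc k)\<close> at least
    \<open>K k\<close>; the summand \<open>k\<close> makes the indices tend to infinity.\<close>
  define r where "r k = (\<Sum>j\<le>k. K j) + k" for k
  have rK: "r k \<ge> K k" and rS: "r (Suc k) \<ge> K k" and rk: "r k \<ge> k" for k
    using member_le_sum[of k "{..k}" K] by (auto simp: r_def)
  define \<Delta> where "\<Delta> k y = x (r (Suc k)) y - x (r k) y" for k y
  have \<Delta>L2: "L2 \<Omega> (\<Delta> k)" for k unfolding \<Delta>_def[abs_def] by (intro L2_diff x)
  have [measurable]: "\<Delta> k \<in> borel_measurable ?M" for k using \<Delta>L2[of k] by (simp add: L2_def)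
  have \<Delta>n: "L2norm \<Omega> (\<Delta> k) \<le> (1/2)^k" for k
    using K[OF rS rK, of k] by (simp add: \<Delta>_def[abs_def] L2dist_def)
  define c where "c = sqrt (measure lebesgue \<Omega>)"
  have c0: "c \<ge> 0" by (simp add: c_def)
  have \<Delta>1: "(\<integral>\<^sup>+y. ennreal (norm (\<Delta> k y)) \<partial>?M) \<le> ennreal (c * (1/2)^k)" for k
  proof -
    have "(\<integral>\<^sup>+y. ennreal (norm (\<Delta> k y)) \<partial>?M) = ennreal (\<integral>y. norm (\<Delta> k y) \<partial>?M)"
      by (rule nn_integral_eq_integral) (use L1_le_L2[OF \<Omega> \<Delta>L2] in auto)
    also have "\<dots> \<le> ennreal (c * (1/2)^k)"
      using L1_le_L2(2)[OF \<Omega> \<Delta>L2, of k] mult_left_mono[OF \<Delta>n c0, of k]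
      by (intro ennreal_leI) (simp add: c_def)
    finally show ?thesis .
  qed
  have "(\<integral>\<^sup>+y. (\<Sum>k. ennreal (norm (\<Delta> k y))) \<partial>?M) = (\<Sum>k. \<integral>\<^sup>+y. ennreal (norm (\<Delta> k y)) \<partial>?M)"
    by (rule nn_integral_suminf) simp
  also have "\<dots> \<le> (\<Sum>k. ennreal (c * (1/2)^k))"
    by (intro suminf_le \<Delta>1) auto
  also have "\<dots> = ennreal (\<Sum>k. c * (1/2)^k)"
    by (intro suminf_ennreal2) (auto simp: c0 intro!: summable_mult summable_geometric)
  finally have "(\<integral>\<^sup>+y. (\<Sum>k. ennreal (norm (\<Delta> k y))) \<partial>?M) \<noteq> \<infinity>"
    by (metis ennreal_neq_top infinity_ennreal_def neq_top_trans)
  then have "AE y in ?M. (\<Sum>k. ennreal (norm (\<Delta> k y))) \<noteq> \<infinity>"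
    by (intro nn_integral_noteq_infinite) auto
  then have conv: "AE y in ?M. (\<lambda>k. x (r k) y) \<longlonglongrightarrow> lim (\<lambda>k. x (r k) y)"
  proof eventually_elim
    case (elim y)
    then have "summable (\<lambda>k. norm (\<Delta> k y))" by (intro summable_suminf_not_top) auto
    then have "summable (\<lambda>k. \<Delta> k y)" by (rule summable_norm_cancel)
    then have "(\<lambda>n. \<Sum>k<n. \<Delta> k y) \<longlonglongrightarrow> (\<Sum>k. \<Delta> k y)" by (rule summable_LIMSEQ)
    then have "(\<lambda>n. x (r 0) y + (\<Sum>k<n. \<Delta> k y)) \<longlonglongrightarrow> x (r 0) y + (\<Sum>k. \<Delta> k y)" by (intro tendsto_intros)
    moreover have "x (r 0) y + (\<Sum>k<n. \<Delta> k y) = x (r n) y" for n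
      unfolding \<Delta>_def by (simp add: sum_lessThan_telescope[of "\<lambda>k. x (r k) y"])
    ultimately show ?case by (simp add: limI)
  qed
  define z where "z y = lim (\<lambda>k. x (r k) y)" for y
  have [measurable]: "z \<in> borel_measurable ?M" unfolding z_def[abs_def] by (rule borel_measurable_lim_metric) simp
  \<comment> \<open>The assumption compares \<open>x m\<close> with a whole tail of the sequence, so
    it covers the subsequence because \<open>r k \<ge> k\<close>.\<close>
  have fatou: "(\<integral>\<^sup>+y. ennreal ((norm (x m y - z y))\<^sup>2) \<partial>?M) \<le> ennreal (e\<^sup>2)"
    if e: "e > 0" and Ke: "\<And>k. k \<ge> K' \<Longrightarrow> L2dist \<Omega> (x m) (x k) < e" for e m K'
  proof -
    have "(\<integral>\<^sup>+y. ennreal ((norm (x m y - z y))\<^sup>2) \<partial>?M) = (\<integral>\<^sup>+y. liminf (\<lambda>k. ennreal ((norm (x m y - x (r k) y))\<^sup>2)) \<partial>?M)"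
    proof (rule nn_integral_cong_AE)
      show "AE y in ?M. ennreal ((norm (x m y - z y))\<^sup>2) = liminf (\<lambda>k. ennreal ((norm (x m y - x (r k) y))\<^sup>2))"
        using conv
      proof eventually_elim
        case (elim y)
        then have "(\<lambda>k. ennreal ((norm (x m y - x (r k) y))\<^sup>2)) \<longlonglongrightarrow> ennreal ((norm (x m y - z y))\<^sup>2)"
          unfolding z_def by (intro tendsto_intros)
        then show ?case by (rule lim_imp_Liminf[OF sequentially_bot, symmetric])
      qed
    qed
    also have "\<dots> \<le> liminf (\<lambda>k. \<integral>\<^sup>+y. ennreal ((norm (x m y - x (r k) y))\<^sup>2) \<partial>?M)"
      by (rule nn_integral_liminf) simp
    also have "\<dots> \<le> ennreal (e\<^sup>2)"
    proof (rule Liminf_le)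
      show "\<forall>\<^sub>F k in sequentially. (\<integral>\<^sup>+y. ennreal ((norm (x m y - x (r k) y))\<^sup>2) \<partial>?M) \<le> ennreal (e\<^sup>2)"
        unfolding eventually_sequentially
      proof (intro exI allI impI)
        fix k assume "k \<ge> K'"
        then have "L2dist \<Omega> (x m) (x (r k)) < e" using Ke[of "r k"] rk[of k] by linarith
        then have "(L2norm \<Omega> (\<lambda>y. x m y - x (r k) y))\<^sup>2 \<le> e\<^sup>2"
          by (intro power_mono) (auto simp: L2dist_def L2norm_nonneg)
        moreover have "(\<integral>\<^sup>+y. ennreal ((norm (x m y - x (r k) y))\<^sup>2) \<partial>?M) = ennreal ((L2norm \<Omega> (\<lambda>y. x m y - x (r k) y))\<^sup>2)"
          unfolding L2norm_sq by (rule nn_integral_eq_integral) (use L2_diff[OF x[of m] x[of "r k"]] in \<open>auto simp: L2_def\<close>)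
        ultimately show "(\<integral>\<^sup>+y. ennreal ((norm (x m y - x (r k) y))\<^sup>2) \<partial>?M) \<le> ennreal (e\<^sup>2)"
          by (simp add: ennreal_leI)
      qed
    qed simp
    finally show ?thesis .
  qed
  have L2d: "L2 \<Omega> (\<lambda>y. x m y - z y) \<and> L2dist \<Omega> (x m) z \<le> e" if "e > 0" and "\<And>k. k \<ge> K' \<Longrightarrow> L2dist \<Omega> (x m) (x k) < e" for e m K'
  proof
    have b: "(\<integral>\<^sup>+y. ennreal ((norm (x m y - z y))\<^sup>2) \<partial>?M) \<le> ennreal (e\<^sup>2)" using fatou[OF that] by blast
    then have i: "integrable ?M (\<lambda>y. (norm (x m y - z y))\<^sup>2)"
      by (intro integrableI_bounded) (auto simp: less_top top_unique intro: le_less_trans)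
    then show "L2 \<Omega> (\<lambda>y. x m y - z y)" by (simp add: L2_def)
    have "ennreal (integral\<^sup>L ?M (\<lambda>y. (norm (x m y - z y))\<^sup>2)) \<le> ennreal (e\<^sup>2)"
      using b by (subst (asm) nn_integral_eq_integral[OF i]) auto
    then have "(L2dist \<Omega> (x m) z)\<^sup>2 \<le> e\<^sup>2" by (simp add: L2dist_def L2norm_sq)
    then show "L2dist \<Omega> (x m) z \<le> e" by (rule power2_le_imp_le) (use that in simp)
  qed
  have ev: "\<exists>K'. \<forall>m\<ge>K'. L2 \<Omega> (\<lambda>y. x m y - z y) \<and> L2dist \<Omega> (x m) z \<le> e" if "e > 0" for e
    using cauchy[OF that] L2d[OF that] by metis
  obtain m where m: "L2 \<Omega> (\<lambda>y. x m y - z y)" using ev[of 1] by auto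
  have "L2 \<Omega> z" using L2_diff[OF x[of m] m] by simp
  moreover have "(\<lambda>n. L2dist \<Omega> (x n) z) \<longlonglongrightarrow> 0"
  proof (rule LIMSEQ_I)
    fix e :: real assume "e > 0"
    then obtain K' where "\<forall>m\<ge>K'. L2dist \<Omega> (x m) z \<le> e / 2" using ev[of "e/2"] by auto
    then show "\<exists>no. \<forall>n\<ge>no. norm (L2dist \<Omega> (x n) z - 0) < e"
      using \<open>e > 0\<close> by (intro exI[of _ K']) (force simp: L2dist_nonneg)
  qed
  ultimately show ?thesis by blast
qed

section \<open>Calculus of divergence-free test fields\<close>

lemma fold_pd_linear:
  assumes "smooth_R3 g" "smooth_R3 h"
  shows "fold pd is (\<lambda>x. a * g x + b * h x) = (\<lambda>x. a * fold pd is g x + b * fold pd is h x)"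
  using assms
proof (induction "is" arbitrary: g h)
  case (Cons i "is")
  have gd: "g differentiable (at x)" and hd: "h differentiable (at x)" for x
    using Cons.prems unfolding smooth_R3_def by (metis fold.simps(1) id_apply)+
  have sm: "smooth_R3 (pd i g)" "smooth_R3 (pd i h)"
    using Cons.prems unfolding smooth_R3_def by (metis fold_simps(2))+
  have "pd i (\<lambda>x. a * g x + b * h x) = (\<lambda>x. a * pd i g x + b * pd i h x)"
  proof
    fix x
    have "((\<lambda>x. a * g x + b * h x) has_derivative (\<lambda>y. a * frechet_derivative g (at x) y + b * frechet_derivative h (at x) y)) (at x)"
      using gd[of x] hd[of x] unfolding frechet_derivative_works by (intro derivative_intros)
    from fun_cong[OF frechet_derivative_at[OF this], of "axis i 1"]
    show "pd i (\<lambda>x. a * g x + b * h x) x = a * pd i g x + b * pd i h x"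
      by (simp add: pd_def)
  qed
  then show ?case using Cons.IH[OF sm] by simp
qed simp

lemma smooth_R3_linear:
  assumes "smooth_R3 g" "smooth_R3 h" shows "smooth_R3 (\<lambda>x. a * g x + b * h x)"
  unfolding smooth_R3_def fold_pd_linear[OF assms]
  using assms by (auto simp: smooth_R3_def)

lemma pd_linear:
  assumes "smooth_R3 g" "smooth_R3 h"
  shows "pd i (\<lambda>x. a * g x + b * h x) x = a * pd i g x + b * pd i h x"
  using fold_pd_linear[OF assms, of "[i]" a b] by simp

lemma test_field_linear:
  assumes "test_field \<Omega> \<phi>" "test_field \<Omega> \<eta>"
  shows "test_field \<Omega> (\<lambda>x. a *\<^sub>R \<phi> x + b *\<^sub>R \<eta> x)"
proof -
  have sm: "smooth_R3 (\<lambda>x. \<phi> x $ j)" "smooth_R3 (\<lambda>x. \<eta> x $ j)" for j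
    using assms by (auto simp: test_field_def)
  obtain K K' where "compact K" "K \<subseteq> \<Omega>" "\<And>x. x \<notin> K \<Longrightarrow> \<phi> x = 0"
      "compact K'" "K' \<subseteq> \<Omega>" "\<And>x. x \<notin> K' \<Longrightarrow> \<eta> x = 0"
    using assms unfolding test_field_def by metis
  then have "\<exists>K. compact K \<and> K \<subseteq> \<Omega> \<and> (\<forall>x. x \<notin> K \<longrightarrow> a *\<^sub>R \<phi> x + b *\<^sub>R \<eta> x = 0)"
    by (intro exI[of _ "K \<union> K'"]) auto
  moreover have "div_field (\<lambda>x. a *\<^sub>R \<phi> x + b *\<^sub>R \<eta> x) x = a * div_field \<phi> x + b * div_field \<eta> x" for x
    unfolding div_field_def by (simp add: pd_linear[OF sm] sum.distrib sum_distrib_left)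
  ultimately show ?thesis
    using assms smooth_R3_linear[OF sm] by (auto simp: test_field_def)
qed

lemma smooth_R3_zero: "smooth_R3 (\<lambda>x. 0)"
proof -
  have "pd i (\<lambda>x. 0) = (\<lambda>x. 0)" for i by (rule ext) (simp add: pd_def)
  then have "fold pd is (\<lambda>x. 0) = (\<lambda>x. 0)" for "is" by (induction "is") auto
  then show ?thesis by (simp add: smooth_R3_def)
qed

lemma test_field_zero: "test_field \<Omega> (\<lambda>x. 0)"
  by (auto simp: test_field_def smooth_R3_zero div_field_def pd_def intro!: exI[of _ "{}"])

lemma smooth_R3_differentiable: "smooth_R3 g \<Longrightarrow> g differentiable (at x)"
  unfolding smooth_R3_def by (metis fold.simps(1) id_apply)

lemma smooth_R3_pd: "smooth_R3 g \<Longrightarrow> smooth_R3 (pd i g)"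
  unfolding smooth_R3_def by (metis fold_simps(2))

lemma smooth_R3_continuous: "smooth_R3 g \<Longrightarrow> continuous_on A g"
  by (meson differentiable_imp_continuous_within smooth_R3_differentiable
      continuous_at_imp_continuous_on)

lemma test_field_continuous: "test_field \<Omega> \<phi> \<Longrightarrow> continuous_on A \<phi>"
  by (subst continuous_on_componentwise) (auto simp: test_field_def Basis_vec_def inner_axis intro: smooth_R3_continuous)

lemma test_field_grad_continuous: "test_field \<Omega> \<phi> \<Longrightarrow> continuous_on A (grad \<phi>)"
  unfolding grad_def by (intro continuous_on_vec_lambda smooth_R3_continuous smooth_R3_pd) (simp add: test_field_def)

text \<open>The complement of the compact set \<open>K\<close> is open, so the field vanishes near
  each of its points and the derivatives vanish with it.\<close>

lemma test_field_support:
  assumes "test_field \<Omega> \<phi>"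
  obtains K where "compact K" "K \<subseteq> \<Omega>" "\<And>x. x \<notin> K \<Longrightarrow> \<phi> x = 0" "\<And>x. x \<notin> K \<Longrightarrow> grad \<phi> x = 0"
proof -
  obtain K where K: "compact K" "K \<subseteq> \<Omega>" "\<And>x. x \<notin> K \<Longrightarrow> \<phi> x = 0"
    using assms unfolding test_field_def by metis
  have "grad \<phi> x = 0" if "x \<notin> K" for x
  proof -
    have "pd i (\<lambda>y. \<phi> y $ j) x = 0" for i j
    proof -
      have "((\<lambda>y. \<phi> y $ j) has_derivative (\<lambda>y. 0)) (at x)"
        using K that compact_imp_closed[OF K(1)]
        by (intro has_derivative_transform_within_open[OF has_derivative_const, of "- K" x 0]) auto
      then show ?thesis unfolding pd_def by (metis frechet_derivative_at)
    qed
    then show ?thesis by (simp add: grad_def vec_eq_iff)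
  qed
  then show ?thesis using that K by blast
qed

lemma L2_continuous_compact_support:
  fixes g :: "pt \<Rightarrow> 'b::euclidean_space"
  assumes "continuous_on UNIV g" "compact K" "\<And>x. x \<notin> K \<Longrightarrow> g x = 0" "open \<Omega>"
  shows "L2 \<Omega> g"
proof (rule L2I)
  have b: "g \<in> borel_measurable borel" using assms(1) by (rule borel_measurable_continuous_onI)
  then have [measurable]: "g \<in> borel_measurable lborel" by simp
  then show "g \<in> borel_measurable (lebesgue_on \<Omega>)"
    by (simp add: measurable_restrict_space1 measurable_completion)
  have "integrable lborel (\<lambda>x. indicator K x *\<^sub>R (norm (g x))\<^sup>2)"
    by (rule borel_integrable_compact) (auto intro!: continuous_intros continuous_on_subset[OF assms(1)] assms(2))
  moreover have "indicator K x *\<^sub>R (norm (g x))\<^sup>2 = (norm (g x))\<^sup>2" for x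
    using assms(3)[of x] by (auto simp: indicator_def)
  ultimately have "integrable lborel (\<lambda>x. (norm (g x))\<^sup>2)" by (simp only:)
  then have "integrable lebesgue (\<lambda>x. (norm (g x))\<^sup>2)" by (simp add: integrable_completion)
  then show "integrable (lebesgue_on \<Omega>) (\<lambda>x. (norm (g x))\<^sup>2)"
    using assms(4) by (subst integrable_restrict_space) (auto intro!: integrable_mult_indicator lmeasurable_open simp del: real_scaleR_def)
qed

lemma test_field_L2: "test_field \<Omega> \<phi> \<Longrightarrow> open \<Omega> \<Longrightarrow> L2 \<Omega> \<phi>"
  by (metis L2_continuous_compact_support test_field_continuous test_field_support)

lemma test_field_grad_L2: "test_field \<Omega> \<phi> \<Longrightarrow> open \<Omega> \<Longrightarrow> L2 \<Omega> (grad \<phi>)"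
  by (metis L2_continuous_compact_support test_field_grad_continuous test_field_support)

section \<open>The space H\<close>

lemma H_space_L2: "u \<in> H_space \<Omega> \<Longrightarrow> L2 \<Omega> u" by (simp add: H_space_def)

lemma H_space_zero: "(\<lambda>x. 0) \<in> H_space \<Omega>"
  by (auto simp: H_space_def L2_zero L2dist_refl intro!: exI[of _ "\<lambda>n x. 0"] test_field_zero)

lemma H_space_linear:
  assumes "open \<Omega>" "u \<in> H_space \<Omega>" "v \<in> H_space \<Omega>"
  shows "(\<lambda>x. a *\<^sub>R u x + b *\<^sub>R v x) \<in> H_space \<Omega>"
proof -
  obtain \<phi> \<eta> where \<phi>: "\<And>n. test_field \<Omega> (\<phi> n)" "(\<lambda>n. L2dist \<Omega> u (\<phi> n)) \<longlonglongrightarrow> 0"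
    and \<eta>: "\<And>n. test_field \<Omega> (\<eta> n)" "(\<lambda>n. L2dist \<Omega> v (\<eta> n)) \<longlonglongrightarrow> 0"
    using assms unfolding H_space_def by blast
  note L = H_space_L2[OF assms(2)] H_space_L2[OF assms(3)] test_field_L2[OF \<phi>(1) assms(1)] test_field_L2[OF \<eta>(1) assms(1)]
  have le: "L2dist \<Omega> (\<lambda>x. a *\<^sub>R u x + b *\<^sub>R v x) (\<lambda>x. a *\<^sub>R \<phi> n x + b *\<^sub>R \<eta> n x) \<le>
     \<bar>a\<bar> * L2dist \<Omega> u (\<phi> n) + \<bar>b\<bar> * L2dist \<Omega> v (\<eta> n)" for n
  proof -
    have "L2dist \<Omega> (\<lambda>x. a *\<^sub>R u x + b *\<^sub>R v x) (\<lambda>x. a *\<^sub>R \<phi> n x + b *\<^sub>R \<eta> n x) =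
       L2norm \<Omega> (\<lambda>x. a *\<^sub>R (u x - \<phi> n x) + b *\<^sub>R (v x - \<eta> n x))"
      unfolding L2dist_def by (simp add: algebra_simps)
    also have "\<dots> \<le> L2norm \<Omega> (\<lambda>x. a *\<^sub>R (u x - \<phi> n x)) + L2norm \<Omega> (\<lambda>x. b *\<^sub>R (v x - \<eta> n x))"
      by (intro L2norm_triangle L2_scaleR L2_diff L)
    finally show ?thesis by (simp add: L2norm_scaleR L2dist_def)
  qed
  have "(\<lambda>n. \<bar>a\<bar> * L2dist \<Omega> u (\<phi> n) + \<bar>b\<bar> * L2dist \<Omega> v (\<eta> n)) \<longlonglongrightarrow> \<bar>a\<bar> * 0 + \<bar>b\<bar> * 0"
    by (intro tendsto_intros \<phi> \<eta>)
  then have "(\<lambda>n. L2dist \<Omega> (\<lambda>x. a *\<^sub>R u x + b *\<^sub>R v x) (\<lambda>x. a *\<^sub>R \<phi> n x + b *\<^sub>R \<eta> n x)) \<longlonglongrightarrow> 0"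
    by (intro tendsto_zero_sandwich[OF L2dist_nonneg le]) simp
  then show ?thesis
    unfolding H_space_def using L2_add[OF L2_scaleR[OF L(1)] L2_scaleR[OF L(2)]] test_field_linear[OF \<phi>(1) \<eta>(1)]
    by (intro CollectI conjI exI[of _ "\<lambda>n x. a *\<^sub>R \<phi> n x + b *\<^sub>R \<eta> n x"]) auto
qed

text \<open>\<open>H_space\<close> is defined through sequences of test fields, so closedness takes
  a diagonal choice: a test field within 1/(n+1) of \<open>x n\<close>.\<close>

lemma H_space_closed:
  assumes "open \<Omega>" "\<And>n. x n \<in> H_space \<Omega>" "L2 \<Omega> z" "(\<lambda>n. L2dist \<Omega> (x n) z) \<longlonglongrightarrow> 0"
  shows "z \<in> H_space \<Omega>"
proof -
  have "\<exists>\<phi>. test_field \<Omega> \<phi> \<and> L2dist \<Omega> (x n) \<phi> < inverse (real (Suc n))" for n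
  proof -
    obtain \<phi> where \<phi>: "\<And>k. test_field \<Omega> (\<phi> k)" "(\<lambda>k. L2dist \<Omega> (x n) (\<phi> k)) \<longlonglongrightarrow> 0"
      using assms(2)[of n] unfolding H_space_def by blast
    have "eventually (\<lambda>k. L2dist \<Omega> (x n) (\<phi> k) < inverse (real (Suc n))) sequentially"
      using \<phi>(2) by (rule order_tendstoD) simp
    then show ?thesis using \<phi>(1) by (auto simp: eventually_sequentially simp del: of_nat_Suc)
  qed
  then obtain \<phi> where \<phi>: "\<And>n. test_field \<Omega> (\<phi> n)" "\<And>n. L2dist \<Omega> (x n) (\<phi> n) < inverse (real (Suc n))"
    by metis
  have le: "L2dist \<Omega> z (\<phi> n) \<le> L2dist \<Omega> (x n) z + inverse (real (Suc n))" for n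
    using L2dist_triangle[OF assms(3) H_space_L2[OF assms(2)[of n]] test_field_L2[OF \<phi>(1)[of n] assms(1)]]
      \<phi>(2)[of n] L2dist_commute[of \<Omega> z "x n"] by linarith
  have "(\<lambda>n. L2dist \<Omega> (x n) z + inverse (real (Suc n))) \<longlonglongrightarrow> 0 + 0"
    by (intro tendsto_add assms LIMSEQ_inverse_real_of_nat)
  then have "(\<lambda>n. L2dist \<Omega> z (\<phi> n)) \<longlonglongrightarrow> 0"
    by (intro tendsto_zero_sandwich[OF L2dist_nonneg le]) simp
  then show ?thesis using \<phi> assms(3) by (auto simp: H_space_def)
qed

section \<open>Rellich compactness\<close>

text \<open>Cauchy-Schwarz against the indicator of \<open>B\<close>, with extended nonnegative
  integrals on the right. Without integrability the Bochner integral on the left is 0 by convention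
  and the bound is trivial.\<close>

lemma norm_integral_sq_le:
  fixes f :: "'a \<Rightarrow> 'b::euclidean_space"
  assumes [measurable]: "f \<in> borel_measurable M" "B \<in> sets M"
  shows "ennreal ((norm (\<integral>x. indicator B x *\<^sub>R f x \<partial>M))\<^sup>2) \<le> emeasure M B * (\<integral>\<^sup>+x. ennreal ((norm (f x))\<^sup>2) * indicator B x \<partial>M)"
proof (cases "integrable M (\<lambda>x. indicator B x *\<^sub>R f x)")
  case True
  have "ennreal ((norm (\<integral>x. indicator B x *\<^sub>R f x \<partial>M))\<^sup>2) = (ennreal (norm (\<integral>x. indicator B x *\<^sub>R f x \<partial>M)))\<^sup>2"
    by (simp add: ennreal_power)
  also have "\<dots> \<le> (\<integral>\<^sup>+x. ennreal (norm (indicator B x *\<^sub>R f x)) \<partial>M)\<^sup>2"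
    by (intro power_mono integral_norm_bound_ennreal True) simp
  also have "(\<integral>\<^sup>+x. ennreal (norm (indicator B x *\<^sub>R f x)) \<partial>M) = (\<integral>\<^sup>+x. indicator B x * (ennreal (norm (f x)) * indicator B x) \<partial>M)"
    by (intro nn_integral_cong) (auto simp: indicator_def)
  also have "(\<dots>)\<^sup>2 \<le> (\<integral>\<^sup>+x. (indicator B x)\<^sup>2 \<partial>M) * (\<integral>\<^sup>+x. (ennreal (norm (f x)) * indicator B x)\<^sup>2 \<partial>M)"
    by (rule Cauchy_Schwarz_nn_integral) auto
  also have "(\<integral>\<^sup>+x. (indicator B x)\<^sup>2 \<partial>M) = (\<integral>\<^sup>+x. indicator B x \<partial>M)"
    by (intro nn_integral_cong) (auto simp: indicator_def)
  also have "\<dots> = emeasure M B" by simp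
  also have "(\<integral>\<^sup>+x. (ennreal (norm (f x)) * indicator B x)\<^sup>2 \<partial>M) = (\<integral>\<^sup>+x. ennreal ((norm (f x))\<^sup>2) * indicator B x \<partial>M)"
    by (intro nn_integral_cong) (auto simp: indicator_def ennreal_power)
  finally show ?thesis .
qed (simp add: not_integrable_integral_eq)

section \<open>Translation estimates and ball averages\<close>

lemma nn_integral_lborel_translation:
  fixes f :: "'a::euclidean_space \<Rightarrow> ennreal"
  assumes [measurable]: "f \<in> borel_measurable borel"
  shows "(\<integral>\<^sup>+x. f (x + z) \<partial>lborel) = (\<integral>\<^sup>+x. f x \<partial>lborel)"
proof -
  have "(\<integral>\<^sup>+x. f x \<partial>lborel) = (\<integral>\<^sup>+x. f x \<partial>distr lborel borel ((+) z))"
    by (simp add: lborel_distr_plus)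
  also have "\<dots> = (\<integral>\<^sup>+x. f (z + x) \<partial>lborel)" by (subst nn_integral_distr) auto
  finally show ?thesis by (simp add: add.commute)
qed

text \<open>In \<open>grad\<close> the first index is the direction of differentiation and the
  second one the component, so the derivative acts by the transposed matrix.\<close>

lemma test_field_has_derivative:
  assumes "test_field \<Omega> \<phi>"
  shows "\<exists>D. (\<phi> has_derivative D) (at x) \<and> (\<forall>z. D z = transpose (grad \<phi> x) *v z)"
proof -
  have d: "(\<lambda>y. \<phi> y $ j) differentiable (at x)" for j
    using assms smooth_R3_differentiable by (auto simp: test_field_def)
  define D where "D z = (\<chi> j. frechet_derivative (\<lambda>y. \<phi> y $ j) (at x) z)" for z
  have 1: "(\<phi> has_derivative D) (at x)"
    using d by (subst has_derivative_componentwise_within)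
      (auto simp: Basis_vec_def inner_axis D_def frechet_derivative_works)
  have "D z = transpose (grad \<phi> x) *v z" for z
  proof -
    have lin: "linear (frechet_derivative (\<lambda>y. \<phi> y $ j) (at x))" for j
      using d linear_frechet_derivative by blast
    have "frechet_derivative (\<lambda>y. \<phi> y $ j) (at x) z = (\<Sum>i\<in>UNIV. z $ i * pd i (\<lambda>y. \<phi> y $ j) x)" for j
    proof -
      have "z = (\<Sum>i\<in>UNIV. z $ i *\<^sub>R axis i 1)" using basis_expansion[of z] by (simp add: scalar_mult_eq_scaleR)
      then have "frechet_derivative (\<lambda>y. \<phi> y $ j) (at x) z = frechet_derivative (\<lambda>y. \<phi> y $ j) (at x) (\<Sum>i\<in>UNIV. z $ i *\<^sub>R axis i 1)" by simp
      also have "\<dots> = (\<Sum>i\<in>UNIV. z $ i * pd i (\<lambda>y. \<phi> y $ j) x)"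
        using lin[of j] by (simp add: linear_sum linear_cmul pd_def)
      finally show ?thesis .
    qed
    then show ?thesis
      by (simp add: D_def vec_eq_iff matrix_vector_mult_def transpose_def grad_def mult.commute)
  qed
  with 1 show ?thesis by blast
qed

text \<open>The norm of the matrix type is the Euclidean norm of all entries, which dominates the
  operator norm.\<close>

lemma norm_transpose_mult_le:
  fixes G :: "real^'n^'m" and z :: "real^'m"
  shows "norm (transpose G *v z) \<le> norm G * norm z"
proof -
  have "transpose G *v z = (\<Sum>i\<in>UNIV. z $ i *\<^sub>R (G $ i))"
    by (simp add: vec_eq_iff matrix_vector_mult_def transpose_def mult.commute)
  also have "norm \<dots> \<le> (\<Sum>i\<in>UNIV. norm (z $ i *\<^sub>R (G $ i)))" by (rule norm_sum)
  also have "\<dots> = (\<Sum>i\<in>UNIV. \<bar>z $ i\<bar> * \<bar>norm (G $ i)\<bar>)" by simp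
  also have "\<dots> \<le> L2_set (\<lambda>i. z $ i) UNIV * L2_set (\<lambda>i. norm (G $ i)) UNIV"
    by (rule L2_set_mult_ineq)
  also have "\<dots> = norm G * norm z" by (simp add: norm_vec_def L2_set_def mult.commute)
  finally show ?thesis .
qed

lemma continuous_borel:
  "continuous_on UNIV g \<Longrightarrow> g \<in> borel_measurable borel"
  by (rule borel_measurable_continuous_onI)

text \<open>The increment is the integral of the derivative along the segment from \<open>x\<close>
  to \<open>x + z\<close>. Cauchy-Schwarz in the segment parameter, Tonelli and translation
  invariance then remove the parameter.\<close>

lemma test_field_translation_le:
  assumes \<phi>: "test_field \<Omega> \<phi>"
  shows "(\<integral>\<^sup>+x. ennreal ((norm (\<phi> (x + z) - \<phi> x))\<^sup>2) \<partial>lborel)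
    \<le> ennreal ((norm z)\<^sup>2) * (\<integral>\<^sup>+x. ennreal ((norm (grad \<phi> x))\<^sup>2) \<partial>lborel)"
proof -
  have cg: "continuous_on UNIV (grad \<phi>)" by (rule test_field_grad_continuous[OF \<phi>])
  have [measurable]: "grad \<phi> \<in> borel_measurable borel" using cg by (rule continuous_borel)
  have pt: "ennreal ((norm (\<phi> (x + z) - \<phi> x))\<^sup>2) \<le> (\<integral>\<^sup>+\<theta>. ennreal ((norm z)\<^sup>2) * (ennreal ((norm (grad \<phi> (x + \<theta> *\<^sub>R z)))\<^sup>2) * indicator {0..1} \<theta>) \<partial>lborel)" for x
  proof -
    define g where "g \<theta> = transpose (grad \<phi> (x + \<theta> *\<^sub>R z)) *v z" for \<theta> :: real
    have c: "continuous_on UNIV g"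
      unfolding g_def matrix_vector_mult_def transpose_def
      by (intro continuous_on_vec_lambda) (auto intro!: continuous_intros continuous_on_compose2[OF cg])
    have "(( \<lambda>\<theta>. \<phi> (x + \<theta> *\<^sub>R z)) has_vector_derivative g \<theta>) (at \<theta> within {0..1})" for \<theta> :: real
    proof -
      obtain D where D: "(\<phi> has_derivative D) (at (x + \<theta> *\<^sub>R z))" "\<And>w. D w = transpose (grad \<phi> (x + \<theta> *\<^sub>R z)) *v w"
        using test_field_has_derivative[OF \<phi>] by blast
      have "((\<lambda>\<theta>. x + \<theta> *\<^sub>R z) has_derivative (\<lambda>s. s *\<^sub>R z)) (at \<theta> within {0..1})"
        by (auto intro!: derivative_eq_intros)
      then have "((\<lambda>\<theta>. \<phi> (x + \<theta> *\<^sub>R z)) has_derivative (\<lambda>s. D (s *\<^sub>R z))) (at \<theta> within {0..1})"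
        using D(1) by (rule has_derivative_compose)
      moreover have "D (s *\<^sub>R z) = s *\<^sub>R g \<theta>" for s
        unfolding D(2) g_def by (simp add: matrix_vector_mult_scaleR)
      ultimately show ?thesis by (simp add: has_vector_derivative_def)
    qed
    then have "has_bochner_integral lborel (\<lambda>\<theta>. indicator {0..1} \<theta> *\<^sub>R g \<theta>) (\<phi> (x + 1 *\<^sub>R z) - \<phi> (x + 0 *\<^sub>R z))"
      by (intro has_bochner_integral_FTC_Icc) (auto intro: continuous_on_subset[OF c])
    then have eq: "\<phi> (x + z) - \<phi> x = (\<integral>\<theta>. indicator {0..1} \<theta> *\<^sub>R g \<theta> \<partial>lborel)"
      by (simp add: has_bochner_integral_integral_eq)
    have "ennreal ((norm (\<phi> (x + z) - \<phi> x))\<^sup>2) \<le> emeasure lborel {0..1::real} * (\<integral>\<^sup>+\<theta>. ennreal ((norm (g \<theta>))\<^sup>2) * indicator {0..1} \<theta> \<partial>lborel)"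
      unfolding eq by (rule norm_integral_sq_le) (use continuous_borel[OF c] in auto)
    also have "\<dots> = (\<integral>\<^sup>+\<theta>. ennreal ((norm (g \<theta>))\<^sup>2) * indicator {0..1} \<theta> \<partial>lborel)" by simp
    also have "\<dots> \<le> (\<integral>\<^sup>+\<theta>. ennreal ((norm z)\<^sup>2) * (ennreal ((norm (grad \<phi> (x + \<theta> *\<^sub>R z)))\<^sup>2) * indicator {0..1} \<theta>) \<partial>lborel)"
    proof (rule nn_integral_mono)
      fix \<theta> :: real
      have "(norm (g \<theta>))\<^sup>2 \<le> (norm z)\<^sup>2 * (norm (grad \<phi> (x + \<theta> *\<^sub>R z)))\<^sup>2"
        using power_mono[OF norm_transpose_mult_le, of "grad \<phi> (x + \<theta> *\<^sub>R z)" z 2] by (simp add: g_def power_mult_distrib mult.commute)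
      then show "ennreal ((norm (g \<theta>))\<^sup>2) * indicator {0..1} \<theta> \<le> ennreal ((norm z)\<^sup>2) * (ennreal ((norm (grad \<phi> (x + \<theta> *\<^sub>R z)))\<^sup>2) * indicator {0..1} \<theta>)"
        by (auto simp: indicator_def ennreal_mult[symmetric] intro: ennreal_leI)
    qed
    finally show ?thesis .
  qed
  have "(\<integral>\<^sup>+x. ennreal ((norm (\<phi> (x + z) - \<phi> x))\<^sup>2) \<partial>lborel)
    \<le> (\<integral>\<^sup>+x. (\<integral>\<^sup>+\<theta>. ennreal ((norm z)\<^sup>2) * (ennreal ((norm (grad \<phi> (x + \<theta> *\<^sub>R z)))\<^sup>2) * indicator {0..1::real} \<theta>) \<partial>lborel) \<partial>lborel)"
    by (intro nn_integral_mono pt)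
  also have "\<dots> = (\<integral>\<^sup>+\<theta>. (\<integral>\<^sup>+x. ennreal ((norm z)\<^sup>2) * (ennreal ((norm (grad \<phi> (x + \<theta> *\<^sub>R z)))\<^sup>2) * indicator {0..1::real} \<theta>) \<partial>lborel) \<partial>lborel)"
    by (rule lborel_pair.Fubini'[symmetric]) measurable
  also have "\<dots> = (\<integral>\<^sup>+\<theta>. ennreal ((norm z)\<^sup>2) * (\<integral>\<^sup>+x. ennreal ((norm (grad \<phi> x))\<^sup>2) \<partial>lborel) * indicator {0..1::real} \<theta> \<partial>lborel)"
  proof (rule nn_integral_cong)
    fix \<theta> :: real
    have "(\<integral>\<^sup>+x. ennreal ((norm (grad \<phi> (x + \<theta> *\<^sub>R z)))\<^sup>2) \<partial>lborel) = (\<integral>\<^sup>+x. ennreal ((norm (grad \<phi> x))\<^sup>2) \<partial>lborel)"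
      by (rule nn_integral_lborel_translation) measurable
    then show "(\<integral>\<^sup>+x. ennreal ((norm z)\<^sup>2) * (ennreal ((norm (grad \<phi> (x + \<theta> *\<^sub>R z)))\<^sup>2) * indicator {0..1::real} \<theta>) \<partial>lborel) =
       ennreal ((norm z)\<^sup>2) * (\<integral>\<^sup>+x. ennreal ((norm (grad \<phi> x))\<^sup>2) \<partial>lborel) * indicator {0..1::real} \<theta>"
      by (simp add: nn_integral_cmult nn_integral_multc mult.assoc)
  qed
  also have "\<dots> = ennreal ((norm z)\<^sup>2) * (\<integral>\<^sup>+x. ennreal ((norm (grad \<phi> x))\<^sup>2) \<partial>lborel)"
    by (simp add: nn_integral_cmult)
  finally show ?thesis .
qed

text \<open>Convolution with the normalised indicator of a ball. For test fields it yields functions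
  that are bounded and Lipschitz with constants depending only on \<open>h\<close> and two
  \<open>L^2\<close> norms, as Arzela-Ascoli requires.\<close>

definition ball_average :: "real \<Rightarrow> (pt \<Rightarrow> 'b::euclidean_space) \<Rightarrow> pt \<Rightarrow> 'b" where
  "ball_average h \<phi> x = (\<integral>z. indicator (cball 0 h) z *\<^sub>R \<phi> (x + z) \<partial>lborel) /\<^sub>R measure lborel (cball (0::pt) h)"

lemma measure_cball_pos: "h > 0 \<Longrightarrow> measure lborel (cball (0::pt) h) > 0"
  by (simp add: content_cball_pos)

lemma emeasure_cball_eq: "emeasure lborel (cball (0::pt) h) = ennreal (measure lborel (cball (0::pt) h))"
  by (rule emeasure_eq_ennreal_measure) (use emeasure_lborel_cball_finite[of "0::pt" h] in auto)

text \<open>Jensen's inequality for the mean over a ball: in \<open>norm_integral_sq_le\<close> the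
  squared prefactor times the volume leaves a single factor 1/volume.\<close>

lemma ball_average_sq_le:
  fixes f :: "pt \<Rightarrow> 'b::euclidean_space"
  assumes h: "h > 0" and [measurable]: "f \<in> borel_measurable borel"
    and eq: "w = (\<integral>z. indicator (cball 0 h) z *\<^sub>R f z \<partial>lborel) /\<^sub>R measure lborel (cball (0::pt) h)"
  shows "ennreal ((norm w)\<^sup>2) \<le> ennreal (1 / measure lborel (cball (0::pt) h)) * (\<integral>\<^sup>+z. ennreal ((norm (f z))\<^sup>2) * indicator (cball 0 h) z \<partial>lborel)"
proof -
  define m where "m = measure lborel (cball (0::pt) h)"
  have m: "m > 0" using h by (simp add: m_def measure_cball_pos)
  define I where "I = (\<integral>z. indicator (cball 0 h) z *\<^sub>R f z \<partial>lborel)"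
  have "ennreal ((norm w)\<^sup>2) = ennreal ((1/m)\<^sup>2) * ennreal ((norm I)\<^sup>2)"
    using m by (simp add: eq m_def[symmetric] I_def[symmetric] ennreal_mult[symmetric] power_mult_distrib divide_inverse)
  also have "\<dots> \<le> ennreal ((1/m)\<^sup>2) * (ennreal m * (\<integral>\<^sup>+z. ennreal ((norm (f z))\<^sup>2) * indicator (cball 0 h) z \<partial>lborel))"
    using norm_integral_sq_le[of f lborel "cball 0 h"] unfolding I_def emeasure_cball_eq m_def
    by (intro mult_left_mono) auto
  also have "\<dots> = ennreal (1 / m) * (\<integral>\<^sup>+z. ennreal ((norm (f z))\<^sup>2) * indicator (cball 0 h) z \<partial>lborel)"
    using m by (simp add: mult.assoc[symmetric] ennreal_mult[symmetric] power2_eq_square)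
  finally show ?thesis by (simp add: m_def)
qed

lemma integrable_ball_average:
  fixes \<phi> :: "pt \<Rightarrow> 'b::euclidean_space"
  assumes "continuous_on UNIV \<phi>"
  shows "integrable lborel (\<lambda>z. indicator (cball 0 h) z *\<^sub>R \<phi> (x + z))"
  by (rule borel_integrable_compact) (auto intro!: continuous_intros continuous_on_compose2[OF assms])

lemma ball_average_bound:
  assumes \<phi>: "test_field \<Omega> \<phi>" and h: "h > 0"
  shows "ennreal ((norm (ball_average h \<phi> x))\<^sup>2) \<le> ennreal (1 / measure lborel (cball (0::pt) h)) * (\<integral>\<^sup>+z. ennreal ((norm (\<phi> z))\<^sup>2) \<partial>lborel)"
proof -
  have [measurable]: "\<phi> \<in> borel_measurable borel" by (rule continuous_borel[OF test_field_continuous[OF \<phi>]])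
  have "ennreal ((norm (ball_average h \<phi> x))\<^sup>2) \<le> ennreal (1 / measure lborel (cball (0::pt) h)) * (\<integral>\<^sup>+z. ennreal ((norm (\<phi> (x + z)))\<^sup>2) * indicator (cball 0 h) z \<partial>lborel)"
    by (rule ball_average_sq_le[OF h]) (auto simp: ball_average_def)
  also have "\<dots> \<le> ennreal (1 / measure lborel (cball (0::pt) h)) * (\<integral>\<^sup>+z. ennreal ((norm (\<phi> (x + z)))\<^sup>2) \<partial>lborel)"
    by (intro mult_left_mono nn_integral_mono) (auto simp: indicator_def)
  also have "(\<integral>\<^sup>+z. ennreal ((norm (\<phi> (x + z)))\<^sup>2) \<partial>lborel) = (\<integral>\<^sup>+z. ennreal ((norm (\<phi> z))\<^sup>2) \<partial>lborel)"
    using nn_integral_lborel_translation[of "\<lambda>z. ennreal ((norm (\<phi> z))\<^sup>2)" x] by (simp add: add.commute)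
  finally show ?thesis .
qed

text \<open>The difference of two averages is the average of the increment of \<phi> under
  translation by \<open>x - y\<close>, which the gradient controls in \<open>L^2\<close>.\<close>

lemma ball_average_lipschitz:
  assumes \<phi>: "test_field \<Omega> \<phi>" and h: "h > 0"
  shows "ennreal ((norm (ball_average h \<phi> x - ball_average h \<phi> y))\<^sup>2) \<le>
    ennreal (1 / measure lborel (cball (0::pt) h)) * (ennreal ((norm (x - y))\<^sup>2) * (\<integral>\<^sup>+z. ennreal ((norm (grad \<phi> z))\<^sup>2) \<partial>lborel))"
proof -
  have c: "continuous_on UNIV \<phi>" by (rule test_field_continuous[OF \<phi>])
  have [measurable]: "\<phi> \<in> borel_measurable borel" by (rule continuous_borel[OF c])
  have "ball_average h \<phi> x - ball_average h \<phi> y = (\<integral>z. indicator (cball 0 h) z *\<^sub>R (\<phi> (x + z) - \<phi> (y + z)) \<partial>lborel) /\<^sub>R measure lborel (cball (0::pt) h)"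
    unfolding ball_average_def
    using integrable_ball_average[OF c, of h x] integrable_ball_average[OF c, of h y]
    by (simp add: scaleR_diff_right)
  from ball_average_sq_le[OF h _ this]
  have "ennreal ((norm (ball_average h \<phi> x - ball_average h \<phi> y))\<^sup>2) \<le> ennreal (1 / measure lborel (cball (0::pt) h)) * (\<integral>\<^sup>+z. ennreal ((norm (\<phi> (x + z) - \<phi> (y + z)))\<^sup>2) * indicator (cball 0 h) z \<partial>lborel)"
    by simp
  also have "\<dots> \<le> ennreal (1 / measure lborel (cball (0::pt) h)) * (\<integral>\<^sup>+z. ennreal ((norm (\<phi> (x + z) - \<phi> (y + z)))\<^sup>2) \<partial>lborel)"
    by (intro mult_left_mono nn_integral_mono) (auto simp: indicator_def)
  also have "(\<integral>\<^sup>+z. ennreal ((norm (\<phi> (x + z) - \<phi> (y + z)))\<^sup>2) \<partial>lborel) = (\<integral>\<^sup>+z. ennreal ((norm (\<phi> (z + (x - y)) - \<phi> z))\<^sup>2) \<partial>lborel)"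
    using nn_integral_lborel_translation[of "\<lambda>z. ennreal ((norm (\<phi> (z + (x - y)) - \<phi> z))\<^sup>2)" y] by (simp add: algebra_simps)
  also have "\<dots> \<le> ennreal ((norm (x - y))\<^sup>2) * (\<integral>\<^sup>+z. ennreal ((norm (grad \<phi> z))\<^sup>2) \<partial>lborel)"
    by (rule test_field_translation_le[OF \<phi>])
  finally show ?thesis by (simp add: mult_left_mono)
qed

text \<open>The error is the mean over \<open>z\<close> in the ball of the increments under
  translation by \<open>z\<close>; after Tonelli each of these contributes at most
  \<open>h^2\<close> times the squared norm of the gradient.\<close>

lemma ball_average_approx:
  assumes \<phi>: "test_field \<Omega> \<phi>" and h: "h > 0" and m[measurable]: "ball_average h \<phi> \<in> borel_measurable borel"
  shows "(\<integral>\<^sup>+x. ennreal ((norm (ball_average h \<phi> x - \<phi> x))\<^sup>2) \<partial>lborel) \<le> ennreal (h\<^sup>2) * (\<integral>\<^sup>+x. ennreal ((norm (grad \<phi> x))\<^sup>2) \<partial>lborel)"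
proof -
  define m where "m = measure lborel (cball (0::pt) h)"
  have m: "m > 0" using h by (simp add: m_def measure_cball_pos)
  have [measurable]: "cball (0::pt) h \<in> sets borel" by simp
  define E where "E = (\<integral>\<^sup>+x. ennreal ((norm (grad \<phi> x))\<^sup>2) \<partial>lborel)"
  have c: "continuous_on UNIV \<phi>" by (rule test_field_continuous[OF \<phi>])
  have [measurable]: "\<phi> \<in> borel_measurable borel" by (rule continuous_borel[OF c])
  have "ennreal ((norm (ball_average h \<phi> x - \<phi> x))\<^sup>2) \<le> ennreal (1 / m) * (\<integral>\<^sup>+z. ennreal ((norm (\<phi> (x + z) - \<phi> x))\<^sup>2) * indicator (cball 0 h) z \<partial>lborel)" for x
  proof -
    have i: "integrable lborel (\<lambda>z. indicator (cball 0 h) z *\<^sub>R \<phi> x :: pt)"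
      by (rule borel_integrable_compact) auto
    have "(\<integral>z. indicator (cball (0::pt) h) z *\<^sub>R \<phi> x \<partial>lborel) = m *\<^sub>R \<phi> x"
      using emeasure_lborel_cball_finite[of "0::pt" h] by (simp add: m_def less_top)
    then have "ball_average h \<phi> x - \<phi> x = (\<integral>z. indicator (cball 0 h) z *\<^sub>R (\<phi> (x + z) - \<phi> x) \<partial>lborel) /\<^sub>R measure lborel (cball (0::pt) h)"
      unfolding ball_average_def scaleR_diff_right
        Bochner_Integration.integral_diff[OF integrable_ball_average[OF c, of h x] i]
      using m by (simp add: m_def[symmetric] scaleR_diff_right)
    from ball_average_sq_le[OF h _ this] show ?thesis by (simp add: m_def)
  qed
  then have "(\<integral>\<^sup>+x. ennreal ((norm (ball_average h \<phi> x - \<phi> x))\<^sup>2) \<partial>lborel) \<le> (\<integral>\<^sup>+x. ennreal (1 / m) * (\<integral>\<^sup>+z. ennreal ((norm (\<phi> (x + z) - \<phi> x))\<^sup>2) * indicator (cball 0 h) z \<partial>lborel) \<partial>lborel)"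
    by (intro nn_integral_mono)
  also have "\<dots> = ennreal (1 / m) * (\<integral>\<^sup>+x. (\<integral>\<^sup>+z. ennreal ((norm (\<phi> (x + z) - \<phi> x))\<^sup>2) * indicator (cball 0 h) z \<partial>lborel) \<partial>lborel)"
    by (rule nn_integral_cmult) measurable
  also have "(\<integral>\<^sup>+x. (\<integral>\<^sup>+z. ennreal ((norm (\<phi> (x + z) - \<phi> x))\<^sup>2) * indicator (cball 0 h) z \<partial>lborel) \<partial>lborel) =
     (\<integral>\<^sup>+z. (\<integral>\<^sup>+x. ennreal ((norm (\<phi> (x + z) - \<phi> x))\<^sup>2) * indicator (cball 0 h) z \<partial>lborel) \<partial>lborel)"
    by (rule lborel_pair.Fubini'[symmetric]) measurable
  also have "\<dots> \<le> (\<integral>\<^sup>+z. ennreal (h\<^sup>2) * E * indicator (cball (0::pt) h) z \<partial>lborel)"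
  proof (rule nn_integral_mono)
    fix z :: pt
    have "(\<integral>\<^sup>+x. ennreal ((norm (\<phi> (x + z) - \<phi> x))\<^sup>2) \<partial>lborel) \<le> ennreal (h\<^sup>2) * E" if "z \<in> cball 0 h"
    proof -
      have "(\<integral>\<^sup>+x. ennreal ((norm (\<phi> (x + z) - \<phi> x))\<^sup>2) \<partial>lborel) \<le> ennreal ((norm z)\<^sup>2) * E"
        unfolding E_def by (rule test_field_translation_le[OF \<phi>])
      also have "\<dots> \<le> ennreal (h\<^sup>2) * E"
        using that by (intro mult_right_mono ennreal_leI power_mono) auto
      finally show ?thesis .
    qed
    then show "(\<integral>\<^sup>+x. ennreal ((norm (\<phi> (x + z) - \<phi> x))\<^sup>2) * indicator (cball 0 h) z \<partial>lborel) \<le> ennreal (h\<^sup>2) * E * indicator (cball (0::pt) h) z"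
      by (auto simp: indicator_def)
  qed
  also have "\<dots> = ennreal (h\<^sup>2) * E * ennreal m"
    by (simp add: nn_integral_cmult emeasure_cball_eq m_def)
  finally have "(\<integral>\<^sup>+x. ennreal ((norm (ball_average h \<phi> x - \<phi> x))\<^sup>2) \<partial>lborel) \<le> ennreal (1/m) * (ennreal (h\<^sup>2) * E * ennreal m)"
    by (simp add: mult_left_mono)
  also have "\<dots> = ennreal (1/m) * ennreal m * (ennreal (h\<^sup>2) * E)" by (simp add: ac_simps)
  also have "ennreal (1/m) * ennreal m = 1" using m by (simp add: ennreal_mult[symmetric])
  finally show ?thesis by (simp add: E_def)
qed

section \<open>Extraction of convergent subsequences\<close>

lemma L2norm_sq_le_nn_integral:
  fixes g :: "pt \<Rightarrow> 'b::euclidean_space"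
  assumes "open \<Omega>" and [measurable]: "g \<in> borel_measurable borel"
  shows "ennreal ((L2norm \<Omega> g)\<^sup>2) \<le> (\<integral>\<^sup>+x. ennreal ((norm (g x))\<^sup>2) \<partial>lborel)"
proof (cases "integrable (lebesgue_on \<Omega>) (\<lambda>x. (norm (g x))\<^sup>2)")
  case True
  have "ennreal ((L2norm \<Omega> g)\<^sup>2) = (\<integral>\<^sup>+x. ennreal ((norm (g x))\<^sup>2) \<partial>lebesgue_on \<Omega>)"
    unfolding L2norm_sq by (rule nn_integral_eq_integral[symmetric, OF True]) simp
  also have "\<dots> = (\<integral>\<^sup>+x. ennreal ((norm (g x))\<^sup>2) * indicator \<Omega> x \<partial>lebesgue)"
    using assms(1) by (intro nn_integral_restrict_space) auto
  also have "\<dots> \<le> (\<integral>\<^sup>+x. ennreal ((norm (g x))\<^sup>2) \<partial>lebesgue)"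
    by (intro nn_integral_mono) (auto simp: indicator_def)
  also have "\<dots> = (\<integral>\<^sup>+x. ennreal ((norm (g x))\<^sup>2) \<partial>lborel)" by (rule nn_integral_completion)
  finally show ?thesis .
\<comment> \<open>If the square is not integrable, \<open>L2norm\<close> takes the default value
  0.\<close>
qed (simp add: L2norm_def not_integrable_integral_eq)

lemma nn_integral_eq_L2norm_sq:
  fixes g :: "pt \<Rightarrow> 'b::euclidean_space"
  assumes "open \<Omega>" "L2 \<Omega> g" "\<And>x. x \<notin> \<Omega> \<Longrightarrow> g x = 0"
  shows "(\<integral>\<^sup>+x. ennreal ((norm (g x))\<^sup>2) \<partial>lborel) = ennreal ((L2norm \<Omega> g)\<^sup>2)"
proof -
  have "ennreal ((L2norm \<Omega> g)\<^sup>2) = (\<integral>\<^sup>+x. ennreal ((norm (g x))\<^sup>2) \<partial>lebesgue_on \<Omega>)"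
    unfolding L2norm_sq by (rule nn_integral_eq_integral[symmetric]) (use assms in \<open>auto simp: L2_def\<close>)
  also have "\<dots> = (\<integral>\<^sup>+x. ennreal ((norm (g x))\<^sup>2) * indicator \<Omega> x \<partial>lebesgue)"
    using assms(1) by (intro nn_integral_restrict_space) auto
  also have "\<dots> = (\<integral>\<^sup>+x. ennreal ((norm (g x))\<^sup>2) \<partial>lebesgue)"
    using assms(3) by (intro nn_integral_cong) (auto simp: indicator_def)
  also have "\<dots> = (\<integral>\<^sup>+x. ennreal ((norm (g x))\<^sup>2) \<partial>lborel)" by (rule nn_integral_completion)
  finally show ?thesis by simp
qed

lemma L2_bounded:
  assumes "\<Omega> \<in> lmeasurable" "g \<in> borel_measurable borel" "\<And>x. x \<in> \<Omega> \<Longrightarrow> norm (g x) \<le> b" "b \<ge> 0"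
  shows "L2 \<Omega> g" "L2norm \<Omega> g \<le> b * sqrt (measure lebesgue \<Omega>)"
proof -
  have m: "g \<in> borel_measurable (lebesgue_on \<Omega>)"
    using assms(2) by (simp add: measurable_restrict_space1 measurable_completion)
  have c: "integrable (lebesgue_on \<Omega>) (\<lambda>x. b\<^sup>2)"
    using assms(1) by (auto simp: fmeasurable_def emeasure_restrict_space space_restrict_space intro!: finite_measure.integrable_const finite_measureI)
  have le: "norm (g x) ^ 2 \<le> b\<^sup>2" if "x \<in> \<Omega>" for x using assms(3)[OF that] by (intro power_mono) auto
  have i: "integrable (lebesgue_on \<Omega>) (\<lambda>x. (norm (g x))\<^sup>2)"
    by (rule Bochner_Integration.integrable_bound[OF c]) (use m le in auto)
  then show "L2 \<Omega> g" using m by (simp add: L2_def)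
  have "(L2norm \<Omega> g)\<^sup>2 \<le> integral\<^sup>L (lebesgue_on \<Omega>) (\<lambda>x. b\<^sup>2)"
    unfolding L2norm_sq by (rule integral_mono[OF i c]) (use le in auto)
  also have "\<dots> = (b * sqrt (measure lebesgue \<Omega>))\<^sup>2"
    using assms(1) by (simp add: measure_restrict_space space_restrict_space fmeasurable_def power_mult_distrib)
  finally show "L2norm \<Omega> g \<le> b * sqrt (measure lebesgue \<Omega>)"
    by (rule power2_le_imp_le) (use assms(4) in auto)
qed

text \<open>Frechet-Kolmogorov at one scale: the averages over balls of radius \<open>h\<close>
  converge uniformly along a subsequence by Arzela-Ascoli, and each lies within \<open>C * h\<close>
  of its field. Two such errors plus the distance of the averages stay below the stated
  bound.\<close>

lemma test_fields_close_subseq: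
  fixes \<phi> :: "nat \<Rightarrow> field"
  assumes \<Omega>: "open \<Omega>" "bounded \<Omega>" and \<phi>: "\<And>n. test_field \<Omega> (\<phi> n)"
    and C: "\<And>n. L2norm \<Omega> (\<phi> n) \<le> C" "\<And>n. L2norm \<Omega> (grad (\<phi> n)) \<le> C" and h: "h > 0"
  shows "\<exists>(r :: nat \<Rightarrow> nat) K. strict_mono r \<and> (\<forall>m\<ge>K. \<forall>n\<ge>K. L2dist \<Omega> (\<phi> (r m)) (\<phi> (r n)) < (2 * C + 1) * h)"
proof -
  have lm: "\<Omega> \<in> lmeasurable" using \<Omega> by (simp add: lmeasurable_open)
  have C0: "C \<ge> 0" using C(1)[of 0] L2norm_nonneg[of \<Omega> "\<phi> 0"] by linarith
  define m where "m = measure lborel (cball (0::pt) h)"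
  have m: "m > 0" using h by (simp add: m_def measure_cball_pos)
  have n1: "(\<integral>\<^sup>+x. ennreal ((norm (\<phi> n x))\<^sup>2) \<partial>lborel) \<le> ennreal (C\<^sup>2)" for n
  proof -
    have "(\<integral>\<^sup>+x. ennreal ((norm (\<phi> n x))\<^sup>2) \<partial>lborel) = ennreal ((L2norm \<Omega> (\<phi> n))\<^sup>2)"
      by (rule nn_integral_eq_L2norm_sq[OF \<Omega>(1) test_field_L2[OF \<phi> \<Omega>(1)]]) (metis test_field_support[OF \<phi>] subsetD)
    also have "\<dots> \<le> ennreal (C\<^sup>2)" by (intro ennreal_leI power_mono C L2norm_nonneg)
    finally show ?thesis .
  qed
  have n2: "(\<integral>\<^sup>+x. ennreal ((norm (grad (\<phi> n) x))\<^sup>2) \<partial>lborel) \<le> ennreal (C\<^sup>2)" for n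
  proof -
    have "(\<integral>\<^sup>+x. ennreal ((norm (grad (\<phi> n) x))\<^sup>2) \<partial>lborel) = ennreal ((L2norm \<Omega> (grad (\<phi> n)))\<^sup>2)"
      by (rule nn_integral_eq_L2norm_sq[OF \<Omega>(1) test_field_grad_L2[OF \<phi> \<Omega>(1)]]) (metis test_field_support[OF \<phi>] subsetD)
    also have "\<dots> \<le> ennreal (C\<^sup>2)" by (intro ennreal_leI power_mono C L2norm_nonneg)
    finally show ?thesis .
  qed
  define A where "A n = ball_average h (\<phi> n)" for n
  have bd: "norm (A n x) \<le> C / sqrt m" for n x
  proof -
    have "ennreal ((norm (A n x))\<^sup>2) \<le> ennreal (1/m) * ennreal (C\<^sup>2)"
      unfolding A_def m_def by (rule order_trans[OF ball_average_bound[OF \<phi> h]]) (intro mult_left_mono n1, simp)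
    also have "\<dots> = ennreal ((C / sqrt m)\<^sup>2)" using m by (simp add: ennreal_mult[symmetric] power_divide)
    finally have "(norm (A n x))\<^sup>2 \<le> (C / sqrt m)\<^sup>2" by simp
    then show ?thesis by (rule power2_le_imp_le) (use C0 m in simp)
  qed
  have lip: "norm (A n x - A n y) \<le> C / sqrt m * norm (x - y)" for n x y
  proof -
    have "ennreal ((norm (A n x - A n y))\<^sup>2) \<le> ennreal (1/m) * (ennreal ((norm (x - y))\<^sup>2) * ennreal (C\<^sup>2))"
      unfolding A_def m_def by (rule order_trans[OF ball_average_lipschitz[OF \<phi> h]]) (intro mult_left_mono n2, simp_all)
    also have "\<dots> = ennreal ((C / sqrt m * norm (x - y))\<^sup>2)"
      using m by (simp add: ennreal_mult[symmetric] power_divide power_mult_distrib)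
    finally have "(norm (A n x - A n y))\<^sup>2 \<le> (C / sqrt m * norm (x - y))\<^sup>2" by simp
    then show ?thesis by (rule power2_le_imp_le) (use C0 m in simp)
  qed
  have cont: "continuous_on UNIV (A n)" for n
  proof (rule lipschitz_on_continuous_on)
    show "(C / sqrt m)-lipschitz_on UNIV (A n)"
      using C0 m lip[of n] by (auto simp: lipschitz_on_def dist_norm)
  qed
  have Am: "A n \<in> borel_measurable borel" for n using cont by (rule continuous_borel)
  have AL2: "L2 \<Omega> (A n)" for n
    by (rule L2_bounded(1)[OF lm Am bd]) (use C0 m in simp)
  have ap: "L2dist \<Omega> (A n) (\<phi> n) \<le> C * h" for n
  proof -
    have pm: "\<phi> n \<in> borel_measurable borel" by (rule continuous_borel[OF test_field_continuous[OF \<phi>]])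
    have "ennreal ((L2norm \<Omega> (\<lambda>x. A n x - \<phi> n x))\<^sup>2) \<le> (\<integral>\<^sup>+x. ennreal ((norm (A n x - \<phi> n x))\<^sup>2) \<partial>lborel)"
      by (intro L2norm_sq_le_nn_integral \<Omega> borel_measurable_diff Am pm)
    also have "\<dots> \<le> ennreal (h\<^sup>2) * ennreal (C\<^sup>2)"
      unfolding A_def using Am[of n] unfolding A_def
      by (intro order_trans[OF ball_average_approx[OF \<phi> h]] mult_left_mono n2) auto
    also have "\<dots> = ennreal ((C * h)\<^sup>2)" by (simp add: ennreal_mult[symmetric] power_mult_distrib mult.commute)
    finally have "(L2norm \<Omega> (\<lambda>x. A n x - \<phi> n x))\<^sup>2 \<le> (C * h)\<^sup>2" by simp
    then show ?thesis unfolding L2dist_def by (rule power2_le_imp_le) (use C0 h in simp)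
  qed
  have cpt: "compact (closure \<Omega>)" using \<Omega> by simp
  obtain g r where gr: "strict_mono (r :: nat \<Rightarrow> nat)"
      "\<And>e. 0 < e \<Longrightarrow> \<exists>N. \<forall>n x. n \<ge> N \<and> x \<in> closure \<Omega> \<longrightarrow> norm (A (r n) x - g x) < e"
  proof (rule Arzela_Ascoli[OF cpt, of A "C / sqrt m"])
    show "norm (A n x) \<le> C / sqrt m" for n x by (rule bd)
    fix x :: pt and e :: real assume "0 < e"
    show "\<exists>d>0. \<forall>n y. y \<in> closure \<Omega> \<and> norm (x - y) < d \<longrightarrow> norm (A n x - A n y) < e"
    proof (intro exI conjI allI impI)
      show "e / (C / sqrt m + 1) > 0" using \<open>0 < e\<close> C0 m by (simp add: add_nonneg_pos)
      fix n y assume y: "y \<in> closure \<Omega> \<and> norm (x - y) < e / (C / sqrt m + 1)"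
      have c1: "C / sqrt m + 1 > 0" using C0 m by (simp add: add_nonneg_pos)
      have "norm (A n x - A n y) \<le> (C / sqrt m + 1) * norm (x - y)"
        using lip[of n x y] by (simp add: algebra_simps add_increasing)
      also have "\<dots> < e" using y c1 by (simp add: pos_less_divide_eq mult.commute)
      finally show "norm (A n x - A n y) < e" .
    qed
  qed blast
  \<comment> \<open>A uniform distance of at most \<open>2 * \<epsilon>\<close> then costs at most
    \<open>h / 2\<close> in \<open>L^2\<close>; the added 1 keeps the denominator positive.\<close>
  define \<epsilon> where "\<epsilon> = h / (4 * (sqrt (measure lebesgue \<Omega>) + 1))"
  have s0: "sqrt (measure lebesgue \<Omega>) + 1 > 0" by (simp add: add_nonneg_pos)
  have \<epsilon>: "\<epsilon> > 0" using h s0 by (simp add: \<epsilon>_def)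
  obtain K where K: "\<And>n x. n \<ge> K \<Longrightarrow> x \<in> closure \<Omega> \<Longrightarrow> norm (A (r n) x - g x) < \<epsilon>" using gr(2)[OF \<epsilon>] by blast
  have "L2dist \<Omega> (\<phi> (r i)) (\<phi> (r n)) < (2 * C + 1) * h" if "i \<ge> K" "n \<ge> K" for i n
  proof -
    have "L2norm \<Omega> (\<lambda>x. A (r i) x - A (r n) x) \<le> (2 * \<epsilon>) * sqrt (measure lebesgue \<Omega>)"
    proof (rule L2_bounded(2)[OF lm])
      show "(\<lambda>x. A (r i) x - A (r n) x) \<in> borel_measurable borel" using Am[of "r i"] Am[of "r n"] by measurable
      fix x assume "x \<in> \<Omega>"
      then have "x \<in> closure \<Omega>" using closure_subset by blast
      then show "norm (A (r i) x - A (r n) x) \<le> 2 * \<epsilon>"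
        using K[OF that(1), of x] K[OF that(2), of x] norm_triangle_ineq4[of "A (r i) x - g x" "A (r n) x - g x"] by simp
    qed (use \<epsilon> in simp)
    also have "\<dots> \<le> 2 * \<epsilon> * (sqrt (measure lebesgue \<Omega>) + 1)" using \<epsilon> by simp
    also have "\<dots> = h / 2" using s0 unfolding \<epsilon>_def by (simp add: divide_simps) (simp add: algebra_simps)?
    finally have 2: "L2dist \<Omega> (A (r i)) (A (r n)) \<le> h / 2" by (simp add: L2dist_def)
    have L: "L2 \<Omega> (\<phi> k)" for k using test_field_L2[OF \<phi> \<Omega>(1)] .
    have "L2dist \<Omega> (\<phi> (r i)) (\<phi> (r n)) \<le> L2dist \<Omega> (\<phi> (r i)) (A (r i)) + L2dist \<Omega> (A (r i)) (\<phi> (r n))"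
      by (rule L2dist_triangle[OF L AL2 L])
    also have "\<dots> \<le> L2dist \<Omega> (\<phi> (r i)) (A (r i)) + (L2dist \<Omega> (A (r i)) (A (r n)) + L2dist \<Omega> (A (r n)) (\<phi> (r n)))"
      using L2dist_triangle[OF AL2[of "r i"] AL2[of "r n"] L[of "r n"]] by simp
    also have "\<dots> \<le> C * h + (h / 2 + C * h)"
      using ap[of "r i"] ap[of "r n"] 2 L2dist_commute[of \<Omega> "\<phi> (r i)" "A (r i)"] by simp
    also have "\<dots> < (2 * C + 1) * h" using h by (simp add: algebra_simps)
    finally show ?thesis .
  qed
  then show ?thesis using gr(1) by blast
qed

text \<open>Diagonal argument over the scales \<open>h = 1/(k+1)\<close>. \<open>P k s\<close> says
  that the oscillation along \<open>s\<close> is eventually below the bound of scale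
  \<open>k\<close>, a property inherited by further subsequences.\<close>

lemma test_fields_Cauchy_subseq:
  fixes \<phi> :: "nat \<Rightarrow> field"
  assumes \<Omega>: "open \<Omega>" "bounded \<Omega>" and \<phi>: "\<And>n. test_field \<Omega> (\<phi> n)"
    and C: "\<And>n. L2norm \<Omega> (\<phi> n) \<le> C" "\<And>n. L2norm \<Omega> (grad (\<phi> n)) \<le> C"
  shows "\<exists>r :: nat \<Rightarrow> nat. strict_mono r \<and> (\<forall>e>0. \<exists>K. \<forall>m\<ge>K. \<forall>n\<ge>K. L2dist \<Omega> (\<phi> (r m)) (\<phi> (r n)) < e)"
proof -
  define P where "P k s \<longleftrightarrow> (\<exists>K. \<forall>m\<ge>K. \<forall>n\<ge>K. L2dist \<Omega> (\<phi> (s m)) (\<phi> (s n)) < (2 * C + 1) * inverse (real (Suc k)))"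
    for k and s :: "nat \<Rightarrow> nat"
  interpret subseqs P
  proof
    fix k and s :: "nat \<Rightarrow> nat"
    obtain r' :: "nat \<Rightarrow> nat" and K where "strict_mono r'" "\<forall>m\<ge>K. \<forall>n\<ge>K. L2dist \<Omega> (\<phi> (s (r' m))) (\<phi> (s (r' n))) < (2 * C + 1) * inverse (real (Suc k))"
      using test_fields_close_subseq[OF \<Omega>, of "\<lambda>n. \<phi> (s n)" C "inverse (real (Suc k))"] \<phi> C by auto
    then show "\<exists>r'. strict_mono r' \<and> P k (s \<circ> r')" unfolding P_def o_def by blast
  qed
  have stable: "P k (s \<circ> r)" if "strict_mono r" and Ps: "P k s" for r s k
  proof -
    obtain K where K: "\<forall>m\<ge>K. \<forall>n\<ge>K. L2dist \<Omega> (\<phi> (s m)) (\<phi> (s n)) < (2 * C + 1) * inverse (real (Suc k))"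
      using Ps unfolding P_def by blast
    have "r m \<ge> K" if "m \<ge> K" for m using seq_suble[OF \<open>strict_mono r\<close>, of m] that by linarith
    then show ?thesis using K unfolding P_def o_def by blast
  qed
  have "\<exists>K. \<forall>m\<ge>K. \<forall>n\<ge>K. L2dist \<Omega> (\<phi> (diagseq m)) (\<phi> (diagseq n)) < e" if "e > 0" for e
  proof -
    have "(\<lambda>k. (2 * C + 1) * inverse (real (Suc k))) \<longlonglongrightarrow> (2 * C + 1) * 0"
      by (intro tendsto_mult tendsto_const LIMSEQ_inverse_real_of_nat)
    then have "eventually (\<lambda>k. (2 * C + 1) * inverse (real (Suc k)) < e) sequentially"
      using that by (intro order_tendstoD(2)[where y=0]) auto
    then obtain k where k: "(2 * C + 1) * inverse (real (Suc k)) < e"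
      unfolding eventually_sequentially by blast
    have "P k (diagseq \<circ> ((+) (Suc k)))" by (rule diagseq_holds) (rule stable)
    then obtain K where K: "\<And>m n. m \<ge> K \<Longrightarrow> n \<ge> K \<Longrightarrow> L2dist \<Omega> (\<phi> (diagseq (Suc k + m))) (\<phi> (diagseq (Suc k + n))) < (2 * C + 1) * inverse (real (Suc k))"
      unfolding P_def o_def by blast
    have "L2dist \<Omega> (\<phi> (diagseq m)) (\<phi> (diagseq n)) < e" if "m \<ge> Suc k + K" "n \<ge> Suc k + K" for m n
    proof -
      have "Suc k + (m - Suc k) = m" "Suc k + (n - Suc k) = n" using that by auto
      then show ?thesis using K[of "m - Suc k" "n - Suc k"] k that by fastforce
    qed
    then show ?thesis by blast
  qed
  then show ?thesis using subseq_diagseq by blast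
qed

text \<open>\<open>V_grad\<close> means approximation by test fields together with their gradients,
  so each \<open>w n\<close> is replaced by a test field within 1/(n+1) in both respects. This
  raises the bound from \<open>C\<close> to \<open>C + 1\<close> and leaves limits
  unchanged.\<close>

theorem Rellich_V:
  fixes w :: "nat \<Rightarrow> field"
  assumes \<Omega>: "open \<Omega>" "bounded \<Omega>" and w: "\<And>n. V_grad \<Omega> (w n) (G n)"
    and C: "\<And>n. L2norm \<Omega> (w n) \<le> C" "\<And>n. L2norm \<Omega> (G n) \<le> C"
  shows "\<exists>z (r :: nat \<Rightarrow> nat). L2 \<Omega> z \<and> strict_mono r \<and> (\<lambda>n. L2dist \<Omega> (w (r n)) z) \<longlonglongrightarrow> 0"
proof -
  have lm: "\<Omega> \<in> lmeasurable" using \<Omega> by (simp add: lmeasurable_open)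
  have L: "L2 \<Omega> (w n)" "L2 \<Omega> (G n)" for n using w[of n] by (auto simp: V_grad_def)
  have "\<exists>\<phi>. test_field \<Omega> \<phi> \<and> L2dist \<Omega> (w n) \<phi> < inverse (real (Suc n)) \<and> L2dist \<Omega> (G n) (grad \<phi>) < inverse (real (Suc n))" for n
  proof -
    obtain \<phi> where \<phi>: "\<And>k. test_field \<Omega> (\<phi> k)" "(\<lambda>k. L2dist \<Omega> (w n) (\<phi> k)) \<longlonglongrightarrow> 0" "(\<lambda>k. L2dist \<Omega> (G n) (grad (\<phi> k))) \<longlonglongrightarrow> 0"
      using w[of n] unfolding V_grad_def by blast
    have "eventually (\<lambda>k. L2dist \<Omega> (w n) (\<phi> k) < inverse (real (Suc n)) \<and> L2dist \<Omega> (G n) (grad (\<phi> k)) < inverse (real (Suc n))) sequentially"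
      by (intro eventually_conj order_tendstoD(2)[OF \<phi>(2)] order_tendstoD(2)[OF \<phi>(3)]) simp_all
    then obtain k where "L2dist \<Omega> (w n) (\<phi> k) < inverse (real (Suc n)) \<and> L2dist \<Omega> (G n) (grad (\<phi> k)) < inverse (real (Suc n))"
      unfolding eventually_sequentially by blast
    then show ?thesis using \<phi>(1) by blast
  qed
  then obtain \<phi> where \<phi>: "\<And>n. test_field \<Omega> (\<phi> n)" "\<And>n. L2dist \<Omega> (w n) (\<phi> n) < inverse (real (Suc n))"
      "\<And>n. L2dist \<Omega> (G n) (grad (\<phi> n)) < inverse (real (Suc n))" by metis
  have T: "L2 \<Omega> (\<phi> n)" "L2 \<Omega> (grad (\<phi> n))" for n
    using test_field_L2[OF \<phi>(1) \<Omega>(1)] test_field_grad_L2[OF \<phi>(1) \<Omega>(1)] by auto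
  have i1: "inverse (real (Suc n)) \<le> 1" for n by (simp add: field_simps)
  have "L2norm \<Omega> (\<phi> n) \<le> C + 1" for n
    using L2norm_le_dist[OF T(1) L(1), of n n] C(1)[of n] \<phi>(2)[of n] i1[of n] L2dist_commute[of \<Omega> "\<phi> n" "w n"] by linarith
  moreover have "L2norm \<Omega> (grad (\<phi> n)) \<le> C + 1" for n
    using L2norm_le_dist[OF T(2) L(2), of n n] C(2)[of n] \<phi>(3)[of n] i1[of n] L2dist_commute[of \<Omega> "grad (\<phi> n)" "G n"] by linarith
  ultimately obtain r :: "nat \<Rightarrow> nat" where r: "strict_mono r" "\<And>e. e > 0 \<Longrightarrow> \<exists>K. \<forall>m\<ge>K. \<forall>n\<ge>K. L2dist \<Omega> (\<phi> (r m)) (\<phi> (r n)) < e"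
    using test_fields_Cauchy_subseq[OF \<Omega>, of \<phi> "C + 1"] \<phi>(1) by blast
  obtain z where z: "L2 \<Omega> z" "(\<lambda>n. L2dist \<Omega> (\<phi> (r n)) z) \<longlonglongrightarrow> 0"
    using L2_complete[OF lm, of "\<lambda>n. \<phi> (r n)"] T r(2) by blast
  have le: "L2dist \<Omega> (w (r n)) z \<le> inverse (real (Suc (r n))) + L2dist \<Omega> (\<phi> (r n)) z" for n
    using L2dist_triangle[OF L(1)[of "r n"] T(1)[of "r n"] z(1)] \<phi>(2)[of "r n"] by linarith
  have "(\<lambda>n. inverse (real (Suc (r n))) + L2dist \<Omega> (\<phi> (r n)) z) \<longlonglongrightarrow> 0 + 0"
    by (intro tendsto_add z LIMSEQ_subseq_LIMSEQ[OF LIMSEQ_inverse_real_of_nat r(1), unfolded o_def])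
  then have "(\<lambda>n. L2dist \<Omega> (w (r n)) z) \<longlonglongrightarrow> 0"
    by (intro tendsto_zero_sandwich[OF L2dist_nonneg le]) simp
  then show ?thesis using z r by blast
qed

section \<open>Distributional derivatives in time\<close>

text \<open>\<open>smooth_R\<close> quantifies over all orders at once, which resists induction.
  Smoothness up to order \<open>k\<close> is shown to be closed under the algebraic operations by
  induction on \<open>k\<close>; all \<open>k\<close> together give back
  \<open>smooth_R\<close>.\<close>

primrec nsmooth :: "nat \<Rightarrow> (real \<Rightarrow> real) \<Rightarrow> bool" where
  "nsmooth 0 f \<longleftrightarrow> (\<forall>x. f differentiable (at x))"
| "nsmooth (Suc k) f \<longleftrightarrow> (\<forall>x. f differentiable (at x)) \<and> nsmooth k (deriv f)"

lemma nsmooth_deriv_iff: "nsmooth k f \<longleftrightarrow> (\<forall>j\<le>k. \<forall>x. ((deriv ^^ j) f) differentiable (at x))"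
proof (induction k arbitrary: f)
  case (Suc k)
  have "(\<forall>j\<le>Suc k. \<forall>x. ((deriv ^^ j) f) differentiable (at x)) \<longleftrightarrow>
      (\<forall>x. f differentiable (at x)) \<and> (\<forall>j\<le>k. \<forall>x. ((deriv ^^ Suc j) f) differentiable (at x))"
    by (metis Suc_le_mono funpow_0 not0_implies_Suc zero_le)
  then show ?case using Suc.IH[of "deriv f"] by (simp add: funpow_swap1)
qed simp

lemma smooth_R_nsmooth: "smooth_R f \<longleftrightarrow> (\<forall>k. nsmooth k f)"
  unfolding nsmooth_deriv_iff smooth_R_def by auto

lemma nsmooth_differentiable: "nsmooth k f \<Longrightarrow> f differentiable (at x)"
  by (cases k) auto

lemma nsmooth_has_deriv: "nsmooth k f \<Longrightarrow> (f has_real_derivative deriv f x) (at x)"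
  using nsmooth_differentiable DERIV_deriv_iff_real_differentiable by blast

lemma smooth_R_has_deriv: "smooth_R f \<Longrightarrow> (f has_real_derivative deriv f x) (at x)"
  unfolding smooth_R_nsmooth using nsmooth_has_deriv by blast

lemma nsmooth_SucI:
  assumes "\<And>x. (f has_real_derivative f' x) (at x)" "nsmooth k f'"
  shows "nsmooth (Suc k) f"
proof -
  have "deriv f = f'" using assms(1) DERIV_imp_deriv by blast
  then show ?thesis using assms real_differentiable_def by auto
qed

lemma nsmooth_Suc_D: "nsmooth (Suc k) f \<Longrightarrow> nsmooth k f"
  by (induction k arbitrary: f) auto

lemma nsmooth_linear: "nsmooth k f \<Longrightarrow> nsmooth k g \<Longrightarrow> nsmooth k (\<lambda>x. a * f x + b * g x)"
proof (induction k arbitrary: f g)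
  case 0 then show ?case by (auto intro!: derivative_intros)
next
  case (Suc k)
  show ?case
    by (rule nsmooth_SucI[where f'="\<lambda>x. a * deriv f x + b * deriv g x"])
      (use Suc nsmooth_has_deriv[OF Suc.prems(1)] nsmooth_has_deriv[OF Suc.prems(2)] in \<open>auto intro!: derivative_eq_intros\<close>)
qed

lemma nsmooth_mult: "nsmooth k f \<Longrightarrow> nsmooth k g \<Longrightarrow> nsmooth k (\<lambda>x. f x * g x)"
proof (induction k arbitrary: f g)
  case 0 then show ?case by (auto intro!: derivative_intros)
next
  case (Suc k)
  have "nsmooth k (\<lambda>x. deriv f x * g x)" "nsmooth k (\<lambda>x. f x * deriv g x)"
    using Suc.IH[of "deriv f" g] Suc.IH[of f "deriv g"] Suc.prems nsmooth_Suc_D by auto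
  then have "nsmooth k (\<lambda>x. 1 * (deriv f x * g x) + 1 * (f x * deriv g x))" by (rule nsmooth_linear)
  then show ?case
    using DERIV_mult[OF nsmooth_has_deriv[OF Suc.prems(1)] nsmooth_has_deriv[OF Suc.prems(2)]]
    by (intro nsmooth_SucI[where f'="\<lambda>x. 1 * (deriv f x * g x) + 1 * (f x * deriv g x)"]) (simp_all add: mult.commute)
qed

lemma nsmooth_affine: "nsmooth k f \<Longrightarrow> nsmooth k (\<lambda>x. f (a * x + c))"
proof (induction k arbitrary: f)
  case 0
  have "((\<lambda>x. f (a * x + c)) has_real_derivative deriv f (a * x + c) * a) (at x)" for x
    by (rule DERIV_chain2[OF nsmooth_has_deriv[OF 0]]) (auto intro!: derivative_eq_intros)
  then show ?case using real_differentiable_def by auto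
next
  case (Suc k)
  have d: "((\<lambda>x. f (a * x + c)) has_real_derivative deriv f (a * x + c) * a) (at x)" for x
    by (rule DERIV_chain2[OF nsmooth_has_deriv[OF Suc.prems]]) (auto intro!: derivative_eq_intros)
  have "nsmooth k (\<lambda>x. deriv f (a * x + c))" using Suc by auto
  from nsmooth_linear[OF this this, of a 0] show ?case
    by (intro nsmooth_SucI[OF d]) (simp add: mult.commute)
qed

text \<open>The flat function exp(-1/x) with a power of 1/x, continued by 0. The powers are included
  because differentiation raises them: the family is closed under derivatives up to linear
  combinations.\<close>

definition exp_pole :: "nat \<Rightarrow> real \<Rightarrow> real" where
  "exp_pole n x = (if x > 0 then (1 / x) ^ n * exp (- (1 / x)) else 0)"

lemma exp_pole_has_deriv:
  "(exp_pole n has_real_derivative - real n * exp_pole (Suc n) x + exp_pole (Suc (Suc n)) x) (at x)"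
proof -
  consider "x < 0" | "x = 0" | "x > 0" by linarith
  then show ?thesis
  proof cases
    case 1
    have "(exp_pole n has_real_derivative 0) (at x)"
      by (rule has_field_derivative_transform_within_open[of "\<lambda>x. 0" _ _ "{..<0}"]) (use 1 in \<open>auto simp: exp_pole_def\<close>)
    then show ?thesis using 1 by (simp add: exp_pole_def)
  next
    case 2
    \<comment> \<open>The right difference quotient at 0 is this expression with
      \<open>t = 1/h\<close>, and the exponential wins.\<close>
    have "((\<lambda>t::real. t ^ Suc n / exp t) \<longlongrightarrow> 0) at_top" by (rule tendsto_power_div_exp_0)
    then have "((\<lambda>h. (inverse h) ^ Suc n / exp (inverse h)) \<longlongrightarrow> 0) (at_right (0::real))"
      by (rule filterlim_compose[OF _ filterlim_inverse_at_top_right])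
    moreover have "\<forall>\<^sub>F h in at_right (0::real). (inverse h) ^ Suc n / exp (inverse h) = (exp_pole n (0 + h) - exp_pole n 0) / h"
      unfolding eventually_at_right_field
      by (intro exI[of _ 1]) (auto simp: exp_pole_def exp_minus field_simps)
    ultimately have r: "((\<lambda>h. (exp_pole n (0 + h) - exp_pole n 0) / h) \<longlongrightarrow> 0) (at_right 0)"
      by (rule Lim_transform_eventually)
    have "\<forall>\<^sub>F h in at_left (0::real). 0 = (exp_pole n (0 + h) - exp_pole n 0) / h"
      unfolding eventually_at_left_field
      by (intro exI[of _ "-1"]) (auto simp: exp_pole_def)
    then have "((\<lambda>h. (exp_pole n (0 + h) - exp_pole n 0) / h) \<longlongrightarrow> 0) (at_left 0)"
      by (rule Lim_transform_eventually[OF tendsto_const])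
    with r have "((\<lambda>h. (exp_pole n (0 + h) - exp_pole n 0) / h) \<longlongrightarrow> 0) (at 0)"
      by (simp add: filterlim_at_split)
    then have "(exp_pole n has_real_derivative 0) (at 0)" unfolding DERIV_def .
    then show ?thesis using 2 by (simp add: exp_pole_def)
  next
    case 3
    have "((\<lambda>x. (1 / x) ^ n * exp (- (1 / x))) has_real_derivative - real n * exp_pole (Suc n) x + exp_pole (Suc (Suc n)) x) (at x)"
      using 3 by (auto intro!: derivative_eq_intros simp: exp_pole_def field_simps power2_eq_square)
        (cases n; simp add: field_simps)
    then show ?thesis
      by (rule has_field_derivative_transform_within_open[of _ _ _ "{0<..}"]) (use 3 in \<open>auto simp: exp_pole_def\<close>)
  qed
qed

lemma nsmooth_exp_pole: "nsmooth k (exp_pole n)"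
proof (induction k arbitrary: n)
  case 0 then show ?case using exp_pole_has_deriv real_differentiable_def by auto
next
  case (Suc k)
  show ?case
    using nsmooth_linear[OF Suc[of "Suc n"] Suc[of "Suc (Suc n)"], of "- real n" 1]
    by (intro nsmooth_SucI[OF exp_pole_has_deriv]) simp
qed

text \<open>The primitive of a smooth bump supported in [0, 1], divided by its total mass.\<close>

lemma smooth_step_exists:
  "\<exists>\<sigma>. smooth_R \<sigma> \<and> (\<forall>x\<le>0. \<sigma> x = 0) \<and> (\<forall>x\<ge>1. \<sigma> x = 1) \<and> (\<forall>x. 0 \<le> deriv \<sigma> x)"
proof -
  define b where "b x = exp_pole 0 x * exp_pole 0 (-1 * x + 1)" for x
  have bs: "nsmooth k b" for k unfolding b_def[abs_def]
    by (intro nsmooth_mult nsmooth_affine nsmooth_exp_pole)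
  have bc: "continuous_on A b" for A
    using nsmooth_differentiable[OF bs[of 0]] by (meson differentiable_imp_continuous_within continuous_at_imp_continuous_on)
  have b0: "b x \<ge> 0" for x by (simp add: b_def exp_pole_def)
  have bz: "x \<le> 0 \<or> x \<ge> 1 \<Longrightarrow> b x = 0" for x by (auto simp: b_def exp_pole_def)
  \<comment> \<open>Integration starts at -1, left of the support, so that 0 is an interior point of
    the interval on which the fundamental theorem is applied.\<close>
  define B where "B x = integral {-1..x} b" for x
  have B0: "B x = 0" if "x \<le> 0" for x
    unfolding B_def using bz that by (intro integral_eq_0_iff[THEN iffD2] integral_unique has_integral_is_0) auto
  have Bd: "(B has_real_derivative b x) (at x)" for x
  proof (cases "x < 0")
    case True
    have "(B has_real_derivative 0) (at x)"
      by (rule has_field_derivative_transform_within_open[of "\<lambda>x. 0" _ _ "{..<0}"]) (use True B0 in auto)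
    then show ?thesis using bz True by simp
  next
    case False
    have "(B has_real_derivative b x) (at x within {-1..x+1})"
      unfolding B_def by (rule integral_has_real_derivative[OF bc]) (use False in auto)
    moreover have "at x within {-1..x+1} = at x" by (rule at_within_interior) (use False in auto)
    ultimately show ?thesis by simp
  qed
  have "B 1 > B 0"
  proof -
    obtain z where z: "0 < z" "z < 1" "B 1 - B 0 = (1 - 0) * b z"
      using MVT2[of 0 1 B b] Bd by auto
    have "b z > 0" using z by (simp add: b_def exp_pole_def)
    then show ?thesis using z by simp
  qed
  then have B1: "B 1 > 0" using B0[of 0] by simp
  \<comment> \<open>The zero summand gives the form that \<open>nsmooth_linear\<close>
    expects.\<close>
  define \<sigma> where "\<sigma> x = (1 / B 1) * B x + 0 * B x" for x
  have sB: "nsmooth k B" for k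
    using nsmooth_SucI[OF Bd bs] nsmooth_Suc_D by blast
  have s: "smooth_R \<sigma>" unfolding smooth_R_nsmooth \<sigma>_def[abs_def] using sB nsmooth_linear by blast
  have \<sigma>d: "(\<sigma> has_real_derivative b x / B 1) (at x)" for x
    unfolding \<sigma>_def[abs_def] using B1 by (auto intro!: derivative_eq_intros Bd)
  have "\<sigma> x = 1" if "x \<ge> 1" for x
  proof -
    have x1: "x \<ge> 1" by (rule that)
    have "B 1 = B x"
    proof (cases "x = 1")
      case False
      obtain z where z: "1 < z" "z < x" "B x - B 1 = (x - 1) * b z"
        using MVT2[of 1 x B b] Bd x1 False by auto
      then show ?thesis using bz[of z] by simp
    qed simp
    then show ?thesis using B1 by (simp add: \<sigma>_def)
  qed
  moreover have "\<sigma> x = 0" if "x \<le> 0" for x using B0[OF that] by (simp add: \<sigma>_def)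
  moreover have "deriv \<sigma> x \<ge> 0" for x using DERIV_imp_deriv[OF \<sigma>d] b0 B1 by simp
  ultimately show ?thesis using s by blast
qed

section \<open>Integrating a distributional time derivative\<close>

lemma lebesgue_on_integral_cont:
  fixes f :: "real \<Rightarrow> real"
  assumes "continuous_on {0..T} f"
  shows "integrable (lebesgue_on {0<..<T}) f" "integral\<^sup>L (lebesgue_on {0<..<T}) f = integral {0..T} f"
proof -
  have "f absolutely_integrable_on {0..T}" using assms by (rule absolutely_integrable_continuous_real)
  then have "f absolutely_integrable_on {0<..<T}" by (rule set_integrable_subset) auto
  then show i: "integrable (lebesgue_on {0<..<T}) f" by (simp add: set_integrable_def integrable_restrict_space)
  show "integral\<^sup>L (lebesgue_on {0<..<T}) f = integral {0..T} f"
    using lebesgue_integral_eq_integral[OF i] by (simp add: integral_open_interval_real)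
qed

text \<open>The scaled derivative of the step is a nonnegative kernel supported in [s, s + 1/(n+1)].
  The support lies to the right of \<open>s\<close>, so \<open>s < T\<close> makes it eventually fit
  into the interval, and its mass there is then 1.\<close>

lemma approximate_identity_tendsto:
  fixes g \<sigma> :: "real \<Rightarrow> real"
  assumes g: "continuous_on {0..T} g" and s: "0 < s" "s < T"
    and \<sigma>: "smooth_R \<sigma>" "\<And>x. x \<le> 0 \<Longrightarrow> \<sigma> x = 0" "\<And>x. x \<ge> 1 \<Longrightarrow> \<sigma> x = 1" "\<And>x. 0 \<le> deriv \<sigma> x"
  shows "(\<lambda>n. integral {0..T} (\<lambda>x. g x * (real (Suc n) * deriv \<sigma> (real (Suc n) * (x - s))))) \<longlonglongrightarrow> g s"
proof (rule LIMSEQ_I)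
  fix e :: real assume e: "0 < e"
  have sd: "(\<sigma> has_real_derivative deriv \<sigma> x) (at x)" for x
    using \<sigma>(1) by (rule smooth_R_has_deriv)
  have cd: "continuous_on A (deriv \<sigma>)" for A
  proof -
    have "nsmooth 1 \<sigma>" using \<sigma>(1) by (simp add: smooth_R_nsmooth)
    then have "\<And>x. deriv \<sigma> differentiable (at x)" by simp
    then show ?thesis by (meson differentiable_imp_continuous_within continuous_at_imp_continuous_on)
  qed
  obtain d where d: "d > 0" "\<And>x. x \<in> {0..T} \<Longrightarrow> dist x s < d \<Longrightarrow> dist (g x) (g s) < e / 2"
    using g[unfolded continuous_on_iff, rule_format, of s "e/2"] s e by auto
  obtain K where K: "inverse (real (Suc K)) < min d (T - s)" using reals_Archimedean[of "min d (T - s)"] d s by auto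
  show "\<exists>no. \<forall>n\<ge>no. norm (integral {0..T} (\<lambda>x. g x * (real (Suc n) * deriv \<sigma> (real (Suc n) * (x - s)))) - g s) < e"
  proof (intro exI allI impI)
    fix n assume "n \<ge> K"
    define N where "N = real (Suc n)"
    have N0: "N > 0" by (simp add: N_def)
    have "inverse N \<le> inverse (real (Suc K))" using \<open>n \<ge> K\<close> by (simp add: N_def field_simps)
    then have N: "inverse N < d" "inverse N < T - s" using K by auto
    have NT: "N * (T - s) \<ge> 1" using N(2) N0 by (simp add: field_simps)
    define k where "k x = N * deriv \<sigma> (N * (x - s))" for x
    have kc: "continuous_on A k" for A
      unfolding k_def by (intro continuous_intros continuous_on_compose2[OF cd[of UNIV]]) auto
    have k0: "k x \<ge> 0" for x using \<sigma>(4) N0 by (simp add: k_def)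
    have "((\<lambda>x. \<sigma> (N * (x - s))) has_real_derivative k x) (at x)" for x
    proof -
      have "((\<lambda>x. N * (x - s)) has_real_derivative N) (at x)" by (auto intro!: derivative_eq_intros)
      from DERIV_chain2[OF sd this] show ?thesis by (simp add: mult.commute k_def)
    qed
    then have "(k has_integral \<sigma> (N * (T - s)) - \<sigma> (N * (0 - s))) {0..T}"
      using s by (intro fundamental_theorem_of_calculus) (auto simp: has_real_derivative_iff_has_vector_derivative[symmetric] intro: has_field_derivative_at_within)
    moreover have "\<sigma> (N * (T - s)) = 1" using \<sigma>(3)[OF NT] .
    moreover have "\<sigma> (N * (0 - s)) = 0" by (rule \<sigma>(2)) (use N0 s in \<open>simp add: mult_nonneg_nonneg\<close>)
    ultimately have ki: "(k has_integral 1) {0..T}" by simp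
    have kz: "k x = 0" if "\<not> (s \<le> x \<and> x \<le> s + inverse N)" for x
    proof -
      have "deriv \<sigma> (N * (x - s)) = 0"
      proof (cases "x < s")
        case True
        then have "N * (x - s) < 0" using N0 by (simp add: mult_pos_neg)
        then have "(\<sigma> has_real_derivative 0) (at (N * (x - s)))"
          using \<sigma>(2) by (intro has_field_derivative_transform_within_open[OF DERIV_const, of "{..<0}" _ 0]) auto
        then show ?thesis by (rule DERIV_imp_deriv)
      next
        case False
        then have "x - s > inverse N" using that by auto
        then have "N * (x - s) > 1" using N0 by (simp add: field_simps)
        then have "(\<sigma> has_real_derivative 0) (at (N * (x - s)))"
          using \<sigma>(3) by (intro has_field_derivative_transform_within_open[OF DERIV_const, of "{1<..}" _ 1]) auto
        then show ?thesis by (rule DERIV_imp_deriv)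
      qed
      then show ?thesis by (simp add: k_def)
    qed
    have le: "norm ((g x - g s) * k x) \<le> e / 2 * k x" if "x \<in> {0..T}" for x
    proof (cases "s \<le> x \<and> x \<le> s + inverse N")
      case True
      then have "dist x s < d" using N(1) by (simp add: dist_real_def)
      then have "\<bar>g x - g s\<bar> \<le> e / 2" using d(2)[OF that] by (simp add: dist_real_def)
      then have "\<bar>g x - g s\<bar> * k x \<le> e / 2 * k x" by (rule mult_right_mono[OF _ k0])
      then show ?thesis using k0[of x] by (simp add: abs_mult)
    qed (simp add: kz)
    have i1: "(\<lambda>x. (g x - g s) * k x) integrable_on {0..T}"
      by (intro integrable_continuous_real continuous_intros g kc)
    have ki2: "((\<lambda>x. e / 2 * k x) has_integral e / 2 * 1) {0..T}"
      by (rule has_integral_mult_right[OF ki])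
    have "norm (integral {0..T} (\<lambda>x. (g x - g s) * k x)) \<le> integral {0..T} (\<lambda>x. e / 2 * k x)"
      by (rule integral_norm_bound_integral[OF i1 has_integral_integrable[OF ki2] le])
    also have "\<dots> = e / 2" using integral_unique[OF ki2] by simp
    finally have b: "norm (integral {0..T} (\<lambda>x. (g x - g s) * k x)) \<le> e / 2" .
    have "((\<lambda>x. (g x - g s) * k x + g s * k x) has_integral integral {0..T} (\<lambda>x. (g x - g s) * k x) + g s * 1) {0..T}"
      by (intro has_integral_add integrable_integral i1 has_integral_mult_right ki)
    then have "integral {0..T} (\<lambda>x. g x * k x) = integral {0..T} (\<lambda>x. (g x - g s) * k x) + g s"
      by (intro integral_unique) (simp add: algebra_simps)
    then show "norm (integral {0..T} (\<lambda>x. g x * (real (Suc n) * deriv \<sigma> (real (Suc n) * (x - s)))) - g s) < e"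
      using b e by (simp add: k_def N_def)
  qed
qed

text \<open>The test functions are differences of two steps, at \<open>s\<close> and at
  \<open>t\<close>: their derivatives concentrate at the two times while they themselves tend to an
  indicator. The sign is that of \<open>g' = - F\<close>, the convention in which the weak
  formulation is written.\<close>

lemma distributional_derivative_integral_interior:
  assumes g: "continuous_on {0..T} g" and F: "integrable (lebesgue_on {0<..<T}) F"
    and weak: "\<And>\<psi>. test_fun 0 T \<psi> \<Longrightarrow> integral\<^sup>L (lebesgue_on {0<..<T}) (\<lambda>t. g t * deriv \<psi> t)
        = integral\<^sup>L (lebesgue_on {0<..<T}) (\<lambda>t. F t * \<psi> t)"
    and st: "0 < s" "s < t" "t < T"
  shows "g s - g t = integral\<^sup>L (lebesgue_on {0<..<T}) (\<lambda>x. indicator {s<..t} x * F x)"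
proof -
  obtain \<sigma> where \<sigma>: "smooth_R \<sigma>" "\<And>x. x \<le> 0 \<Longrightarrow> \<sigma> x = 0" "\<And>x. x \<ge> 1 \<Longrightarrow> \<sigma> x = 1" "\<And>x. 0 \<le> deriv \<sigma> x"
    using smooth_step_exists by blast
  have sd: "(\<sigma> has_real_derivative deriv \<sigma> x) (at x)" for x
    using \<sigma>(1) by (rule smooth_R_has_deriv)
  have cd: "continuous_on A (deriv \<sigma>)" for A
  proof -
    have "nsmooth 1 \<sigma>" using \<sigma>(1) by (simp add: smooth_R_nsmooth)
    then have "\<And>x. deriv \<sigma> differentiable (at x)" by simp
    then show ?thesis by (meson differentiable_imp_continuous_within continuous_at_imp_continuous_on)
  qed
  have mono: "\<sigma> x \<le> \<sigma> y" if "x \<le> y" for x y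
    using that sd \<sigma>(4) by (intro DERIV_nonneg_imp_nondecreasing[of x y \<sigma>]) auto
  have \<sigma>01: "0 \<le> \<sigma> x" "\<sigma> x \<le> 1" for x
    using mono[of "min x 0" x] mono[of x "max x 1"] \<sigma>(2)[of "min x 0"] \<sigma>(3)[of "max x 1"] by auto
  \<comment> \<open>Written with affine arguments and explicit coefficients so that
    \<open>nsmooth_affine\<close> and \<open>nsmooth_linear\<close> apply; \<open>\<psi>eq\<close>
    restores the readable form.\<close>
  define \<psi> where "\<psi> n x = 1 * \<sigma> (real (Suc n) * x + (- real (Suc n) * s)) + (-1) * \<sigma> (real (Suc n) * x + (- real (Suc n) * t))" for n x
  have \<psi>s: "smooth_R (\<psi> n)" for n
    using \<sigma>(1) unfolding smooth_R_nsmooth \<psi>_def[abs_def] by (intro allI nsmooth_linear nsmooth_affine) auto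
  have \<psi>eq: "\<psi> n x = \<sigma> (real (Suc n) * (x - s)) - \<sigma> (real (Suc n) * (x - t))" for n x
    by (simp add: \<psi>_def algebra_simps)
  have \<psi>d: "deriv (\<psi> n) x = real (Suc n) * deriv \<sigma> (real (Suc n) * (x - s)) - real (Suc n) * deriv \<sigma> (real (Suc n) * (x - t))" for n x
  proof (rule DERIV_imp_deriv)
    have d: "((\<lambda>x. \<sigma> (real (Suc n) * (x - a))) has_real_derivative real (Suc n) * deriv \<sigma> (real (Suc n) * (x - a))) (at x)" for a
    proof -
      have "((\<lambda>x. real (Suc n) * (x - a)) has_real_derivative real (Suc n)) (at x)" by (auto intro!: derivative_eq_intros)
      from DERIV_chain2[OF sd this] show ?thesis by (simp add: mult.commute del: of_nat_Suc)
    qed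
    have "((\<lambda>x. \<sigma> (real (Suc n) * (x - s)) - \<sigma> (real (Suc n) * (x - t))) has_real_derivative
      real (Suc n) * deriv \<sigma> (real (Suc n) * (x - s)) - real (Suc n) * deriv \<sigma> (real (Suc n) * (x - t))) (at x)"
      by (intro DERIV_diff d)
    then show "(\<psi> n has_real_derivative real (Suc n) * deriv \<sigma> (real (Suc n) * (x - s)) - real (Suc n) * deriv \<sigma> (real (Suc n) * (x - t))) (at x)"
      by (simp add: \<psi>eq[abs_def])
  qed
  \<comment> \<open>From this index on the step at \<open>t\<close> is completed before
    \<open>T\<close>, so the support of \<open>\<psi> n\<close> is a compact subset of the open
    interval.\<close>
  obtain K where K: "inverse (real (Suc K)) < T - t" using reals_Archimedean[of "T - t"] st by auto
  have tf: "test_fun 0 T (\<psi> n)" if "n \<ge> K" for n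
  proof -
    have inv: "inverse (real (Suc n)) \<le> inverse (real (Suc K))" using that by (simp add: field_simps)
    have z: "\<psi> n x = 0" if "x \<notin> {s..t + inverse (real (Suc n))}" for x
    proof (cases "x < s")
      case True
      have "real (Suc n) * (x - s) \<le> 0" "real (Suc n) * (x - t) \<le> 0"
        using True st by (simp_all add: mult_nonneg_nonpos del: of_nat_Suc)
      then show ?thesis by (simp add: \<psi>eq \<sigma>(2) del: of_nat_Suc)
    next
      case False
      then have "x - t \<ge> inverse (real (Suc n))" using that by auto
      then have 1: "real (Suc n) * (x - t) \<ge> 1" by (simp add: field_simps del: of_nat_Suc)
      moreover have "real (Suc n) * (x - s) \<ge> real (Suc n) * (x - t)" using st by (intro mult_left_mono) auto
      ultimately have "1 \<le> real (Suc n) * (x - s)" by linarith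
      then show ?thesis using 1 by (simp add: \<psi>eq \<sigma>(3) del: of_nat_Suc)
    qed
    have "t + inverse (real (Suc n)) < T" using K inv by linarith
    then show ?thesis unfolding test_fun_def using \<psi>s z st(1) by blast
  qed
  define A where "A a n = integral {0..T} (\<lambda>x. g x * (real (Suc n) * deriv \<sigma> (real (Suc n) * (x - a))))" for a n
  have ci: "continuous_on {0..T} (\<lambda>x. g x * (real (Suc n) * deriv \<sigma> (real (Suc n) * (x - a))))" for a n
    by (intro continuous_intros g continuous_on_compose2[OF cd[of UNIV]]) auto
  have eq: "A s n - A t n = integral\<^sup>L (lebesgue_on {0<..<T}) (\<lambda>x. F x * \<psi> n x)" if "n \<ge> K" for n
  proof -
    have "A s n - A t n = integral\<^sup>L (lebesgue_on {0<..<T}) (\<lambda>x. g x * (real (Suc n) * deriv \<sigma> (real (Suc n) * (x - s))) - g x * (real (Suc n) * deriv \<sigma> (real (Suc n) * (x - t))))"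
      unfolding A_def lebesgue_on_integral_cont(2)[OF ci, symmetric]
      by (rule Bochner_Integration.integral_diff[symmetric]) (rule lebesgue_on_integral_cont(1)[OF ci])+
    also have "\<dots> = integral\<^sup>L (lebesgue_on {0<..<T}) (\<lambda>x. g x * deriv (\<psi> n) x)"
      by (simp add: \<psi>d right_diff_distrib del: of_nat_Suc)
    also have "\<dots> = integral\<^sup>L (lebesgue_on {0<..<T}) (\<lambda>x. F x * \<psi> n x)" by (rule weak[OF tf[OF that]])
    finally show ?thesis .
  qed
  have lim1: "(\<lambda>n. A s n - A t n) \<longlonglongrightarrow> g s - g t"
    unfolding A_def using st by (intro tendsto_diff approximate_identity_tendsto g \<sigma>) auto
  have \<psi>m: "\<psi> n \<in> borel_measurable (lebesgue_on {0<..<T})" for n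
  proof -
    have "continuous_on UNIV (\<psi> n)"
      using \<psi>s[of n] nsmooth_differentiable[of 0 "\<psi> n"] unfolding smooth_R_nsmooth
      by (meson differentiable_imp_continuous_within continuous_at_imp_continuous_on)
    then have "\<psi> n \<in> borel_measurable borel" by (rule continuous_borel)
    then show ?thesis by (simp add: measurable_restrict_space1 measurable_completion)
  qed
  have lim2: "(\<lambda>n. integral\<^sup>L (lebesgue_on {0<..<T}) (\<lambda>x. F x * \<psi> n x)) \<longlonglongrightarrow> integral\<^sup>L (lebesgue_on {0<..<T}) (\<lambda>x. indicator {s<..t} x * F x)"
  proof (rule integral_dominated_convergence[where w="\<lambda>x. norm (F x)"])
    have Fm[measurable]: "F \<in> borel_measurable (lebesgue_on {0<..<T})" using F by auto
    show "(\<lambda>x. indicator {s<..t} x * F x) \<in> borel_measurable (lebesgue_on {0<..<T})"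
      by (intro borel_measurable_times Fm borel_measurable_indicator) (subst sets_restrict_space_iff; use st in auto)
    show "(\<lambda>x. F x * \<psi> n x) \<in> borel_measurable (lebesgue_on {0<..<T})" for n
      by (intro borel_measurable_times Fm \<psi>m)
    show "integrable (lebesgue_on {0<..<T}) (\<lambda>x. norm (F x))" using F by auto
    have "\<bar>\<psi> n x\<bar> \<le> 1" for n x
      using \<sigma>01[of "real (Suc n) * (x - s)"] \<sigma>01[of "real (Suc n) * (x - t)"] by (simp add: \<psi>eq abs_le_iff del: of_nat_Suc)
    then show "AE x in lebesgue_on {0<..<T}. norm (F x * \<psi> n x) \<le> norm (F x)" for n
      by (simp add: abs_mult mult_left_le)
    \<comment> \<open>The step rises to the right of its base point, so at the base point itself the
      limit is 0; the limiting interval is open at \<open>s\<close> and closed at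
      \<open>t\<close>.\<close>
    have lim\<sigma>: "(\<lambda>n. \<sigma> (real (Suc n) * (x - a))) \<longlonglongrightarrow> (if x \<le> a then 0 else 1)" for x a
    proof (cases "x \<le> a")
      case True
      then have "\<sigma> (real (Suc n) * (x - a)) = 0" for n
        by (intro \<sigma>(2)) (simp add: mult_nonneg_nonpos del: of_nat_Suc)
      then show ?thesis using True by (simp del: of_nat_Suc)
    next
      case False
      obtain L where L: "inverse (real (Suc L)) < x - a" using reals_Archimedean[of "x - a"] False by auto
      have "\<sigma> (real (Suc n) * (x - a)) = 1" if "n \<ge> L" for n
      proof (rule \<sigma>(3))
        have "inverse (real (Suc n)) \<le> inverse (real (Suc L))" using that by (simp add: field_simps)
        then have "inverse (real (Suc n)) \<le> x - a" using L by linarith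
        then show "1 \<le> real (Suc n) * (x - a)" by (simp add: field_simps del: of_nat_Suc)
      qed
      then have "\<forall>\<^sub>F n in sequentially. 1 = \<sigma> (real (Suc n) * (x - a))"
        unfolding eventually_sequentially by (intro exI[of _ L]) auto
      then show ?thesis using False by (auto intro: Lim_transform_eventually[OF tendsto_const])
    qed
    have "(\<lambda>n. F x * \<psi> n x) \<longlonglongrightarrow> indicator {s<..t} x * F x" for x
    proof -
      have "(\<lambda>n. F x * (\<sigma> (real (Suc n) * (x - s)) - \<sigma> (real (Suc n) * (x - t)))) \<longlonglongrightarrow> F x * ((if x \<le> s then 0 else 1) - (if x \<le> t then 0 else 1))"
        by (intro tendsto_mult tendsto_const tendsto_diff lim\<sigma>)
      moreover have "F x * ((if x \<le> s then 0 else 1) - (if x \<le> t then 0 else 1)) = indicator {s<..t} x * F x"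
        using st by (auto simp: indicator_def)
      ultimately show ?thesis by (simp add: \<psi>eq del: of_nat_Suc)
    qed
    then show "AE x in lebesgue_on {0<..<T}. (\<lambda>n. F x * \<psi> n x) \<longlonglongrightarrow> indicator {s<..t} x * F x" by simp
  qed
  have "(\<lambda>n. A s n - A t n) \<longlonglongrightarrow> integral\<^sup>L (lebesgue_on {0<..<T}) (\<lambda>x. indicator {s<..t} x * F x)"
  proof (rule Lim_transform_eventually[OF lim2])
    show "\<forall>\<^sub>F n in sequentially. integral\<^sup>L (lebesgue_on {0<..<T}) (\<lambda>x. F x * \<psi> n x) = A s n - A t n"
      unfolding eventually_sequentially using eq by (intro exI[of _ K]) auto
  qed
  then show ?thesis by (rule LIMSEQ_unique[OF lim1])
qed

text \<open>Compactly supported test functions cannot see the end points 0 and \<open>T\<close>.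
  These are reached by moving \<open>s\<close> and \<open>t\<close> inwards, using continuity of
  \<open>g\<close> on one side and dominated convergence on the other.\<close>

lemma distributional_derivative_integral:
  assumes g: "continuous_on {0..T} g" and F: "integrable (lebesgue_on {0<..<T}) F"
    and weak: "\<And>\<psi>. test_fun 0 T \<psi> \<Longrightarrow> integral\<^sup>L (lebesgue_on {0<..<T}) (\<lambda>t. g t * deriv \<psi> t)
        = integral\<^sup>L (lebesgue_on {0<..<T}) (\<lambda>t. F t * \<psi> t)"
    and st: "0 \<le> s" "s < t" "t \<le> T"
  shows "g s - g t = integral\<^sup>L (lebesgue_on {0<..<T}) (\<lambda>x. indicator {s<..<t} x * F x)"
proof -
  \<comment> \<open>Denominators start at 3, which keeps the points in order: twice the displacement
    is less than \<open>t - s\<close>.\<close>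
  define a b where "a n = s + (t - s) / real (n + 3)" and "b n = t - (t - s) / real (n + 3)" for n
  have z: "(\<lambda>n. (t - s) / real (n + 3)) \<longlonglongrightarrow> 0"
    by (rule LIMSEQ_ignore_initial_segment[where f="\<lambda>n. (t - s) / real n"]) (rule lim_const_over_n)
  have al: "a \<longlonglongrightarrow> s + 0" and bl: "b \<longlonglongrightarrow> t - 0"
    unfolding a_def b_def by (intro tendsto_intros z)+
  have ab: "s < a n" "a n < b n" "b n < t" for n
  proof -
    define D where "D = (t - s) / real (n + 3)"
    have 1: "D > 0" using st by (simp add: D_def)
    have "D \<le> (t - s) / 3" unfolding D_def using st by (intro divide_left_mono) auto
    then have D3: "3 * D \<le> t - s" by simp
    show "s < a n" using 1 unfolding a_def D_def[symmetric] by linarith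
    show "a n < b n" using 1 D3 st unfolding a_def b_def D_def[symmetric] by linarith
    show "b n < t" using 1 unfolding b_def D_def[symmetric] by linarith
  qed
  have lim1: "(\<lambda>n. g (a n) - g (b n)) \<longlonglongrightarrow> g s - g t"
  proof (intro tendsto_diff continuous_on_tendsto_compose[OF g])
    have "a n \<in> {0..T} \<and> b n \<in> {0..T}" for n using ab[of n] st by simp
    then show "\<forall>\<^sub>F n in sequentially. a n \<in> {0..T}" "\<forall>\<^sub>F n in sequentially. b n \<in> {0..T}"
      by auto
  qed (use al bl st in auto)
  have eq: "g (a n) - g (b n) = integral\<^sup>L (lebesgue_on {0<..<T}) (\<lambda>x. indicator {a n<..b n} x * F x)" for n
    using ab[of n] st by (intro distributional_derivative_integral_interior[OF g F weak]) auto
  have lim2: "(\<lambda>n. integral\<^sup>L (lebesgue_on {0<..<T}) (\<lambda>x. indicator {a n<..b n} x * F x)) \<longlonglongrightarrow> integral\<^sup>L (lebesgue_on {0<..<T}) (\<lambda>x. indicator {s<..<t} x * F x)"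
  proof (rule integral_dominated_convergence[where w="\<lambda>x. norm (F x)"])
    have Fm[measurable]: "F \<in> borel_measurable (lebesgue_on {0<..<T})" using F by auto
    show "(\<lambda>x. indicator {s<..<t} x * F x) \<in> borel_measurable (lebesgue_on {0<..<T})"
      by (intro borel_measurable_times Fm borel_measurable_indicator) (subst sets_restrict_space_iff; use st in auto)
    show "(\<lambda>x. indicator {a n<..b n} x * F x) \<in> borel_measurable (lebesgue_on {0<..<T})" for n
      by (intro borel_measurable_times Fm borel_measurable_indicator) (subst sets_restrict_space_iff; use ab[of n] st in auto)
    show "integrable (lebesgue_on {0<..<T}) (\<lambda>x. norm (F x))" using F by auto
    show "AE x in lebesgue_on {0<..<T}. norm (indicator {a n<..b n} x * F x) \<le> norm (F x)" for n
      by (auto simp: indicator_def)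
    have "(\<lambda>n. indicator {a n<..b n} x :: real) \<longlonglongrightarrow> indicator {s<..<t} x" for x
    proof (cases "x \<in> {s<..<t}")
      case True
      have "\<forall>\<^sub>F n in sequentially. a n < x" using al True by (intro order_tendstoD) auto
      moreover have "\<forall>\<^sub>F n in sequentially. x < b n" using bl True by (intro order_tendstoD) auto
      ultimately have "\<forall>\<^sub>F n in sequentially. (1::real) = indicator {a n<..b n} x"
        by eventually_elim (auto simp: indicator_def)
      then show ?thesis using True by (auto intro: Lim_transform_eventually[OF tendsto_const])
    next
      case False
      then have "indicator {a n<..b n} x = (0::real)" for n using ab[of n] by (auto simp: indicator_def)
      then show ?thesis using False by simp
    qed
    then show "AE x in lebesgue_on {0<..<T}. (\<lambda>n. indicator {a n<..b n} x * F x) \<longlonglongrightarrow> indicator {s<..<t} x * F x"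
      by (intro AE_I2 tendsto_mult tendsto_const)
  qed
  show ?thesis by (rule LIMSEQ_unique[OF lim1]) (use lim2 eq in simp)
qed

section \<open>Continuity of translated pairings\<close>

text \<open>The three-epsilon argument, isolated because every approximation step in the translation
  lemmas ends with it.\<close>

lemma approx_LIMSEQ:
  fixes a :: "nat \<Rightarrow> real"
  assumes "\<And>e. e > 0 \<Longrightarrow> \<exists>c c'. c \<longlonglongrightarrow> c' \<and> (\<forall>n. \<bar>a n - c n\<bar> \<le> e) \<and> \<bar>a' - c'\<bar> \<le> e"
  shows "a \<longlonglongrightarrow> a'"
proof (rule LIMSEQ_I)
  fix e :: real assume e: "0 < e"
  obtain c c' where c: "c \<longlonglongrightarrow> c'" "\<And>n. \<bar>a n - c n\<bar> \<le> e/4" "\<bar>a' - c'\<bar> \<le> e/4"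
    using assms[of "e/4"] e by auto
  obtain K where K: "\<And>n. n \<ge> K \<Longrightarrow> norm (c n - c') < e/4" using LIMSEQ_D[OF c(1), of "e/4"] e by auto
  show "\<exists>no. \<forall>n\<ge>no. norm (a n - a') < e"
  proof (intro exI allI impI)
    fix n assume "n \<ge> K"
    then have "\<bar>c n - c'\<bar> < e/4" using K by auto
    then show "norm (a n - a') < e" unfolding real_norm_def using c(2)[of n] c(3) e by linarith
  qed
qed

lemma lborel_translation:
  fixes f :: "'a::euclidean_space \<Rightarrow> 'b::euclidean_space"
  assumes [measurable]: "f \<in> borel_measurable borel"
  shows "integrable lborel (\<lambda>x. f (x + z)) \<longleftrightarrow> integrable lborel f"
    and "(\<integral>x. f (x + z) \<partial>lborel) = (\<integral>x. f x \<partial>lborel)"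
proof -
  have eq: "lborel = distr lborel borel ((+) z)" by (simp add: lborel_distr_plus)
  have "integrable lborel f \<longleftrightarrow> integrable lborel (\<lambda>x. f (z + x))"
    by (subst eq, subst integrable_distr_eq) auto
  then show "integrable lborel (\<lambda>x. f (x + z)) \<longleftrightarrow> integrable lborel f" by (simp add: add.commute)
  have "(\<integral>x. f x \<partial>lborel) = (\<integral>x. f (z + x) \<partial>lborel)"
    by (subst eq, subst integral_distr) auto
  then show "(\<integral>x. f (x + z) \<partial>lborel) = (\<integral>x. f x \<partial>lborel)" by (simp add: add.commute)
qed

definition trunc :: "real \<Rightarrow> real \<Rightarrow> real" where "trunc k a = max (- k) (min k a)"

lemma trunc_bound: "k \<ge> 0 \<Longrightarrow> \<bar>trunc k a\<bar> \<le> k" by (auto simp: trunc_def)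
lemma trunc_diff_le: "k \<ge> 0 \<Longrightarrow> \<bar>a - trunc k a\<bar> \<le> \<bar>a\<bar>" by (auto simp: trunc_def)
lemma trunc_le: "k \<ge> 0 \<Longrightarrow> \<bar>trunc k a\<bar> \<le> \<bar>a\<bar>" by (auto simp: trunc_def)
lemma trunc_id: "\<bar>a\<bar> \<le> k \<Longrightarrow> trunc k a = a" by (auto simp: trunc_def)
lemma trunc_zero [simp]: "k \<ge> 0 \<Longrightarrow> trunc k 0 = 0" by (auto simp: trunc_def)
lemma trunc_measurable [measurable]: "f \<in> borel_measurable M \<Longrightarrow> (\<lambda>x. trunc k (f x)) \<in> borel_measurable M"
  unfolding trunc_def by (intro borel_measurable_max borel_measurable_min) auto
lemma trunc_continuous: "continuous_on UNIV (trunc k)"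
  unfolding trunc_def by (intro continuous_intros)
lemma trunc_tendsto: "(\<lambda>n. trunc (real n) a) \<longlonglongrightarrow> a"
proof (rule Lim_transform_eventually[OF tendsto_const])
  obtain K where "\<bar>a\<bar> \<le> real K" using real_arch_simple by blast
  then show "\<forall>\<^sub>F n in sequentially. a = trunc (real n) a"
    unfolding eventually_sequentially by (intro exI[of _ K]) (auto simp: trunc_id)
qed

text \<open>A measurable function is almost everywhere a limit of continuous ones. Truncating the
  approximants at level \<open>k\<close> does not disturb the limit, since \<open>A\<close> itself
  is bounded by \<open>k\<close>.\<close>

lemma bounded_borel_approx_continuous:
  fixes A :: "'a::euclidean_space \<Rightarrow> real"
  assumes A: "A \<in> borel_measurable borel" "\<And>x. \<bar>A x\<bar> \<le> k"
  obtains g where "\<And>n. continuous_on UNIV (g n)" "\<And>n x. \<bar>g n x\<bar> \<le> k" "AE x in lborel. (\<lambda>n. g n x) \<longlonglongrightarrow> A x"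
proof -
  have k0: "k \<ge> 0" using A(2)[of 0] by linarith
  have "A \<in> borel_measurable lebesgue" using A(1) by (simp add: measurable_completion)
  then have "A measurable_on UNIV" by (intro lebesgue_measurable_imp_measurable_on_real) auto
  then obtain N g where N: "negligible N" and g: "\<And>n. continuous_on UNIV (g n)" "\<And>x. x \<notin> N \<Longrightarrow> (\<lambda>n. g n x) \<longlonglongrightarrow> A x"
    unfolding measurable_on_def by auto
  show ?thesis
  proof (rule that[of "\<lambda>n x. trunc k (g n x)"])
    show "continuous_on UNIV (\<lambda>x. trunc k (g n x))" for n
      by (rule continuous_on_compose2[OF trunc_continuous g(1)]) auto
    show "\<bar>trunc k (g n x)\<bar> \<le> k" for n x using k0 by (rule trunc_bound)
    have "AE x in lebesgue. x \<notin> N" using N by (intro AE_not_in) (simp add: negligible_iff_null_sets)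
    then have "AE x in lborel. x \<notin> N" by (simp add: AE_completion_iff)
    then show "AE x in lborel. (\<lambda>n. trunc k (g n x)) \<longlonglongrightarrow> A x"
    proof eventually_elim
      case (elim x)
      have "(\<lambda>n. trunc k (g n x)) \<longlonglongrightarrow> trunc k (A x)"
        by (rule continuous_on_tendsto_compose[OF trunc_continuous g(2)[OF elim]]) auto
      then show ?case using A(2)[of x] by (simp add: trunc_id)
    qed
  qed
qed

text \<open>First rung of a ladder that ends with \<open>translation_pairing\<close>. For continuous
  \<open>A\<close> dominated convergence suffices; a general \<open>A\<close> is approximated by
  continuous functions in \<open>L^1\<close> of a bounded set, with an error independent of the
  translation.\<close>

lemma translation_pairing_bounded:
  fixes A B :: "'a::euclidean_space \<Rightarrow> real"
  assumes A[measurable]: "A \<in> borel_measurable borel" and Ak: "\<And>x. \<bar>A x\<bar> \<le> k"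
    and B[measurable]: "B \<in> borel_measurable borel" and Bj: "\<And>x. \<bar>B x\<bar> \<le> j" and supp: "\<And>x. x \<notin> cball 0 R \<Longrightarrow> B x = 0"
    and z: "z \<longlonglongrightarrow> 0"
  shows "(\<lambda>n. \<integral>x. A (x + z n) * B x \<partial>lborel) \<longlonglongrightarrow> (\<integral>x. A x * B x \<partial>lborel)"
proof -
  have j0: "j \<ge> 0" using Bj[of 0] by linarith
  obtain Z where Z: "\<And>n. norm (z n) \<le> Z" using z convergent_imp_Bseq[of z] by (auto simp: convergent_def Bseq_def)
  \<comment> \<open>\<open>D\<close> contains every translate by \<open>z n\<close> of the support
    of \<open>B\<close>, so \<open>A\<close> has to be approximated only there.\<close>
  define D where "D = cball (0::'a) (R + Z)"
  have Dm[measurable]: "D \<in> sets borel" by (simp add: D_def)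
  have Di: "integrable lborel (\<lambda>x. indicator D x :: real)"
    unfolding D_def using emeasure_lborel_cball_finite[of "0::'a" "R + Z"] by (simp add: integrable_indicator_iff)
  have BD: "\<bar>B x\<bar> \<le> j * indicator D (x + z n)" for x n
  proof (cases "x \<in> cball 0 R")
    case True
    then have "x + z n \<in> D" using Z[of n] norm_triangle_ineq[of x "z n"] by (simp add: D_def)
    then show ?thesis using Bj[of x] by simp
  qed (use supp j0 in \<open>simp add: indicator_def\<close>)
  have Bi: "integrable lborel B"
  proof (rule Bochner_Integration.integrable_bound[of lborel "\<lambda>x. j * indicator (cball (0::'a) R) x"])
    show "integrable lborel (\<lambda>x. j * indicator (cball (0::'a) R) x)"
      using emeasure_lborel_cball_finite[of "0::'a" R] by (simp add: integrable_indicator_iff)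
    show "AE x in lborel. norm (B x) \<le> norm (j * indicator (cball (0::'a) R) x)"
      using Bj supp j0 by (intro AE_I2) (auto simp: indicator_def)
  qed simp
  have prodi: "integrable lborel (\<lambda>x. h x * B x)" if [measurable]: "h \<in> borel_measurable borel" and "\<And>x. \<bar>h x\<bar> \<le> l" for h l
  proof (rule Bochner_Integration.integrable_bound[of lborel "\<lambda>x. l * B x"])
    show "AE x in lborel. norm (h x * B x) \<le> norm (l * B x)"
      using that(2) by (intro AE_I2) (auto simp: abs_mult intro!: mult_right_mono order_trans[OF that(2) abs_ge_self])
  qed (use Bi in auto)
  obtain g where g: "\<And>n. continuous_on UNIV (g n)" "\<And>n x. \<bar>g n x\<bar> \<le> k" "AE x in lborel. (\<lambda>n. g n x) \<longlonglongrightarrow> A x"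
    using bounded_borel_approx_continuous[OF A Ak] by blast
  have gm[measurable]: "g n \<in> borel_measurable borel" for n using g(1) by (rule continuous_borel)
  have lim: "(\<lambda>m. \<integral>x. indicator D x * \<bar>A x - g m x\<bar> \<partial>lborel) \<longlonglongrightarrow> (\<integral>x. 0 \<partial>(lborel :: 'a measure))"
  proof (rule integral_dominated_convergence[where w="\<lambda>x. (2 * k) * indicator D x"])
    show "integrable lborel (\<lambda>x. 2 * k * indicator D x)" using Di by simp
    show "AE x in lborel. norm (indicator D x * \<bar>A x - g m x\<bar>) \<le> 2 * k * indicator D x" for m
    proof (intro AE_I2)
      fix x show "norm (indicator D x * \<bar>A x - g m x\<bar>) \<le> 2 * k * indicator D x"
        using Ak[of x] g(2)[of m x] by (auto simp: indicator_def)
    qed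
    show "AE x in lborel. (\<lambda>m. indicator D x * \<bar>A x - g m x\<bar>) \<longlonglongrightarrow> 0"
      using g(3)
    proof eventually_elim
      case (elim x)
      have "(\<lambda>m. indicator D x * \<bar>A x - g m x\<bar>) \<longlonglongrightarrow> indicator D x * \<bar>A x - A x\<bar>"
        by (intro tendsto_intros elim)
      then show ?case by simp
    qed
  qed measurable
  have cmp: "\<bar>(\<integral>x. A (x + w) * B x \<partial>lborel) - (\<integral>x. g m (x + w) * B x \<partial>lborel)\<bar> \<le> j * (\<integral>x. indicator D x * \<bar>A x - g m x\<bar> \<partial>lborel)"
    if w: "\<And>x. \<bar>B x\<bar> \<le> j * indicator D (x + w)" for m w
  proof -
    have iD: "integrable lborel (\<lambda>x. indicator D x * \<bar>A x - g m x\<bar>)"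
    proof (rule Bochner_Integration.integrable_bound[of lborel "\<lambda>x. (2 * k) * indicator D x"])
      show "AE x in lborel. norm (indicator D x * \<bar>A x - g m x\<bar>) \<le> norm (2 * k * indicator D x)"
      proof (intro AE_I2)
        fix x show "norm (indicator D x * \<bar>A x - g m x\<bar>) \<le> norm (2 * k * indicator D x)"
          using Ak[of x] g(2)[of m x] by (auto simp: indicator_def)
      qed
    qed (use Di in auto)
    have "\<bar>(\<integral>x. A (x + w) * B x \<partial>lborel) - (\<integral>x. g m (x + w) * B x \<partial>lborel)\<bar> = \<bar>\<integral>x. A (x + w) * B x - g m (x + w) * B x \<partial>lborel\<bar>"
      by (subst Bochner_Integration.integral_diff) (auto intro!: prodi Ak g)
    also have "\<dots> \<le> (\<integral>x. j * (indicator D (x + w) * \<bar>A (x + w) - g m (x + w)\<bar>) \<partial>lborel)"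
    proof (rule integral_abs_bound_integral)
      show "integrable lborel (\<lambda>x. A (x + w) * B x - g m (x + w) * B x)"
        by (auto intro!: prodi Ak g Bochner_Integration.integrable_diff)
      show "integrable lborel (\<lambda>x. j * (indicator D (x + w) * \<bar>A (x + w) - g m (x + w)\<bar>))"
        using lborel_translation(1)[of "\<lambda>x. indicator D x * \<bar>A x - g m x\<bar>" w] iD by simp
      fix x
      have "\<bar>A (x + w) * B x - g m (x + w) * B x\<bar> = \<bar>B x\<bar> * \<bar>A (x + w) - g m (x + w)\<bar>"
        by (simp add: abs_mult[symmetric] algebra_simps)
      also have "\<dots> \<le> (j * indicator D (x + w)) * \<bar>A (x + w) - g m (x + w)\<bar>" by (intro mult_right_mono w) simp
      finally show "\<bar>A (x + w) * B x - g m (x + w) * B x\<bar> \<le> j * (indicator D (x + w) * \<bar>A (x + w) - g m (x + w)\<bar>)"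
        by (simp add: mult.assoc)
    qed
    also have "\<dots> = j * (\<integral>x. indicator D x * \<bar>A x - g m x\<bar> \<partial>lborel)"
      using lborel_translation(2)[of "\<lambda>x. j * (indicator D x * \<bar>A x - g m x\<bar>)" w] by simp
    finally show ?thesis .
  qed
  have BD0: "\<bar>B x\<bar> \<le> j * indicator D (x + 0)" for x
  proof (cases "x \<in> cball 0 R")
    case True
    have "Z \<ge> 0" using Z[of 0] norm_ge_zero[of "z 0"] by linarith
    then have "x \<in> D" using True by (simp add: D_def)
    then show ?thesis using Bj[of x] by simp
  qed (use supp j0 in \<open>simp add: indicator_def\<close>)
  show ?thesis
  proof (rule approx_LIMSEQ)
    fix e :: real assume e: "e > 0"
    have "(\<lambda>m. j * (\<integral>x. indicator D x * \<bar>A x - g m x\<bar> \<partial>lborel)) \<longlonglongrightarrow> j * 0"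
      using lim by (intro tendsto_intros) simp
    then have "\<forall>\<^sub>F m in sequentially. j * (\<integral>x. indicator D x * \<bar>A x - g m x\<bar> \<partial>lborel) < e"
      using e by (intro order_tendstoD(2)[where y=0]) auto
    then obtain m where m: "j * (\<integral>x. indicator D x * \<bar>A x - g m x\<bar> \<partial>lborel) < e"
      unfolding eventually_sequentially by blast
    have "(\<lambda>n. \<integral>x. g m (x + z n) * B x \<partial>lborel) \<longlonglongrightarrow> (\<integral>x. g m x * B x \<partial>lborel)"
    proof (rule integral_dominated_convergence[where w="\<lambda>x. k * \<bar>B x\<bar>"])
      show "integrable lborel (\<lambda>x. k * \<bar>B x\<bar>)" using Bi by simp
      show "AE x in lborel. (\<lambda>n. g m (x + z n) * B x) \<longlonglongrightarrow> g m x * B x"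
      proof (intro AE_I2 tendsto_mult tendsto_const)
        fix x
        have "(\<lambda>n. x + z n) \<longlonglongrightarrow> x + 0" by (intro tendsto_intros z)
        then show "(\<lambda>n. g m (x + z n)) \<longlonglongrightarrow> g m x"
          by (intro continuous_on_tendsto_compose[OF g(1)]) auto
      qed
      show "AE x in lborel. norm (g m (x + z n) * B x) \<le> k * \<bar>B x\<bar>" for n
        by (intro AE_I2) (auto simp: abs_mult intro!: mult_right_mono g(2))
    qed measurable
    moreover have "\<bar>(\<integral>x. A (x + z n) * B x \<partial>lborel) - (\<integral>x. g m (x + z n) * B x \<partial>lborel)\<bar> \<le> e" for n
      using cmp[OF BD, of n m] m by linarith
    moreover have "\<bar>(\<integral>x. A x * B x \<partial>lborel) - (\<integral>x. g m x * B x \<partial>lborel)\<bar> \<le> e"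
      using cmp[OF BD0, of m] m by simp
    ultimately show "\<exists>c c'. c \<longlonglongrightarrow> c' \<and> (\<forall>n. \<bar>(\<integral>x. A (x + z n) * B x \<partial>lborel) - c n\<bar> \<le> e) \<and> \<bar>(\<integral>x. A x * B x \<partial>lborel) - c'\<bar> \<le> e"
      by blast
  qed
qed

text \<open>Second rung: \<open>B\<close> is truncated. The error is small in \<open>L^1\<close> and
  is multiplied by the bound of \<open>A\<close>, uniformly in the translation.\<close>

lemma translation_pairing_integrable:
  fixes A B :: "'a::euclidean_space \<Rightarrow> real"
  assumes A[measurable]: "A \<in> borel_measurable borel" and Ak: "\<And>x. \<bar>A x\<bar> \<le> k"
    and B: "integrable lborel B" and supp: "\<And>x. x \<notin> cball 0 R \<Longrightarrow> B x = 0"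
    and z: "z \<longlonglongrightarrow> 0"
  shows "(\<lambda>n. \<integral>x. A (x + z n) * B x \<partial>lborel) \<longlonglongrightarrow> (\<integral>x. A x * B x \<partial>lborel)"
proof (rule approx_LIMSEQ)
  fix e :: real assume e: "e > 0"
  have [measurable]: "B \<in> borel_measurable borel" using B by auto
  have k0: "k \<ge> 0" using Ak[of 0] by linarith
  have "(\<lambda>j. \<integral>x. \<bar>B x - trunc (real j) (B x)\<bar> \<partial>lborel) \<longlonglongrightarrow> (\<integral>x. 0 \<partial>(lborel :: 'a measure))"
  proof (rule integral_dominated_convergence[where w="\<lambda>x. \<bar>B x\<bar>"])
    show "AE x in lborel. (\<lambda>j. \<bar>B x - trunc (real j) (B x)\<bar>) \<longlonglongrightarrow> 0"
    proof (rule AE_I2)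
      fix x
      have "(\<lambda>j. \<bar>B x - trunc (real j) (B x)\<bar>) \<longlonglongrightarrow> \<bar>B x - B x\<bar>" by (intro tendsto_intros trunc_tendsto)
      then show "(\<lambda>j. \<bar>B x - trunc (real j) (B x)\<bar>) \<longlonglongrightarrow> 0" by simp
    qed
  qed (use B in \<open>auto simp: trunc_diff_le\<close>)
  then have "(\<lambda>j. k * (\<integral>x. \<bar>B x - trunc (real j) (B x)\<bar> \<partial>lborel)) \<longlonglongrightarrow> k * 0"
    by (intro tendsto_intros) simp
  then have "\<forall>\<^sub>F j in sequentially. k * (\<integral>x. \<bar>B x - trunc (real j) (B x)\<bar> \<partial>lborel) < e"
    using e by (intro order_tendstoD(2)[where y=0]) auto
  then obtain j where j: "k * (\<integral>x. \<bar>B x - trunc (real j) (B x)\<bar> \<partial>lborel) < e"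
    unfolding eventually_sequentially by blast
  define C where "C x = trunc (real j) (B x)" for x
  have [measurable]: "C \<in> borel_measurable borel" unfolding C_def[abs_def] by measurable
  have Ci: "integrable lborel C"
    by (rule Bochner_Integration.integrable_bound[OF B]) (auto simp: C_def trunc_le)
  have prodi: "integrable lborel (\<lambda>x. A (x + w) * h x)" if h: "integrable lborel h" for h w
  proof (rule Bochner_Integration.integrable_bound[of lborel "\<lambda>x. k * h x"])
    have [measurable]: "h \<in> borel_measurable borel" using h by auto
    show "(\<lambda>x. A (x + w) * h x) \<in> borel_measurable lborel" by measurable
    show "AE x in lborel. norm (A (x + w) * h x) \<le> norm (k * h x)"
      using Ak k0 by (intro AE_I2) (auto simp: abs_mult intro!: mult_right_mono)
  qed (use h in auto)
  have cmp: "\<bar>(\<integral>x. A (x + w) * B x \<partial>lborel) - (\<integral>x. A (x + w) * C x \<partial>lborel)\<bar> \<le> e" for w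
  proof -
    have "\<bar>(\<integral>x. A (x + w) * B x \<partial>lborel) - (\<integral>x. A (x + w) * C x \<partial>lborel)\<bar> = \<bar>\<integral>x. A (x + w) * B x - A (x + w) * C x \<partial>lborel\<bar>"
      using prodi[OF B] prodi[OF Ci] by simp
    also have "\<dots> \<le> (\<integral>x. k * \<bar>B x - C x\<bar> \<partial>lborel)"
    proof (rule integral_abs_bound_integral)
      show "integrable lborel (\<lambda>x. A (x + w) * B x - A (x + w) * C x)" using prodi[OF B] prodi[OF Ci] by simp
      show "integrable lborel (\<lambda>x. k * \<bar>B x - C x\<bar>)" using B Ci by simp
      fix x show "\<bar>A (x + w) * B x - A (x + w) * C x\<bar> \<le> k * \<bar>B x - C x\<bar>"
        by (simp add: abs_mult right_diff_distrib[symmetric] mult_right_mono Ak)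
    qed
    also have "\<dots> \<le> e" using j by (simp add: C_def)
    finally show ?thesis .
  qed
  have "(\<lambda>n. \<integral>x. A (x + z n) * C x \<partial>lborel) \<longlonglongrightarrow> (\<integral>x. A x * C x \<partial>lborel)"
    by (rule translation_pairing_bounded[where k=k and j="real j" and R=R])
      (use Ak z supp in \<open>auto simp: C_def trunc_bound\<close>)
  then show "\<exists>c c'. c \<longlonglongrightarrow> c' \<and> (\<forall>n. \<bar>(\<integral>x. A (x + z n) * B x \<partial>lborel) - c n\<bar> \<le> e) \<and> \<bar>(\<integral>x. A x * B x \<partial>lborel) - c'\<bar> \<le> e"
    using cmp[of "z _"] cmp[of 0] by auto
qed

lemma powr_le_one_plus: "0 \<le> a \<Longrightarrow> 1 \<le> p \<Longrightarrow> a \<le> 1 + a powr p" for a p :: real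
proof (cases "a \<le> 1")
  case False
  assume "1 \<le> p"
  then have "a powr 1 \<le> a powr p" using False by (intro powr_mono) auto
  then show ?thesis using False by simp
qed (auto intro: add_increasing2)

text \<open>In the pairings below \<open>q\<close> belongs to the translated factor and
  \<open>p\<close> to the fixed one.\<close>

locale conjugate_exponents =
  fixes p q :: real
  assumes pq: "p > 1" "q > 1" "1/p + 1/q = 1"
begin

lemma young: assumes "0 \<le> a" "0 \<le> b" shows "a * b \<le> a powr q + b powr p"
proof -
  have "a * b \<le> a powr q / q + b powr p / p"
    using Youngs_inequality[of q p a b] pq assms by (simp add: add.commute)
  moreover have "a powr q / q \<le> a powr q" "b powr p / p \<le> b powr p"
    using pq by (auto simp: divide_le_eq mult_le_cancel_left1)
  ultimately show ?thesis by linarith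
qed

text \<open>Young's inequality with a free weight: a small \<eta> tames the factor whose norm is
  merely bounded, while the large power of \<open>1/\<eta>\<close> falls on the factor that can be
  made small.\<close>

lemma young_eps: assumes "0 \<le> a" "0 \<le> b" "\<eta> > 0" shows "a * b \<le> (1/\<eta>) powr q * a powr q + \<eta> powr p * b powr p"
  using young[of "1/\<eta> * a" "\<eta> * b"] assms by (simp add: powr_mult powr_divide)

lemma integrable_pairing:
  fixes A B :: "'a \<Rightarrow> 'b::euclidean_space"
  assumes [measurable]: "A \<in> borel_measurable M" "B \<in> borel_measurable M"
    and Aq: "integrable M (\<lambda>x. norm (A x) powr q)" and Bp: "integrable M (\<lambda>x. norm (B x) powr p)"
  shows "integrable M (\<lambda>x. inner (A x) (B x))"
proof (rule Bochner_Integration.integrable_bound[of M "\<lambda>x. norm (A x) powr q + norm (B x) powr p"])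
  show "AE x in M. norm (A x \<bullet> B x) \<le> norm (norm (A x) powr q + norm (B x) powr p)"
  proof (rule AE_I2)
    fix x
    have "norm (A x \<bullet> B x) \<le> norm (A x) * norm (B x)" using Cauchy_Schwarz_ineq2[of "A x" "B x"] by simp
    also have "\<dots> \<le> norm (A x) powr q + norm (B x) powr p" by (rule young) auto
    finally show "norm (A x \<bullet> B x) \<le> norm (norm (A x) powr q + norm (B x) powr p)" by simp
  qed
qed (use Aq Bp in auto)

text \<open>Third rung: now \<open>A\<close> is truncated, with an error in \<open>L^q\<close>. The
  bounded support makes \<open>B\<close> integrable, as the second rung requires.\<close>

lemma translation_pairing_real:
  fixes A B :: "'a::euclidean_space \<Rightarrow> real"
  assumes A[measurable]: "A \<in> borel_measurable borel" and Aq: "integrable lborel (\<lambda>x. \<bar>A x\<bar> powr q)"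
    and B[measurable]: "B \<in> borel_measurable borel" and Bp: "integrable lborel (\<lambda>x. \<bar>B x\<bar> powr p)"
    and supp: "\<And>x. x \<notin> cball 0 R \<Longrightarrow> B x = 0" and z: "z \<longlonglongrightarrow> 0"
  shows "(\<lambda>n. \<integral>x. A (x + z n) * B x \<partial>lborel) \<longlonglongrightarrow> (\<integral>x. A x * B x \<partial>lborel)"
proof (rule approx_LIMSEQ)
  fix e :: real assume e: "e > 0"
  have B1: "integrable lborel B"
  proof (rule Bochner_Integration.integrable_bound[of lborel "\<lambda>x. indicator (cball (0::'a) R) x + \<bar>B x\<bar> powr p"])
    show "integrable lborel (\<lambda>x. indicator (cball (0::'a) R) x + \<bar>B x\<bar> powr p)"
      using Bp emeasure_lborel_cball_finite[of "0::'a" R] by (simp add: integrable_indicator_iff)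
    show "AE x in lborel. norm (B x) \<le> norm (indicator (cball 0 R) x + \<bar>B x\<bar> powr p)"
    proof (rule AE_I2)
      fix x show "norm (B x) \<le> norm (indicator (cball 0 R) x + \<bar>B x\<bar> powr p)"
        using powr_le_one_plus[of "\<bar>B x\<bar>" p] pq supp[of x] by (auto simp: indicator_def)
    qed
  qed simp
  define Ib where "Ib = (\<integral>x. \<bar>B x\<bar> powr p \<partial>lborel)"
  have Ib0: "Ib \<ge> 0" by (simp add: Ib_def)
  \<comment> \<open>Chosen so that \<open>\<eta> powr p * (Ib + 1) = e / 2\<close>; the added 1
    covers \<open>Ib = 0\<close>.\<close>
  define \<eta> where "\<eta> = (e / (2 * (Ib + 1))) powr (1/p)"
  have \<eta>: "\<eta> > 0" using e Ib0 by (simp add: \<eta>_def)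
  have "\<eta> powr p = e / (2 * (Ib + 1))" using pq e Ib0 by (simp add: \<eta>_def powr_powr)
  then have "\<eta> powr p * (Ib + 1) = e / 2" using Ib0 by (simp add: field_simps)
  then have \<eta>e: "\<eta> powr p * Ib \<le> e / 2"
    using mult_left_mono[of Ib "Ib + 1" "\<eta> powr p"] by simp
  have "(\<lambda>k. \<integral>x. \<bar>A x - trunc (real k) (A x)\<bar> powr q \<partial>lborel) \<longlonglongrightarrow> (\<integral>x. 0 \<partial>(lborel :: 'a measure))"
  proof (rule integral_dominated_convergence[where w="\<lambda>x. \<bar>A x\<bar> powr q"])
    show "AE x in lborel. (\<lambda>k. \<bar>A x - trunc (real k) (A x)\<bar> powr q) \<longlonglongrightarrow> 0"
    proof (rule AE_I2)
      fix x
      have "(\<lambda>j. \<bar>A x - trunc (real j) (A x)\<bar>) \<longlonglongrightarrow> \<bar>A x - A x\<bar>" by (intro tendsto_intros trunc_tendsto)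
      then have "(\<lambda>j. \<bar>A x - trunc (real j) (A x)\<bar> powr q) \<longlonglongrightarrow> 0 powr q"
        using pq by (intro tendsto_powr2) auto
      then show "(\<lambda>j. \<bar>A x - trunc (real j) (A x)\<bar> powr q) \<longlonglongrightarrow> 0" by simp
    qed
    show "AE x in lborel. norm (\<bar>A x - trunc (real k) (A x)\<bar> powr q) \<le> \<bar>A x\<bar> powr q" for k
      using pq by (intro AE_I2) (auto intro!: powr_mono2 trunc_diff_le)
  qed (use Aq in auto)
  then have "(\<lambda>k. (1/\<eta>) powr q * (\<integral>x. \<bar>A x - trunc (real k) (A x)\<bar> powr q \<partial>lborel)) \<longlonglongrightarrow> (1/\<eta>) powr q * 0"
    by (intro tendsto_intros) simp
  then have "\<forall>\<^sub>F k in sequentially. (1/\<eta>) powr q * (\<integral>x. \<bar>A x - trunc (real k) (A x)\<bar> powr q \<partial>lborel) < e / 2"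
    using e by (intro order_tendstoD(2)[where y=0]) auto
  then obtain k where k: "(1/\<eta>) powr q * (\<integral>x. \<bar>A x - trunc (real k) (A x)\<bar> powr q \<partial>lborel) < e / 2"
    unfolding eventually_sequentially by blast
  define C where "C x = trunc (real k) (A x)" for x
  have Cm[measurable]: "C \<in> borel_measurable borel" unfolding C_def[abs_def] by measurable
  have Cq: "integrable lborel (\<lambda>x. \<bar>C x\<bar> powr q)"
    by (rule Bochner_Integration.integrable_bound[OF Aq]) (use pq in \<open>auto simp: C_def intro!: powr_mono2 trunc_le\<close>)
  have Dq: "integrable lborel (\<lambda>x. \<bar>A x - C x\<bar> powr q)"
    by (rule Bochner_Integration.integrable_bound[OF Aq]) (use pq in \<open>auto simp: C_def intro!: powr_mono2 trunc_diff_le\<close>)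
  have prodi: "integrable lborel (\<lambda>x. h (x + w) * B x)" if [measurable]: "h \<in> borel_measurable borel" and h: "integrable lborel (\<lambda>x. \<bar>h x\<bar> powr q)" for h w
    using integrable_pairing[of "\<lambda>x. h (x + w)" lborel B] Bp lborel_translation(1)[of "\<lambda>x. \<bar>h x\<bar> powr q" w] h by simp
  have cmp: "\<bar>(\<integral>x. A (x + w) * B x \<partial>lborel) - (\<integral>x. C (x + w) * B x \<partial>lborel)\<bar> \<le> e" for w
  proof -
    have tD: "integrable lborel (\<lambda>x. \<bar>A (x + w) - C (x + w)\<bar> powr q)"
      using lborel_translation(1)[of "\<lambda>x. \<bar>A x - C x\<bar> powr q" w] Dq by simp
    have "\<bar>(\<integral>x. A (x + w) * B x \<partial>lborel) - (\<integral>x. C (x + w) * B x \<partial>lborel)\<bar> = \<bar>\<integral>x. A (x + w) * B x - C (x + w) * B x \<partial>lborel\<bar>"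
      using prodi[OF A Aq] prodi[OF Cm Cq] by simp
    also have "\<dots> \<le> (\<integral>x. (1/\<eta>) powr q * \<bar>A (x + w) - C (x + w)\<bar> powr q + \<eta> powr p * \<bar>B x\<bar> powr p \<partial>lborel)"
    proof (rule integral_abs_bound_integral)
      show "integrable lborel (\<lambda>x. A (x + w) * B x - C (x + w) * B x)" using prodi[OF A Aq] prodi[OF Cm Cq] by simp
      show "integrable lborel (\<lambda>x. (1/\<eta>) powr q * \<bar>A (x + w) - C (x + w)\<bar> powr q + \<eta> powr p * \<bar>B x\<bar> powr p)"
        using tD Bp by simp
      fix x
      have "\<bar>A (x + w) * B x - C (x + w) * B x\<bar> = \<bar>A (x + w) - C (x + w)\<bar> * \<bar>B x\<bar>"
        by (simp add: abs_mult[symmetric] algebra_simps)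
      also have "\<dots> \<le> (1/\<eta>) powr q * \<bar>A (x + w) - C (x + w)\<bar> powr q + \<eta> powr p * \<bar>B x\<bar> powr p"
        by (rule young_eps) (use \<eta> in auto)
      finally show "\<bar>A (x + w) * B x - C (x + w) * B x\<bar> \<le> (1/\<eta>) powr q * \<bar>A (x + w) - C (x + w)\<bar> powr q + \<eta> powr p * \<bar>B x\<bar> powr p" .
    qed
    also have "\<dots> = (1/\<eta>) powr q * (\<integral>x. \<bar>A (x + w) - C (x + w)\<bar> powr q \<partial>lborel) + \<eta> powr p * Ib"
      using tD Bp by (simp add: Ib_def)
    also have "(\<integral>x. \<bar>A (x + w) - C (x + w)\<bar> powr q \<partial>lborel) = (\<integral>x. \<bar>A x - C x\<bar> powr q \<partial>lborel)"
      using lborel_translation(2)[of "\<lambda>x. \<bar>A x - C x\<bar> powr q" w] by simp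
    also have "(1/\<eta>) powr q * \<dots> + \<eta> powr p * Ib \<le> e" using k \<eta>e by (simp add: C_def)
    finally show ?thesis .
  qed
  have "(\<lambda>n. \<integral>x. C (x + z n) * B x \<partial>lborel) \<longlonglongrightarrow> (\<integral>x. C x * B x \<partial>lborel)"
    by (rule translation_pairing_integrable[where k="real k" and R=R])
      (use B1 z supp in \<open>auto simp: C_def trunc_bound\<close>)
  then show "\<exists>c c'. c \<longlonglongrightarrow> c' \<and> (\<forall>n. \<bar>(\<integral>x. A (x + z n) * B x \<partial>lborel) - c n\<bar> \<le> e) \<and> \<bar>(\<integral>x. A x * B x \<partial>lborel) - c'\<bar> \<le> e"
    using cmp[of "z _"] cmp[of 0] by auto
qed

lemma translation_pairing:
  fixes A B :: "'a::euclidean_space \<Rightarrow> 'b::euclidean_space"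
  assumes A[measurable]: "A \<in> borel_measurable borel" and Aq: "integrable lborel (\<lambda>x. norm (A x) powr q)"
    and B[measurable]: "B \<in> borel_measurable borel" and Bp: "integrable lborel (\<lambda>x. norm (B x) powr p)"
    and supp: "\<And>x. x \<notin> cball 0 R \<Longrightarrow> B x = 0" and z: "z \<longlonglongrightarrow> 0"
  shows "(\<lambda>n. \<integral>x. inner (A (x + z n)) (B x) \<partial>lborel) \<longlonglongrightarrow> (\<integral>x. inner (A x) (B x) \<partial>lborel)"
proof -
  have Ab: "integrable lborel (\<lambda>x. \<bar>A x \<bullet> b\<bar> powr q)" if "b \<in> Basis" for b
    by (rule Bochner_Integration.integrable_bound[OF Aq]) (use pq that in \<open>auto intro!: powr_mono2 Basis_le_norm\<close>)
  have Bb: "integrable lborel (\<lambda>x. \<bar>B x \<bullet> b\<bar> powr p)" if "b \<in> Basis" for b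
    by (rule Bochner_Integration.integrable_bound[OF Bp]) (use pq that in \<open>auto intro!: powr_mono2 Basis_le_norm\<close>)
  have i: "integrable lborel (\<lambda>x. (A (x + w) \<bullet> b) * (B x \<bullet> b))" if "b \<in> Basis" for b w
    using integrable_pairing[of "\<lambda>x. A (x + w) \<bullet> b" lborel "\<lambda>x. B x \<bullet> b"] Bb[OF that] Ab[OF that]
      lborel_translation(1)[of "\<lambda>x. \<bar>A x \<bullet> b\<bar> powr q" w] by simp
  have eq: "(\<integral>x. inner (A (x + w)) (B x) \<partial>lborel) = (\<Sum>b\<in>Basis. \<integral>x. (A (x + w) \<bullet> b) * (B x \<bullet> b) \<partial>lborel)" for w
    by (subst euclidean_inner) (rule Bochner_Integration.integral_sum, rule i)
  have "(\<lambda>n. \<Sum>b\<in>Basis. \<integral>x. (A (x + z n) \<bullet> b) * (B x \<bullet> b) \<partial>lborel) \<longlonglongrightarrow> (\<Sum>b\<in>Basis. \<integral>x. (A x \<bullet> b) * (B x \<bullet> b) \<partial>lborel)"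
    by (intro tendsto_sum translation_pairing_real[of "\<lambda>x. A x \<bullet> _" "\<lambda>x. B x \<bullet> _" R] Ab Bb z) (auto simp: supp)
  then show ?thesis using eq[of 0] by (simp add: eq)
qed

end

section \<open>Borel representatives\<close>

text \<open>A slice of a Lebesgue measurable function of several variables need not be measurable,
  whereas Fubini is used throughout for products of \<open>lborel\<close>. Extension by zero lets
  all integrals run over the whole space.\<close>

lemma borel_representative:
  fixes f :: "'a::euclidean_space \<Rightarrow> 'b::euclidean_space"
  assumes S: "S \<in> sets borel" and f: "f \<in> borel_measurable (lebesgue_on S)"
  obtains g where "g \<in> borel_measurable borel" "\<And>x. x \<notin> S \<Longrightarrow> g x = 0" "AE x in lborel. x \<in> S \<longrightarrow> g x = f x"
proof -
  let ?h = "\<lambda>x. if x \<in> S then f x else 0"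
  have h: "?h \<in> borel_measurable lebesgue" using S f by (intro borel_measurable_if_I) auto
  have "\<exists>k\<in>borel_measurable lborel. AE x in lborel. ?h x \<bullet> b = k x" for b
    by (rule completion_ex_borel_measurable_real) (use h in measurable)
  then obtain k where k: "\<And>b. k b \<in> borel_measurable lborel" "\<And>b. AE x in lborel. ?h x \<bullet> b = k b x" by metis
  define g where "g x = (if x \<in> S then \<Sum>b\<in>Basis. k b x *\<^sub>R b else 0)" for x
  have km: "k b \<in> borel_measurable borel" for b using k(1)[of b] by simp
  have "(\<lambda>x. \<Sum>b\<in>Basis. k b x *\<^sub>R b) \<in> borel_measurable borel"
    using km by (intro borel_measurable_sum borel_measurable_scaleR) auto
  then have gm: "g \<in> borel_measurable borel"
    unfolding g_def[abs_def] using S by (intro measurable_If_set) auto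
  have "AE x in lborel. \<forall>b\<in>Basis. ?h x \<bullet> b = k b x" using k(2) by (intro AE_finite_allI) auto
  then have "AE x in lborel. x \<in> S \<longrightarrow> g x = f x"
  proof eventually_elim
    case (elim x)
    show ?case
    proof
      assume "x \<in> S"
      then have "g x = (\<Sum>b\<in>Basis. (f x \<bullet> b) *\<^sub>R b)" using elim by (simp add: g_def)
      then show "g x = f x" by (simp add: euclidean_representation)
    qed
  qed
  then show ?thesis using gm by (intro that[of g]) (auto simp: g_def)
qed

text \<open>The bridge between the integrals of the definitions, over restricted Lebesgue measure,
  and those of Borel representatives.\<close>

lemma lebesgue_on_eq_lborel:
  fixes g h :: "'a::euclidean_space \<Rightarrow> 'b::euclidean_space"
  assumes S: "S \<in> sets borel" and g: "g \<in> borel_measurable borel" "\<And>x. x \<notin> S \<Longrightarrow> g x = 0"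
    and h: "h \<in> borel_measurable (lebesgue_on S)" and ae: "AE x in lborel. x \<in> S \<longrightarrow> g x = h x"
  shows "integrable (lebesgue_on S) h \<longleftrightarrow> integrable lborel g"
    and "integral\<^sup>L (lebesgue_on S) h = integral\<^sup>L lborel g"
proof -
  have m: "(\<lambda>x. indicator S x *\<^sub>R h x) \<in> borel_measurable lebesgue"
  proof -
    have "(\<lambda>x. if x \<in> S then h x else 0) \<in> borel_measurable lebesgue" using S h by (intro borel_measurable_if_I) auto
    moreover have "(\<lambda>x. if x \<in> S then h x else 0) = (\<lambda>x. indicator S x *\<^sub>R h x)" by (auto simp: indicator_def)
    ultimately show ?thesis by simp
  qed
  have gm: "g \<in> borel_measurable lebesgue" using g(1) by (simp add: measurable_completion)
  have "AE x in lborel. indicator S x *\<^sub>R h x = g x" using ae by eventually_elim (auto simp: indicator_def g(2))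
  then have ae': "AE x in lebesgue. indicator S x *\<^sub>R h x = g x" by (rule AE_completion)
  have "integrable (lebesgue_on S) h \<longleftrightarrow> integrable lebesgue (\<lambda>x. indicator S x *\<^sub>R h x)"
    using S by (intro integrable_restrict_space) auto
  also have "\<dots> \<longleftrightarrow> integrable lebesgue g" by (rule integrable_cong_AE[OF m gm ae'])
  also have "\<dots> \<longleftrightarrow> integrable lborel g" using g(1) by (intro integrable_completion) simp
  finally show "integrable (lebesgue_on S) h \<longleftrightarrow> integrable lborel g" .
  have "integral\<^sup>L (lebesgue_on S) h = integral\<^sup>L lebesgue (\<lambda>x. indicator S x *\<^sub>R h x)"
    using S by (intro integral_restrict_space) auto
  also have "\<dots> = integral\<^sup>L lebesgue g" by (rule integral_cong_AE[OF m gm ae'])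
  also have "\<dots> = integral\<^sup>L lborel g" using g(1) by (intro integral_completion) simp
  finally show "integral\<^sup>L (lebesgue_on S) h = integral\<^sup>L lborel g" .
qed

section \<open>Pairings lagged in time\<close>

context conjugate_exponents
begin

text \<open>What the weak formulation produces when it is integrated over the past window (r - h, r)
  with the present value \<open>B (r, _)\<close> as test field.\<close>

definition lagged_pairing :: "(real \<times> 'c::euclidean_space \<Rightarrow> 'b::euclidean_space) \<Rightarrow> (real \<times> 'c \<Rightarrow> 'b) \<Rightarrow> real \<Rightarrow> real \<Rightarrow> real" where
  "lagged_pairing A B h r = (\<integral>\<tau>. (if r - h < \<tau> \<and> \<tau> < r then (\<integral>x. inner (A (\<tau>, x)) (B (r, x)) \<partial>lborel) else 0) \<partial>lborel)"

text \<open>Young's inequality dominates the integrand by the \<open>q\<close>-th power of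
  \<open>A\<close> plus the \<open>p\<close>-th power of the slice of \<open>B\<close>; the latter
  does not depend on \<tau> but counts only during a window of finite length.\<close>

lemma lagged_slice_integrable:
  fixes A B :: "real \<times> 'c::euclidean_space \<Rightarrow> 'b::euclidean_space"
  assumes A[measurable]: "A \<in> borel_measurable borel" and Aq: "integrable lborel (\<lambda>x. norm (A x) powr q)"
    and B[measurable]: "B \<in> borel_measurable borel" and Br: "integrable lborel (\<lambda>x. norm (B (r, x)) powr p)"
    and h: "h > 0"
  shows "integrable (lborel \<Otimes>\<^sub>M lborel) (\<lambda>(\<tau>, x). if r - h < \<tau> \<and> \<tau> < r then inner (A (\<tau>, x)) (B (r, x)) else 0)"
proof -
  have Aq': "integrable (lborel \<Otimes>\<^sub>M lborel) (\<lambda>x. norm (A x) powr q)" using Aq by (simp add: lborel_prod)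
  have aeA: "AE \<tau> in lborel. integrable lborel (\<lambda>x. norm (A (\<tau>, x)) powr q)" by (rule lborel_pair.AE_integrable_fst'[OF Aq'])
  have Aint: "integrable lborel (\<lambda>\<tau>. \<integral>x. norm (A (\<tau>, x)) powr q \<partial>lborel)" by (rule lborel_pair.integrable_fst'[OF Aq'])
  define V where "V \<tau> x = (if r - h < \<tau> \<and> \<tau> < r then inner (A (\<tau>, x)) (B (r, x)) else 0)" for \<tau> x
  have Vm[measurable]: "case_prod V \<in> borel_measurable (lborel \<Otimes>\<^sub>M lborel)"
    unfolding V_def[abs_def] by measurable
  define b where "b = (\<integral>x. norm (B (r, x)) powr p \<partial>lborel)"
  have Vi: "AE \<tau> in lborel. integrable lborel (V \<tau>) \<and> (\<integral>x. norm (V \<tau> x) \<partial>lborel) \<le> (\<integral>x. norm (A (\<tau>, x)) powr q \<partial>lborel) + b * indicator {r - h<..<r} \<tau>"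
    using aeA
  proof eventually_elim
    fix \<tau> assume a: "integrable lborel (\<lambda>x. norm (A (\<tau>, x)) powr q)"
    have i: "integrable lborel (\<lambda>x. inner (A (\<tau>, x)) (B (r, x)))"
      using integrable_pairing[of "\<lambda>x. A (\<tau>, x)" lborel "\<lambda>x. B (r, x)"] a Br by simp
    then have 1: "integrable lborel (V \<tau>)" by (cases "r - h < \<tau> \<and> \<tau> < r") (auto simp: V_def[abs_def])
    have "(\<integral>x. norm (V \<tau> x) \<partial>lborel) \<le> (\<integral>x. norm (A (\<tau>, x)) powr q + norm (B (r, x)) powr p * indicator {r - h<..<r} \<tau> \<partial>lborel)"
    proof (rule integral_mono)
      show "integrable lborel (\<lambda>x. norm (V \<tau> x))" using 1 by simp
      show "integrable lborel (\<lambda>x. norm (A (\<tau>, x)) powr q + norm (B (r, x)) powr p * indicator {r - h<..<r} \<tau>)" using a Br by simp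
      fix x
      have "\<bar>A (\<tau>, x) \<bullet> B (r, x)\<bar> \<le> norm (A (\<tau>, x)) * norm (B (r, x))" by (rule Cauchy_Schwarz_ineq2)
      also have "\<dots> \<le> norm (A (\<tau>, x)) powr q + norm (B (r, x)) powr p" by (rule young) auto
      finally show "norm (V \<tau> x) \<le> norm (A (\<tau>, x)) powr q + norm (B (r, x)) powr p * indicator {r - h<..<r} \<tau>"
        by (auto simp: V_def)
    qed
    also have "\<dots> = (\<integral>x. norm (A (\<tau>, x)) powr q \<partial>lborel) + b * indicator {r - h<..<r} \<tau>"
      using a Br by (simp add: b_def)
    finally show "integrable lborel (V \<tau>) \<and> (\<integral>x. norm (V \<tau> x) \<partial>lborel) \<le> (\<integral>x. norm (A (\<tau>, x)) powr q \<partial>lborel) + b * indicator {r - h<..<r} \<tau>"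
      using 1 by simp
  qed
  have VI: "integrable (lborel \<Otimes>\<^sub>M lborel) (case_prod V)"
  proof (rule lborel_pair.Fubini_integrable[OF Vm])
    show "integrable lborel (\<lambda>\<tau>. \<integral>x. norm (case (\<tau>, x) of (\<tau>, x) \<Rightarrow> V \<tau> x) \<partial>lborel)"
    proof (rule Bochner_Integration.integrable_bound[of lborel "\<lambda>\<tau>. (\<integral>x. norm (A (\<tau>, x)) powr q \<partial>lborel) + b * indicator {r - h<..<r} \<tau>"])
      show "integrable lborel (\<lambda>\<tau>. (\<integral>x. norm (A (\<tau>, x)) powr q \<partial>lborel) + b * indicator {r - h<..<r} \<tau>)"
        using Aint h by (simp add: integrable_indicator_iff)
      show "(\<lambda>\<tau>. \<integral>x. norm (case (\<tau>, x) of (\<tau>, x) \<Rightarrow> V \<tau> x) \<partial>lborel) \<in> borel_measurable lborel" by measurable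
      show "AE \<tau> in lborel. norm (\<integral>x. norm (case (\<tau>, x) of (\<tau>, x) \<Rightarrow> V \<tau> x) \<partial>lborel) \<le> norm ((\<integral>x. norm (A (\<tau>, x)) powr q \<partial>lborel) + b * indicator {r - h<..<r} \<tau>)"
        using Vi by eventually_elim (auto intro: order_trans[OF _ abs_ge_self])
    qed
    show "AE \<tau> in lborel. integrable lborel (\<lambda>x. case (\<tau>, x) of (\<tau>, x) \<Rightarrow> V \<tau> x)" using Vi by eventually_elim simp
  qed
  then show ?thesis by (simp add: V_def[abs_def])
qed

text \<open>The substitution \<tau> = r - s turns the lag into a translation in time: integration
  over \<open>r\<close> gives the space-time pairing of \<open>B\<close> with \<open>A\<close>
  shifted by \<open>s\<close>, integrated over the lag \<open>s\<close> in (0, h).\<close>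

lemma lagged_pairing_integral:
  fixes A B :: "real \<times> 'c::euclidean_space \<Rightarrow> 'b::euclidean_space"
  assumes A[measurable]: "A \<in> borel_measurable borel" and Aq: "integrable lborel (\<lambda>x. norm (A x) powr q)"
    and B[measurable]: "B \<in> borel_measurable borel" and Bp: "integrable lborel (\<lambda>x. norm (B x) powr p)"
    and h: "h > 0"
  shows "integrable lborel (lagged_pairing A B h)"
    and "integral\<^sup>L lborel (lagged_pairing A B h) = (\<integral>s. indicator {0<..<h} s * (\<integral>z. inner (A (z + (- s, 0))) (B z) \<partial>lborel) \<partial>lborel)"
    and "integrable lborel (\<lambda>s. indicator {0<..<h} s * (\<integral>z. inner (A (z + (- s, 0))) (B z) \<partial>lborel))"
proof -
  \<comment> \<open>The integrand as a function of the lag and of the space-time point; its double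
    integral is evaluated in both orders.\<close>
  define W where "W s z = indicator {0<..<h} s * inner (A (z + (- s, 0))) (B z)" for s :: real and z :: "real \<times> 'c"
  define Ia where "Ia = (\<integral>z. norm (A z) powr q \<partial>lborel)"
  define Ib where "Ib = (\<integral>z. norm (B z) powr p \<partial>lborel)"
  have tq: "integrable lborel (\<lambda>z. norm (A (z + w)) powr q)" "(\<integral>z. norm (A (z + w)) powr q \<partial>lborel) = Ia" for w
    using lborel_translation[of "\<lambda>z. norm (A z) powr q" w] Aq by (auto simp: Ia_def)
  have Wm[measurable]: "case_prod W \<in> borel_measurable (lborel \<Otimes>\<^sub>M lborel)"
    unfolding W_def[abs_def] by measurable
  have Wi: "integrable lborel (W s)" for s
    unfolding W_def using integrable_pairing[of "\<lambda>z. A (z + (- s, 0))" lborel B] tq[of "(-s, 0)"] Bp by simp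
  have Wb: "(\<integral>z. norm (W s z) \<partial>lborel) \<le> (Ia + Ib) * indicator {0<..<h} s" for s
  proof -
    have "(\<integral>z. norm (W s z) \<partial>lborel) \<le> (\<integral>z. (norm (A (z + (- s, 0))) powr q + norm (B z) powr p) * indicator {0<..<h} s \<partial>lborel)"
    proof (rule integral_mono)
      show "integrable lborel (\<lambda>z. norm (W s z))" using Wi by simp
      show "integrable lborel (\<lambda>z. (norm (A (z + (- s, 0))) powr q + norm (B z) powr p) * indicator {0<..<h} s)"
        using tq[of "(-s, 0)"] Bp by simp
      fix z
      have "\<bar>A (z + (- s, 0)) \<bullet> B z\<bar> \<le> norm (A (z + (- s, 0))) * norm (B z)" by (rule Cauchy_Schwarz_ineq2)
      also have "\<dots> \<le> norm (A (z + (- s, 0))) powr q + norm (B z) powr p" by (rule young) auto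
      finally show "norm (W s z) \<le> (norm (A (z + (- s, 0))) powr q + norm (B z) powr p) * indicator {0<..<h} s"
        by (auto simp: W_def indicator_def)
    qed
    also have "\<dots> = (Ia + Ib) * indicator {0<..<h} s"
      using tq[of "(-s, 0)"] Bp by (simp add: Ib_def)
    finally show ?thesis .
  qed
  have ind: "integrable lborel (\<lambda>s. indicator {0<..<h} s :: real)" using h by (simp add: integrable_indicator_iff)
  have WI: "integrable (lborel \<Otimes>\<^sub>M lborel) (case_prod W)"
  proof (rule lborel_pair.Fubini_integrable[OF Wm])
    show "integrable lborel (\<lambda>s. \<integral>z. norm (case (s, z) of (s, z) \<Rightarrow> W s z) \<partial>lborel)"
    proof (rule Bochner_Integration.integrable_bound[of lborel "\<lambda>s. (Ia + Ib) * indicator {0<..<h} s"])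
      show "integrable lborel (\<lambda>s. (Ia + Ib) * indicator {0<..<h} s)" using ind by simp
      show "(\<lambda>s. \<integral>z. norm (case (s, z) of (s, z) \<Rightarrow> W s z) \<partial>lborel) \<in> borel_measurable lborel"
        by measurable
      show "AE s in lborel. norm (\<integral>z. norm (case (s, z) of (s, z) \<Rightarrow> W s z) \<partial>lborel) \<le> norm ((Ia + Ib) * indicator {0<..<h} s)"
        using Wb by (intro AE_I2) (auto intro: order_trans[OF _ abs_ge_self])
    qed
    show "AE s in lborel. integrable lborel (\<lambda>z. case (s, z) of (s, z) \<Rightarrow> W s z)" using Wi by simp
  qed
  define g where "g z = (\<integral>s. W s z \<partial>lborel)" for z
  have gi: "integrable lborel g" unfolding g_def[abs_def] by (rule lborel_pair.integrable_snd[OF WI])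
  have Weq: "(\<integral>z. W s z \<partial>lborel) = indicator {0<..<h} s * (\<integral>z. inner (A (z + (- s, 0))) (B z) \<partial>lborel)" for s
    unfolding W_def by simp
  have "integral\<^sup>L lborel g = integral\<^sup>L (lborel \<Otimes>\<^sub>M lborel) (case_prod W)"
    unfolding g_def[abs_def] by (rule lborel_pair.integral_snd[OF WI])
  also have "\<dots> = (\<integral>s. \<integral>z. W s z \<partial>lborel \<partial>lborel)" by (rule lborel_pair.integral_fst[OF WI, symmetric])
  finally have g1: "integral\<^sup>L lborel g = (\<integral>s. indicator {0<..<h} s * (\<integral>z. inner (A (z + (- s, 0))) (B z) \<partial>lborel) \<partial>lborel)"
    by (simp only: Weq)
  show "integrable lborel (\<lambda>s. indicator {0<..<h} s * (\<integral>z. inner (A (z + (- s, 0))) (B z) \<partial>lborel))"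
    using lborel_pair.integrable_fst[OF WI] by (simp only: Weq)
  have gi': "integrable (lborel \<Otimes>\<^sub>M lborel) g" using gi by (simp add: lborel_prod)
  have gr: "integrable lborel (\<lambda>r. \<integral>x. g (r, x) \<partial>lborel)" by (rule lborel_pair.integrable_fst'[OF gi'])
  have g2: "(\<integral>r. \<integral>x. g (r, x) \<partial>lborel \<partial>lborel) = integral\<^sup>L lborel g"
    using lborel_pair.integral_fst'[OF gi'] by (simp add: lborel_prod)
  have Bp': "integrable (lborel \<Otimes>\<^sub>M lborel) (\<lambda>x. norm (B x) powr p)" using Bp by (simp add: lborel_prod)
  have aeB: "AE r in lborel. integrable lborel (\<lambda>x. norm (B (r, x)) powr p)" by (rule lborel_pair.AE_integrable_fst'[OF Bp'])
  have km: "lagged_pairing A B h \<in> borel_measurable lborel"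
    unfolding lagged_pairing_def[abs_def] by measurable
  have eq: "AE r in lborel. lagged_pairing A B h r = (\<integral>x. g (r, x) \<partial>lborel)"
    using aeB
  proof eventually_elim
    case (elim r)
    define V where "V \<tau> x = (if r - h < \<tau> \<and> \<tau> < r then inner (A (\<tau>, x)) (B (r, x)) else 0)" for \<tau> x
    have VI: "integrable (lborel \<Otimes>\<^sub>M lborel) (case_prod V)"
      using lagged_slice_integrable[OF A Aq B elim h] by (simp add: V_def[abs_def])
    have "lagged_pairing A B h r = (\<integral>\<tau>. \<integral>x. V \<tau> x \<partial>lborel \<partial>lborel)"
      unfolding lagged_pairing_def V_def by (intro Bochner_Integration.integral_cong) auto
    also have "\<dots> = (\<integral>x. \<integral>\<tau>. V \<tau> x \<partial>lborel \<partial>lborel)" by (rule lborel_pair.Fubini_integral[OF VI, symmetric])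
    also have "\<dots> = (\<integral>x. g (r, x) \<partial>lborel)"
    proof (rule Bochner_Integration.integral_cong)
      fix x
      have "(\<integral>\<tau>. V \<tau> x \<partial>lborel) = (\<integral>s. V (r + (-1) * s) x \<partial>lborel)"
        using lborel_integral_real_affine[of "-1" "\<lambda>\<tau>. V \<tau> x" r] by simp
      also have "\<dots> = g (r, x)"
        unfolding g_def by (intro Bochner_Integration.integral_cong) (auto simp: V_def W_def indicator_def)
      finally show "(\<integral>\<tau>. V \<tau> x \<partial>lborel) = g (r, x)" .
    qed simp
    finally show "lagged_pairing A B h r = (\<integral>x. g (r, x) \<partial>lborel)" .
  qed
  show "integrable lborel (lagged_pairing A B h)"
    using integrable_cong_AE[OF km _ eq] gr by auto
  have "integral\<^sup>L lborel (lagged_pairing A B h) = (\<integral>r. \<integral>x. g (r, x) \<partial>lborel \<partial>lborel)"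
    using gr by (intro integral_cong_AE km eq) auto
  then show "integral\<^sup>L lborel (lagged_pairing A B h) = (\<integral>s. indicator {0<..<h} s * (\<integral>z. inner (A (z + (- s, 0))) (B z) \<partial>lborel) \<partial>lborel)"
    using g1 g2 by simp
qed

text \<open>By continuity of translations the shifted pairing \<open>I s\<close> is within
  \<open>e\<close> of the unshifted one for small \<open>s\<close>; integrating over
  \<open>s\<close> in (0, h) multiplies this by \<open>h\<close>.\<close>

lemma lagged_pairing_limit:
  fixes A B :: "real \<times> 'c::euclidean_space \<Rightarrow> 'b::euclidean_space"
  assumes A: "A \<in> borel_measurable borel" and Aq: "integrable lborel (\<lambda>x. norm (A x) powr q)"
    and B: "B \<in> borel_measurable borel" and Bp: "integrable lborel (\<lambda>x. norm (B x) powr p)"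
    and supp: "\<And>x. x \<notin> cball 0 R \<Longrightarrow> B x = 0" and e: "e > 0"
  shows "\<exists>\<delta>>0. \<forall>h. 0 < h \<and> h < \<delta> \<longrightarrow> \<bar>integral\<^sup>L lborel (lagged_pairing A B h) - h * (\<integral>x. inner (A x) (B x) \<partial>lborel)\<bar> \<le> e * h"
proof -
  define I where "I s = (\<integral>z. inner (A (z + (- s, 0))) (B z) \<partial>lborel)" for s
  have I0: "I 0 = (\<integral>x. inner (A x) (B x) \<partial>lborel)"
    by (simp add: I_def zero_prod_def[symmetric])
  \<comment> \<open>\<open>translation_pairing\<close> gives continuity along sequences, hence the
    argument by contradiction.\<close>
  have "\<exists>\<delta>>0. \<forall>s. 0 < s \<and> s < \<delta> \<longrightarrow> \<bar>I s - I 0\<bar> \<le> e"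
  proof (rule ccontr)
    assume "\<not> ?thesis"
    then have "\<forall>n. \<exists>s. 0 < s \<and> s < inverse (real (Suc n)) \<and> \<not> \<bar>I s - I 0\<bar> \<le> e"
      by (metis inverse_positive_iff_positive of_nat_0_less_iff zero_less_Suc)
    then obtain s where s: "\<And>n. 0 < s n" "\<And>n. s n < inverse (real (Suc n))" "\<And>n. \<not> \<bar>I (s n) - I 0\<bar> \<le> e" by metis
    have "s \<longlonglongrightarrow> 0"
      by (rule tendsto_zero_sandwich[OF _ _ LIMSEQ_inverse_real_of_nat]) (use s in \<open>auto intro: less_imp_le simp del: of_nat_Suc\<close>)
    then have "(\<lambda>n. (- s n, 0::'c)) \<longlonglongrightarrow> (- 0, 0)" by (intro tendsto_intros)
    then have "(\<lambda>n. (- s n, 0::'c)) \<longlonglongrightarrow> 0" by (simp add: zero_prod_def)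
    from translation_pairing[OF A Aq B Bp supp this] have "(\<lambda>n. I (s n)) \<longlonglongrightarrow> I 0"
      unfolding I0 by (simp add: I_def)
    from LIMSEQ_D[OF this e] obtain n where "norm (I (s n) - I 0) < e" by blast
    then show False using s(3)[of n] by simp
  qed
  then obtain \<delta> where \<delta>: "\<delta> > 0" "\<And>s. 0 < s \<Longrightarrow> s < \<delta> \<Longrightarrow> \<bar>I s - I 0\<bar> \<le> e" by blast
  have "\<bar>integral\<^sup>L lborel (lagged_pairing A B h) - h * I 0\<bar> \<le> e * h" if h: "0 < h" "h < \<delta>" for h
  proof -
    have i1: "integrable lborel (\<lambda>s. indicator {0<..<h} s * I s)"
      unfolding I_def by (rule lagged_pairing_integral(3)[OF A Aq B Bp h(1)])
    have ind: "integrable lborel (\<lambda>s. indicator {0<..<h} s * c :: real)" "(\<integral>s. indicator {0<..<h} s * c \<partial>lborel) = h * c" for c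
      using h by (simp_all add: integrable_indicator_iff)
    have "integral\<^sup>L lborel (lagged_pairing A B h) - h * I 0 = (\<integral>s. indicator {0<..<h} s * I s \<partial>lborel) - (\<integral>s. indicator {0<..<h} s * I 0 \<partial>lborel)"
      unfolding ind(2) using lagged_pairing_integral(2)[OF A Aq B Bp h(1)] by (simp add: I_def)
    also have "\<dots> = (\<integral>s. indicator {0<..<h} s * I s - indicator {0<..<h} s * I 0 \<partial>lborel)"
      by (rule Bochner_Integration.integral_diff[symmetric, OF i1 ind(1)])
    finally have "\<bar>integral\<^sup>L lborel (lagged_pairing A B h) - h * I 0\<bar> = \<bar>\<integral>s. indicator {0<..<h} s * I s - indicator {0<..<h} s * I 0 \<partial>lborel\<bar>" by simp
    also have "\<dots> \<le> (\<integral>s. indicator {0<..<h} s * e \<partial>lborel)"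
      by (rule integral_abs_bound_integral) (use i1 ind(1) \<delta>(2) h in \<open>auto simp: indicator_def\<close>)
    also have "\<dots> = e * h" using ind(2)[of e] by simp
    finally show ?thesis .
  qed
  then show ?thesis using \<delta>(1) unfolding I0[symmetric] by blast
qed

end

section \<open>The energy inequality\<close>

text \<open>\<open>s^4 / (4 * m)\<close> is the price of the convective term when a share
  \<open>m\<close> of the viscosity is spent on it; \<open>s^2\<close> pays for the force and for
  dissipation of the square norm. For \<beta> > 3 the damping wins by its power, for \<beta> = 3 the
  coefficients must decide.\<close>

lemma superquartic_damping:
  fixes \<mu> \<alpha> \<beta> :: real
  assumes "\<mu> > 0" "\<alpha> > 0" "\<beta> > 3 \<or> (\<beta> = 3 \<and> 4 * \<alpha> * \<mu> > 1)"
  shows "\<exists>m C. 0 < m \<and> m < \<mu> \<and> 0 \<le> C \<and> (\<forall>s\<ge>0. s\<^sup>2 + s^4 / (4 * m) - C \<le> \<alpha> * s powr (\<beta> + 1))"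
  using assms(3)
proof
  assume \<beta>: "\<beta> > 3"
  define m where "m = \<mu> / 2"
  have m: "0 < m" "m < \<mu>" using assms by (auto simp: m_def)
  define L where "L = 1 / (4 * m) + 1"
  have L: "L > 0" using m by (simp add: L_def add_pos_pos)
  \<comment> \<open>For \<open>s \<ge> K\<close> the factor
    \<open>\<alpha> * s powr (\<beta> - 3)\<close> is at least \<open>L\<close>, and
    \<open>L * s^4\<close> dominates the left side because \<open>s \<ge> 1\<close>; for
    \<open>s < K\<close> the constant absorbs everything.\<close>
  define K where "K = max 1 ((L / \<alpha>) powr (1 / (\<beta> - 3)))"
  have K1: "K \<ge> 1" by (simp add: K_def)
  have "s\<^sup>2 + s^4 / (4 * m) - (K\<^sup>2 + K^4 / (4 * m)) \<le> \<alpha> * s powr (\<beta> + 1)" if s: "s \<ge> 0" for s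
  proof (cases "s \<ge> K")
    case True
    then have s1: "s \<ge> 1" using K1 by simp
    have "L / \<alpha> = ((L / \<alpha>) powr (1 / (\<beta> - 3))) powr (\<beta> - 3)" using \<beta> L assms by (simp add: powr_powr)
    also have "\<dots> \<le> s powr (\<beta> - 3)" using True \<beta> by (intro powr_mono2) (auto simp: K_def)
    finally have "L \<le> \<alpha> * s powr (\<beta> - 3)" using assms by (simp add: field_simps)
    then have "L * s^4 \<le> \<alpha> * s powr (\<beta> - 3) * s^4" by (intro mult_right_mono) auto
    also have "\<dots> = \<alpha> * s powr (\<beta> + 1)"
    proof -
      have "s powr (\<beta> + 1) = s powr (\<beta> - 3) * s powr 4" using powr_add[of s "\<beta> - 3" 4] by (simp add: algebra_simps)
      also have "s powr 4 = s^4" using s1 powr_realpow[of s 4] by simp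
      finally show ?thesis by simp
    qed
    finally have 1: "L * s^4 \<le> \<alpha> * s powr (\<beta> + 1)" .
    have "s\<^sup>2 \<le> s^4" using s1 by (intro power_increasing) auto
    then have "s\<^sup>2 + s^4 / (4 * m) \<le> L * s^4" by (simp add: L_def algebra_simps)
    moreover have "0 \<le> K\<^sup>2 + K^4 / (4 * m)" using m by simp
    ultimately show ?thesis using 1 by linarith
  next
    case False
    then have "s\<^sup>2 \<le> K\<^sup>2" "s^4 \<le> K^4" using s by (auto intro: power_mono)
    then have "s\<^sup>2 + s^4 / (4 * m) \<le> K\<^sup>2 + K^4 / (4 * m)" using m by (intro add_mono divide_right_mono) auto
    moreover have "0 \<le> \<alpha> * s powr (\<beta> + 1)" using assms by simp
    ultimately show ?thesis by linarith
  qed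
  moreover have "0 \<le> K\<^sup>2 + K^4 / (4 * m)" using m by simp
  ultimately show ?thesis using m by blast
next
  assume \<beta>: "\<beta> = 3 \<and> 4 * \<alpha> * \<mu> > 1"
  \<comment> \<open>The midpoint between \<open>1 / (4 * \<alpha>)\<close> and \<mu>: it leaves both
    unspent viscosity and a positive surplus \<eta> in the coefficient of
    \<open>s^4\<close>.\<close>
  define m where "m = (\<mu> + 1 / (4 * \<alpha>)) / 2"
  have lt: "1 / (4 * \<alpha>) < \<mu>" using \<beta> assms by (simp add: field_simps)
  then have m: "0 < m" "m < \<mu>" "1 / (4 * \<alpha>) < m" using assms by (auto simp: m_def add_pos_pos)
  define \<eta> where "\<eta> = \<alpha> - 1 / (4 * m)"
  have \<eta>: "\<eta> > 0" using m assms by (simp add: \<eta>_def field_simps)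
  have "s\<^sup>2 + s^4 / (4 * m) - 1 / \<eta> \<le> \<alpha> * s powr (\<beta> + 1)" if s: "s \<ge> 0" for s
  proof -
    have p: "s powr (\<beta> + 1) = s^4" using \<beta> powr_realpow[of s 4] s by (cases "s = 0") auto
    have "0 \<le> (\<eta> * s\<^sup>2 - 1)\<^sup>2 / \<eta>" using \<eta> by simp
    also have "\<dots> = \<eta> * s^4 - 2 * s\<^sup>2 + 1 / \<eta>"
      using \<eta> by (simp add: power2_eq_square field_simps power4_eq_xxxx)
    finally have "2 * s\<^sup>2 - 1 / \<eta> \<le> \<eta> * s^4" by linarith
    moreover have "0 \<le> s\<^sup>2" by simp
    ultimately have "s\<^sup>2 - 1 / \<eta> \<le> \<eta> * s^4" by linarith
    then show ?thesis unfolding p by (simp add: \<eta>_def algebra_simps)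
  qed
  moreover have "0 \<le> 1 / \<eta>" using \<eta> by simp
  ultimately show ?thesis using m by blast
qed

text \<open>The pointwise form of (u . grad) v with \<open>G\<close> as gradient of v; with the
  index convention of \<open>grad\<close> it is the transpose of \<open>G\<close> applied to
  \<open>u\<close>.\<close>

definition convect :: "pt \<Rightarrow> real^3^3 \<Rightarrow> pt" where
  "convect u G = (\<Sum>i\<in>UNIV. (u $ i) *\<^sub>R (G $ i))"

lemma norm_convect_le: "norm (convect u G) \<le> norm G * norm u"
proof -
  have "convect u G = transpose G *v u"
    by (simp add: convect_def vec_eq_iff matrix_vector_mult_def transpose_def mult.commute)
  then show ?thesis using norm_transpose_mult_le[of G u] by simp
qed

lemma inner_convect: "inner (convect u G) w = (\<Sum>i\<in>UNIV. \<Sum>j\<in>UNIV. u $ i * G $ i $ j * w $ j)"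
  unfolding convect_def inner_sum_left inner_scaleR_left
  by (simp add: inner_vec_def[of "G $ _"] sum_distrib_left mult.assoc)

lemma convect_measurable [measurable]:
  assumes [measurable]: "f \<in> borel_measurable M" "g \<in> borel_measurable M"
  shows "(\<lambda>x. convect (f x) (g x)) \<in> borel_measurable M"
proof -
  have [measurable]: "(\<lambda>x. f x $ i) \<in> borel_measurable M" "(\<lambda>x. g x $ i) \<in> borel_measurable M" for i
    by (rule borel_measurable_continuous_on[OF _ assms(1)], intro continuous_intros)
      (rule borel_measurable_continuous_on[OF _ assms(2)], intro continuous_intros)
  show ?thesis unfolding convect_def by measurable
qed

text \<open>The assumption on \<open>\<beta>\<close>, \<open>\<alpha>\<close>, \<open>\<mu>\<close> is exactly what lets viscosity and damping absorb the
  convective term.\<close>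

lemma coercivity:
  fixes \<mu> \<alpha> \<beta> :: real
  assumes "\<mu> > 0" "\<alpha> > 0" "\<beta> > 3 \<or> (\<beta> = 3 \<and> 4 * \<alpha> * \<mu> > 1)"
  shows "\<exists>\<delta> C. 0 < \<delta> \<and> 0 \<le> C \<and> (\<forall>u G f. \<delta> * ((norm G)\<^sup>2 + (norm u)\<^sup>2) - C * (1 + (norm f)\<^sup>2) \<le>
     \<mu> * (norm G)\<^sup>2 + inner (convect u G + (\<alpha> * norm u powr (\<beta> - 1)) *\<^sub>R u - f) u)"
proof -
  obtain m C where m: "0 < m" "m < \<mu>" "0 \<le> C" and C: "\<And>s. s \<ge> 0 \<Longrightarrow> s\<^sup>2 + s^4 / (4 * m) - C \<le> \<alpha> * s powr (\<beta> + 1)"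
    using superquartic_damping[OF assms] by blast
  \<comment> \<open>\<open>\<mu> - m\<close> is the unspent viscosity; of the term
    \<open>b^2\<close> granted by \<open>superquartic_damping\<close> the force takes one half and
    leaves the other.\<close>
  define \<delta> where "\<delta> = min (\<mu> - m) (1/2)"
  define D where "D = max C (1/2)"
  have "\<delta> * ((norm G)\<^sup>2 + (norm u)\<^sup>2) - D * (1 + (norm f)\<^sup>2) \<le>
     \<mu> * (norm G)\<^sup>2 + inner (convect u G + (\<alpha> * norm u powr (\<beta> - 1)) *\<^sub>R u - f) u" for u G f
  proof -
    define a b c where "a = norm G" and "b = norm u" and "c = norm f"
    have nn: "a \<ge> 0" "b \<ge> 0" "c \<ge> 0" by (auto simp: a_def b_def c_def)
    have pw: "b powr (\<beta> - 1) * b\<^sup>2 = b powr (\<beta> + 1)"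
    proof (cases "b = 0")
      case False
      then have "b\<^sup>2 = b powr 2" using nn powr_realpow[of b 2] by simp
      then show ?thesis using powr_add[of b "\<beta> - 1" 2] by (simp add: algebra_simps)
    qed simp
    have "\<bar>inner (convect u G) u\<bar> \<le> norm (convect u G) * norm u" by (rule Cauchy_Schwarz_ineq2)
    also have "\<dots> \<le> a * b * b" using norm_convect_le[of u G] by (auto simp: a_def b_def intro: mult_right_mono)
    \<comment> \<open>Young's inequality with weight \<open>m\<close>, by completing the square.
      This is where viscosity and damping share the convective term.\<close>
    also have "\<dots> \<le> m * a\<^sup>2 + b^4 / (4 * m)"
    proof -
      have "0 \<le> (2 * m * a - b\<^sup>2)\<^sup>2 / (4 * m)" using m by simp
      also have "\<dots> = m * a\<^sup>2 - a * b * b + b^4 / (4 * m)"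
        using m by (simp add: power2_eq_square field_simps power4_eq_xxxx)
      finally show ?thesis by linarith
    qed
    finally have 1: "inner (convect u G) u \<ge> - (m * a\<^sup>2 + b^4 / (4 * m))" by linarith
    have "inner f u \<le> c * b" using norm_cauchy_schwarz[of f u] by (simp add: b_def c_def)
    also have "\<dots> \<le> c\<^sup>2 / 2 + b\<^sup>2 / 2" using sum_squares_bound[of c b] by simp
    finally have 2: "inner f u \<le> c\<^sup>2 / 2 + b\<^sup>2 / 2" .
    have 3: "inner ((\<alpha> * norm u powr (\<beta> - 1)) *\<^sub>R u) u = \<alpha> * b powr (\<beta> + 1)"
      using pw by (simp add: b_def power2_norm_eq_inner[symmetric] mult.assoc)
    have 4: "b\<^sup>2 + b^4 / (4 * m) - C \<le> \<alpha> * b powr (\<beta> + 1)" using C nn by blast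
    have 5: "inner (convect u G + (\<alpha> * norm u powr (\<beta> - 1)) *\<^sub>R u - f) u = inner (convect u G) u + \<alpha> * b powr (\<beta> + 1) - inner f u"
      by (simp add: inner_add_left inner_diff_left 3[simplified])
    have 6: "\<delta> * a\<^sup>2 \<le> (\<mu> - m) * a\<^sup>2" by (intro mult_right_mono) (auto simp: \<delta>_def)
    have 7: "\<delta> * b\<^sup>2 \<le> 1/2 * b\<^sup>2" unfolding \<delta>_def by (intro mult_right_mono min.cobounded2) simp
    have 8: "1/2 * c\<^sup>2 \<le> D * c\<^sup>2" by (intro mult_right_mono) (auto simp: D_def)
    have 9: "C \<le> D" by (simp add: D_def)
    show ?thesis unfolding 5 unfolding a_def[symmetric] b_def[symmetric] c_def[symmetric]
      using 1 2 4 6 7 8 9 by (simp add: algebra_simps)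
  qed
  moreover have "0 < \<delta>" using m by (simp add: \<delta>_def)
  moreover have "0 \<le> D" by (simp add: D_def)
  ultimately show ?thesis by blast
qed

text \<open>Each part of the flux is bounded by the same power of a quantity that is integrable over
  the cylinder, which puts it in the dual of \<open>L^(\<beta>+1)\<close>. The convective part is
  critical: 1/2 + 1/(\<beta>+1) is at most \<beta>/(\<beta>+1) exactly when \<beta> \<ge> 3.\<close>

lemma flux_growth:
  fixes a b c \<beta> :: real
  assumes \<beta>: "\<beta> \<ge> 3" and nn: "a \<ge> 0" "b \<ge> 0" "c \<ge> 0"
  defines "M \<equiv> 1 + a\<^sup>2 + b powr (\<beta> + 1) + c\<^sup>2"
  shows "a * b \<le> M powr (\<beta> / (\<beta> + 1))" "b powr \<beta> \<le> M powr (\<beta> / (\<beta> + 1))" "c \<le> M powr (\<beta> / (\<beta> + 1))"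
proof -
  have M1: "M \<ge> 1" by (simp add: M_def add_nonneg_nonneg)
  have half: "x \<le> M powr (1/2)" if "x \<ge> 0" "x\<^sup>2 \<le> M" for x
    using that M1 by (simp add: powr_half_sqrt real_le_rsqrt)
  have a: "a \<le> M powr (1/2)" by (rule half) (use nn in \<open>auto simp: M_def\<close>)
  have c: "c \<le> M powr (1/2)" by (rule half) (use nn in \<open>auto simp: M_def\<close>)
  have "b = (b powr (\<beta> + 1)) powr (1 / (\<beta> + 1))" using nn \<beta> by (simp add: powr_powr)
  also have "\<dots> \<le> M powr (1 / (\<beta> + 1))" using \<beta> by (intro powr_mono2) (auto simp: M_def add_nonneg_nonneg)
  finally have b: "b \<le> M powr (1 / (\<beta> + 1))" .
  have "a * b \<le> M powr (1/2) * M powr (1 / (\<beta> + 1))" using a b nn by (intro mult_mono) auto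
  also have "\<dots> = M powr (1/2 + 1 / (\<beta> + 1))" by (simp add: powr_add)
  also have "\<dots> \<le> M powr (\<beta> / (\<beta> + 1))"
  proof (rule powr_mono[OF _ M1])
    have "1 / (\<beta> + 1) \<le> 1 / 4" "\<beta> / (\<beta> + 1) = 1 - 1 / (\<beta> + 1)" using \<beta> by (auto simp: field_simps)
    then show "1/2 + 1 / (\<beta> + 1) \<le> \<beta> / (\<beta> + 1)" by linarith
  qed
  finally show "a * b \<le> M powr (\<beta> / (\<beta> + 1))" .
  have "b powr \<beta> \<le> (M powr (1 / (\<beta> + 1))) powr \<beta>" using b nn \<beta> by (intro powr_mono2) auto
  then show "b powr \<beta> \<le> M powr (\<beta> / (\<beta> + 1))" by (simp add: powr_powr)
  have "M powr (1/2) \<le> M powr (\<beta> / (\<beta> + 1))" using M1 \<beta> by (intro powr_mono) (auto simp: field_simps)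
  then show "c \<le> M powr (\<beta> / (\<beta> + 1))" using c by linarith
qed

lemma norm_add_diff_le: "norm (x + y - z) \<le> norm x + norm y + norm z" for x :: "'a::real_normed_vector"
  using norm_triangle_ineq4[of "x + y" z] norm_triangle_ineq[of x y] by linarith

lemma L2_of_Lp:
  fixes U :: "'a::euclidean_space \<Rightarrow> 'b::euclidean_space"
  assumes [measurable]: "U \<in> borel_measurable borel" and p: "p \<ge> 2" and i: "integrable lborel (\<lambda>x. norm (U x) powr p)"
    and S: "emeasure lborel S < \<infinity>" "S \<in> sets borel" and supp: "\<And>x. x \<notin> S \<Longrightarrow> U x = 0"
  shows "integrable lborel (\<lambda>x. (norm (U x))\<^sup>2)"
proof (rule Bochner_Integration.integrable_bound[of lborel "\<lambda>x. indicator S x + norm (U x) powr p"])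
  show "integrable lborel (\<lambda>x. indicator S x + norm (U x) powr p)" using S i by (simp add: integrable_indicator_iff)
  show "AE x in lborel. norm ((norm (U x))\<^sup>2) \<le> norm (indicator S x + norm (U x) powr p)"
  proof (rule AE_I2)
    fix x
    have "b\<^sup>2 \<le> 1 + b powr p" if "b \<ge> 0" for b :: real
    proof (cases "b \<le> 1")
      case True
      then have "b\<^sup>2 \<le> 1" using that by (simp add: power_le_one)
      then show ?thesis by (simp add: add_increasing2)
    next
      case False
      then have "b\<^sup>2 = b powr 2" using powr_realpow[of b 2] by simp
      also have "\<dots> \<le> b powr p" using False p by (intro powr_mono) auto
      finally show ?thesis by simp
    qed
    then show "norm ((norm (U x))\<^sup>2) \<le> norm (indicator S x + norm (U x) powr p)"
      using supp[of x] by (cases "x \<in> S") auto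
  qed
qed simp

section \<open>Solutions with Borel representatives\<close>

text \<open>\<open>U\<close>, \<open>\<Gamma>\<close> and \<open>fh\<close> represent solution,
  gradient and force, extended by zero. The original \<open>u\<close> and \<open>G\<close> are kept
  because the weak formulation and the weak continuity speak of them at individual times.\<close>

locale borel_solution =
  fixes \<Omega> :: "pt set" and \<mu> \<alpha> \<beta> T :: real and f :: field and u :: "real \<Rightarrow> field" and G :: "real \<Rightarrow> pt \<Rightarrow> real^3^3"
    and U :: "real \<times> pt \<Rightarrow> pt" and \<Gamma> :: "real \<times> pt \<Rightarrow> real^3^3" and fh :: field
  assumes \<Omega>: "open \<Omega>" "bounded \<Omega>" and T: "T > 0" and \<beta>: "\<beta> \<ge> 3" and \<alpha>: "\<alpha> > 0"
    and f: "L2 \<Omega> f" and fh[measurable]: "fh \<in> borel_measurable borel" and fh_supp: "\<And>x. x \<notin> \<Omega> \<Longrightarrow> fh x = 0"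
    and fh_eq: "AE x in lborel. x \<in> \<Omega> \<longrightarrow> fh x = f x"
    and U[measurable]: "U \<in> borel_measurable borel" and U_supp: "\<And>z. z \<notin> {0<..<T} \<times> \<Omega> \<Longrightarrow> U z = 0"
    and U_int: "integrable lborel (\<lambda>z. norm (U z) powr (\<beta> + 1))"
    and \<Gamma>[measurable]: "\<Gamma> \<in> borel_measurable borel" and \<Gamma>_supp: "\<And>z. z \<notin> {0<..<T} \<times> \<Omega> \<Longrightarrow> \<Gamma> z = 0"
    and \<Gamma>_int: "integrable lborel (\<lambda>z. (norm (\<Gamma> z))\<^sup>2)"
    and rep: "AE t in lborel. t \<in> {0<..<T} \<longrightarrow> V_grad \<Omega> (u t) (G t) \<and> (AE x in lborel. x \<in> \<Omega> \<longrightarrow> U (t, x) = u t x \<and> \<Gamma> (t, x) = G t x)"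
    and uH: "\<And>t. t \<in> {0..T} \<Longrightarrow> u t \<in> H_space \<Omega>"
    and u_cont: "\<And>v. v \<in> H_space \<Omega> \<Longrightarrow> continuous_on {0..T} (\<lambda>t. L2inner \<Omega> (u t) v)"
    and weak: "\<And>v Gv F. V_grad \<Omega> v Gv \<Longrightarrow> Lp \<Omega> (\<beta> + 1) v \<Longrightarrow>
        F = (\<lambda>t. \<mu> * L2inner \<Omega> (G t) Gv + bform \<Omega> (u t) (G t) v
                        + \<alpha> * L2inner \<Omega> (\<lambda>x. norm (u t x) powr (\<beta> - 1) *\<^sub>R u t x) v
                        - L2inner \<Omega> f v) \<Longrightarrow>
        integrable (lebesgue_on {0<..<T}) F \<and>
               (\<forall>\<psi>. test_fun 0 T \<psi> \<longrightarrow>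
                  integral\<^sup>L (lebesgue_on {0<..<T}) (\<lambda>t. L2inner \<Omega> (u t) v * deriv \<psi> t)
                  = integral\<^sup>L (lebesgue_on {0<..<T}) (\<lambda>t. F t * \<psi> t))"
begin

text \<open>Two pairs of exponents: the flux lies in the dual of \<open>L^(\<beta>+1)\<close> and is
  paired with \<open>U\<close>, the gradient lies in \<open>L^2\<close> and is paired with
  itself.\<close>

sublocale pairing: conjugate_exponents "\<beta> + 1" "(\<beta> + 1) / \<beta>"
  by unfold_locales (use \<beta> in \<open>auto simp: field_simps\<close>)

sublocale two: conjugate_exponents 2 2
  by unfold_locales auto

text \<open>All terms of the equation apart from time derivative, viscosity and pressure. The force
  is cut off in time so that the required power of the flux is integrable over space-time.\<close>

definition flux :: "real \<times> pt \<Rightarrow> pt" where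
  "flux z = convect (U z) (\<Gamma> z) + (\<alpha> * norm (U z) powr (\<beta> - 1)) *\<^sub>R U z - indicator {0<..<T} (fst z) *\<^sub>R fh (snd z)"

text \<open>The quantity of \<open>flux_growth\<close>, localised to the space-time cylinder so that
  its constant 1 is integrable as well.\<close>

definition bound :: "real \<times> pt \<Rightarrow> real" where
  "bound z = (1 + (norm (\<Gamma> z))\<^sup>2 + norm (U z) powr (\<beta> + 1) + (norm (fh (snd z)))\<^sup>2) * indicator ({0<..<T} \<times> \<Omega>) z"

lemma \<Omega>_borel [measurable]: "\<Omega> \<in> sets borel" using \<Omega>(1) by simp

lemma emeasure_\<Omega>_finite: "emeasure lborel \<Omega> < \<infinity>"
  using \<Omega>(2) emeasure_bounded_finite by blast

lemma Q_borel [measurable]: "{0<..<T} \<times> \<Omega> \<in> sets borel"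
  using \<Omega>(1) by (intro borel_open open_Times) auto

lemma Q_bounded: "bounded ({0<..<T} \<times> \<Omega>)"
  using \<Omega>(2) by (intro bounded_Times) auto

lemma emeasure_Q_finite: "emeasure lborel ({0<..<T} \<times> \<Omega>) < \<infinity>"
  using Q_bounded emeasure_bounded_finite by blast

lemma flux_borel [measurable]: "flux \<in> borel_measurable borel"
  unfolding flux_def[abs_def] borel_prod[symmetric] using U \<Gamma> unfolding borel_prod[symmetric] by measurable

lemma fh_L2: "integrable lborel (\<lambda>x. (norm (fh x))\<^sup>2)" "(\<integral>x. (norm (fh x))\<^sup>2 \<partial>lborel) = (L2norm \<Omega> f)\<^sup>2"
proof -
  have h: "(\<lambda>x. (norm (f x))\<^sup>2) \<in> borel_measurable (lebesgue_on \<Omega>)" using f by (auto simp: L2_def)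
  have ae: "AE x in lborel. x \<in> \<Omega> \<longrightarrow> (norm (fh x))\<^sup>2 = (norm (f x))\<^sup>2" using fh_eq by eventually_elim auto
  note * = lebesgue_on_eq_lborel[OF \<Omega>_borel _ _ h ae]
  show "integrable lborel (\<lambda>x. (norm (fh x))\<^sup>2)" using *(1) f fh_supp by (simp add: L2_def)
  show "(\<integral>x. (norm (fh x))\<^sup>2 \<partial>lborel) = (L2norm \<Omega> f)\<^sup>2" unfolding L2norm_sq using *(2) fh_supp by simp
qed

lemma force_int:
  "integrable lborel (\<lambda>z. (1 + (norm (fh (snd z)))\<^sup>2) * indicator ({0<..<T} \<times> \<Omega>) z)"
  "(\<integral>z. (1 + (norm (fh (snd z)))\<^sup>2) * indicator ({0<..<T} \<times> \<Omega>) z \<partial>lborel) = T * (measure lebesgue \<Omega> + (L2norm \<Omega> f)\<^sup>2)"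
proof -
  define k where "k x = (1 + (norm (fh x))\<^sup>2) * indicator \<Omega> x" for x
  have keq: "k x = indicator \<Omega> x + (norm (fh x))\<^sup>2" for x using fh_supp[of x] by (auto simp: k_def indicator_def)
  have ki: "integrable lborel k"
    unfolding keq[abs_def] using fh_L2(1) emeasure_\<Omega>_finite by (simp add: integrable_indicator_iff)
  have kI: "integral\<^sup>L lborel k = measure lebesgue \<Omega> + (L2norm \<Omega> f)\<^sup>2"
    unfolding keq[abs_def] using fh_L2 emeasure_\<Omega>_finite by (simp add: integrable_indicator_iff)
  have eq: "(1 + (norm (fh (snd z)))\<^sup>2) * indicator ({0<..<T} \<times> \<Omega>) z = (case z of (t, x) \<Rightarrow> indicator {0<..<T} t * k x)" for z
    by (cases z) (auto simp: k_def indicator_def)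
  have [measurable]: "k \<in> borel_measurable borel" using ki by auto
  have I: "integrable (lborel \<Otimes>\<^sub>M lborel) (\<lambda>(t, x). indicator {0<..<T} t * k x)"
    by (rule lborel_pair.Fubini_integrable) (use ki T in \<open>auto simp: abs_mult integrable_indicator_iff\<close>)
  then show "integrable lborel (\<lambda>z. (1 + (norm (fh (snd z)))\<^sup>2) * indicator ({0<..<T} \<times> \<Omega>) z)"
    unfolding eq by (simp add: lborel_prod)
  have "(\<integral>z. (1 + (norm (fh (snd z)))\<^sup>2) * indicator ({0<..<T} \<times> \<Omega>) z \<partial>lborel) = (\<integral>t. \<integral>x. indicator {0<..<T} t * k x \<partial>lborel \<partial>lborel)"
    unfolding eq lborel_pair.integral_fst[OF I] by (simp add: lborel_prod)
  also have "\<dots> = T * (measure lebesgue \<Omega> + (L2norm \<Omega> f)\<^sup>2)"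
    using T by (simp add: kI)
  finally show "(\<integral>z. (1 + (norm (fh (snd z)))\<^sup>2) * indicator ({0<..<T} \<times> \<Omega>) z \<partial>lborel) = T * (measure lebesgue \<Omega> + (L2norm \<Omega> f)\<^sup>2)" .
qed

lemma bound_int: "integrable lborel bound"
proof -
  have "bound z = (1 + (norm (fh (snd z)))\<^sup>2) * indicator ({0<..<T} \<times> \<Omega>) z + (norm (\<Gamma> z))\<^sup>2 + norm (U z) powr (\<beta> + 1)" for z
    using U_supp[of z] \<Gamma>_supp[of z] by (auto simp: bound_def indicator_def)
  then have "bound = (\<lambda>z. (1 + (norm (fh (snd z)))\<^sup>2) * indicator ({0<..<T} \<times> \<Omega>) z + (norm (\<Gamma> z))\<^sup>2 + norm (U z) powr (\<beta> + 1))" by auto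
  then show ?thesis using force_int(1) \<Gamma>_int U_int by simp
qed

lemma bound_nonneg: "bound z \<ge> 0" by (auto simp: bound_def indicator_def add_nonneg_nonneg)

lemma powr_q_le_bound:
  assumes "0 \<le> X" "X \<le> c * (1 + (norm (\<Gamma> z))\<^sup>2 + norm (U z) powr (\<beta> + 1) + (norm (fh (snd z)))\<^sup>2) powr (\<beta> / (\<beta> + 1))"
    "c \<ge> 0" "z \<notin> {0<..<T} \<times> \<Omega> \<Longrightarrow> X = 0"
  shows "X powr ((\<beta> + 1) / \<beta>) \<le> c powr ((\<beta> + 1) / \<beta>) * bound z"
proof (cases "z \<in> {0<..<T} \<times> \<Omega>")
  case True
  define M where "M = 1 + (norm (\<Gamma> z))\<^sup>2 + norm (U z) powr (\<beta> + 1) + (norm (fh (snd z)))\<^sup>2"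
  have M: "M \<ge> 0" by (simp add: M_def add_nonneg_nonneg)
  have "X powr ((\<beta> + 1) / \<beta>) \<le> (c * M powr (\<beta> / (\<beta> + 1))) powr ((\<beta> + 1) / \<beta>)"
    using assms \<beta> by (intro powr_mono2) (auto simp: M_def)
  also have "\<dots> = c powr ((\<beta> + 1) / \<beta>) * M" using assms \<beta> M by (simp add: powr_mult powr_powr)
  also have "M = bound z" using True by (simp add: M_def bound_def)
  finally show ?thesis .
qed (use assms bound_nonneg in auto)

text \<open>The parts are bounded one by one, not only their sum, because the weak formulation has a
  separate integral for each and these have to be recombined.\<close>

lemma flux_parts_le:
  "norm (convect (U z) (\<Gamma> z)) powr ((\<beta> + 1) / \<beta>) \<le> bound z"
  "norm (norm (U z) powr (\<beta> - 1) *\<^sub>R U z) powr ((\<beta> + 1) / \<beta>) \<le> bound z"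
  "norm (indicator {0<..<T} (fst z) *\<^sub>R fh (snd z)) powr ((\<beta> + 1) / \<beta>) \<le> bound z"
  "norm (flux z) powr ((\<beta> + 1) / \<beta>) \<le> (2 + \<alpha>) powr ((\<beta> + 1) / \<beta>) * bound z"
proof -
  define M where "M = 1 + (norm (\<Gamma> z))\<^sup>2 + norm (U z) powr (\<beta> + 1) + (norm (fh (snd z)))\<^sup>2"
  note g = flux_growth[OF \<beta>, of "norm (\<Gamma> z)" "norm (U z)" "norm (fh (snd z))", folded M_def]
  have 1: "norm (convect (U z) (\<Gamma> z)) \<le> M powr (\<beta> / (\<beta> + 1))"
    using norm_convect_le[of "U z" "\<Gamma> z"] g(1) by simp
  have e: "norm (norm (U z) powr (\<beta> - 1) *\<^sub>R U z) = norm (U z) powr \<beta>"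
  proof (cases "U z = 0")
    case False
    then have "norm (U z) powr (\<beta> - 1) * norm (U z) powr 1 = norm (U z) powr \<beta>"
      using powr_add[of "norm (U z)" "\<beta> - 1" 1] by simp
    then show ?thesis using False by simp
  qed (use \<beta> in simp)
  have 2: "norm (norm (U z) powr (\<beta> - 1) *\<^sub>R U z) \<le> M powr (\<beta> / (\<beta> + 1))" unfolding e using g(2) by simp
  have 3: "norm (indicator {0<..<T} (fst z) *\<^sub>R fh (snd z)) \<le> M powr (\<beta> / (\<beta> + 1))"
    using g(3) by (auto simp: indicator_def)
  have z3: "norm (indicator {0<..<T} (fst z) *\<^sub>R fh (snd z)) = 0" if "z \<notin> {0<..<T} \<times> \<Omega>"
    using that fh_supp by (cases z) (auto simp: indicator_def)
  have z1: "norm (convect (U z) (\<Gamma> z)) = 0" if "z \<notin> {0<..<T} \<times> \<Omega>"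
    using norm_convect_le[of "U z" "\<Gamma> z"] U_supp[OF that] by simp
  have z2: "norm (norm (U z) powr (\<beta> - 1) *\<^sub>R U z) = 0" if "z \<notin> {0<..<T} \<times> \<Omega>" using U_supp[OF that] by simp
  show "norm (convect (U z) (\<Gamma> z)) powr ((\<beta> + 1) / \<beta>) \<le> bound z"
    using powr_q_le_bound[of "norm (convect (U z) (\<Gamma> z))" 1 z] 1 z1 by (simp add: M_def)
  show "norm (norm (U z) powr (\<beta> - 1) *\<^sub>R U z) powr ((\<beta> + 1) / \<beta>) \<le> bound z"
    using powr_q_le_bound[of "norm (norm (U z) powr (\<beta> - 1) *\<^sub>R U z)" 1 z] 2 z2 by (simp add: M_def)
  show "norm (indicator {0<..<T} (fst z) *\<^sub>R fh (snd z)) powr ((\<beta> + 1) / \<beta>) \<le> bound z"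
    using powr_q_le_bound[of "norm (indicator {0<..<T} (fst z) *\<^sub>R fh (snd z))" 1 z] 3 z3 by (simp add: M_def)
  have fl: "flux z = convect (U z) (\<Gamma> z) + \<alpha> *\<^sub>R (norm (U z) powr (\<beta> - 1) *\<^sub>R U z) - indicator {0<..<T} (fst z) *\<^sub>R fh (snd z)"
    by (simp add: flux_def)
  have "norm (flux z) \<le> norm (convect (U z) (\<Gamma> z)) + norm (\<alpha> *\<^sub>R (norm (U z) powr (\<beta> - 1) *\<^sub>R U z)) + norm (indicator {0<..<T} (fst z) *\<^sub>R fh (snd z))"
    unfolding fl by (rule norm_add_diff_le)
  also have "norm (\<alpha> *\<^sub>R (norm (U z) powr (\<beta> - 1) *\<^sub>R U z)) = \<alpha> * norm (norm (U z) powr (\<beta> - 1) *\<^sub>R U z)"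
    using \<alpha> by (subst norm_scaleR) simp
  finally have le: "norm (flux z) \<le> norm (convect (U z) (\<Gamma> z)) + \<alpha> * norm (norm (U z) powr (\<beta> - 1) *\<^sub>R U z) + norm (indicator {0<..<T} (fst z) *\<^sub>R fh (snd z))" .
  have "\<alpha> * norm (norm (U z) powr (\<beta> - 1) *\<^sub>R U z) \<le> \<alpha> * M powr (\<beta> / (\<beta> + 1))" using 2 \<alpha> by (intro mult_left_mono) auto
  then have 4: "norm (flux z) \<le> (2 + \<alpha>) * M powr (\<beta> / (\<beta> + 1))" using le 1 3 unfolding distrib_right by linarith
  have z4: "norm (flux z) = 0" if "z \<notin> {0<..<T} \<times> \<Omega>"
    using le norm_ge_zero[of "flux z"] unfolding z1[OF that] z2[OF that] z3[OF that] by linarith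
  show "norm (flux z) powr ((\<beta> + 1) / \<beta>) \<le> (2 + \<alpha>) powr ((\<beta> + 1) / \<beta>) * bound z"
    using powr_q_le_bound[of "norm (flux z)" "2 + \<alpha>" z] 4 z4 \<alpha> by (simp add: M_def)
qed

lemma flux_int: "integrable lborel (\<lambda>z. norm (flux z) powr ((\<beta> + 1) / \<beta>))"
  by (rule Bochner_Integration.integrable_bound[of lborel "\<lambda>z. (2 + \<alpha>) powr ((\<beta> + 1) / \<beta>) * bound z"])
    (use bound_int flux_parts_le(4) in \<open>auto intro!: AE_I2 order_trans[OF _ abs_ge_self]\<close>)

lemma flux_supp: "fst z \<notin> {0<..<T} \<Longrightarrow> flux z = 0"
  using U_supp[of z] by (cases z) (auto simp: flux_def convect_def indicator_def)

text \<open>The times at which \<open>u t\<close> may serve as test field and the slices of the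
  representatives can be trusted; almost every time in (0, T) is of this kind.\<close>

definition good :: "real \<Rightarrow> bool" where
  "good t \<longleftrightarrow> t \<in> {0<..<T} \<and> V_grad \<Omega> (u t) (G t) \<and> (AE x in lborel. x \<in> \<Omega> \<longrightarrow> U (t, x) = u t x \<and> \<Gamma> (t, x) = G t x) \<and>
     integrable lborel (\<lambda>x. bound (t, x))"

lemma AE_good: "AE t in lborel. t \<in> {0<..<T} \<longrightarrow> good t"
proof -
  have "integrable (lborel \<Otimes>\<^sub>M lborel) bound" using bound_int by (simp add: lborel_prod)
  from lborel_pair.AE_integrable_fst'[OF this] rep show ?thesis
    by eventually_elim (auto simp: good_def)
qed

lemma slice_borel [measurable]:
  "(\<lambda>x. U (t, x)) \<in> borel_measurable borel" "(\<lambda>x. \<Gamma> (t, x)) \<in> borel_measurable borel" "(\<lambda>x. flux (t, x)) \<in> borel_measurable borel"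
  by measurable

lemma good_slice_int:
  assumes "good t"
  shows "integrable lborel (\<lambda>x. norm (U (t, x)) powr (\<beta> + 1))" "integrable lborel (\<lambda>x. (norm (\<Gamma> (t, x)))\<^sup>2)"
    "integrable lborel (\<lambda>x. norm (convect (U (t, x)) (\<Gamma> (t, x))) powr ((\<beta> + 1) / \<beta>))"
    "integrable lborel (\<lambda>x. norm (norm (U (t, x)) powr (\<beta> - 1) *\<^sub>R U (t, x)) powr ((\<beta> + 1) / \<beta>))"
    "integrable lborel (\<lambda>x. norm (fh x) powr ((\<beta> + 1) / \<beta>))"
proof -
  have b: "integrable lborel (\<lambda>x. bound (t, x))" and t: "t \<in> {0<..<T}" using assms by (auto simp: good_def)
  have bb: "norm (g x) \<le> norm (bound (t, x))" if "0 \<le> g x" "g x \<le> bound (t, x)" for g :: "pt \<Rightarrow> real" and x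
    using that by simp
  have "norm (U (t, x)) powr (\<beta> + 1) \<le> bound (t, x)" "(norm (\<Gamma> (t, x)))\<^sup>2 \<le> bound (t, x)" for x
    using U_supp[of "(t, x)"] \<Gamma>_supp[of "(t, x)"] by (auto simp: bound_def indicator_def add_nonneg_nonneg)
  then show "integrable lborel (\<lambda>x. norm (U (t, x)) powr (\<beta> + 1))" "integrable lborel (\<lambda>x. (norm (\<Gamma> (t, x)))\<^sup>2)"
    by (auto intro!: Bochner_Integration.integrable_bound[OF b] AE_I2 bb)
  show "integrable lborel (\<lambda>x. norm (convect (U (t, x)) (\<Gamma> (t, x))) powr ((\<beta> + 1) / \<beta>))"
    using flux_parts_le(1)[of "(t, _)"] by (intro Bochner_Integration.integrable_bound[OF b] AE_I2 bb) auto
  show "integrable lborel (\<lambda>x. norm (norm (U (t, x)) powr (\<beta> - 1) *\<^sub>R U (t, x)) powr ((\<beta> + 1) / \<beta>))"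
    using flux_parts_le(2)[of "(t, _)"] by (intro Bochner_Integration.integrable_bound[OF b] AE_I2 bb) auto
  show "integrable lborel (\<lambda>x. norm (fh x) powr ((\<beta> + 1) / \<beta>))"
    using flux_parts_le(3)[of "(t, _)"] t by (intro Bochner_Integration.integrable_bound[OF b] AE_I2 bb) auto
qed

lemma good_L2: assumes "good t" shows "L2 \<Omega> (u t)" "L2 \<Omega> (G t)"
  using assms by (auto simp: good_def V_grad_def)

lemma slice_supp: "x \<notin> \<Omega> \<Longrightarrow> U (t, x) = 0" "x \<notin> \<Omega> \<Longrightarrow> \<Gamma> (t, x) = 0"
  using U_supp[of "(t, x)"] \<Gamma>_supp[of "(t, x)"] by auto

lemma good_Lp: assumes "good t" shows "Lp \<Omega> (\<beta> + 1) (u t)"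
proof -
  have m: "u t \<in> borel_measurable (lebesgue_on \<Omega>)" using good_L2(1)[OF assms] by (simp add: L2_def)
  have "AE x in lborel. x \<in> \<Omega> \<longrightarrow> norm (U (t, x)) powr (\<beta> + 1) = norm (u t x) powr (\<beta> + 1)"
    using assms unfolding good_def by (auto elim: eventually_mono)
  then have "integrable (lebesgue_on \<Omega>) (\<lambda>x. norm (u t x) powr (\<beta> + 1))"
    using lebesgue_on_eq_lborel(1)[OF \<Omega>_borel, of "\<lambda>x. norm (U (t, x)) powr (\<beta> + 1)" "\<lambda>x. norm (u t x) powr (\<beta> + 1)"]
      good_slice_int(1)[OF assms] slice_supp m by simp
  then show ?thesis using m by (simp add: Lp_def)
qed

lemma good_norms:
  assumes "good t"
  shows "(L2norm \<Omega> (u t))\<^sup>2 = (\<integral>x. (norm (U (t, x)))\<^sup>2 \<partial>lborel)" "(L2norm \<Omega> (G t))\<^sup>2 = (\<integral>x. (norm (\<Gamma> (t, x)))\<^sup>2 \<partial>lborel)"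
proof -
  have m: "u t \<in> borel_measurable (lebesgue_on \<Omega>)" "G t \<in> borel_measurable (lebesgue_on \<Omega>)"
    using good_L2[OF assms] by (auto simp: L2_def)
  have "AE x in lborel. x \<in> \<Omega> \<longrightarrow> (norm (U (t, x)))\<^sup>2 = (norm (u t x))\<^sup>2"
    using assms unfolding good_def by (auto elim: eventually_mono)
  then show "(L2norm \<Omega> (u t))\<^sup>2 = (\<integral>x. (norm (U (t, x)))\<^sup>2 \<partial>lborel)"
    unfolding L2norm_sq using m slice_supp by (intro lebesgue_on_eq_lborel(2)[OF \<Omega>_borel]) auto
  have "AE x in lborel. x \<in> \<Omega> \<longrightarrow> (norm (\<Gamma> (t, x)))\<^sup>2 = (norm (G t x))\<^sup>2"
    using assms unfolding good_def by (auto elim: eventually_mono)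
  then show "(L2norm \<Omega> (G t))\<^sup>2 = (\<integral>x. (norm (\<Gamma> (t, x)))\<^sup>2 \<partial>lborel)"
    unfolding L2norm_sq using m slice_supp by (intro lebesgue_on_eq_lborel(2)[OF \<Omega>_borel]) auto
qed

text \<open>Translates the integrand of the weak formulation, with test field \<open>u r\<close>,
  into Borel slices. Here the separate integrals are joined into one pairing with the flux, ready
  for \<open>lagged_pairing\<close>.\<close>

lemma weak_form_slices:
  assumes \<tau>: "good \<tau>" and r: "good r"
  shows "\<mu> * L2inner \<Omega> (G \<tau>) (G r) + bform \<Omega> (u \<tau>) (G \<tau>) (u r)
           + \<alpha> * L2inner \<Omega> (\<lambda>x. norm (u \<tau> x) powr (\<beta> - 1) *\<^sub>R u \<tau> x) (u r) - L2inner \<Omega> f (u r)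
    = \<mu> * (\<integral>x. inner (\<Gamma> (\<tau>, x)) (\<Gamma> (r, x)) \<partial>lborel) + (\<integral>x. inner (flux (\<tau>, x)) (U (r, x)) \<partial>lborel)"
proof -
  have m[measurable]: "u \<tau> \<in> borel_measurable (lebesgue_on \<Omega>)" "G \<tau> \<in> borel_measurable (lebesgue_on \<Omega>)"
    "u r \<in> borel_measurable (lebesgue_on \<Omega>)" "G r \<in> borel_measurable (lebesgue_on \<Omega>)" "f \<in> borel_measurable (lebesgue_on \<Omega>)"
    using good_L2[OF \<tau>] good_L2[OF r] f by (auto simp: L2_def)
  have t: "\<tau> \<in> {0<..<T}" using \<tau> by (simp add: good_def)
  have ae\<tau>: "AE x in lborel. x \<in> \<Omega> \<longrightarrow> U (\<tau>, x) = u \<tau> x \<and> \<Gamma> (\<tau>, x) = G \<tau> x" using \<tau> by (simp add: good_def)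
  have aer: "AE x in lborel. x \<in> \<Omega> \<longrightarrow> U (r, x) = u r x \<and> \<Gamma> (r, x) = G r x" using r by (simp add: good_def)
  have 1: "L2inner \<Omega> (G \<tau>) (G r) = (\<integral>x. inner (\<Gamma> (\<tau>, x)) (\<Gamma> (r, x)) \<partial>lborel)"
    unfolding L2inner_def
  proof (rule lebesgue_on_eq_lborel(2)[OF \<Omega>_borel])
    show "AE x in lborel. x \<in> \<Omega> \<longrightarrow> inner (\<Gamma> (\<tau>, x)) (\<Gamma> (r, x)) = inner (G \<tau> x) (G r x)" using ae\<tau> aer by eventually_elim auto
  qed (use slice_supp in auto)
  have 2: "bform \<Omega> (u \<tau>) (G \<tau>) (u r) = (\<integral>x. inner (convect (U (\<tau>, x)) (\<Gamma> (\<tau>, x))) (U (r, x)) \<partial>lborel)"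
    unfolding bform_def inner_convect[symmetric]
  proof (rule lebesgue_on_eq_lborel(2)[OF \<Omega>_borel])
    show "AE x in lborel. x \<in> \<Omega> \<longrightarrow> inner (convect (U (\<tau>, x)) (\<Gamma> (\<tau>, x))) (U (r, x)) = inner (convect (u \<tau> x) (G \<tau> x)) (u r x)"
      using ae\<tau> aer by eventually_elim auto
  qed (use slice_supp in auto)
  have 3: "L2inner \<Omega> (\<lambda>x. norm (u \<tau> x) powr (\<beta> - 1) *\<^sub>R u \<tau> x) (u r) = (\<integral>x. inner (norm (U (\<tau>, x)) powr (\<beta> - 1) *\<^sub>R U (\<tau>, x)) (U (r, x)) \<partial>lborel)"
    unfolding L2inner_def
  proof (rule lebesgue_on_eq_lborel(2)[OF \<Omega>_borel])
    show "AE x in lborel. x \<in> \<Omega> \<longrightarrow> inner (norm (U (\<tau>, x)) powr (\<beta> - 1) *\<^sub>R U (\<tau>, x)) (U (r, x)) = inner (norm (u \<tau> x) powr (\<beta> - 1) *\<^sub>R u \<tau> x) (u r x)"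
      using ae\<tau> aer by eventually_elim auto
  qed (use slice_supp in auto)
  have 4: "L2inner \<Omega> f (u r) = (\<integral>x. inner (fh x) (U (r, x)) \<partial>lborel)"
    unfolding L2inner_def
  proof (rule lebesgue_on_eq_lborel(2)[OF \<Omega>_borel])
    show "AE x in lborel. x \<in> \<Omega> \<longrightarrow> inner (fh x) (U (r, x)) = inner (f x) (u r x)"
      using fh_eq aer by eventually_elim auto
  qed (use slice_supp in auto)
  note i = pairing.integrable_pairing[of _ lborel "\<lambda>x. U (r, x)", OF _ _ _ good_slice_int(1)[OF r]]
  have i2: "integrable lborel (\<lambda>x. inner (convect (U (\<tau>, x)) (\<Gamma> (\<tau>, x))) (U (r, x)))"
    by (rule i) (use good_slice_int(3)[OF \<tau>] in auto)
  have i3: "integrable lborel (\<lambda>x. inner (norm (U (\<tau>, x)) powr (\<beta> - 1) *\<^sub>R U (\<tau>, x)) (U (r, x)))"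
    by (rule i) (use good_slice_int(4)[OF \<tau>] in auto)
  have i4: "integrable lborel (\<lambda>x. inner (fh x) (U (r, x)))"
    by (rule i) (use good_slice_int(5)[OF \<tau>] in auto)
  have "inner (flux (\<tau>, x)) (U (r, x)) = inner (convect (U (\<tau>, x)) (\<Gamma> (\<tau>, x))) (U (r, x)) +
      \<alpha> * inner (norm (U (\<tau>, x)) powr (\<beta> - 1) *\<^sub>R U (\<tau>, x)) (U (r, x)) - inner (fh x) (U (r, x))" for x
    using t by (simp add: flux_def inner_add_left inner_diff_left)
  then have "(\<integral>x. inner (flux (\<tau>, x)) (U (r, x)) \<partial>lborel) = (\<integral>x. inner (convect (U (\<tau>, x)) (\<Gamma> (\<tau>, x))) (U (r, x)) +
      \<alpha> * inner (norm (U (\<tau>, x)) powr (\<beta> - 1) *\<^sub>R U (\<tau>, x)) (U (r, x)) - inner (fh x) (U (r, x)) \<partial>lborel)" by presburger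
  also have "\<dots> = bform \<Omega> (u \<tau>) (G \<tau>) (u r) + \<alpha> * L2inner \<Omega> (\<lambda>x. norm (u \<tau> x) powr (\<beta> - 1) *\<^sub>R u \<tau> x) (u r) - L2inner \<Omega> f (u r)"
    unfolding 2 3 4 using Bochner_Integration.integral_diff[OF Bochner_Integration.integrable_add[OF i2 integrable_mult_right[OF i3, of \<alpha>]] i4]
      Bochner_Integration.integral_add[OF i2 integrable_mult_right[OF i3, of \<alpha>]] by simp
  finally show ?thesis unfolding 1 by simp
qed

end

section \<open>Energy balance along a time lag\<close>

context borel_solution
begin

text \<open>The weak formulation with test field \<open>u r\<close>, integrated from
  \<open>s\<close> to \<open>r\<close>, expresses (u s, u r) - |u r|^2; the product is then replaced
  by half the sum of the squares.\<close>

lemma lag_inequality: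
  assumes r: "good r" and h: "h > 0"
  shows "1/2 * (L2norm \<Omega> (u r))\<^sup>2 - 1/2 * (L2norm \<Omega> (u (max (r - h) 0)))\<^sup>2
     \<le> - (\<mu> * two.lagged_pairing \<Gamma> \<Gamma> h r + pairing.lagged_pairing flux U h r)"
proof -
  have rT: "0 < r" "r < T" using r by (auto simp: good_def)
  \<comment> \<open>The window is cut off at the initial time. The lagged pairings are unaffected,
    as \<open>\<Gamma>\<close> and \<open>flux\<close> vanish at negative times.\<close>
  define s where "s = max (r - h) 0"
  have s: "0 \<le> s" "s < r" using rT h by (auto simp: s_def)
  define F where "F t = \<mu> * L2inner \<Omega> (G t) (G r) + bform \<Omega> (u t) (G t) (u r)
      + \<alpha> * L2inner \<Omega> (\<lambda>x. norm (u t x) powr (\<beta> - 1) *\<^sub>R u t x) (u r) - L2inner \<Omega> f (u r)" for t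
  have w: "integrable (lebesgue_on {0<..<T}) F \<and>
               (\<forall>\<psi>. test_fun 0 T \<psi> \<longrightarrow>
                  integral\<^sup>L (lebesgue_on {0<..<T}) (\<lambda>t. L2inner \<Omega> (u t) (u r) * deriv \<psi> t)
                  = integral\<^sup>L (lebesgue_on {0<..<T}) (\<lambda>t. F t * \<psi> t))"
    by (rule weak[of "u r" "G r"]) (use r good_Lp[OF r] in \<open>auto simp: good_def F_def[abs_def]\<close>)
  have ur: "u r \<in> H_space \<Omega>" using uH rT by simp
  have eq: "L2inner \<Omega> (u s) (u r) - L2inner \<Omega> (u r) (u r) = integral\<^sup>L (lebesgue_on {0<..<T}) (\<lambda>x. indicator {s<..<r} x * F x)"
    by (rule distributional_derivative_integral[OF u_cont[OF ur]]) (use w s rT in auto)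
  define K1 where "K1 \<tau> = (if r - h < \<tau> \<and> \<tau> < r then (\<integral>x. inner (\<Gamma> (\<tau>, x)) (\<Gamma> (r, x)) \<partial>lborel) else 0)" for \<tau>
  define K2 where "K2 \<tau> = (if r - h < \<tau> \<and> \<tau> < r then (\<integral>x. inner (flux (\<tau>, x)) (U (r, x)) \<partial>lborel) else 0)" for \<tau>
  have \<Gamma>2: "integrable lborel (\<lambda>z. norm (\<Gamma> z) powr 2)" using \<Gamma>_int by simp
  have \<Gamma>r: "integrable lborel (\<lambda>x. norm (\<Gamma> (r, x)) powr 2)" using good_slice_int(2)[OF r] by simp
  have "integrable lborel (\<lambda>\<tau>. \<integral>x. (if r - h < \<tau> \<and> \<tau> < r then inner (\<Gamma> (\<tau>, x)) (\<Gamma> (r, x)) else 0) \<partial>lborel)"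
    by (rule lborel_pair.integrable_fst[OF two.lagged_slice_integrable[OF \<Gamma> \<Gamma>2 \<Gamma> \<Gamma>r h]])
  moreover have "(\<integral>x. (if r - h < \<tau> \<and> \<tau> < r then inner (\<Gamma> (\<tau>, x)) (\<Gamma> (r, x)) else 0) \<partial>lborel) = K1 \<tau>" for \<tau>
    by (auto simp: K1_def)
  ultimately have K1i: "integrable lborel K1" by simp
  have "integrable lborel (\<lambda>\<tau>. \<integral>x. (if r - h < \<tau> \<and> \<tau> < r then inner (flux (\<tau>, x)) (U (r, x)) else 0) \<partial>lborel)"
    by (rule lborel_pair.integrable_fst[OF pairing.lagged_slice_integrable[OF flux_borel flux_int U good_slice_int(1)[OF r] h]])
  moreover have "(\<integral>x. (if r - h < \<tau> \<and> \<tau> < r then inner (flux (\<tau>, x)) (U (r, x)) else 0) \<partial>lborel) = K2 \<tau>" for \<tau>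
    by (auto simp: K2_def)
  ultimately have K2i: "integrable lborel K2" by simp
  have "integral\<^sup>L (lebesgue_on {0<..<T}) (\<lambda>x. indicator {s<..<r} x * F x) = (\<integral>\<tau>. \<mu> * K1 \<tau> + K2 \<tau> \<partial>lborel)"
  proof (rule lebesgue_on_eq_lborel(2))
    show "(\<lambda>\<tau>. \<mu> * K1 \<tau> + K2 \<tau>) \<in> borel_measurable borel" using K1i K2i by simp
    show "\<mu> * K1 \<tau> + K2 \<tau> = 0" if "\<tau> \<notin> {0<..<T}" for \<tau>
    proof -
      have "\<Gamma> (\<tau>, x) = 0" "flux (\<tau>, x) = 0" for x using \<Gamma>_supp[of "(\<tau>, x)"] flux_supp[of "(\<tau>, x)"] that by auto
      then show ?thesis by (simp add: K1_def K2_def)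
    qed
    have "F \<in> borel_measurable (lebesgue_on {0<..<T})" using w by auto
    moreover have "{s<..<r} \<in> sets (lebesgue_on {0<..<T})" by (subst sets_restrict_space_iff) (use s rT in auto)
    ultimately show "(\<lambda>x. indicator {s<..<r} x * F x) \<in> borel_measurable (lebesgue_on {0<..<T})"
      by (intro borel_measurable_times borel_measurable_indicator) auto
    show "AE \<tau> in lborel. \<tau> \<in> {0<..<T} \<longrightarrow> \<mu> * K1 \<tau> + K2 \<tau> = indicator {s<..<r} \<tau> * F \<tau>"
      using AE_good
    proof eventually_elim
      case (elim \<tau>)
      show ?case
      proof
        assume t: "\<tau> \<in> {0<..<T}"
        then have "good \<tau>" using elim by blast
        have c: "(r - h < \<tau> \<and> \<tau> < r) \<longleftrightarrow> \<tau> \<in> {s<..<r}" using t by (auto simp: s_def)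
        show "\<mu> * K1 \<tau> + K2 \<tau> = indicator {s<..<r} \<tau> * F \<tau>"
          using weak_form_slices[OF \<open>good \<tau>\<close> r] unfolding K1_def K2_def c F_def by (simp add: indicator_def)
      qed
    qed
  qed simp
  also have "\<dots> = \<mu> * integral\<^sup>L lborel K1 + integral\<^sup>L lborel K2" using K1i K2i by simp
  also have "\<dots> = \<mu> * two.lagged_pairing \<Gamma> \<Gamma> h r + pairing.lagged_pairing flux U h r"
    by (simp add: two.lagged_pairing_def pairing.lagged_pairing_def K1_def[abs_def] K2_def[abs_def])
  finally have e1: "L2inner \<Omega> (u s) (u r) - (L2norm \<Omega> (u r))\<^sup>2 = \<mu> * two.lagged_pairing \<Gamma> \<Gamma> h r + pairing.lagged_pairing flux U h r"
    using eq by (simp add: L2norm_sq_inner)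
  have us: "L2 \<Omega> (u s)" using uH[of s] s rT H_space_L2 by auto
  have "L2inner \<Omega> (u s) (u r) \<le> L2norm \<Omega> (u s) * L2norm \<Omega> (u r)" by (rule L2_Cauchy_Schwarz[OF us good_L2(1)[OF r]])
  also have "\<dots> \<le> 1/2 * (L2norm \<Omega> (u s))\<^sup>2 + 1/2 * (L2norm \<Omega> (u r))\<^sup>2"
    using sum_squares_bound[of "L2norm \<Omega> (u s)" "L2norm \<Omega> (u r)"] by simp
  finally show ?thesis using e1 unfolding s_def[symmetric] by linarith
qed

definition Y :: "real \<Rightarrow> real" where "Y t = (\<integral>x. (norm (U (t, x)))\<^sup>2 \<partial>lborel)"
definition E :: "real \<Rightarrow> real" where "E t = (\<integral>x. (norm (\<Gamma> (t, x)))\<^sup>2 \<partial>lborel)"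

lemma U_L2: "integrable lborel (\<lambda>z. (norm (U z))\<^sup>2)"
  by (rule L2_of_Lp[OF U _ U_int emeasure_Q_finite Q_borel U_supp]) (use \<beta> in auto)

lemma Y_int: "integrable lborel Y" "integral\<^sup>L lborel Y = (\<integral>z. (norm (U z))\<^sup>2 \<partial>lborel)"
proof -
  have i: "integrable (lborel \<Otimes>\<^sub>M lborel) (\<lambda>z. (norm (U z))\<^sup>2)" using U_L2 by (simp add: lborel_prod)
  show "integrable lborel Y" unfolding Y_def[abs_def] by (rule lborel_pair.integrable_fst'[OF i])
  show "integral\<^sup>L lborel Y = (\<integral>z. (norm (U z))\<^sup>2 \<partial>lborel)"
    unfolding Y_def[abs_def] using lborel_pair.integral_fst'[OF i] by (simp add: lborel_prod)
qed

lemma E_int: "integrable lborel E" "integral\<^sup>L lborel E = (\<integral>z. (norm (\<Gamma> z))\<^sup>2 \<partial>lborel)"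
proof -
  have i: "integrable (lborel \<Otimes>\<^sub>M lborel) (\<lambda>z. (norm (\<Gamma> z))\<^sup>2)" using \<Gamma>_int by (simp add: lborel_prod)
  show "integrable lborel E" unfolding E_def[abs_def] by (rule lborel_pair.integrable_fst'[OF i])
  show "integral\<^sup>L lborel E = (\<integral>z. (norm (\<Gamma> z))\<^sup>2 \<partial>lborel)"
    unfolding E_def[abs_def] using lborel_pair.integral_fst'[OF i] by (simp add: lborel_prod)
qed

lemma Y_nonneg: "0 \<le> Y t" and E_nonneg: "0 \<le> E t" by (simp_all add: Y_def E_def)

lemma Y_supp: "t \<notin> {0<..<T} \<Longrightarrow> Y t = 0" and E_supp: "t \<notin> {0<..<T} \<Longrightarrow> E t = 0"
proof -
  assume "t \<notin> {0<..<T}"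
  then have "U (t, x) = 0" "\<Gamma> (t, x) = 0" for x using U_supp[of "(t, x)"] \<Gamma>_supp[of "(t, x)"] by auto
  then show "Y t = 0" "E t = 0" by (simp_all add: Y_def E_def)
qed

lemma Y_good: "good t \<Longrightarrow> Y t = (L2norm \<Omega> (u t))\<^sup>2" and E_good: "good t \<Longrightarrow> E t = (L2norm \<Omega> (G t))\<^sup>2"
  by (simp_all add: good_norms Y_def E_def)

text \<open>On integrating \<open>lag_inequality\<close> over \<open>r\<close>, the energies at
  \<open>r\<close> and at \<open>r - h\<close> cancel up to two windows of length \<open>h\<close>.
  In the first window the earlier time is cut off to 0, so the initial energy enters
  exactly.\<close>

lemma averaged_lag_inequality:
  assumes h: "0 < h" "h < T"
  shows "1/2 * (\<integral>r. Y r * indicator {T - h..<T} r \<partial>lborel) - 1/2 * h * (L2norm \<Omega> (u 0))\<^sup>2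
     \<le> - (\<mu> * integral\<^sup>L lborel (two.lagged_pairing \<Gamma> \<Gamma> h) + integral\<^sup>L lborel (pairing.lagged_pairing flux U h))"
proof -
  define y0 where "y0 = (L2norm \<Omega> (u 0))\<^sup>2"
  have \<Gamma>2: "integrable lborel (\<lambda>z. norm (\<Gamma> z) powr 2)" using \<Gamma>_int by simp
  have l1: "integrable lborel (two.lagged_pairing \<Gamma> \<Gamma> h)" by (rule two.lagged_pairing_integral(1)[OF \<Gamma> \<Gamma>2 \<Gamma> \<Gamma>2 h(1)])
  have l2: "integrable lborel (pairing.lagged_pairing flux U h)" by (rule pairing.lagged_pairing_integral(1)[OF flux_borel flux_int U U_int h(1)])
  have [measurable]: "Y \<in> borel_measurable borel" using Y_int(1) by auto
  \<comment> \<open>Translates of null sets are null, so the earlier time \<open>r - h\<close> is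
    good for almost every \<open>r\<close> too.\<close>
  have tr: "AE r in lborel. r - h \<in> {0<..<T} \<longrightarrow> good (r - h)"
  proof -
    have "AE t in distr lborel borel ((+) (- h)). t \<in> {0<..<T} \<longrightarrow> good t"
      unfolding lborel_distr_plus by (rule AE_good)
    from AE_distrD[OF _ this] show ?thesis by simp
  qed
  \<comment> \<open>The energy at the earlier time for almost every \<open>r\<close>: the initial
    energy while the window is cut off, the shifted \<open>Y\<close> afterwards.\<close>
  define Z where "Z r = y0 * indicator {0<..h} r + Y (r + (- h)) * indicator {h<..<T} r" for r
  have Yti: "integrable lborel (\<lambda>r. Y (r + (- h)))" using lborel_translation(1)[of Y "- h"] Y_int(1) by simp
  have YtI: "(\<integral>r. Y (r + (- h)) * indicator {h<..<T} r \<partial>lborel) = (\<integral>r. Y r * indicator {0<..<T - h} r \<partial>lborel)"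
  proof -
    have "(\<integral>r. Y (r + (- h)) * indicator {h<..<T} r \<partial>lborel) = (\<integral>r. (\<lambda>r. Y r * indicator {0<..<T - h} r) (r + (- h)) \<partial>lborel)"
      by (intro Bochner_Integration.integral_cong) (auto simp: indicator_def)
    also have "\<dots> = (\<integral>r. Y r * indicator {0<..<T - h} r \<partial>lborel)" by (rule lborel_translation(2)) simp
    finally show ?thesis .
  qed
  have i1: "integrable lborel (\<lambda>r. Y (r + (- h)) * indicator {h<..<T} r)"
    using integrable_mult_indicator[OF _ Yti, of "{h<..<T}"] by (simp add: mult.commute)
  have i2: "integrable lborel (\<lambda>r. y0 * indicator {0<..h} r)" "(\<integral>r. y0 * indicator {0<..h} r \<partial>lborel) = y0 * h"
    using h by (simp_all add: integrable_indicator_iff)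
  have Zi: "integrable lborel Z" unfolding Z_def[abs_def] using i1 i2 by simp
  have ZI: "integral\<^sup>L lborel Z = y0 * h + (\<integral>r. Y r * indicator {0<..<T - h} r \<partial>lborel)"
    unfolding Z_def[abs_def] Bochner_Integration.integral_add[OF i2(1) i1] YtI i2(2) ..
  let ?l = "\<lambda>r. \<mu> * two.lagged_pairing \<Gamma> \<Gamma> h r + pairing.lagged_pairing flux U h r"
  have "AE r in lborel. 1/2 * Y r \<le> 1/2 * Z r - ?l r"
    using AE_good tr
  proof eventually_elim
    case (elim r)
    show ?case
    proof (cases "r \<in> {0<..<T}")
      case True
      then have g: "good r" using elim by blast
      have "(L2norm \<Omega> (u (max (r - h) 0)))\<^sup>2 = Z r"
      proof (cases "r \<le> h")
        case rh: True
        then show ?thesis using True by (simp add: Z_def y0_def)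
      next
        case rh: False
        then have "good (r - h)" using elim True h by auto
        then show ?thesis using Y_good[of "r - h"] rh True by (simp add: Z_def)
      qed
      then show ?thesis using lag_inequality[OF g h(1)] Y_good[OF g] by simp
    next
      case False
      \<comment> \<open>Off (0, T) the factor taken at time \<open>r\<close> vanishes, and with it
        both pairings.\<close>
      have "U (r, x) = 0" "\<Gamma> (r, x) = 0" for x using U_supp[of "(r, x)"] \<Gamma>_supp[of "(r, x)"] False by auto
      then have "(if c then (\<integral>x. inner (\<Gamma> (\<tau>, x)) (\<Gamma> (r, x)) \<partial>lborel) else 0) = 0"
          "(if c then (\<integral>x. inner (flux (\<tau>, x)) (U (r, x)) \<partial>lborel) else 0) = 0" for c \<tau> by simp_all
      then have "?l r = 0" by (simp only: two.lagged_pairing_def pairing.lagged_pairing_def integral_zero mult_zero_right add_0)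
      moreover have "Z r \<ge> 0" using Y_nonneg by (simp add: Z_def y0_def indicator_def)
      ultimately show ?thesis using Y_supp[OF False] by simp
    qed
  qed
  then have "(\<integral>r. 1/2 * Y r \<partial>lborel) \<le> (\<integral>r. 1/2 * Z r - ?l r \<partial>lborel)"
    using Y_int(1) Zi l1 l2 by (intro integral_mono_AE) auto
  also have "\<dots> = 1/2 * integral\<^sup>L lborel Z - (\<mu> * integral\<^sup>L lborel (two.lagged_pairing \<Gamma> \<Gamma> h) + integral\<^sup>L lborel (pairing.lagged_pairing flux U h))"
    using Zi l1 l2 by simp
  finally have 1: "1/2 * integral\<^sup>L lborel Y \<le> 1/2 * (y0 * h + (\<integral>r. Y r * indicator {0<..<T - h} r \<partial>lborel))
     - (\<mu> * integral\<^sup>L lborel (two.lagged_pairing \<Gamma> \<Gamma> h) + integral\<^sup>L lborel (pairing.lagged_pairing flux U h))"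
    by (simp add: ZI)
  have j: "integrable lborel (\<lambda>r. Y r * indicator A r)" if "A \<in> sets borel" for A
    using integrable_mult_indicator[OF _ Y_int(1), of A] that by (simp add: mult.commute)
  have "integral\<^sup>L lborel Y = (\<integral>r. Y r * indicator {0<..<T - h} r + Y r * indicator {T - h..<T} r \<partial>lborel)"
    using Y_supp h by (intro Bochner_Integration.integral_cong) (auto simp: indicator_def)
  also have "\<dots> = (\<integral>r. Y r * indicator {0<..<T - h} r \<partial>lborel) + (\<integral>r. Y r * indicator {T - h..<T} r \<partial>lborel)"
    by (intro Bochner_Integration.integral_add j) auto
  finally show ?thesis using 1 unfolding y0_def by (simp add: algebra_simps)
qed

text \<open>Weak continuity suffices: (u r, u T) tends to |u T|^2 and is at most half the sum of the
  squares, so |u r|^2 is at least |u T|^2 - e for good \<open>r\<close> near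
  \<open>T\<close>.\<close>

lemma terminal_energy_le:
  assumes e: "e > 0"
  shows "\<exists>\<delta>>0. \<forall>h. 0 < h \<and> h < \<delta> \<longrightarrow> h * ((L2norm \<Omega> (u T))\<^sup>2 - e) \<le> (\<integral>r. Y r * indicator {T - h..<T} r \<partial>lborel)"
proof -
  have uT: "u T \<in> H_space \<Omega>" using uH T by simp
  obtain d where d: "d > 0" "\<And>r. r \<in> {0..T} \<Longrightarrow> dist r T < d \<Longrightarrow> dist (L2inner \<Omega> (u r) (u T)) (L2inner \<Omega> (u T) (u T)) < e / 2"
    using u_cont[OF uT, unfolded continuous_on_iff, rule_format, of T "e/2"] T e by auto
  show ?thesis
  proof (intro exI conjI allI impI)
    show "min d T > 0" using d T by simp
    fix h assume h: "0 < h \<and> h < min d T"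
    let ?c = "(L2norm \<Omega> (u T))\<^sup>2 - e"
    have "h * ?c = (\<integral>r. ?c * indicator {T - h..<T} r \<partial>lborel)" using h by simp
    also have "\<dots> \<le> (\<integral>r. Y r * indicator {T - h..<T} r \<partial>lborel)"
    proof (rule integral_mono_AE)
      show "integrable lborel (\<lambda>r. ?c * indicator {T - h..<T} r)" using h by (simp add: integrable_indicator_iff)
      show "integrable lborel (\<lambda>r. Y r * indicator {T - h..<T} r)"
        using integrable_mult_indicator[OF _ Y_int(1), of "{T - h..<T}"] by (simp add: mult.commute)
      show "AE r in lborel. ?c * indicator {T - h..<T} r \<le> Y r * indicator {T - h..<T} r"
        using AE_good
      proof eventually_elim
        case (elim r)
        show ?case
        proof (cases "r \<in> {T - h..<T}")
          case True
          then have g: "good r" using elim h by auto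
          have "dist r T < d" "r \<in> {0..T}" using True h by (auto simp: dist_real_def)
          then have "dist (L2inner \<Omega> (u r) (u T)) (L2inner \<Omega> (u T) (u T)) < e / 2" by (intro d(2))
          then have "L2inner \<Omega> (u r) (u T) > (L2norm \<Omega> (u T))\<^sup>2 - e / 2"
            unfolding L2norm_sq_inner dist_real_def by linarith
          moreover have "L2inner \<Omega> (u r) (u T) \<le> 1/2 * (L2norm \<Omega> (u r))\<^sup>2 + 1/2 * (L2norm \<Omega> (u T))\<^sup>2"
            using L2_Cauchy_Schwarz[OF good_L2(1)[OF g] H_space_L2[OF uT]] sum_squares_bound[of "L2norm \<Omega> (u r)" "L2norm \<Omega> (u T)"] by simp
          ultimately have "?c \<le> Y r" unfolding Y_good[OF g] by linarith
          then show ?thesis using True by simp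
        qed simp
      qed
    qed
    finally show "h * ?c \<le> (\<integral>r. Y r * indicator {T - h..<T} r \<partial>lborel)" .
  qed
qed

text \<open>The averaged inequality divided by \<open>h\<close>, for small \<open>h\<close>: the
  pairings are evaluated by \<open>lagged_pairing_limit\<close> and the terminal window by
  \<open>terminal_energy_le\<close>.\<close>

lemma energy_inequality_flux:
  "(L2norm \<Omega> (u T))\<^sup>2 + 2 * (\<mu> * (\<integral>z. (norm (\<Gamma> z))\<^sup>2 \<partial>lborel) + (\<integral>z. inner (flux z) (U z) \<partial>lborel)) \<le> (L2norm \<Omega> (u 0))\<^sup>2"
proof (rule field_le_epsilon)
  fix e :: real assume e: "e > 0"
  obtain R where "\<forall>z\<in>{0<..<T} \<times> \<Omega>. norm z \<le> R" using Q_bounded[unfolded bounded_iff] by auto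
  then have "{0<..<T} \<times> \<Omega> \<subseteq> cball 0 R" by auto
  then have Us: "\<And>z. z \<notin> cball 0 R \<Longrightarrow> U z = 0" and \<Gamma>s: "\<And>z. z \<notin> cball 0 R \<Longrightarrow> \<Gamma> z = 0"
    using U_supp \<Gamma>_supp by blast+
  have \<Gamma>2: "integrable lborel (\<lambda>z. norm (\<Gamma> z) powr 2)" using \<Gamma>_int by simp
  define I1 where "I1 = (\<integral>z. inner (\<Gamma> z) (\<Gamma> z) \<partial>lborel)"
  define I2 where "I2 = (\<integral>z. inner (flux z) (U z) \<partial>lborel)"
  \<comment> \<open>Error budget per unit of \<open>h\<close>: \<open>e/4\<close> from the terminal
    window and \<open>e/8\<close> from each pairing, where \<open>e1\<close> compensates the factor
    \<mu>. Doubling the inequality turns the sum into \<open>e\<close>.\<close>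
  define e1 where "e1 = e / (8 * (\<bar>\<mu>\<bar> + 1))"
  have e1: "e1 > 0" using e by (simp add: e1_def add_nonneg_pos)
  obtain d1 where d1: "d1 > 0" "\<And>h. 0 < h \<Longrightarrow> h < d1 \<Longrightarrow> \<bar>integral\<^sup>L lborel (two.lagged_pairing \<Gamma> \<Gamma> h) - h * I1\<bar> \<le> e1 * h"
    using two.lagged_pairing_limit[OF \<Gamma> \<Gamma>2 \<Gamma> \<Gamma>2 \<Gamma>s e1] unfolding I1_def by blast
  have e8: "e / 8 > 0" using e by simp
  obtain d2 where d2: "d2 > 0" "\<And>h. 0 < h \<Longrightarrow> h < d2 \<Longrightarrow> \<bar>integral\<^sup>L lborel (pairing.lagged_pairing flux U h) - h * I2\<bar> \<le> (e/8) * h"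
    using pairing.lagged_pairing_limit[OF flux_borel flux_int U U_int Us e8] unfolding I2_def by blast
  obtain d3 where d3: "d3 > 0" "\<And>h. 0 < h \<Longrightarrow> h < d3 \<Longrightarrow> h * ((L2norm \<Omega> (u T))\<^sup>2 - e/2) \<le> (\<integral>r. Y r * indicator {T - h..<T} r \<partial>lborel)"
    using terminal_energy_le[of "e/2"] e by auto
  define h where "h = min (min d1 d2) (min d3 T) / 2"
  have h: "0 < h" "h < d1" "h < d2" "h < d3" "h < T" using d1 d2 d3 T by (auto simp: h_def)
  define L1 where "L1 = integral\<^sup>L lborel (two.lagged_pairing \<Gamma> \<Gamma> h)"
  define L2 where "L2 = integral\<^sup>L lborel (pairing.lagged_pairing flux U h)"
  define W where "W = h * ((L2norm \<Omega> (u T))\<^sup>2 - e/2)"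
  have a: "1/2 * W - 1/2 * h * (L2norm \<Omega> (u 0))\<^sup>2 \<le> - (\<mu> * L1 + L2)"
    using averaged_lag_inequality[OF h(1,5), folded L1_def L2_def] d3(2)[OF h(1,4), folded W_def] by linarith
  have b: "\<bar>L1 - h * I1\<bar> \<le> e1 * h" "\<bar>L2 - h * I2\<bar> \<le> e/8 * h"
    using d1(2)[OF h(1,2)] d2(2)[OF h(1,3)] by (auto simp: L1_def L2_def)
  have b2: "h * I2 - e/8 * h \<le> L2" using b(2) by linarith
  have c: "- (\<mu> * L1) \<le> - (\<mu> * (h * I1)) + e/8 * h"
  proof -
    have "\<bar>\<mu> * (L1 - h * I1)\<bar> \<le> \<bar>\<mu>\<bar> * (e1 * h)" unfolding abs_mult by (intro mult_left_mono b) simp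
    also have "\<dots> \<le> (\<bar>\<mu>\<bar> + 1) * (e1 * h)" using e1 h by (intro mult_right_mono) auto
    also have "\<dots> = e/8 * h"
    proof -
      have "k * (e / (8 * k) * h) = e/8 * h" if "k \<noteq> 0" for k using that by simp
      from this[of "\<bar>\<mu>\<bar> + 1"] show ?thesis unfolding e1_def by linarith
    qed
    finally show ?thesis unfolding right_diff_distrib by linarith
  qed
  have "h * ((L2norm \<Omega> (u T))\<^sup>2 + 2 * (\<mu> * I1 + I2)) \<le> h * ((L2norm \<Omega> (u 0))\<^sup>2 + e)"
    using a b2 c unfolding W_def by (simp add: algebra_simps)
  then have "(L2norm \<Omega> (u T))\<^sup>2 + 2 * (\<mu> * I1 + I2) \<le> (L2norm \<Omega> (u 0))\<^sup>2 + e" using h(1) by simp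
  then show "(L2norm \<Omega> (u T))\<^sup>2 + 2 * (\<mu> * (\<integral>z. (norm (\<Gamma> z))\<^sup>2 \<partial>lborel) + (\<integral>z. inner (flux z) (U z) \<partial>lborel)) \<le> (L2norm \<Omega> (u 0))\<^sup>2 + e"
    by (simp add: I1_def I2_def power2_norm_eq_inner)
qed

text \<open>The pointwise coercivity is integrated over the cylinder; off it every term is zero, the
  constant being cut off by the indicator.\<close>

lemma energy_inequality_coercive:
  assumes coercive: "\<And>u G f. \<delta> * ((norm G)\<^sup>2 + (norm u)\<^sup>2) - C * (1 + (norm f)\<^sup>2) \<le>
     \<mu> * (norm G)\<^sup>2 + inner (convect u G + (\<alpha> * norm u powr (\<beta> - 1)) *\<^sub>R u - f) u"
  shows "(L2norm \<Omega> (u T))\<^sup>2 + 2 * \<delta> * (integral\<^sup>L lborel E + integral\<^sup>L lborel Y)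
    \<le> (L2norm \<Omega> (u 0))\<^sup>2 + 2 * C * (measure lebesgue \<Omega> + (L2norm \<Omega> f)\<^sup>2) * T"
proof -
  have fi: "integrable lborel (\<lambda>z. inner (flux z) (U z))"
    by (rule pairing.integrable_pairing) (use flux_int U_int in auto)
  have "(\<integral>z. \<delta> * ((norm (\<Gamma> z))\<^sup>2 + (norm (U z))\<^sup>2) - C * ((1 + (norm (fh (snd z)))\<^sup>2) * indicator ({0<..<T} \<times> \<Omega>) z) \<partial>lborel)
     \<le> (\<integral>z. \<mu> * (norm (\<Gamma> z))\<^sup>2 + inner (flux z) (U z) \<partial>lborel)"
  proof (rule integral_mono)
    show "integrable lborel (\<lambda>z. \<delta> * ((norm (\<Gamma> z))\<^sup>2 + (norm (U z))\<^sup>2) - C * ((1 + (norm (fh (snd z)))\<^sup>2) * indicator ({0<..<T} \<times> \<Omega>) z))"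
      using U_L2 \<Gamma>_int force_int(1) by simp
    show "integrable lborel (\<lambda>z. \<mu> * (norm (\<Gamma> z))\<^sup>2 + inner (flux z) (U z))" using \<Gamma>_int fi by simp
    fix z
    show "\<delta> * ((norm (\<Gamma> z))\<^sup>2 + (norm (U z))\<^sup>2) - C * ((1 + (norm (fh (snd z)))\<^sup>2) * indicator ({0<..<T} \<times> \<Omega>) z) \<le> \<mu> * (norm (\<Gamma> z))\<^sup>2 + inner (flux z) (U z)"
    proof (cases "z \<in> {0<..<T} \<times> \<Omega>")
      case True
      then have "fst z \<in> {0<..<T}" by auto
      then have "flux z = convect (U z) (\<Gamma> z) + (\<alpha> * norm (U z) powr (\<beta> - 1)) *\<^sub>R U z - fh (snd z)" by (simp add: flux_def)
      then show ?thesis using coercive[of "\<Gamma> z" "U z" "fh (snd z)"] True by simp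
    next
      case False
      then show ?thesis using U_supp[OF False] \<Gamma>_supp[OF False] by simp
    qed
  qed
  moreover have "(\<integral>z. \<delta> * ((norm (\<Gamma> z))\<^sup>2 + (norm (U z))\<^sup>2) - C * ((1 + (norm (fh (snd z)))\<^sup>2) * indicator ({0<..<T} \<times> \<Omega>) z) \<partial>lborel)
     = \<delta> * (integral\<^sup>L lborel E + integral\<^sup>L lborel Y) - C * (T * (measure lebesgue \<Omega> + (L2norm \<Omega> f)\<^sup>2))"
    unfolding E_int(2) Y_int(2) force_int(2)[symmetric] using U_L2 \<Gamma>_int force_int(1) by simp
  moreover have "(\<integral>z. \<mu> * (norm (\<Gamma> z))\<^sup>2 + inner (flux z) (U z) \<partial>lborel) = \<mu> * (\<integral>z. (norm (\<Gamma> z))\<^sup>2 \<partial>lborel) + (\<integral>z. inner (flux z) (U z) \<partial>lborel)"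
    using \<Gamma>_int fi by simp
  ultimately show ?thesis using energy_inequality_flux by (simp add: algebra_simps)
qed

end

lemma weak_solution_borel:
  assumes "open \<Omega>" "bounded \<Omega>" "\<beta> \<ge> 3" "\<alpha> > 0" "L2 \<Omega> f" and sol: "weak_solution \<Omega> \<mu> \<alpha> \<beta> f u0 T u"
  obtains G U \<Gamma> fh where "borel_solution \<Omega> \<mu> \<alpha> \<beta> T f u G U \<Gamma> fh"
proof -
  let ?Q = "{0<..<T} \<times> \<Omega>"
  have Q: "?Q \<in> sets borel" using assms(1) by (intro borel_open open_Times) auto
  have \<Omega>b: "\<Omega> \<in> sets borel" using assms(1) by simp
  obtain G where um: "(\<lambda>(t,x). u t x) \<in> borel_measurable (lebesgue_on ?Q)"
    and ui: "integrable (lebesgue_on ?Q) (\<lambda>(t,x). norm (u t x) powr (\<beta> + 1))"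
    and Gm: "(\<lambda>(t,x). G t x) \<in> borel_measurable (lebesgue_on ?Q)"
    and Gi: "integrable (lebesgue_on ?Q) (\<lambda>(t,x). (norm (G t x))\<^sup>2)"
    and V: "AE t in lebesgue_on {0<..<T}. V_grad \<Omega> (u t) (G t)"
    and weak: "\<And>v Gv F. V_grad \<Omega> v Gv \<Longrightarrow> Lp \<Omega> (\<beta> + 1) v \<Longrightarrow>
        F = (\<lambda>t. \<mu> * L2inner \<Omega> (G t) Gv + bform \<Omega> (u t) (G t) v
                        + \<alpha> * L2inner \<Omega> (\<lambda>x. norm (u t x) powr (\<beta> - 1) *\<^sub>R u t x) v
                        - L2inner \<Omega> f v) \<Longrightarrow>
        integrable (lebesgue_on {0<..<T}) F \<and>
               (\<forall>\<psi>. test_fun 0 T \<psi> \<longrightarrow>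
                  integral\<^sup>L (lebesgue_on {0<..<T}) (\<lambda>t. L2inner \<Omega> (u t) v * deriv \<psi> t)
                  = integral\<^sup>L (lebesgue_on {0<..<T}) (\<lambda>t. F t * \<psi> t))"
    using sol unfolding weak_solution_def Let_def by (elim conjE exE) blast
  have T: "T > 0" and uH: "\<And>t. t \<in> {0..T} \<Longrightarrow> u t \<in> H_space \<Omega>"
    and uc: "\<And>v. v \<in> H_space \<Omega> \<Longrightarrow> continuous_on {0..T} (\<lambda>t. L2inner \<Omega> (u t) v)"
    using sol unfolding weak_solution_def by auto
  obtain U where U: "U \<in> borel_measurable borel" "\<And>z. z \<notin> ?Q \<Longrightarrow> U z = 0" "AE z in lborel. z \<in> ?Q \<longrightarrow> U z = (case z of (t, x) \<Rightarrow> u t x)"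
    using borel_representative[OF Q um] by blast
  obtain \<Gamma> where \<Gamma>: "\<Gamma> \<in> borel_measurable borel" "\<And>z. z \<notin> ?Q \<Longrightarrow> \<Gamma> z = 0" "AE z in lborel. z \<in> ?Q \<longrightarrow> \<Gamma> z = (case z of (t, x) \<Rightarrow> G t x)"
    using borel_representative[OF Q Gm] by blast
  have "f \<in> borel_measurable (lebesgue_on \<Omega>)" using assms by (simp add: L2_def)
  then obtain fh where fh: "fh \<in> borel_measurable borel" "\<And>x. x \<notin> \<Omega> \<Longrightarrow> fh x = 0" "AE x in lborel. x \<in> \<Omega> \<longrightarrow> fh x = f x"
    using borel_representative[OF \<Omega>b] by blast
  have [measurable]: "U \<in> borel_measurable borel" "\<Gamma> \<in> borel_measurable borel" by (fact U \<Gamma>)+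
  have Ui: "integrable lborel (\<lambda>z. norm (U z) powr (\<beta> + 1))"
  proof -
    have "AE z in lborel. z \<in> ?Q \<longrightarrow> norm (U z) powr (\<beta> + 1) = (case z of (t, x) \<Rightarrow> norm (u t x) powr (\<beta> + 1))"
      using U(3) by eventually_elim auto
    from lebesgue_on_eq_lborel(1)[OF Q _ _ borel_measurable_integrable[OF ui] this] ui U show ?thesis by simp
  qed
  have \<Gamma>i: "integrable lborel (\<lambda>z. (norm (\<Gamma> z))\<^sup>2)"
  proof -
    have "AE z in lborel. z \<in> ?Q \<longrightarrow> (norm (\<Gamma> z))\<^sup>2 = (case z of (t, x) \<Rightarrow> (norm (G t x))\<^sup>2)"
      using \<Gamma>(3) by eventually_elim auto
    from lebesgue_on_eq_lborel(1)[OF Q _ _ borel_measurable_integrable[OF Gi] this] Gi \<Gamma> show ?thesis by simp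
  qed
  \<comment> \<open>Equality almost everywhere in space-time passes to almost every time slice; the
    gradient relation is already given time by time and is added afterwards.\<close>
  have "AE z in lborel \<Otimes>\<^sub>M lborel. z \<in> ?Q \<longrightarrow> U z = (case z of (t, x) \<Rightarrow> u t x) \<and> \<Gamma> z = (case z of (t, x) \<Rightarrow> G t x)"
    unfolding lborel_prod using U(3) \<Gamma>(3) by eventually_elim auto
  from lborel_pair.AE_pair[OF this]
  have ae: "AE t in lborel. AE x in lborel. (t, x) \<in> ?Q \<longrightarrow> U (t, x) = u t x \<and> \<Gamma> (t, x) = G t x" by simp
  have "AE t in lebesgue. t \<in> {0<..<T} \<longrightarrow> V_grad \<Omega> (u t) (G t)"
    using V by (subst (asm) AE_restrict_space_iff) auto
  then have V': "AE t in lborel. t \<in> {0<..<T} \<longrightarrow> V_grad \<Omega> (u t) (G t)" by (simp add: AE_completion_iff)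
  have rep: "AE t in lborel. t \<in> {0<..<T} \<longrightarrow> V_grad \<Omega> (u t) (G t) \<and> (AE x in lborel. x \<in> \<Omega> \<longrightarrow> U (t, x) = u t x \<and> \<Gamma> (t, x) = G t x)"
    using ae V' by eventually_elim (auto elim: eventually_mono)
  have "borel_solution \<Omega> \<mu> \<alpha> \<beta> T f u G U \<Gamma> fh"
    by (unfold_locales; fact assms T fh U(1) U(2) Ui \<Gamma>(1) \<Gamma>(2) \<Gamma>i rep uH uc weak)
  then show ?thesis by (rule that)
qed

text \<open>Hides the representatives: only two functions of time remain visible, which at almost
  every time are the squared norms of a gradient and of the field.\<close>

theorem energy_inequality:
  assumes "open \<Omega>" "bounded \<Omega>" "\<beta> \<ge> 3" "\<alpha> > 0" "L2 \<Omega> f" and sol: "weak_solution \<Omega> \<mu> \<alpha> \<beta> f u0 T u"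
    and coercive: "\<And>u G f. \<delta> * ((norm G)\<^sup>2 + (norm u)\<^sup>2) - C * (1 + (norm f)\<^sup>2) \<le>
     \<mu> * (norm G)\<^sup>2 + inner (convect u G + (\<alpha> * norm u powr (\<beta> - 1)) *\<^sub>R u - f) u"
  obtains E Y :: "real \<Rightarrow> real" where "integrable lborel E" "integrable lborel Y" "\<And>t. 0 \<le> E t" "\<And>t. 0 \<le> Y t"
    "\<And>t. t \<notin> {0<..<T} \<Longrightarrow> E t = 0" "\<And>t. t \<notin> {0<..<T} \<Longrightarrow> Y t = 0"
    "AE t in lborel. t \<in> {0<..<T} \<longrightarrow> Y t = (L2norm \<Omega> (u t))\<^sup>2 \<and> (\<exists>Gt. V_grad \<Omega> (u t) Gt \<and> E t = (L2norm \<Omega> Gt)\<^sup>2)"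
    "(L2norm \<Omega> (u T))\<^sup>2 + 2 * \<delta> * (integral\<^sup>L lborel E + integral\<^sup>L lborel Y)
      \<le> (L2norm \<Omega> (u 0))\<^sup>2 + 2 * C * (measure lebesgue \<Omega> + (L2norm \<Omega> f)\<^sup>2) * T"
proof -
  obtain G U \<Gamma> fh where "borel_solution \<Omega> \<mu> \<alpha> \<beta> T f u G U \<Gamma> fh"
    using weak_solution_borel[OF assms(1-6)] by blast
  then interpret borel_solution \<Omega> \<mu> \<alpha> \<beta> T f u G U \<Gamma> fh .
  have "AE t in lborel. t \<in> {0<..<T} \<longrightarrow> Y t = (L2norm \<Omega> (u t))\<^sup>2 \<and> (\<exists>Gt. V_grad \<Omega> (u t) Gt \<and> E t = (L2norm \<Omega> Gt)\<^sup>2)"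
    using AE_good by eventually_elim (use Y_good E_good good_def in blast)
  then show ?thesis
    using that[of E Y] E_int(1) Y_int(1) E_nonneg Y_nonneg E_supp Y_supp energy_inequality_coercive[OF coercive] by blast
qed

section \<open>The semigroup of weak solutions\<close>

lemma AE_lborel_translation:
  fixes w :: "'a::euclidean_space"
  assumes "AE x in lborel. P x" shows "AE x in lborel. P (x + w)"
proof -
  have "AE x in distr lborel borel ((+) w). P x" unfolding lborel_distr_plus by (rule assms)
  from AE_distrD[OF _ this] show ?thesis by (simp add: add.commute)
qed

text \<open>Everything is moved through a Borel representative. The equality of integrals is for
  functions that vanish on the part of \<open>S'\<close> missed by the translation, as shifted test
  functions do.\<close>

lemma lebesgue_on_translation:
  fixes h :: "'a::euclidean_space \<Rightarrow> 'b::euclidean_space"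
  assumes S: "S \<in> sets borel" "S' \<in> sets borel" and sub: "\<And>z. z \<in> S \<Longrightarrow> z + w \<in> S'"
    and h: "h \<in> borel_measurable (lebesgue_on S')"
  shows "(\<lambda>z. h (z + w)) \<in> borel_measurable (lebesgue_on S)"
    and "integrable (lebesgue_on S') h \<Longrightarrow> integrable (lebesgue_on S) (\<lambda>z. h (z + w))"
    and "(\<And>z. z \<in> S' \<Longrightarrow> z - w \<notin> S \<Longrightarrow> h z = 0) \<Longrightarrow>
      integral\<^sup>L (lebesgue_on S) (\<lambda>z. h (z + w)) = integral\<^sup>L (lebesgue_on S') h"
proof -
  obtain g where g: "g \<in> borel_measurable borel" "\<And>x. x \<notin> S' \<Longrightarrow> g x = 0" "AE x in lborel. x \<in> S' \<longrightarrow> g x = h x"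
    using borel_representative[OF S(2) h] by blast
  define k where "k x = indicator S x *\<^sub>R g (x + w)" for x
  have gw: "(\<lambda>x. g (x + w)) \<in> borel_measurable borel" using g(1) by measurable
  have km: "k \<in> borel_measurable borel" unfolding k_def[abs_def] using gw S(1) by measurable
  have ae: "AE x in lborel. x \<in> S \<longrightarrow> k x = h (x + w)"
    using AE_lborel_translation[OF g(3), of w] by eventually_elim (auto simp: k_def sub)
  have "(\<lambda>x. if x \<in> S then h (x + w) else 0) \<in> borel_measurable lebesgue"
  proof (rule borel_measurable_AE)
    show "k \<in> borel_measurable lebesgue" using km by (simp add: measurable_completion)
    show "AE x in lebesgue. k x = (if x \<in> S then h (x + w) else 0)"
      by (rule AE_completion) (use ae in eventually_elim, auto simp: k_def)
  qed
  then show m: "(\<lambda>z. h (z + w)) \<in> borel_measurable (lebesgue_on S)"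
    using S(1) by (subst (asm) borel_measurable_if) auto
  have kS: "x \<notin> S \<Longrightarrow> k x = 0" for x by (simp add: k_def)
  note r1 = lebesgue_on_eq_lborel[OF S(1) km kS m ae]
  note r2 = lebesgue_on_eq_lborel[OF S(2) g(1,2) h g(3)]
  show "integrable (lebesgue_on S) (\<lambda>z. h (z + w))" if "integrable (lebesgue_on S') h"
  proof -
    have "integrable lborel (\<lambda>x. g (x + w))" using that r2(1) lborel_translation(1)[OF g(1), of w] by simp
    then have "integrable lborel k" unfolding k_def[abs_def] using S(1) by (intro integrable_mult_indicator) auto
    then show ?thesis using r1(1) by simp
  qed
  show "integral\<^sup>L (lebesgue_on S) (\<lambda>z. h (z + w)) = integral\<^sup>L (lebesgue_on S') h" if z: "\<And>z. z \<in> S' \<Longrightarrow> z - w \<notin> S \<Longrightarrow> h z = 0"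
  proof -
    have "AE x in lborel. k x = g (x + w)"
      using AE_lborel_translation[OF g(3), of w]
    proof eventually_elim
      case (elim x)
      show ?case
      proof (cases "x \<in> S")
        case False
        show ?thesis
        proof (cases "x + w \<in> S'")
          case True
          then have "g (x + w) = 0" using elim z[OF True] False by simp
          then show ?thesis by (simp add: k_def)
        qed (use g(2) in \<open>simp add: k_def\<close>)
      qed (simp add: k_def)
    qed
    then have "integral\<^sup>L lborel k = (\<integral>x. g (x + w) \<partial>lborel)"
      using km gw by (intro integral_cong_AE) auto
    also have "\<dots> = integral\<^sup>L lborel g" by (rule lborel_translation(2)[OF g(1)])
    finally show ?thesis using r1(2) r2(2) by simp
  qed
qed

lemma V_grad_H: "V_grad \<Omega> v Gv \<Longrightarrow> v \<in> H_space \<Omega>"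
  unfolding V_grad_def H_space_def by blast

text \<open>Integrals over (0, s + T) against the shifted function see only the restarted solution,
  because the function and its derivative vanish up to time \<open>s\<close>.\<close>

lemma test_fun_shift:
  assumes "test_fun 0 T \<psi>" "0 \<le> s"
  shows "test_fun 0 (s + T) (\<lambda>t. \<psi> (t - s))" "deriv (\<lambda>t. \<psi> (t - s)) t = deriv \<psi> (t - s)"
    "t \<le> s \<Longrightarrow> \<psi> (t - s) = 0" "t \<le> s \<Longrightarrow> deriv \<psi> (t - s) = 0"
proof -
  obtain c d where cd: "0 < c" "d < T" "\<And>t. t \<notin> {c..d} \<Longrightarrow> \<psi> t = 0" and sm: "smooth_R \<psi>"
    using assms(1) unfolding test_fun_def by blast
  have "smooth_R (\<lambda>t. \<psi> (1 * t + (- s)))"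
    using sm unfolding smooth_R_nsmooth using nsmooth_affine by blast
  then have sm': "smooth_R (\<lambda>t. \<psi> (t - s))" by simp
  have "0 < c + s \<and> d + s < s + T \<and> (\<forall>t. t \<notin> {c + s..d + s} \<longrightarrow> \<psi> (t - s) = 0)"
    using cd assms(2) by auto
  then show "test_fun 0 (s + T) (\<lambda>t. \<psi> (t - s))" unfolding test_fun_def using sm' by blast
  have "((\<lambda>t. t - s) has_real_derivative 1) (at t)" by (auto intro!: derivative_eq_intros)
  from DERIV_chain2[OF smooth_R_has_deriv[OF sm] this]
  show "deriv (\<lambda>t. \<psi> (t - s)) t = deriv \<psi> (t - s)" by (simp add: DERIV_imp_deriv)
  show "\<psi> (t - s) = 0" if "t \<le> s" using cd that by auto
  show "deriv \<psi> (t - s) = 0" if "t \<le> s"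
  proof -
    have "(\<psi> has_real_derivative 0) (at (t - s))"
      by (rule has_field_derivative_transform_within_open[OF DERIV_const, of "{..<c}" _ 0]) (use cd that in auto)
    then show ?thesis by (rule DERIV_imp_deriv)
  qed
qed

text \<open>Prepares the semigroup law. The new datum \<open>w\<close> is prescribed only up to
  distance zero, since \<open>S s x\<close> need not equal \<open>u s\<close> as a function.\<close>

lemma weak_solution_shift:
  assumes \<Omega>: "open \<Omega>" and sol: "weak_solution \<Omega> \<mu> \<alpha> \<beta> f u0 (s + T) u" and s: "0 \<le> s" and T: "0 < T"
    and w: "L2dist \<Omega> (u s) w = 0"
  shows "weak_solution \<Omega> \<mu> \<alpha> \<beta> f w T (\<lambda>t. u (t + s))"
proof -
  let ?Q = "{0<..<T} \<times> \<Omega>" and ?Q' = "{0<..<s + T} \<times> \<Omega>"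
  have Q: "?Q \<in> sets borel" "?Q' \<in> sets borel" using \<Omega> by (auto intro!: borel_open open_Times)
  have I: "{0<..<T} \<in> sets borel" "{0<..<s + T} \<in> sets borel" by auto
  have subQ: "z + (s, 0) \<in> ?Q'" if "z \<in> ?Q" for z using that s by (cases z) auto
  have subI: "t + s \<in> {0<..<s + T}" if "t \<in> {0<..<T}" for t using that s by auto
  have uH: "\<And>t. t \<in> {0..s + T} \<Longrightarrow> u t \<in> H_space \<Omega>"
    and uc: "\<And>v. v \<in> H_space \<Omega> \<Longrightarrow> continuous_on {0..s + T} (\<lambda>t. L2inner \<Omega> (u t) v)"
    and um: "(\<lambda>(t,x). u t x) \<in> borel_measurable (lebesgue_on ?Q')"
    and ui: "integrable (lebesgue_on ?Q') (\<lambda>(t,x). norm (u t x) powr (\<beta> + 1))"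
    using sol unfolding weak_solution_def by auto
  obtain M where M: "\<And>t. t \<in> {0..s + T} \<Longrightarrow> L2norm \<Omega> (u t) \<le> M" using sol unfolding weak_solution_def by blast
  obtain G where Gm: "(\<lambda>(t,x). G t x) \<in> borel_measurable (lebesgue_on ?Q')"
    and Gi: "integrable (lebesgue_on ?Q') (\<lambda>(t,x). (norm (G t x))\<^sup>2)"
    and V: "AE t in lebesgue_on {0<..<s + T}. V_grad \<Omega> (u t) (G t)"
    and weak: "\<And>v Gv F. V_grad \<Omega> v Gv \<Longrightarrow> Lp \<Omega> (\<beta> + 1) v \<Longrightarrow>
        F = (\<lambda>t. \<mu> * L2inner \<Omega> (G t) Gv + bform \<Omega> (u t) (G t) v
                        + \<alpha> * L2inner \<Omega> (\<lambda>x. norm (u t x) powr (\<beta> - 1) *\<^sub>R u t x) v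
                        - L2inner \<Omega> f v) \<Longrightarrow>
        integrable (lebesgue_on {0<..<s + T}) F \<and>
               (\<forall>\<psi>. test_fun 0 (s + T) \<psi> \<longrightarrow>
                  integral\<^sup>L (lebesgue_on {0<..<s + T}) (\<lambda>t. L2inner \<Omega> (u t) v * deriv \<psi> t)
                  = integral\<^sup>L (lebesgue_on {0<..<s + T}) (\<lambda>t. F t * \<psi> t))"
    using sol unfolding weak_solution_def Let_def by (elim conjE exE) blast
  have cp: "(\<lambda>z. (case z of (t, x) \<Rightarrow> k t x)) (z + (s, 0)) = (case z of (t, x) \<Rightarrow> k (t + s) x)" for k :: "real \<Rightarrow> pt \<Rightarrow> 'z" and z
    by (cases z) simp
  have um': "(\<lambda>(t,x). u (t + s) x) \<in> borel_measurable (lebesgue_on ?Q)"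
    using lebesgue_on_translation(1)[OF Q subQ um] by (simp add: cp)
  have ui': "integrable (lebesgue_on ?Q) (\<lambda>(t,x). norm (u (t + s) x) powr (\<beta> + 1))"
    using lebesgue_on_translation(2)[OF Q subQ borel_measurable_integrable[OF ui] ui] by (simp add: cp)
  have Gm': "(\<lambda>(t,x). G (t + s) x) \<in> borel_measurable (lebesgue_on ?Q)"
    using lebesgue_on_translation(1)[OF Q subQ Gm] by (simp add: cp)
  have Gi': "integrable (lebesgue_on ?Q) (\<lambda>(t,x). (norm (G (t + s) x))\<^sup>2)"
    using lebesgue_on_translation(2)[OF Q subQ borel_measurable_integrable[OF Gi] Gi] by (simp add: cp)
  have V': "AE t in lebesgue_on {0<..<T}. V_grad \<Omega> (u (t + s)) (G (t + s))"
  proof -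
    have "AE t in lebesgue. t \<in> {0<..<s + T} \<longrightarrow> V_grad \<Omega> (u t) (G t)"
      using V by (subst (asm) AE_restrict_space_iff) auto
    then have "AE t in lborel. t \<in> {0<..<s + T} \<longrightarrow> V_grad \<Omega> (u t) (G t)" by (simp add: AE_completion_iff)
    from AE_lborel_translation[OF this, of s]
    have "AE t in lborel. t \<in> {0<..<T} \<longrightarrow> V_grad \<Omega> (u (t + s)) (G (t + s))"
      by eventually_elim (use subI in blast)
    then have "AE t in lebesgue. t \<in> {0<..<T} \<longrightarrow> V_grad \<Omega> (u (t + s)) (G (t + s))" by (rule AE_completion)
    then show ?thesis by (subst AE_restrict_space_iff) auto
  qed
  have weak': "integrable (lebesgue_on {0<..<T}) (\<lambda>t. F (t + s)) \<and>
       (\<forall>\<psi>. test_fun 0 T \<psi> \<longrightarrow>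
          integral\<^sup>L (lebesgue_on {0<..<T}) (\<lambda>t. L2inner \<Omega> (u (t + s)) v * deriv \<psi> t)
          = integral\<^sup>L (lebesgue_on {0<..<T}) (\<lambda>t. F (t + s) * \<psi> t))"
    if v: "V_grad \<Omega> v Gv" "Lp \<Omega> (\<beta> + 1) v" and F: "F = (\<lambda>t. \<mu> * L2inner \<Omega> (G t) Gv + bform \<Omega> (u t) (G t) v
                        + \<alpha> * L2inner \<Omega> (\<lambda>x. norm (u t x) powr (\<beta> - 1) *\<^sub>R u t x) v
                        - L2inner \<Omega> f v)" for v Gv F
  proof (intro conjI allI impI)
    have Fi: "integrable (lebesgue_on {0<..<s + T}) F" using weak[OF v F] by blast
    have Fm: "F \<in> borel_measurable (lebesgue_on {0<..<s + T})" using Fi by auto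
    show "integrable (lebesgue_on {0<..<T}) (\<lambda>t. F (t + s))"
      by (rule lebesgue_on_translation(2)[OF I subI Fm Fi])
    fix \<psi> assume \<psi>: "test_fun 0 T \<psi>"
    note sh = test_fun_shift[OF \<psi> s]
    have sm: "smooth_R \<psi>" using \<psi> by (simp add: test_fun_def)
    have c0: "continuous_on UNIV \<psi>" and c1: "continuous_on UNIV (deriv \<psi>)"
    proof -
      have "nsmooth 1 \<psi>" using sm by (simp add: smooth_R_nsmooth)
      then have "\<And>x. \<psi> differentiable (at x)" "\<And>x. deriv \<psi> differentiable (at x)" by simp_all
      then show "continuous_on UNIV \<psi>" "continuous_on UNIV (deriv \<psi>)"
        by (meson differentiable_imp_continuous_within continuous_at_imp_continuous_on)+
    qed
    have m1: "(\<lambda>t. L2inner \<Omega> (u t) v * deriv \<psi> (t - s)) \<in> borel_measurable (lebesgue_on {0<..<s + T})"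
    proof (rule continuous_imp_measurable_on_sets_lebesgue)
      show "continuous_on {0<..<s + T} (\<lambda>t. L2inner \<Omega> (u t) v * deriv \<psi> (t - s))"
        by (intro continuous_intros continuous_on_subset[OF uc[OF V_grad_H[OF v(1)]]] continuous_on_compose2[OF c1]) auto
    qed auto
    have m2: "(\<lambda>t. F t * \<psi> (t - s)) \<in> borel_measurable (lebesgue_on {0<..<s + T})"
    proof (rule borel_measurable_times[OF Fm])
      show "(\<lambda>t. \<psi> (t - s)) \<in> borel_measurable (lebesgue_on {0<..<s + T})"
        by (rule continuous_imp_measurable_on_sets_lebesgue) (auto intro!: continuous_intros continuous_on_compose2[OF c0])
    qed
    have "integral\<^sup>L (lebesgue_on {0<..<T}) (\<lambda>t. L2inner \<Omega> (u (t + s)) v * deriv \<psi> ((t + s) - s)) =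
        integral\<^sup>L (lebesgue_on {0<..<s + T}) (\<lambda>t. L2inner \<Omega> (u t) v * deriv \<psi> (t - s))"
      by (rule lebesgue_on_translation(3)[OF I subI m1]) (use sh(4) in auto)
    also have "\<dots> = integral\<^sup>L (lebesgue_on {0<..<s + T}) (\<lambda>t. L2inner \<Omega> (u t) v * deriv (\<lambda>t. \<psi> (t - s)) t)"
      by (simp add: sh(2))
    also have "\<dots> = integral\<^sup>L (lebesgue_on {0<..<s + T}) (\<lambda>t. F t * \<psi> (t - s))"
      using weak[OF v F] sh(1) by blast
    also have "\<dots> = integral\<^sup>L (lebesgue_on {0<..<T}) (\<lambda>t. F (t + s) * \<psi> ((t + s) - s))"
      by (rule lebesgue_on_translation(3)[OF I subI m2, symmetric]) (use sh(3) in auto)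
    finally show "integral\<^sup>L (lebesgue_on {0<..<T}) (\<lambda>t. L2inner \<Omega> (u (t + s)) v * deriv \<psi> t)
          = integral\<^sup>L (lebesgue_on {0<..<T}) (\<lambda>t. F (t + s) * \<psi> t)" by simp
  qed
  show ?thesis
    unfolding weak_solution_def Let_def
  proof (intro conjI exI[of _ "\<lambda>t. G (t + s)"] allI impI ballI)
    show "0 < T" by (rule T)
    show "u (t + s) \<in> H_space \<Omega>" if "t \<in> {0..T}" for t using uH that s by auto
    show "\<exists>M. \<forall>t\<in>{0..T}. L2norm \<Omega> (u (t + s)) \<le> M" using M s by (intro exI[of _ M]) auto
    show "continuous_on {0..T} (\<lambda>t. L2inner \<Omega> (u (t + s)) v)" if "v \<in> H_space \<Omega>" for v
      by (rule continuous_on_compose2[OF uc[OF that]]) (use s in \<open>auto intro!: continuous_intros\<close>)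
    show "L2dist \<Omega> (u (0 + s)) w = 0" using w by simp
  qed (use um' ui' Gm' Gi' V' weak'[OF _ _ refl] in \<open>auto simp del: split_paired_All\<close>)
qed

section \<open>The semigroup as a dissipative system\<close>

text \<open>The constants \<delta> and \<open>C\<close> of the coercivity estimate are parameters,
  so the two cases of the condition on \<beta>, \<alpha>, \<mu> are no longer distinguished from
  here on.\<close>

locale damped_NS_semigroup =
  fixes \<Omega> :: "pt set" and \<mu> \<alpha> \<beta> :: real and f :: field
    and S :: "real \<Rightarrow> field \<Rightarrow> field" and \<delta> C :: real
  assumes \<Omega>: "open \<Omega>" "bounded \<Omega>" and \<beta>: "\<beta> \<ge> 3" and \<alpha>: "\<alpha> > 0" and f: "f \<in> H_space \<Omega>"
    and \<delta>: "\<delta> > 0" and C: "C \<ge> 0"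
    and coercive: "\<And>u G f. \<delta> * ((norm G)\<^sup>2 + (norm u)\<^sup>2) - C * (1 + (norm f)\<^sup>2) \<le>
     \<mu> * (norm G)\<^sup>2 + inner (convect u G + (\<alpha> * norm u powr (\<beta> - 1)) *\<^sub>R u - f) u"
    and S_in_H: "\<And>t u0. 0 \<le> t \<Longrightarrow> u0 \<in> H_space \<Omega> \<Longrightarrow> S t u0 \<in> H_space \<Omega>"
    and S_sol: "\<And>u0. u0 \<in> H_space \<Omega> \<Longrightarrow> \<exists>u. global_weak_solution \<Omega> \<mu> \<alpha> \<beta> f u0 u \<and>
                   (\<forall>t\<ge>0. L2dist \<Omega> (S t u0) (u t) = 0)"
    and uniq: "\<And>u0 T u w t. u0 \<in> H_space \<Omega> \<Longrightarrow> weak_solution \<Omega> \<mu> \<alpha> \<beta> f u0 T u \<Longrightarrow>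
                   weak_solution \<Omega> \<mu> \<alpha> \<beta> f u0 T w \<Longrightarrow> t \<in> {0..T} \<Longrightarrow> L2dist \<Omega> (u t) (w t) = 0"
    and cont: "\<And>t u0 e. 0 \<le> t \<Longrightarrow> u0 \<in> H_space \<Omega> \<Longrightarrow> 0 < e \<Longrightarrow> \<exists>d>0. \<forall>v0\<in>H_space \<Omega>.
                   L2dist \<Omega> u0 v0 < d \<longrightarrow> L2dist \<Omega> (S t u0) (S t v0) < e"
begin

lemma solution_at:
  assumes "x \<in> H_space \<Omega>"
  obtains u where "\<And>T. T > 0 \<Longrightarrow> weak_solution \<Omega> \<mu> \<alpha> \<beta> f x T u" "\<And>t. 0 \<le> t \<Longrightarrow> L2dist \<Omega> (S t x) (u t) = 0"
    "\<And>t. 0 \<le> t \<Longrightarrow> u t \<in> H_space \<Omega>"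
proof -
  obtain u where u: "global_weak_solution \<Omega> \<mu> \<alpha> \<beta> f x u" "\<forall>t\<ge>0. L2dist \<Omega> (S t x) (u t) = 0"
    using S_sol[OF assms] by blast
  have ws: "weak_solution \<Omega> \<mu> \<alpha> \<beta> f x T u" if "T > 0" for T using u(1) that by (simp add: global_weak_solution_def)
  have "u t \<in> H_space \<Omega>" if "0 \<le> t" for t
  proof -
    have "\<forall>r\<in>{0..t + 1}. u r \<in> H_space \<Omega>" using ws[of "t + 1"] that unfolding weak_solution_def by simp
    then show ?thesis using that by simp
  qed
  then show ?thesis using that[of u] ws u(2) by blast
qed

lemma semigroup_property:
  assumes s: "0 \<le> s" and t: "0 \<le> t" and x: "x \<in> H_space \<Omega>"
  shows "L2dist \<Omega> (S (t + s) x) (S t (S s x)) = 0"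
proof -
  obtain u where u: "\<And>T. T > 0 \<Longrightarrow> weak_solution \<Omega> \<mu> \<alpha> \<beta> f x T u" "\<And>t. 0 \<le> t \<Longrightarrow> L2dist \<Omega> (S t x) (u t) = 0"
      "\<And>t. 0 \<le> t \<Longrightarrow> u t \<in> H_space \<Omega>" using solution_at[OF x] by blast
  have Sx: "S s x \<in> H_space \<Omega>" using S_in_H s x by blast
  obtain w where w: "\<And>T. T > 0 \<Longrightarrow> weak_solution \<Omega> \<mu> \<alpha> \<beta> f (S s x) T w" "\<And>t. 0 \<le> t \<Longrightarrow> L2dist \<Omega> (S t (S s x)) (w t) = 0"
      "\<And>t. 0 \<le> t \<Longrightarrow> w t \<in> H_space \<Omega>" using solution_at[OF Sx] by blast
  \<comment> \<open>Both candidates start from \<open>S s x\<close> up to distance zero, so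
    uniqueness identifies them. The horizon \<open>t + 1\<close> is positive also for
    \<open>t = 0\<close>.\<close>
  have "weak_solution \<Omega> \<mu> \<alpha> \<beta> f (S s x) (t + 1) (\<lambda>r. u (r + s))"
    by (rule weak_solution_shift[OF \<Omega>(1) u(1) s]) (use s t u(2)[OF s] L2dist_commute[of \<Omega> "u s"] in auto)
  from uniq[OF Sx this w(1), of t] have "L2dist \<Omega> (u (t + s)) (w t) = 0" using t by simp
  moreover have L: "L2 \<Omega> (S (t + s) x)" "L2 \<Omega> (u (t + s))" "L2 \<Omega> (w t)" "L2 \<Omega> (S t (S s x))"
    using H_space_L2 S_in_H u(3) w(3) Sx s t x by auto
  ultimately show ?thesis
    using L2dist_triangle[OF L(1,2,4)] L2dist_triangle[OF L(2,3,4)] u(2)[of "t + s"] w(2)[OF t] s t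
      L2dist_commute[of \<Omega> "w t"] L2dist_nonneg[of \<Omega> "S (t + s) x" "S t (S s x)"] by simp
qed

text \<open>The rate at which force and coercivity constant can feed the energy: twice the integral
  of \<open>C * (1 + |f|^2)\<close> over \<Omega>.\<close>

definition \<kappa> :: real where "\<kappa> = 2 * C * (measure lebesgue \<Omega> + (L2norm \<Omega> f)\<^sup>2)"

lemma \<kappa>_nonneg: "\<kappa> \<ge> 0" using C by (simp add: \<kappa>_def)

text \<open>The gradient belongs to the representative \<open>w\<close> that the weak solution
  provides at time \<open>t\<close>; it is at distance zero from \<open>S t x\<close>.\<close>

lemma S_energy:
  assumes x: "x \<in> H_space \<Omega>" and T: "T > 0"
  obtains E Y :: "real \<Rightarrow> real" where "integrable lborel E" "integrable lborel Y" "\<And>t. 0 \<le> E t" "\<And>t. 0 \<le> Y t"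
    "\<And>t. t \<notin> {0<..<T} \<Longrightarrow> E t = 0" "\<And>t. t \<notin> {0<..<T} \<Longrightarrow> Y t = 0"
    "AE t in lborel. t \<in> {0<..<T} \<longrightarrow> Y t = (L2norm \<Omega> (S t x))\<^sup>2 \<and> (\<exists>w Gt. w \<in> H_space \<Omega> \<and> L2dist \<Omega> (S t x) w = 0 \<and> V_grad \<Omega> w Gt \<and> E t = (L2norm \<Omega> Gt)\<^sup>2)"
    "(L2norm \<Omega> (S T x))\<^sup>2 + 2 * \<delta> * (integral\<^sup>L lborel E + integral\<^sup>L lborel Y) \<le> (L2norm \<Omega> x)\<^sup>2 + \<kappa> * T"
proof -
  obtain u where u: "\<And>T. T > 0 \<Longrightarrow> weak_solution \<Omega> \<mu> \<alpha> \<beta> f x T u" "\<And>t. 0 \<le> t \<Longrightarrow> L2dist \<Omega> (S t x) (u t) = 0"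
      "\<And>t. 0 \<le> t \<Longrightarrow> u t \<in> H_space \<Omega>" using solution_at[OF x] by blast
  have n: "L2norm \<Omega> (S t x) = L2norm \<Omega> (u t)" if "0 \<le> t" for t
    using L2norm_eq_of_dist_zero[of \<Omega> "S t x" "u t"] H_space_L2 S_in_H u that x by blast
  have "L2dist \<Omega> (u 0) x = 0" using u(1)[OF T] unfolding weak_solution_def by blast
  then have n0: "L2norm \<Omega> (u 0) = L2norm \<Omega> x"
    using L2norm_eq_of_dist_zero[of \<Omega> "u 0" x] H_space_L2 u(3)[of 0] x by auto
  obtain E Y :: "real \<Rightarrow> real" where EY: "integrable lborel E" "integrable lborel Y" "\<And>t. 0 \<le> E t" "\<And>t. 0 \<le> Y t"
    "\<And>t. t \<notin> {0<..<T} \<Longrightarrow> E t = 0" "\<And>t. t \<notin> {0<..<T} \<Longrightarrow> Y t = 0"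
    "AE t in lborel. t \<in> {0<..<T} \<longrightarrow> Y t = (L2norm \<Omega> (u t))\<^sup>2 \<and> (\<exists>Gt. V_grad \<Omega> (u t) Gt \<and> E t = (L2norm \<Omega> Gt)\<^sup>2)"
    "(L2norm \<Omega> (u T))\<^sup>2 + 2 * \<delta> * (integral\<^sup>L lborel E + integral\<^sup>L lborel Y)
      \<le> (L2norm \<Omega> (u 0))\<^sup>2 + 2 * C * (measure lebesgue \<Omega> + (L2norm \<Omega> f)\<^sup>2) * T"
    using energy_inequality[OF \<Omega> \<beta> \<alpha> H_space_L2[OF f] u(1)[OF T] coercive] by blast
  show ?thesis
  proof (rule that[of E Y])
    show "AE t in lborel. t \<in> {0<..<T} \<longrightarrow> Y t = (L2norm \<Omega> (S t x))\<^sup>2 \<and> (\<exists>w Gt. w \<in> H_space \<Omega> \<and> L2dist \<Omega> (S t x) w = 0 \<and> V_grad \<Omega> w Gt \<and> E t = (L2norm \<Omega> Gt)\<^sup>2)"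
      using EY(7)
    proof eventually_elim
      case (elim t)
      show ?case
      proof
        assume t: "t \<in> {0<..<T}"
        then show "Y t = (L2norm \<Omega> (S t x))\<^sup>2 \<and> (\<exists>w Gt. w \<in> H_space \<Omega> \<and> L2dist \<Omega> (S t x) w = 0 \<and> V_grad \<Omega> w Gt \<and> E t = (L2norm \<Omega> Gt)\<^sup>2)"
          using elim n[of t] u(2)[of t] u(3)[of t] by auto
      qed
    qed
    show "(L2norm \<Omega> (S T x))\<^sup>2 + 2 * \<delta> * (integral\<^sup>L lborel E + integral\<^sup>L lborel Y) \<le> (L2norm \<Omega> x)\<^sup>2 + \<kappa> * T"
      using EY(8) n[of T] n0 T by (simp add: \<kappa>_def)
  qed (use EY in auto)
qed

lemma S_norm_growth:
  assumes "x \<in> H_space \<Omega>" "0 < T" shows "(L2norm \<Omega> (S T x))\<^sup>2 \<le> (L2norm \<Omega> x)\<^sup>2 + \<kappa> * T"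
proof -
  obtain E Y :: "real \<Rightarrow> real" where EY: "\<And>t. 0 \<le> E t" "\<And>t. 0 \<le> Y t"
    and EY3: "(L2norm \<Omega> (S T x))\<^sup>2 + 2 * \<delta> * (integral\<^sup>L lborel E + integral\<^sup>L lborel Y) \<le> (L2norm \<Omega> x)\<^sup>2 + \<kappa> * T"
    by (rule S_energy[OF assms]) (rule that, assumption+)
  have "0 \<le> 2 * \<delta> * (integral\<^sup>L lborel E + integral\<^sup>L lborel Y)"
    using EY \<delta> by (intro mult_nonneg_nonneg add_nonneg_nonneg Bochner_Integration.integral_nonneg) auto
  then show ?thesis using EY3 by linarith
qed

lemma S_norm_add:
  assumes "x \<in> H_space \<Omega>" "0 \<le> s" "0 \<le> t" shows "L2norm \<Omega> (S (t + s) x) = L2norm \<Omega> (S t (S s x))"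
  using L2norm_eq_of_dist_zero[OF _ _ semigroup_property[OF assms(2,3,1)]] H_space_L2 S_in_H assms by simp

lemma S_zero_norm: assumes "x \<in> H_space \<Omega>" shows "L2norm \<Omega> (S 0 x) = L2norm \<Omega> x"
proof -
  obtain u where u: "\<And>T. T > 0 \<Longrightarrow> weak_solution \<Omega> \<mu> \<alpha> \<beta> f x T u" "\<And>t. 0 \<le> t \<Longrightarrow> L2dist \<Omega> (S t x) (u t) = 0"
      "\<And>t. 0 \<le> t \<Longrightarrow> u t \<in> H_space \<Omega>" using solution_at[OF assms] by blast
  have "L2dist \<Omega> (u 0) x = 0" using u(1)[of 1] unfolding weak_solution_def by simp
  then show ?thesis
    using L2norm_eq_of_dist_zero[of \<Omega> "u 0" x] L2norm_eq_of_dist_zero[of \<Omega> "S 0 x" "u 0"] H_space_L2 u(2,3)[of 0] S_in_H[of 0 x] assms by auto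
qed

text \<open>Averaging the growth bound over the last \<open>1 / \<delta>\<close> units of time against the dissipation gives a
  contraction of the energy up to a constant, without a differential inequality.\<close>

lemma S_norm_contraction:
  assumes x: "x \<in> H_space \<Omega>"
  shows "(L2norm \<Omega> (S (1 / \<delta>) x))\<^sup>2 \<le> (L2norm \<Omega> x)\<^sup>2 / 2 + 3 / 2 * \<kappa> / \<delta>"
proof -
  \<comment> \<open>With this length \<open>2 * \<delta> * L = 2\<close>: twice the final energy, up
    to a constant, is bounded by a single initial energy.\<close>
  define L where "L = 1 / \<delta>"
  have L: "L > 0" using \<delta> by (simp add: L_def)
  obtain E Y :: "real \<Rightarrow> real" where EY: "integrable lborel E" "integrable lborel Y" "\<And>t. 0 \<le> E t" "\<And>t. 0 \<le> Y t"
    "\<And>t. t \<notin> {0<..<L} \<Longrightarrow> E t = 0" "\<And>t. t \<notin> {0<..<L} \<Longrightarrow> Y t = 0"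
    "AE t in lborel. t \<in> {0<..<L} \<longrightarrow> Y t = (L2norm \<Omega> (S t x))\<^sup>2 \<and> (\<exists>w Gt. w \<in> H_space \<Omega> \<and> L2dist \<Omega> (S t x) w = 0 \<and> V_grad \<Omega> w Gt \<and> E t = (L2norm \<Omega> Gt)\<^sup>2)"
    "(L2norm \<Omega> (S L x))\<^sup>2 + 2 * \<delta> * (integral\<^sup>L lborel E + integral\<^sup>L lborel Y) \<le> (L2norm \<Omega> x)\<^sup>2 + \<kappa> * L"
    using S_energy[OF x L] by blast
  let ?c = "(L2norm \<Omega> (S L x))\<^sup>2 - \<kappa> * L"
  have "?c * L = (\<integral>t. ?c * indicator {0<..<L} t \<partial>lborel)" using L by simp
  also have "\<dots> \<le> integral\<^sup>L lborel Y"
  proof (rule integral_mono_AE)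
    show "integrable lborel (\<lambda>t. ?c * indicator {0<..<L} t)" using L by (simp add: integrable_indicator_iff)
    show "integrable lborel Y" by (rule EY)
    show "AE t in lborel. ?c * indicator {0<..<L} t \<le> Y t"
      using EY(7)
    proof eventually_elim
      case (elim t)
      show ?case
      proof (cases "t \<in> {0<..<L}")
        case True
        have Sx: "S t x \<in> H_space \<Omega>" using S_in_H x True by auto
        \<comment> \<open>The growth bound from time \<open>t\<close> to \<open>L\<close>, read as a
          lower bound for the energy at time \<open>t\<close>.\<close>
        have "(L2norm \<Omega> (S L x))\<^sup>2 = (L2norm \<Omega> (S (L - t) (S t x)))\<^sup>2"
          using S_norm_add[OF x, of t "L - t"] True by simp
        also have "\<dots> \<le> (L2norm \<Omega> (S t x))\<^sup>2 + \<kappa> * (L - t)" using S_norm_growth[OF Sx, of "L - t"] True by simp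
        also have "\<dots> \<le> (L2norm \<Omega> (S t x))\<^sup>2 + \<kappa> * L" using \<kappa>_nonneg True by (intro add_left_mono mult_left_mono) auto
        finally show ?thesis using elim True by simp
      qed (use EY(6) in simp)
    qed
  qed
  finally have 1: "?c * L \<le> integral\<^sup>L lborel Y" .
  have E0: "0 \<le> integral\<^sup>L lborel E" using EY(3) by (intro Bochner_Integration.integral_nonneg) auto
  have "2 * \<delta> * (?c * L) \<le> 2 * \<delta> * (integral\<^sup>L lborel E + integral\<^sup>L lborel Y)"
    using 1 E0 \<delta> by (intro mult_left_mono) auto
  also have "\<dots> \<le> (L2norm \<Omega> x)\<^sup>2 + \<kappa> * L" using EY(8) zero_le_power2[of "L2norm \<Omega> (S L x)"] by linarith
  finally have "2 * \<delta> * (?c * L) \<le> (L2norm \<Omega> x)\<^sup>2 + \<kappa> * L" .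
  moreover have "2 * \<delta> * (?c * L) = 2 * ?c" using \<delta> by (simp add: L_def)
  ultimately have "2 * ?c \<le> (L2norm \<Omega> x)\<^sup>2 + \<kappa> * L" by simp
  then show ?thesis unfolding L_def[symmetric] using \<delta> by (simp add: L_def)
qed

text \<open>\<open>3 * \<kappa> / \<delta>\<close> is the fixed point of the energy map y |-> y/2 +
  (3/2) \<kappa>/\<delta> in \<open>S_norm_contraction\<close>; the added 1 makes absorption happen
  in finite time.\<close>

definition \<rho> :: real where "\<rho> = sqrt (3 * \<kappa> / \<delta> + 1)"

text \<open>A time is split into a remainder \<open>r\<close>, where the growth bound applies, and
  \<open>n\<close> periods of length \<open>1 / \<delta>\<close>, each of which halves the energy up
  to a constant.\<close>

lemma S_absorbing:
  "\<exists>t0\<ge>0. \<forall>t\<ge>t0. \<forall>x\<in>H_space \<Omega>. L2norm \<Omega> x \<le> R \<longrightarrow> L2norm \<Omega> (S t x) \<le> \<rho>"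
proof -
  define L where "L = 1 / \<delta>"
  have L: "L > 0" using \<delta> by (simp add: L_def)
  define D where "D = 3 / 2 * \<kappa> / \<delta>"
  have D: "D \<ge> 0" using \<kappa>_nonneg \<delta> by (simp add: D_def)
  have iter: "(L2norm \<Omega> (S (r + real n * L) x))\<^sup>2 \<le> (1/2)^n * (L2norm \<Omega> (S r x))\<^sup>2 + 2 * D" if "x \<in> H_space \<Omega>" "0 \<le> r" for x r n
  proof (induction n)
    case 0 then show ?case using D by simp
  next
    case (Suc n)
    have nn: "0 \<le> r + real n * L" using that L by simp
    have Sx: "S (r + real n * L) x \<in> H_space \<Omega>" using S_in_H[OF nn that(1)] .
    have "(L2norm \<Omega> (S (r + real (Suc n) * L) x))\<^sup>2 = (L2norm \<Omega> (S L (S (r + real n * L) x)))\<^sup>2"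
      using S_norm_add[OF that(1) nn, of L] L by (simp add: algebra_simps)
    also have "\<dots> \<le> (L2norm \<Omega> (S (r + real n * L) x))\<^sup>2 / 2 + D"
      unfolding L_def D_def by (rule S_norm_contraction) (use Sx in \<open>simp add: L_def\<close>)
    also have "\<dots> \<le> ((1/2)^n * (L2norm \<Omega> (S r x))\<^sup>2 + 2 * D) / 2 + D" using Suc by simp
    also have "\<dots> = (1/2)^Suc n * (L2norm \<Omega> (S r x))\<^sup>2 + 2 * D" by (simp add: field_simps)
    finally show ?case .
  qed
  \<comment> \<open>Bounds the energy after a remainder of at most one period, for all starting
    points of norm at most \<open>R\<close>.\<close>
  define K where "K = R\<^sup>2 + \<kappa> * L"
  have "(\<lambda>n. (1/2::real)^n * K) \<longlonglongrightarrow> 0 * K" by (intro tendsto_mult tendsto_const LIMSEQ_realpow_zero) auto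
  then have "\<forall>\<^sub>F n in sequentially. (1/2::real)^n * K < 1" by (intro order_tendstoD(2)[where y="0 * K"]) auto
  then obtain n0 where n0: "\<And>n. n \<ge> n0 \<Longrightarrow> (1/2::real)^n * K < 1" unfolding eventually_sequentially by blast
  show ?thesis
  proof (intro exI[of _ "real n0 * L"] conjI allI impI ballI)
    show "0 \<le> real n0 * L" using L by simp
    fix t x assume t: "real n0 * L \<le> t" and x: "x \<in> H_space \<Omega>" and R: "L2norm \<Omega> x \<le> R"
    have t0: "0 \<le> t" using t L by (meson mult_nonneg_nonneg less_imp_le of_nat_0_le_iff order_trans)
    define n where "n = nat \<lfloor>t / L\<rfloor>"
    define r where "r = t - real n * L"
    have nle: "real n \<le> t / L" "t / L < real n + 1"
      using t0 L by (auto simp: n_def)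
    have rn: "0 \<le> r" "r \<le> L" using nle L by (auto simp: r_def field_simps)
    have "real n0 \<le> t / L" using t L by (simp add: field_simps)
    then have "real n0 < real n + 1" using nle(2) by linarith
    then have n: "n \<ge> n0" by linarith
    have yr: "(L2norm \<Omega> (S r x))\<^sup>2 \<le> K"
    proof -
      have x2: "(L2norm \<Omega> x)\<^sup>2 \<le> R\<^sup>2" using R by (intro power_mono L2norm_nonneg)
      show ?thesis
      \<comment> \<open>The growth bound is stated for positive times; at time 0 the norm is that of
        \<open>x\<close>.\<close>
      proof (cases "r = 0")
        case True
        then show ?thesis using S_zero_norm[OF x] x2 \<kappa>_nonneg L by (simp add: K_def add_increasing2)
      next
        case False
        then have "(L2norm \<Omega> (S r x))\<^sup>2 \<le> (L2norm \<Omega> x)\<^sup>2 + \<kappa> * r" using S_norm_growth[OF x, of r] rn by simp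
        also have "\<dots> \<le> R\<^sup>2 + \<kappa> * L" using x2 rn \<kappa>_nonneg by (intro add_mono mult_left_mono) auto
        finally show ?thesis by (simp add: K_def)
      qed
    qed
    have "(L2norm \<Omega> (S t x))\<^sup>2 \<le> (1/2)^n * (L2norm \<Omega> (S r x))\<^sup>2 + 2 * D"
      using iter[OF x rn(1), of n] by (simp add: r_def)
    also have "\<dots> \<le> (1/2)^n * K + 2 * D" using yr by (intro add_right_mono mult_left_mono) auto
    also have "\<dots> \<le> 1 + 2 * D" using n0[OF n] by simp
    also have "\<dots> = \<rho>\<^sup>2" using D by (simp add: \<rho>_def D_def add_nonneg_nonneg)
    finally show "L2norm \<Omega> (S t x) \<le> \<rho>" by (rule power2_le_imp_le) (use D in \<open>simp add: \<rho>_def D_def add_nonneg_nonneg\<close>)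
  qed
qed

lemma S_compact:
  fixes x :: "nat \<Rightarrow> field"
  assumes x: "\<And>n. x n \<in> H_space \<Omega> \<and> L2norm \<Omega> (x n) \<le> \<rho>"
  shows "\<exists>a\<in>H_space \<Omega>. \<exists>r. strict_mono r \<and> (\<lambda>n::nat. L2dist \<Omega> (S 1 (x (r n))) a) \<longlonglongrightarrow> 0"
proof -
  have xH: "x n \<in> H_space \<Omega>" for n using x by blast
  \<comment> \<open>What a value \<open>E\<close> of the gradient energy certifies about the
    \<open>n\<close>-th orbit at time \<open>t\<close>.\<close>
  define Q where "Q n E t \<longleftrightarrow> (\<exists>w Gt. w \<in> H_space \<Omega> \<and> L2dist \<Omega> (S t (x n)) w = 0 \<and> V_grad \<Omega> w Gt \<and> E = (L2norm \<Omega> Gt)\<^sup>2)" for n E t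
  have "\<exists>E. integrable lborel E \<and> (\<forall>t. 0 \<le> E t) \<and> (AE t in lborel. t \<in> {0<..<1} \<longrightarrow> Q n (E t) t) \<and>
      integral\<^sup>L lborel E \<le> (\<rho>\<^sup>2 + \<kappa>) / (2 * \<delta>)" for n
  proof -
    obtain E Y :: "real \<Rightarrow> real" where EY: "integrable lborel E" "integrable lborel Y" "\<And>t. 0 \<le> E t" "\<And>t. 0 \<le> Y t"
      "AE t in lborel. t \<in> {0<..<1} \<longrightarrow> Y t = (L2norm \<Omega> (S t (x n)))\<^sup>2 \<and> (\<exists>w Gt. w \<in> H_space \<Omega> \<and> L2dist \<Omega> (S t (x n)) w = 0 \<and> V_grad \<Omega> w Gt \<and> E t = (L2norm \<Omega> Gt)\<^sup>2)"
      "(L2norm \<Omega> (S 1 (x n)))\<^sup>2 + 2 * \<delta> * (integral\<^sup>L lborel E + integral\<^sup>L lborel Y) \<le> (L2norm \<Omega> (x n))\<^sup>2 + \<kappa> * 1"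
      by (rule S_energy[OF xH[of n] zero_less_one]) (rule that, assumption+)
    have "AE t in lborel. t \<in> {0<..<1} \<longrightarrow> Q n (E t) t" using EY(5) by eventually_elim (auto simp: Q_def)
    moreover have "integral\<^sup>L lborel E \<le> (\<rho>\<^sup>2 + \<kappa>) / (2 * \<delta>)"
    proof -
      have "0 \<le> integral\<^sup>L lborel Y" using EY(4) by (intro Bochner_Integration.integral_nonneg) auto
      then have "2 * \<delta> * integral\<^sup>L lborel E \<le> 2 * \<delta> * (integral\<^sup>L lborel E + integral\<^sup>L lborel Y)" using \<delta> by (intro mult_left_mono) auto
      also have "\<dots> \<le> (L2norm \<Omega> (x n))\<^sup>2 + \<kappa>" using EY(6) zero_le_power2[of "L2norm \<Omega> (S 1 (x n))"] by linarith
      also have "\<dots> \<le> \<rho>\<^sup>2 + \<kappa>" using x[of n] by (intro add_right_mono power_mono L2norm_nonneg) auto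
      finally show ?thesis using \<delta> by (simp add: field_simps)
    qed
    ultimately show ?thesis using EY(1,3) by (intro exI[of _ E]) simp
  qed
  from choice[OF allI[OF this]] obtain E where Eall: "\<forall>n. integrable lborel (E n) \<and> (\<forall>t. 0 \<le> E n t) \<and>
      (AE t in lborel. t \<in> {0<..<1} \<longrightarrow> Q n (E n t) t) \<and> integral\<^sup>L lborel (E n) \<le> (\<rho>\<^sup>2 + \<kappa>) / (2 * \<delta>)" ..
  have E: "\<And>n. integrable lborel (E n)" "\<And>n t. 0 \<le> E n t" "\<And>n. AE t in lborel. t \<in> {0<..<1} \<longrightarrow> Q n (E n t) t"
      "\<And>n. integral\<^sup>L lborel (E n) \<le> (\<rho>\<^sup>2 + \<kappa>) / (2 * \<delta>)" using Eall by auto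
  have [measurable]: "E n \<in> borel_measurable lborel" for n using E(1) by auto
  have "(\<integral>\<^sup>+t. liminf (\<lambda>n. ennreal (E n t)) \<partial>lborel) \<le> liminf (\<lambda>n. \<integral>\<^sup>+t. ennreal (E n t) \<partial>lborel)"
    by (rule nn_integral_liminf) simp
  also have "\<dots> \<le> ennreal ((\<rho>\<^sup>2 + \<kappa>) / (2 * \<delta>))"
  proof (rule Liminf_le)
    show "\<forall>\<^sub>F n in sequentially. (\<integral>\<^sup>+t. ennreal (E n t) \<partial>lborel) \<le> ennreal ((\<rho>\<^sup>2 + \<kappa>) / (2 * \<delta>))"
    proof (intro always_eventually allI)
      fix n
      have "(\<integral>\<^sup>+t. ennreal (E n t) \<partial>lborel) = ennreal (integral\<^sup>L lborel (E n))"
        by (rule nn_integral_eq_integral) (use E in auto)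
      then show "(\<integral>\<^sup>+t. ennreal (E n t) \<partial>lborel) \<le> ennreal ((\<rho>\<^sup>2 + \<kappa>) / (2 * \<delta>))" using E(4)[of n] by (simp add: ennreal_leI)
    qed
  qed simp
  finally have "(\<integral>\<^sup>+t. liminf (\<lambda>n. ennreal (E n t)) \<partial>lborel) \<noteq> \<infinity>"
    by (metis ennreal_neq_top infinity_ennreal_def neq_top_trans)
  then have fin: "AE t in lborel. liminf (\<lambda>n. ennreal (E n t)) \<noteq> \<infinity>" by (intro nn_integral_noteq_infinite) auto
  \<comment> \<open>Countably many exceptional sets, one for each orbit, still form a null set, so a
    single time can serve all orbits; (0, 1) is not null and contains one.\<close>
  have all: "AE t in lborel. \<forall>n. t \<in> {0<..<1} \<longrightarrow> Q n (E n t) t" unfolding AE_all_countable using E(3) by blast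
  have "\<exists>t\<in>{0<..<1::real}. liminf (\<lambda>n. ennreal (E n t)) \<noteq> \<infinity> \<and> (\<forall>n. Q n (E n t) t)"
  proof (rule ccontr)
    assume c: "\<not> ?thesis"
    have "AE t in lborel. t \<notin> {0<..<1::real}" using fin all by eventually_elim (use c in blast)
    then have "{0<..<1::real} \<in> null_sets lborel" by (subst AE_iff_null_sets) auto
    then show False by (simp add: null_sets_def)
  qed
  then obtain t where t: "0 < t" "t < 1" and lf: "liminf (\<lambda>n. ennreal (E n t)) \<noteq> \<infinity>" and Qt: "\<And>n. Q n (E n t) t" by auto
  obtain c where c: "liminf (\<lambda>n. ennreal (E n t)) < ennreal c" "c > 0"
  proof -
    obtain b where "liminf (\<lambda>n. ennreal (E n t)) = ennreal b" "b \<ge> 0"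
      using lf by (cases "liminf (\<lambda>n. ennreal (E n t))") auto
    then show ?thesis using that[of "b + 1"] by (simp add: ennreal_less_iff)
  qed
  \<comment> \<open>A lower limit below \<open>c\<close> gives values at most \<open>c\<close>
    infinitely often, not eventually; hence the first subsequence \<open>r1\<close>.\<close>
  have "infinite {n. E n t \<le> c}"
  proof
    assume "finite {n. E n t \<le> c}"
    then obtain k where k: "\<And>n. n \<ge> k \<Longrightarrow> \<not> E n t \<le> c"
      by (metis (mono_tags, lifting) finite_nat_set_iff_bounded leD mem_Collect_eq)
    have "ennreal c \<le> liminf (\<lambda>n. ennreal (E n t))"
      by (rule Liminf_bounded, unfold eventually_sequentially, intro exI[of _ k] allI impI ennreal_leI)
        (use k in \<open>simp add: not_le less_imp_le\<close>)
    then show False using c(1) by simp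
  qed
  from infinite_enumerate[OF this] obtain r1 :: "nat \<Rightarrow> nat" where r1: "strict_mono r1" "\<And>n. E (r1 n) t \<le> c" by auto
  have "\<forall>n. \<exists>q. fst q \<in> H_space \<Omega> \<and> L2dist \<Omega> (S t (x n)) (fst q) = 0 \<and> V_grad \<Omega> (fst q) (snd q) \<and> E n t = (L2norm \<Omega> (snd q))\<^sup>2"
    using Qt unfolding Q_def by simp
  from choice[OF this] obtain q where q: "\<forall>n. fst (q n) \<in> H_space \<Omega> \<and> L2dist \<Omega> (S t (x n)) (fst (q n)) = 0 \<and>
      V_grad \<Omega> (fst (q n)) (snd (q n)) \<and> E n t = (L2norm \<Omega> (snd (q n)))\<^sup>2" ..
  define w where "w n = fst (q n)" for n
  define Gt where "Gt n = snd (q n)" for n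
  have w: "\<And>n. w n \<in> H_space \<Omega>" "\<And>n. L2dist \<Omega> (S t (x n)) (w n) = 0" "\<And>n. V_grad \<Omega> (w n) (Gt n)"
      "\<And>n. E n t = (L2norm \<Omega> (Gt n))\<^sup>2" using q by (auto simp: w_def Gt_def)
  have StH: "S t (x n) \<in> H_space \<Omega>" for n using S_in_H xH t by simp
  \<comment> \<open>One number for both hypotheses of \<open>Rellich_V\<close>: \<open>c\<close>
    bounds the squared gradients, \<open>\<rho>^2 + \<kappa>\<close> the squared norms of the fields
    up to time 1.\<close>
  define M where "M = sqrt (c + \<rho>\<^sup>2 + \<kappa>)"
  have M1: "L2norm \<Omega> (Gt (r1 n)) \<le> M" for n
  proof -
    have "(L2norm \<Omega> (Gt (r1 n)))\<^sup>2 \<le> c + \<rho>\<^sup>2 + \<kappa>" using r1(2)[of n] w(4)[of "r1 n"] \<kappa>_nonneg zero_le_power2[of \<rho>] by linarith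
    then show ?thesis unfolding M_def by (rule real_le_rsqrt)
  qed
  have M2: "L2norm \<Omega> (w n) \<le> M" for n
  proof -
    have "(L2norm \<Omega> (w n))\<^sup>2 = (L2norm \<Omega> (S t (x n)))\<^sup>2"
      using L2norm_eq_of_dist_zero[OF H_space_L2[OF StH] H_space_L2[OF w(1)] w(2)] by simp
    also have "\<dots> \<le> (L2norm \<Omega> (x n))\<^sup>2 + \<kappa> * t" by (rule S_norm_growth[OF xH t(1)])
    also have "\<dots> \<le> \<rho>\<^sup>2 + \<kappa> * 1" using x[of n] t \<kappa>_nonneg by (intro add_mono power_mono mult_left_mono L2norm_nonneg) auto
    also have "\<dots> \<le> c + \<rho>\<^sup>2 + \<kappa>" using c by simp
    finally show ?thesis unfolding M_def by (rule real_le_rsqrt)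
  qed
  obtain z and r2 :: "nat \<Rightarrow> nat" where z: "L2 \<Omega> z" "strict_mono r2" "(\<lambda>n. L2dist \<Omega> (w (r1 (r2 n))) z) \<longlonglongrightarrow> 0"
    using Rellich_V[OF \<Omega>, of "\<lambda>n. w (r1 n)" "\<lambda>n. Gt (r1 n)" M] w(3) M1 M2 by blast
  have zH: "z \<in> H_space \<Omega>" by (rule H_space_closed[OF \<Omega>(1) w(1) z(1,3)])
  define r where "r n = r1 (r2 n)" for n
  have r: "strict_mono r" unfolding r_def using r1(1) z(2) by (simp add: strict_mono_def)
  have lim: "(\<lambda>n. L2dist \<Omega> (w (r n)) z) \<longlonglongrightarrow> 0" using z(3) by (simp add: r_def)
  have aH: "S (1 - t) z \<in> H_space \<Omega>" using S_in_H zH t by simp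
  \<comment> \<open>Continuity of \<open>S (1 - t)\<close> at \<open>z\<close> is applied to
    \<open>S t (x (r n))\<close>, which is as close to \<open>z\<close> as its representative
    \<open>w (r n)\<close>.\<close>
  have "(\<lambda>n. L2dist \<Omega> (S 1 (x (r n))) (S (1 - t) z)) \<longlonglongrightarrow> 0"
  proof (rule LIMSEQ_I)
    fix e :: real assume e: "0 < e"
    obtain d where d: "d > 0" "\<And>v. v \<in> H_space \<Omega> \<Longrightarrow> L2dist \<Omega> z v < d \<Longrightarrow> L2dist \<Omega> (S (1 - t) z) (S (1 - t) v) < e"
      using cont[of "1 - t" z e] zH t e by auto
    obtain k where "\<forall>n\<ge>k. norm (L2dist \<Omega> (w (r n)) z - 0) < d" using LIMSEQ_D[OF lim d(1)] by blast
    then have k: "\<And>n. n \<ge> k \<Longrightarrow> L2dist \<Omega> (w (r n)) z < d" by (auto simp: abs_less_iff)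
    show "\<exists>no. \<forall>n\<ge>no. norm (L2dist \<Omega> (S 1 (x (r n))) (S (1 - t) z) - 0) < e"
    proof (intro exI allI impI)
      fix n assume "n \<ge> k"
      note L = H_space_L2[OF zH] H_space_L2[OF w(1)[of "r n"]] H_space_L2[OF StH[of "r n"]] H_space_L2[OF aH]
      have "L2dist \<Omega> z (S t (x (r n))) \<le> L2dist \<Omega> z (w (r n)) + L2dist \<Omega> (w (r n)) (S t (x (r n)))" by (rule L2dist_triangle[OF L(1,2,3)])
      then have "L2dist \<Omega> z (S t (x (r n))) < d"
        using k[OF \<open>n \<ge> k\<close>] w(2)[of "r n"] L2dist_commute[of \<Omega> "w (r n)"] by simp
      then have 1: "L2dist \<Omega> (S (1 - t) z) (S (1 - t) (S t (x (r n)))) < e" by (rule d(2)[OF StH])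
      have 2: "L2dist \<Omega> (S 1 (x (r n))) (S (1 - t) (S t (x (r n)))) = 0"
        using semigroup_property[of t "1 - t" "x (r n)"] t xH by simp
      have H1: "S 1 (x (r n)) \<in> H_space \<Omega>" "S (1 - t) (S t (x (r n))) \<in> H_space \<Omega>" using S_in_H xH StH t by auto
      have "L2dist \<Omega> (S 1 (x (r n))) (S (1 - t) z) \<le> L2dist \<Omega> (S 1 (x (r n))) (S (1 - t) (S t (x (r n)))) + L2dist \<Omega> (S (1 - t) (S t (x (r n)))) (S (1 - t) z)"
        by (rule L2dist_triangle[OF H_space_L2[OF H1(1)] H_space_L2[OF H1(2)] L(4)])
      then show "norm (L2dist \<Omega> (S 1 (x (r n))) (S (1 - t) z) - 0) < e"
        using 1 2 L2dist_commute[of \<Omega> "S (1 - t) z"] L2dist_nonneg[of \<Omega> "S 1 (x (r n))" "S (1 - t) z"] by simp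
    qed
  qed
  then show ?thesis using aH r by blast
qed

text \<open>Balls of the linear space \<open>H\<close> are convex, so the straight segment
  serves.\<close>

lemma H_segment:
  assumes x: "x \<in> H_space \<Omega>" and y: "y \<in> H_space \<Omega>"
  shows "\<exists>c L. c 0 = x \<and> c 1 = y \<and> (\<forall>\<theta>\<in>{0..1}. c \<theta> \<in> H_space \<Omega> \<and> L2norm \<Omega> (c \<theta>) \<le> max (L2norm \<Omega> x) (L2norm \<Omega> y)) \<and>
      (\<forall>\<theta>\<in>{0..1}. \<forall>\<theta>'\<in>{0..1}. L2dist \<Omega> (c \<theta>) (c \<theta>') \<le> L * \<bar>\<theta> - \<theta>'\<bar>)"
proof -
  define c where "c \<theta> = (\<lambda>z. (1 - \<theta>) *\<^sub>R x z + \<theta> *\<^sub>R y z)" for \<theta> :: real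
  have L: "L2 \<Omega> x" "L2 \<Omega> y" using x y H_space_L2 by auto
  have "L2norm \<Omega> (c \<theta>) \<le> max (L2norm \<Omega> x) (L2norm \<Omega> y)" if "\<theta> \<in> {0..1}" for \<theta>
  proof -
    have "L2norm \<Omega> (c \<theta>) \<le> (1 - \<theta>) * L2norm \<Omega> x + \<theta> * L2norm \<Omega> y"
      using L2norm_triangle[OF L2_scaleR[OF L(1), of "1 - \<theta>"] L2_scaleR[OF L(2), of \<theta>]] that by (simp add: c_def L2norm_scaleR)
    also have "\<dots> \<le> max (L2norm \<Omega> x) (L2norm \<Omega> y)" by (rule convex_bound_le) (use that in auto)
    finally show ?thesis .
  qed
  moreover have "L2dist \<Omega> (c \<theta>) (c \<theta>') \<le> L2dist \<Omega> y x * \<bar>\<theta> - \<theta>'\<bar>" for \<theta> \<theta>'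
  proof -
    have "c \<theta> z - c \<theta>' z = (\<theta> - \<theta>') *\<^sub>R (y z - x z)" for z by (simp add: c_def algebra_simps)
    then have "L2dist \<Omega> (c \<theta>) (c \<theta>') = \<bar>\<theta> - \<theta>'\<bar> * L2dist \<Omega> y x" by (simp add: L2dist_def L2norm_scaleR)
    then show ?thesis by (simp add: mult.commute)
  qed
  moreover have "c 0 = x" "c 1 = y" by (auto simp: c_def)
  moreover have "c \<theta> \<in> H_space \<Omega>" for \<theta> unfolding c_def by (rule H_space_linear[OF \<Omega>(1) x y])
  ultimately show ?thesis by blast
qed

sublocale dissipative_semigroup "H_space \<Omega>" "L2dist \<Omega>" "L2norm \<Omega>" S \<rho>
proof (unfold_locales, goal_cases)
  case (4 x y z) then show ?case by (intro L2dist_triangle H_space_L2)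
next
  case (5 x y) then show ?case by (intro L2norm_le_dist H_space_L2)
next
  case (9 R) show ?case by (rule S_absorbing)
next
  case (10 xs) then show ?case by (rule S_compact)
next
  case (11 x y) then show ?case by (rule H_segment)
qed (use L2dist_nonneg L2dist_refl L2dist_commute S_in_H semigroup_property cont in auto)

text \<open>\<open>dist_H\<close> is extended-real valued and a supremum over the empty set is minus
  infinity there; a point of \<open>B\<close> is what makes the lower bound 0 true. The upper bound
  is \<open>attractor_attracts\<close> for the radius of \<open>B\<close>.\<close>

lemma attractor_attracts_dist:
  assumes B: "B \<subseteq> H_space \<Omega>" "H_bounded \<Omega> B" "B \<noteq> {}"
  shows "((\<lambda>t. dist_H \<Omega> (S t ` B) attractor) \<longlongrightarrow> 0) at_top"
proof (rule order_tendstoI)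
  fix a :: ereal assume a: "a < 0"
  have "0 \<le> dist_H \<Omega> (S t ` B) attractor" for t
  proof -
    obtain b where "b \<in> B" using B(3) by blast
    have "0 \<le> (INF y\<in>attractor. ereal (L2dist \<Omega> (S t b) y))" by (rule INF_greatest) (simp add: L2dist_nonneg)
    also have "\<dots> \<le> dist_H \<Omega> (S t ` B) attractor" unfolding dist_H_def using \<open>b \<in> B\<close> by (intro SUP_upper) auto
    finally show ?thesis .
  qed
  then show "\<forall>\<^sub>F t in at_top. a < dist_H \<Omega> (S t ` B) attractor" using a by (intro always_eventually allI) (rule less_le_trans)
next
  fix a :: ereal assume a: "0 < a"
  obtain e where e: "0 < ereal e" "ereal e < a" using ereal_dense2[OF a] by blast
  obtain R where R: "\<And>b. b \<in> B \<Longrightarrow> L2norm \<Omega> b \<le> R" using B(2) unfolding H_bounded_def by blast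
  obtain t0 where t0: "\<And>t x. t \<ge> t0 \<Longrightarrow> x \<in> H_space \<Omega> \<Longrightarrow> L2norm \<Omega> x \<le> R \<Longrightarrow> \<exists>a\<in>attractor. L2dist \<Omega> (S t x) a < e"
    using attractor_attracts[of e R] e by auto
  show "\<forall>\<^sub>F t in at_top. dist_H \<Omega> (S t ` B) attractor < a"
    unfolding eventually_at_top_linorder
  proof (intro exI allI impI)
    fix t assume t: "t0 \<le> t"
    have "dist_H \<Omega> (S t ` B) attractor \<le> ereal e"
      unfolding dist_H_def
    proof (rule SUP_least)
      fix y assume "y \<in> S t ` B"
      then obtain b where b: "b \<in> B" "y = S t b" by blast
      then obtain z where z: "z \<in> attractor" "L2dist \<Omega> y z < e" using t0[OF t] B(1) R by blast
      have "(INF z\<in>attractor. ereal (L2dist \<Omega> y z)) \<le> ereal (L2dist \<Omega> y z)" by (rule INF_lower[OF z(1)])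
      also have "\<dots> \<le> ereal e" using z(2) by simp
      finally show "(INF z\<in>attractor. ereal (L2dist \<Omega> y z)) \<le> ereal e" .
    qed
    then show "dist_H \<Omega> (S t ` B) attractor < a" using e(2) by (rule le_less_trans)
  qed
qed

end

theorem theorem3p6:
  fixes \<Omega> :: "pt set" and \<mu> \<alpha> \<beta> :: real and f :: field
    and S :: "real \<Rightarrow> field \<Rightarrow> field"
  assumes "open \<Omega>" and "bounded \<Omega>" and "smooth_boundary \<Omega>"
    and "\<mu> > 0" and "\<alpha> > 0" and "f \<in> H_space \<Omega>"
    and "\<beta> > 3 \<or> (\<beta> = 3 \<and> 4 * \<alpha> * \<mu> > 1)"
    \<comment> \<open>S is the semigroup generated by the (known to be well-posed) weak solutions\<close>
    and S_in_H: "\<forall>t\<ge>0. \<forall>u0\<in>H_space \<Omega>. S t u0 \<in> H_space \<Omega>"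
    and S_sol: "\<forall>u0\<in>H_space \<Omega>. \<exists>u. global_weak_solution \<Omega> \<mu> \<alpha> \<beta> f u0 u \<and>
                   (\<forall>t\<ge>0. L2dist \<Omega> (S t u0) (u t) = 0)"
    and uniq: "\<forall>u0\<in>H_space \<Omega>. \<forall>T u w. weak_solution \<Omega> \<mu> \<alpha> \<beta> f u0 T u \<and>
                   weak_solution \<Omega> \<mu> \<alpha> \<beta> f u0 T w \<longrightarrow> (\<forall>t\<in>{0..T}. L2dist \<Omega> (u t) (w t) = 0)"
    and cont: "\<forall>t\<ge>0. \<forall>u0\<in>H_space \<Omega>. \<forall>e>0. \<exists>d>0. \<forall>v0\<in>H_space \<Omega>.
                   L2dist \<Omega> u0 v0 < d \<longrightarrow> L2dist \<Omega> (S t u0) (S t v0) < e"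
  shows "\<exists>\<A>. \<A> \<subseteq> H_space \<Omega> \<and> H_compact \<Omega> \<A> \<and> H_connected \<Omega> \<A> \<and>
           (\<forall>t\<ge>0. H_seteq \<Omega> (S t ` \<A>) \<A>) \<and>
           (\<forall>B. B \<subseteq> H_space \<Omega> \<and> H_bounded \<Omega> B \<and> B \<noteq> {} \<longrightarrow>
               ((\<lambda>t. dist_H \<Omega> (S t ` B) \<A>) \<longlongrightarrow> 0) at_top)"
proof -
  have \<beta>: "\<beta> \<ge> 3" using assms(7) by auto
  obtain \<delta> C where \<delta>: "0 < \<delta>" "0 \<le> C" and coercive: "\<And>u G f. \<delta> * ((norm G)\<^sup>2 + (norm u)\<^sup>2) - C * (1 + (norm f)\<^sup>2) \<le>
     \<mu> * (norm G)\<^sup>2 + inner (convect u G + (\<alpha> * norm u powr (\<beta> - 1)) *\<^sub>R u - f) u"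
    using coercivity[OF assms(4,5,7)] by blast
  interpret damped_NS_semigroup \<Omega> \<mu> \<alpha> \<beta> f S \<delta> C
  proof (unfold_locales, goal_cases)
    case (11 u0 T u w t)
    then show ?case using uniq by blast
  qed (use assms(1,2,5,6) \<beta> \<delta> coercive S_in_H S_sol cont in auto)
  show ?thesis
  proof (intro exI[of _ attractor] conjI allI impI)
    show "attractor \<subseteq> H_space \<Omega>" by (rule attractor_subset)
    show "H_compact \<Omega> attractor" unfolding H_compact_def using attractor_compact by blast
    show "H_connected \<Omega> attractor"
      unfolding H_connected_def
    proof (intro notI, elim exE conjE)
      fix V W
      assume "H_open \<Omega> V" "H_open \<Omega> W" "attractor \<subseteq> V \<union> W" "attractor \<inter> V \<noteq> {}" "attractor \<inter> W \<noteq> {}" "attractor \<inter> V \<inter> W = {}"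
      then show False unfolding H_open_def by (intro attractor_connected[of V W]) simp_all
    qed
    \<comment> \<open>Forward invariance holds literally; backwards a point is reached only up to
      distance zero, which is equality in the quotient by almost everywhere equality.\<close>
    show "H_seteq \<Omega> (S t ` attractor) attractor" if "0 \<le> t" for t
      unfolding H_seteq_def
    proof (intro conjI ballI)
      fix a assume "a \<in> S t ` attractor"
      then have "a \<in> attractor" using attractor_forward[OF that] by blast
      then show "\<exists>b\<in>attractor. L2dist \<Omega> a b = 0" using L2dist_refl by blast
    next
      fix b assume "b \<in> attractor"
      then show "\<exists>a\<in>S t ` attractor. L2dist \<Omega> a b = 0" using attractor_backward[OF that] by blast
    qed
    show "((\<lambda>t. dist_H \<Omega> (S t ` B) attractor) \<longlongrightarrow> 0) at_top" if "B \<subseteq> H_space \<Omega> \<and> H_bounded \<Omega> B \<and> B \<noteq> {}" for B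
      using attractor_attracts_dist that by blast
  qed
qed

end
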